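(* Let $(X,D)$ be a marked smooth projective curve and $r\ge2$. Let $(E,E_\bullet)$ and $(E',E'_\bullet)$ be (full flag) parabolic vector bundles of rank $r$ on $(X,D)$ such that $\mathrm{PEnd}_0(E,E_\bullet)$ and $\mathrm{PEnd}_0(E',E'_\bullet)$ are isomorphic as Lie algebra bundles. Then $(E',E'_\bullet)$ can be obtained from $(E,E_\bullet)$ through a combination of the following transformations: (1) tensorization with a line bundle $L$ over $X$, $(E,E_\bullet)\mapsto(E\otimes L,E_\bullet\otimes L)$; (2) parabolic dualization $(E,E_\bullet)\mapsto(E,E_\bullet)^\vee$; (3) Hecke transformation at a parabolic point $x\in D$, $(E,E_\bullet)\mapsto\mathcal{H}_x(E,E_\bullet)$.
   Context: A marked curve $(X,D)$ is an irreducible smooth complex projective curve $X$ with a finite set $D\subset X$ of $|D|\ge 1$ distinct points. A (full flag) quasi-parabolic vector bundle $(E,E_\bullet)$ of rank $r$ on $(X,D)$ is a rank $r$ vector bundle $E$ on $X$ with, for each $x\in D$, a full flag $E|_x=E_{x,1}\supsetneq\cdots\supsetneq E_{x,r}\supsetneq E_{x,r+1}=0$ (weights play no role here, and isomorphisms are of quasi-parabolic bundles). $\mathrm{PEnd}_0(E,E_\bullet)\subset\mathrm{End}_0(E)$ is the (locally free) sheaf of local traceless endomorphisms $\varphi$ of $E$ with $\varphi(E_{x,i})\subseteq E_{x,i}$ for all $x\in D$ and all $i$; it is a sheaf of Lie algebras over $\mathcal{O}_X$ under the commutator, and an isomorphism of Lie algebra bundles is an $\mathcal{O}_X$-linear isomorphism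 compatible with brackets. $(E,E_\bullet)^\vee$ has bundle $E^\vee$ and flags $(E^\vee)_{x,i}=\mathrm{ann}(E_{x,r+2-i})$. For $x\in D$ let $E_x^i=\ker(E\to E|_x/E_{x,i})$, $1\le i\le r+1$, so $E=E_x^1\supsetneq E_x^2\supsetneq\cdots\supsetneq E_x^{r+1}=E(-x)$ (this chain is equivalent to the flag at $x$); $\mathcal{H}_x(E,E_\bullet)$ has underlying bundle $E_x^2$, flag at $x$ given by the chain $E_x^2\supsetneq\cdots\supsetneq E_x^r\supsetneq E(-x)\supsetneq E_x^2(-x)$, and at $y\in D\setminus\{x\}$ the flag of $E$ via $E_x^2|_y=E|_y$. *)

theory Defs
  imports "HOL-Analysis.Analysis" "HOL-Library.Extended_Nat" "HOL-Library.Numeral_Type"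
begin

section \<open>Projective algebraic sets\<close>

text \<open>A point of the projective space of the coordinate space is a line through the origin
  (with the origin included).\<close>

type_synonym 'n point = "(complex ^ 'n) set"

definition proj_space :: "'n::finite point set" where
  "proj_space = {range (\<lambda>c. c *s v) | v. v \<noteq> 0}"

inductive cpolynomial :: "(complex ^ 'n::finite \<Rightarrow> complex) \<Rightarrow> bool" where
  const: "cpolynomial (\<lambda>_. c)"
| coord: "cpolynomial (\<lambda>v. v $ i)"
| add: "cpolynomial f \<Longrightarrow> cpolynomial g \<Longrightarrow> cpolynomial (\<lambda>v. f v + g v)"
| mult: "cpolynomial f \<Longrightarrow> cpolynomial g \<Longrightarrow> cpolynomial (\<lambda>v. f v * g v)"

text \<open>Polynomials over the infinite field of complex numbers are identified with polynomial
  functions; for these, homogeneity of degree \<open>d\<close> (zero included) is the following.\<close>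

definition form :: "nat \<Rightarrow> (complex ^ 'n::finite \<Rightarrow> complex) \<Rightarrow> bool" where
  "form d F \<longleftrightarrow> cpolynomial F \<and> (\<forall>c v. F (c *s v) = c ^ d * F v)"

definition zclosed :: "'n::finite point set \<Rightarrow> bool" where
  "zclosed Z \<longleftrightarrow> (\<exists>S. (\<forall>F\<in>S. \<exists>d. form d F) \<and>
     Z = {p \<in> proj_space. \<forall>F\<in>S. \<forall>v\<in>p - {0}. F v = 0})"

definition zopen :: "'n::finite point set \<Rightarrow> 'n point set \<Rightarrow> bool" where
  "zopen X U \<longleftrightarrow> U \<subseteq> X \<and> zclosed (X - U)"

definition zirreducible :: "'n::finite point set \<Rightarrow> bool" where
  "zirreducible Z \<longleftrightarrow> Z \<noteq> {} \<and>
     (\<forall>A B. zclosed A \<and> zclosed B \<and> Z \<subseteq> A \<union> B \<longrightarrow> Z \<subseteq> A \<or> Z \<subseteq> B)"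

text \<open>Krull dimension: supremum of the lengths of chains of irreducible closed subsets.\<close>

definition zdim :: "'n::finite point set \<Rightarrow> enat" where
  "zdim X = Sup {enat k | k. \<exists>Z :: nat \<Rightarrow> 'n point set.
     (\<forall>i\<le>k. zclosed (Z i) \<and> zirreducible (Z i) \<and> Z i \<subseteq> X) \<and> (\<forall>i<k. Z i \<subset> Z (Suc i))}"

text \<open>The tangent space, at a nonzero vector \<open>a\<close>, of the affine cone over \<open>X\<close>: the common kernel
  of the differentials at \<open>a\<close> of all forms vanishing on \<open>X\<close>. It has dimension one more than the
  tangent space of \<open>X\<close> at the point spanned by \<open>a\<close>, so \<open>smooth\<close> is the Jacobian criterion.\<close>

definition cone_tangent :: "'n::finite point set \<Rightarrow> complex ^ 'n \<Rightarrow> (complex ^ 'n) set" where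
  "cone_tangent X a = {w. \<forall>F d. form d F \<and> (\<forall>p\<in>X. \<forall>v\<in>p - {0}. F v = 0) \<longrightarrow>
     deriv (\<lambda>t::complex. F (a + t *s w)) 0 = 0}"

definition smooth :: "'n::finite point set \<Rightarrow> bool" where
  "smooth X \<longleftrightarrow> (\<forall>p\<in>X. \<forall>a\<in>p - {0}. enat (vec.dim (cone_tangent X a)) = zdim X + 1)"

definition smooth_projective_curve :: "'n::finite point set \<Rightarrow> bool" where
  "smooth_projective_curve X \<longleftrightarrow> zclosed X \<and> zirreducible X \<and> zdim X = 1 \<and> smooth X"

definition marked_curve :: "'n::finite point set \<Rightarrow> 'n point set \<Rightarrow> bool" where
  "marked_curve X D \<longleftrightarrow> smooth_projective_curve X \<and> finite D \<and> D \<noteq> {} \<and> D \<subseteq> X"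


section \<open>Sheaves of modules\<close>

text \<open>All sheaves below are sheaves of functions on (the closed points of) \<open>X\<close>. A section over an
  open set \<open>U\<close> is represented by a function on all points which is \<open>0\<close> outside \<open>U\<close>; \<open>res V\<close> is
  then restriction to \<open>V\<close>. Values of a sheaf at non-open sets are irrelevant.\<close>

definition res :: "'p set \<Rightarrow> ('p \<Rightarrow> 'v::zero) \<Rightarrow> 'p \<Rightarrow> 'v" where
  "res V s = (\<lambda>p. if p \<in> V then s p else 0)"

definition regular :: "'n::finite point set \<Rightarrow> 'n point set \<Rightarrow> ('n point \<Rightarrow> complex) set" where
  "regular X U = {f. (\<forall>p. p \<notin> U \<longrightarrow> f p = 0) \<and>
     (\<forall>p\<in>U. \<exists>V d G H. zopen X V \<and> p \<in> V \<and> V \<subseteq> U \<and> form d G \<and> form d H \<and>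
        (\<forall>q\<in>V. \<forall>v\<in>q - {0}. H v \<noteq> 0 \<and> f q = G v / H v))}"

type_synonym ('n, 'v) fsheaf = "'n point set \<Rightarrow> ('n point \<Rightarrow> 'v) set"

definition is_sheaf :: "'n::finite point set \<Rightarrow> ('n, 'v::zero) fsheaf \<Rightarrow> bool" where
  "is_sheaf X M \<longleftrightarrow> (\<forall>U. zopen X U \<longrightarrow>
     (\<forall>s\<in>M U. \<forall>p. p \<notin> U \<longrightarrow> s p = 0) \<and>
     (\<forall>V s. zopen X V \<and> V \<subseteq> U \<and> s \<in> M U \<longrightarrow> res V s \<in> M V) \<and>
     (\<forall>s. (\<forall>p. p \<notin> U \<longrightarrow> s p = 0) \<and>
          (\<forall>p\<in>U. \<exists>V. zopen X V \<and> p \<in> V \<and> V \<subseteq> U \<and> res V s \<in> M V) \<longrightarrow> s \<in> M U))"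

text \<open>\<open>\<O>\<^sub>X\<close>-linear isomorphisms; \<open>sm\<close> and \<open>sn\<close> are the scalar multiplications on the
  values of the sections.\<close>

definition sheaf_iso ::
  "'n::finite point set \<Rightarrow> (complex \<Rightarrow> 'v \<Rightarrow> 'v) \<Rightarrow> (complex \<Rightarrow> 'w \<Rightarrow> 'w) \<Rightarrow>
    ('n, 'v::ab_group_add) fsheaf \<Rightarrow> ('n, 'w::ab_group_add) fsheaf \<Rightarrow>
    ('n point set \<Rightarrow> ('n point \<Rightarrow> 'v) \<Rightarrow> ('n point \<Rightarrow> 'w)) \<Rightarrow> bool" where
  "sheaf_iso X sm sn M N \<Phi> \<longleftrightarrow> (\<forall>U. zopen X U \<longrightarrow>
     bij_betw (\<Phi> U) (M U) (N U) \<and>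
     (\<forall>s\<in>M U. \<forall>t\<in>M U. \<Phi> U (\<lambda>p. s p + t p) = (\<lambda>p. \<Phi> U s p + \<Phi> U t p)) \<and>
     (\<forall>f\<in>regular X U. \<forall>s\<in>M U. \<Phi> U (\<lambda>p. sm (f p) (s p)) = (\<lambda>p. sn (f p) (\<Phi> U s p))) \<and>
     (\<forall>V. zopen X V \<and> V \<subseteq> U \<longrightarrow> (\<forall>s\<in>M U. \<Phi> V (res V s) = res V (\<Phi> U s))))"


section \<open>Vector bundles\<close>

text \<open>A vector bundle of rank \<open>r = CARD('r)\<close> is given by its sheaf of sections. A basis of each fibre
  is chosen once and for all, so that every fibre is the vector space \<open>complex ^ 'r\<close>; these choices
  are made pointwise and are in no way compatible with the algebraic structure. The latter is
  carried by the sheaf: locally there is a trivialization \<open>g\<close>, consisting of arbitrary linear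
  isomorphisms from the standard space to the fibres, under which the sections are exactly the
  \<open>r\<close>-tuples of regular functions.\<close>

definition vector_bundle :: "'n::finite point set \<Rightarrow> ('n, complex ^ 'r::finite) fsheaf \<Rightarrow> bool" where
  "vector_bundle X E \<longleftrightarrow> is_sheaf X E \<and>
     (\<forall>p\<in>X. \<exists>U (g :: 'n point \<Rightarrow> complex ^ 'r ^ 'r). zopen X U \<and> p \<in> U \<and>
        (\<forall>q\<in>U. invertible (g q)) \<and>
        (\<forall>V. zopen X V \<and> V \<subseteq> U \<longrightarrow>
           E V = {res V (\<lambda>q. g q *v f q) | f. \<forall>i. (\<lambda>q. f q $ i) \<in> regular X V}))"

abbreviation line_bundle :: "'n::finite point set \<Rightarrow> ('n, complex ^ 1) fsheaf \<Rightarrow> bool" where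
  "line_bundle \<equiv> vector_bundle"

text \<open>The tensor product with a line bundle, with fibres identified by
  \<open>v \<otimes> l \<mapsto> (l $ 1) *s v\<close>; its sections are locally finite sums of pure tensors of sections.\<close>

definition tensor_line :: "'n::finite point set \<Rightarrow> ('n, complex ^ 'r::finite) fsheaf \<Rightarrow>
    ('n, complex ^ 1) fsheaf \<Rightarrow> ('n, complex ^ 'r) fsheaf" where
  "tensor_line X E L U = {t. (\<forall>p. p \<notin> U \<longrightarrow> t p = 0) \<and>
     (\<forall>p\<in>U. \<exists>V (k::nat) s l. zopen X V \<and> p \<in> V \<and> V \<subseteq> U \<and>
        (\<forall>j<k. s j \<in> E V \<and> l j \<in> L V) \<and>
        (\<forall>q\<in>V. t q = (\<Sum>j<k. (l j q $ 1) *s s j q)))}"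

text \<open>The dual space of \<open>complex ^ 'r\<close> is identified with \<open>complex ^ 'r\<close> by the following bilinear
  (not Hermitian) pairing.\<close>

definition pairing :: "complex ^ 'r::finite \<Rightarrow> complex ^ 'r \<Rightarrow> complex" where
  "pairing w v = (\<Sum>i\<in>UNIV. w $ i * v $ i)"

definition ann :: "(complex ^ 'r::finite) set \<Rightarrow> (complex ^ 'r) set" where
  "ann W = {w. \<forall>v\<in>W. pairing w v = 0}"

definition dual_bundle :: "'n::finite point set \<Rightarrow> ('n, complex ^ 'r::finite) fsheaf \<Rightarrow>
    ('n, complex ^ 'r) fsheaf" where
  "dual_bundle X E U = {t. (\<forall>p. p \<notin> U \<longrightarrow> t p = 0) \<and>
     (\<forall>V s. zopen X V \<and> V \<subseteq> U \<and> s \<in> E V \<longrightarrow> res V (\<lambda>p. pairing (t p) (s p)) \<in> regular X V)}"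


section \<open>Quasi-parabolic bundles\<close>

text \<open>\<open>flag P x i\<close> is meaningful only for \<open>x\<close> in \<open>D\<close> and \<open>1 \<le> i \<le> r + 1\<close>.\<close>

record ('n, 'r) qpar =
  sheaf_of :: "('n, complex ^ 'r) fsheaf"
  flag :: "'n point \<Rightarrow> nat \<Rightarrow> (complex ^ 'r) set"

definition full_flag :: "(nat \<Rightarrow> (complex ^ 'r::finite) set) \<Rightarrow> bool" where
  "full_flag W \<longleftrightarrow> (\<forall>i\<in>{1..CARD('r) + 1}. vec.subspace (W i)) \<and>
     W 1 = UNIV \<and> (\<forall>i\<in>{1..CARD('r)}. W (i + 1) \<subset> W i) \<and> W (CARD('r) + 1) = {0}"

definition quasi_parabolic ::
  "'n::finite point set \<Rightarrow> 'n point set \<Rightarrow> ('n, 'r::finite) qpar \<Rightarrow> bool" where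
  "quasi_parabolic X D P \<longleftrightarrow> vector_bundle X (sheaf_of P) \<and> (\<forall>x\<in>D. full_flag (flag P x))"

definition qpar_isomorphic ::
  "'n::finite point set \<Rightarrow> 'n point set \<Rightarrow> ('n, 'r::finite) qpar \<Rightarrow> ('n, 'r) qpar \<Rightarrow> bool" where
  "qpar_isomorphic X D P Q \<longleftrightarrow> (\<exists>g :: 'n point \<Rightarrow> complex ^ 'r ^ 'r.
     (\<forall>p\<in>X. invertible (g p)) \<and>
     (\<forall>U. zopen X U \<longrightarrow> bij_betw (\<lambda>s p. g p *v s p) (sheaf_of P U) (sheaf_of Q U)) \<and>
     (\<forall>x\<in>D. \<forall>i\<in>{1..CARD('r) + 1}. (*v) (g x) ` flag P x i = flag Q x i))"

definition tensor_qpar :: "'n::finite point set \<Rightarrow> ('n, 'r::finite) qpar \<Rightarrow>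
    ('n, complex ^ 1) fsheaf \<Rightarrow> ('n, 'r) qpar" where
  "tensor_qpar X P L = \<lparr>sheaf_of = tensor_line X (sheaf_of P) L, flag = flag P\<rparr>"

definition dual_qpar :: "'n::finite point set \<Rightarrow> ('n, 'r::finite) qpar \<Rightarrow> ('n, 'r) qpar" where
  "dual_qpar X P = \<lparr>sheaf_of = dual_bundle X (sheaf_of P),
     flag = (\<lambda>x i. ann (flag P x (CARD('r) + 2 - i)))\<rparr>"

text \<open>The subsheaf of sections with value at \<open>x\<close> in the \<open>i\<close>-th step of the flag, that is,
  the kernel of \<open>E \<rightarrow> E|\<^sub>x / E\<^bsub>x,i\<^esub>\<close>.\<close>

definition flag_kernel :: "('n, 'r::finite) qpar \<Rightarrow> 'n point \<Rightarrow> nat \<Rightarrow>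
    ('n, complex ^ 'r) fsheaf" where
  "flag_kernel P x i U = {s \<in> sheaf_of P U. x \<in> U \<longrightarrow> s x \<in> flag P x i}"

text \<open>\<open>Q\<close> is a Hecke transform of \<open>P\<close> at \<open>x\<close>: its bundle is, up to an isomorphism \<open>\<Phi>\<close>, the
  sheaf \<open>flag_kernel P x 2\<close>, and \<open>\<Phi>\<close> transports the chain of subsheaves attached to its flag at \<open>x\<close>
  to the shifted chain (the last member, the twist by \<open>-x\<close>, corresponds automatically), and at the
  other points the flag of \<open>Q\<close> to that of \<open>P\<close>. This determines \<open>Q\<close> up to isomorphism.\<close>

definition hecke_transform :: "'n::finite point set \<Rightarrow> 'n point set \<Rightarrow> 'n point \<Rightarrow>
    ('n, 'r::finite) qpar \<Rightarrow> ('n, 'r) qpar \<Rightarrow> bool" where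
  "hecke_transform X D x P Q \<longleftrightarrow> quasi_parabolic X D Q \<and>
     (\<exists>\<Phi>. sheaf_iso X (*s) (*s) (sheaf_of Q) (flag_kernel P x 2) \<Phi> \<and>
        (\<forall>U. zopen X U \<longrightarrow>
           (\<forall>i\<in>{1..CARD('r)}. \<Phi> U ` flag_kernel Q x i U = flag_kernel P x (i + 1) U) \<and>
           (\<forall>y\<in>D - {x}. \<forall>i\<in>{1..CARD('r) + 1}.
              \<Phi> U ` flag_kernel Q y i U = flag_kernel P x 2 U \<inter> flag_kernel P y i U)))"

inductive obtainable :: "'n::finite point set \<Rightarrow> 'n point set \<Rightarrow>
    ('n, 'r::finite) qpar \<Rightarrow> ('n, 'r) qpar \<Rightarrow> bool" for X D P where
  refl: "obtainable X D P P"
| iso: "obtainable X D P Q \<Longrightarrow> quasi_parabolic X D R \<Longrightarrow> qpar_isomorphic X D Q R \<Longrightarrow>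
    obtainable X D P R"
| tensor: "obtainable X D P Q \<Longrightarrow> line_bundle X L \<Longrightarrow> obtainable X D P (tensor_qpar X Q L)"
| dual: "obtainable X D P Q \<Longrightarrow> obtainable X D P (dual_qpar X Q)"
| hecke: "obtainable X D P Q \<Longrightarrow> x \<in> D \<Longrightarrow> hecke_transform X D x Q R \<Longrightarrow> obtainable X D P R"


section \<open>The Lie algebra bundle of traceless parabolic endomorphisms\<close>

text \<open>A local endomorphism of the bundle is a family of endomorphisms of the fibres preserving the
  regular sections.\<close>

definition PEnd0 :: "'n::finite point set \<Rightarrow> 'n point set \<Rightarrow> ('n, 'r::finite) qpar \<Rightarrow>
    ('n, complex ^ 'r ^ 'r) fsheaf" where
  "PEnd0 X D P U = {A. (\<forall>p. p \<notin> U \<longrightarrow> A p = 0) \<and>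
     (\<forall>V s. zopen X V \<and> V \<subseteq> U \<and> s \<in> sheaf_of P V \<longrightarrow> (\<lambda>p. A p *v s p) \<in> sheaf_of P V) \<and>
     (\<forall>p\<in>U. trace (A p) = 0) \<and>
     (\<forall>x\<in>D \<inter> U. \<forall>i\<in>{1..CARD('r) + 1}. (*v) (A x) ` flag P x i \<subseteq> flag P x i)}"

definition mscale :: "complex \<Rightarrow> complex ^ 'r ^ 'r \<Rightarrow> complex ^ 'r ^ 'r" where
  "mscale c A = (\<chi> i j. c * A $ i $ j)"

definition lie_isomorphic_PEnd0 :: "'n::finite point set \<Rightarrow> 'n point set \<Rightarrow>
    ('n, 'r::finite) qpar \<Rightarrow> ('n, 'r) qpar \<Rightarrow> bool" where
  "lie_isomorphic_PEnd0 X D P Q \<longleftrightarrow> (\<exists>\<Phi>.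
     sheaf_iso X mscale mscale (PEnd0 X D P) (PEnd0 X D Q) \<Phi> \<and>
     (\<forall>U. zopen X U \<longrightarrow> (\<forall>A\<in>PEnd0 X D P U. \<forall>B\<in>PEnd0 X D P U.
        \<Phi> U (\<lambda>p. A p ** B p - B p ** A p) =
        (\<lambda>p. \<Phi> U A p ** \<Phi> U B p - \<Phi> U B p ** \<Phi> U A p))))"

end

theory Submission
  imports Defs
begin

text \<open>On the fibres over \<open>X - D\<close> the given isomorphism is an automorphism of the Lie algebra of traceless
  matrices, hence inner or the composition of an inner one with \<open>A \<mapsto> - transpose A\<close>. Each alternative is
  closed in the Zariski topology, so by irreducibility the same one holds everywhere, and after dualizing
  \<open>E\<close> if necessary the isomorphism is fibrewise conjugation by some \<open>g q\<close>, unique up to scalars. Rescaled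
  suitably, \<open>g\<close> is locally given by a regular matrix. At a point of \<open>D\<close> it carries the Iwahori order of one flag
  to that of the other, hence is a power of the cyclic shift times a unit of this order, and the power is
  absorbed by Hecke transformations. The remaining local scalar factors are the transition functions of a
  line bundle. Uniformizers at the points of \<open>D\<close> come from smoothness: the
  differentials of the equations of the curve cut out a one-dimensional tangent space, and a linear form
  which does not vanish on it is a uniformizer.\<close>

text \<open>The data are sections only, and the fibres carry unrelated bases, so nothing about a
  fibre is available at once. Off \<open>D\<close> the isomorphism descends to fibres, because a
  section vanishing at a point is a combination of sections with coefficients vanishing there. At a
  point of \<open>D\<close> the values of sections do not fill the traceless matrices and no map of
  fibres is used: statements at \<open>D\<close> are identities between regular functions, proved
  off \<open>D\<close> and extended by density. Being inner is an existence statement and not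
  visibly closed; it is replaced by an equation, multiplicativity modulo scalars, from which the
  conjugating matrix is recovered by the Skolem-Noether argument on all matrices. This matrix is
  chosen point by point; regularity is produced locally from the images of matrix units. A matrix
  unit below the diagonal is not parabolic at \<open>D\<close> and has to be multiplied by a
  uniformizer first, which is why a simple pole appears and why finitely many shifts remain to be
  undone.\<close>

section \<open>Matrix algebra: rank-one matrices, scalar multiples, traceless parts\<close>

definition outer :: "complex ^ 'r \<Rightarrow> complex ^ 'r \<Rightarrow> complex ^ 'r ^ 'r" where
  "outer a f = (\<chi> i j. a $ i * f $ j)"

lemma mscale_nth [simp]: "mscale c A $ i $ j = c * A $ i $ j"
  by (simp add: mscale_def)

lemma outer_nth [simp]: "outer a f $ i $ j = a $ i * f $ j"
  by (simp add: outer_def)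

lemma mat_eqI: "(\<And>i j. A $ i $ j = B $ i $ j) \<Longrightarrow> A = B"
  by (simp add: vec_eq_iff)

lemma outer_mult: "outer a f ** B = outer a (f v* B)"
  by (rule mat_eqI) (simp add: matrix_matrix_mult_def vector_matrix_mult_def sum_distrib_left mult_ac)

lemma mult_outer: "B ** outer a f = outer (B *v a) f"
  by (rule mat_eqI) (simp add: matrix_matrix_mult_def matrix_vector_mult_def sum_distrib_left sum_distrib_right mult_ac)

lemma outer_mult_vec: "outer a f *v b = pairing f b *s a"
  by (simp add: vec_eq_iff matrix_vector_mult_def pairing_def sum_distrib_left mult_ac)

lemma vec_mult_outer: "b v* outer a f = pairing a b *s f"
  by (simp add: vec_eq_iff vector_matrix_mult_def pairing_def sum_distrib_left sum_distrib_right mult_ac)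

lemma trace_outer: "trace (outer a f) = pairing f a"
  by (simp add: trace_def pairing_def mult_ac)

lemma trace_mscale: "trace (mscale c A) = c * trace A"
  by (simp add: trace_def sum_distrib_left)

lemma trace_minus: "trace (- A) = - trace (A :: complex ^ 'r ^ 'r)"
  by (simp add: trace_def sum_negf)

lemma trace_transpose: "trace (transpose A) = trace A"
  by (simp add: trace_def transpose_def)

lemma trace_zero: "trace (0 :: complex ^ 'r ^ 'r) = 0"
  by (simp add: trace_def)

lemma mscale_mult_left: "mscale c A ** B = mscale c (A ** B)"
  by (rule mat_eqI) (simp add: matrix_matrix_mult_def sum_distrib_left mult_ac)

lemma mscale_mult_right: "A ** mscale c B = mscale c (A ** B)"
  by (rule mat_eqI) (simp add: matrix_matrix_mult_def sum_distrib_left mult_ac)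

lemma mscale_mult_vec: "mscale c A *v v = c *s (A *v v)"
  by (simp add: vec_eq_iff matrix_vector_mult_def sum_distrib_left mult_ac)

lemma mscale_mscale: "mscale c (mscale d A) = mscale (c * d) A"
  by (rule mat_eqI) (simp add: mult_ac)

lemma mscale_one [simp]: "mscale 1 A = A"
  by (rule mat_eqI) simp

lemma mscale_minus_one [simp]: "mscale (- 1) A = - A"
  by (rule mat_eqI) simp

lemma mscale_zero [simp]: "mscale 0 A = 0"
  by (rule mat_eqI) simp

lemma mscale_zero_right [simp]: "mscale c 0 = 0"
  by (rule mat_eqI) simp

lemma mscale_diff: "mscale c (A - B) = mscale c A - mscale c B"
  by (rule mat_eqI) (simp add: algebra_simps)

lemma mscale_eq_0_iff [simp]: "mscale c A = 0 \<longleftrightarrow> c = 0 \<or> A = 0"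
  by (auto simp: vec_eq_iff)

lemma transpose_mscale: "transpose (mscale c A) = mscale c (transpose A)"
  by (rule mat_eqI) (simp add: transpose_def)

lemma transpose_add: "transpose (A + B) = transpose A + transpose (B :: complex ^ 'r ^ 'r)"
  by (rule mat_eqI) (simp add: transpose_def)

lemma transpose_diff: "transpose (A - B) = transpose A - transpose (B :: complex ^ 'r ^ 'r)"
  by (rule mat_eqI) (simp add: transpose_def)

lemma transpose_minus: "transpose (- A) = - transpose (A :: complex ^ 'r ^ 'r)"
  by (rule mat_eqI) (simp add: transpose_def)

lemma mat_mult_add_left: "(A + B) ** C = A ** C + B ** (C :: complex ^ 'r ^ 'r)"
  by (rule mat_eqI) (simp add: matrix_matrix_mult_def distrib_right sum.distrib)

lemma mat_mult_diff_left: "(A - B) ** C = A ** C - B ** (C :: complex ^ 'r ^ 'r)"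
  by (rule mat_eqI) (simp add: matrix_matrix_mult_def left_diff_distrib sum_subtractf)

lemma mat_mult_diff_right: "A ** (B - C) = A ** B - A ** (C :: complex ^ 'r ^ 'r)"
  by (rule mat_eqI) (simp add: matrix_matrix_mult_def right_diff_distrib sum_subtractf)

lemma mat_mult_minus_left: "(- A) ** B = - (A ** (B :: complex ^ 'r ^ 'r))"
  by (rule mat_eqI) (simp add: matrix_matrix_mult_def sum_negf)

lemma mat_mult_minus_right: "A ** (- B) = - (A ** (B :: complex ^ 'r ^ 'r))"
  by (rule mat_eqI) (simp add: matrix_matrix_mult_def sum_negf)

lemmas mat_ring_simps = mat_mult_diff_left mat_mult_diff_right matrix_add_ldistrib
  mat_mult_add_left mat_mult_minus_left mat_mult_minus_right mscale_mult_left mscale_mult_right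
  matrix_mul_assoc

lemma outer_eq_0_iff [simp]: "outer a f = 0 \<longleftrightarrow> a = 0 \<or> f = 0"
  by (auto simp: vec_eq_iff)

lemma mat_nonzero_mult_vec: "A \<noteq> 0 \<Longrightarrow> \<exists>u. A *v u \<noteq> (0 :: complex ^ 'r)"
  using matrix_eq[of A 0] by auto

lemma mat_nonzero_vec_mult: 
  assumes "(A :: complex ^ 'r ^ 'r) \<noteq> 0" shows "\<exists>k. k v* A \<noteq> 0"
proof -
  have "transpose A \<noteq> 0"
    using assms by (auto simp: vec_eq_iff transpose_def)
  then show ?thesis
    using mat_nonzero_mult_vec[of "transpose A"] by simp
qed

lemma not_invertible_left_kernel:
  assumes "\<not> invertible (A :: complex ^ 'r ^ 'r)" shows "\<exists>k. k \<noteq> 0 \<and> k v* A = 0"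
proof -
  have "\<not> invertible (transpose A)"
    using assms by (simp add: invertible_det_nz)
  then obtain k where "k \<noteq> 0" "transpose A *v k = 0"
    unfolding invertible_left_inverse using matrix_left_invertible_ker by blast
  then show ?thesis
    by auto
qed

lemma matrix_inv:
  assumes "invertible (A :: complex ^ 'r ^ 'r)"
  shows "matrix_inv A ** A = mat 1" "A ** matrix_inv A = mat 1"
proof -
  have "\<exists>B. A ** B = mat 1 \<and> B ** A = mat 1"
    using assms by (simp add: invertible_def)
  then have "A ** matrix_inv A = mat 1 \<and> matrix_inv A ** A = mat 1"
    unfolding matrix_inv_def by (rule someI_ex)
  then show "matrix_inv A ** A = mat 1" "A ** matrix_inv A = mat 1"
    by auto
qed

lemma matrix_inv_mult_vec:
  assumes "invertible (A :: complex ^ 'r ^ 'r)"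
  shows "matrix_inv A *v (A *v v) = v" "A *v (matrix_inv A *v v) = v"
  using matrix_inv[OF assms] by (simp_all add: matrix_vector_mul_assoc)

lemma matrix_inv_eqI:
  assumes "A ** B = mat 1" shows "invertible A" "matrix_inv A = (B :: complex ^ 'r ^ 'r)"
proof -
  show *: "invertible A"
    using assms invertible_right_inverse by blast
  show "matrix_inv A = B"
    using matrix_mul_assoc[of "matrix_inv A" A B] by (simp add: assms matrix_inv(1)[OF *])
qed

lemma invertible_matrix_inv:
  "invertible (A :: complex ^ 'r ^ 'r) \<Longrightarrow> invertible (matrix_inv A)"
  using matrix_inv_eqI(1) matrix_inv(1) by blast

definition traceless :: "complex ^ 'r ^ 'r \<Rightarrow> complex ^ 'r ^ 'r" where
  "traceless A = A - mscale (trace A / of_nat CARD('r)) (mat 1)"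

lemma trace_traceless [simp]: "trace (traceless (A :: complex ^ 'r ^ 'r)) = 0"
  by (simp add: traceless_def trace_sub trace_mscale trace_I)

lemma traceless_id: "trace A = 0 \<Longrightarrow> traceless A = A"
  by (simp add: traceless_def)

section \<open>Automorphisms of the Lie algebra of traceless matrices\<close>

text \<open>All conditions are restricted to traceless arguments: the type has no room for the Lie
  algebra itself, and the fibre maps built later are meaningful on traceless matrices only.
  Injectivity is put as a trivial kernel.\<close>

definition sl_aut :: "(complex ^ 'r ^ 'r \<Rightarrow> complex ^ 'r ^ 'r) \<Rightarrow> bool" where
  "sl_aut \<phi> \<longleftrightarrow> (\<forall>A B. trace A = 0 \<and> trace B = 0 \<longrightarrow>
      \<phi> (A + B) = \<phi> A + \<phi> B \<and> \<phi> (A ** B - B ** A) = \<phi> A ** \<phi> B - \<phi> B ** \<phi> A) \<and>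
    (\<forall>A c. trace A = 0 \<longrightarrow> \<phi> (mscale c A) = mscale c (\<phi> A) \<and> trace (\<phi> A) = 0 \<and>
      (\<phi> A = 0 \<longrightarrow> A = 0)) \<and>
    (\<forall>B. trace B = 0 \<longrightarrow> (\<exists>A. trace A = 0 \<and> \<phi> A = B))"

lemma trace_bracket: "trace (A ** B - B ** A) = (0 :: complex)"
  for A B :: "complex ^ 'r ^ 'r"
  using trace_mul_sym[of A B] by (simp add: trace_sub)

context
  fixes \<phi> :: "complex ^ 'r ^ 'r \<Rightarrow> complex ^ 'r ^ 'r"
  assumes aut: "sl_aut \<phi>"
begin

lemma sl_aut_add: "trace A = 0 \<Longrightarrow> trace B = 0 \<Longrightarrow> \<phi> (A + B) = \<phi> A + \<phi> B"
  using aut unfolding sl_aut_def by blast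

lemma sl_aut_bracket: "trace A = 0 \<Longrightarrow> trace B = 0 \<Longrightarrow>
    \<phi> (A ** B - B ** A) = \<phi> A ** \<phi> B - \<phi> B ** \<phi> A"
  using aut unfolding sl_aut_def by blast

lemma sl_aut_scale: "trace A = 0 \<Longrightarrow> \<phi> (mscale c A) = mscale c (\<phi> A)"
  using aut unfolding sl_aut_def by blast

lemma sl_aut_trace: "trace A = 0 \<Longrightarrow> trace (\<phi> A) = 0"
  using aut unfolding sl_aut_def by blast

lemma sl_aut_inj: "trace A = 0 \<Longrightarrow> \<phi> A = 0 \<Longrightarrow> A = 0"
  using aut unfolding sl_aut_def by blast

lemma sl_aut_surj: "trace B = 0 \<Longrightarrow> \<exists>A. trace A = 0 \<and> \<phi> A = B"
  using aut unfolding sl_aut_def by blast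

lemma sl_aut_minus: "trace A = 0 \<Longrightarrow> \<phi> (- A) = - \<phi> A"
  using sl_aut_scale[of A "- 1"] by simp

text \<open>The normalization device of this part: an automorphism is composed with conjugations
  until it fixes a piece of the algebra large enough to make it the identity.\<close>

lemma sl_aut_conj:
  assumes "invertible g"
  shows "sl_aut (\<lambda>A. matrix_inv g ** \<phi> A ** g)"
proof -
  have g: "g ** matrix_inv g = mat 1" "matrix_inv g ** g = mat 1"
    using assms by (auto simp: matrix_inv)
  have conj_mult: "(matrix_inv g ** A ** g) ** (matrix_inv g ** B ** g) = matrix_inv g ** (A ** B) ** g" for A B
  proof -
    have "(matrix_inv g ** A ** g) ** (matrix_inv g ** B ** g) = matrix_inv g ** A ** (g ** matrix_inv g) ** B ** g"
      by (simp only: matrix_mul_assoc)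
    then show ?thesis
      by (simp add: g matrix_mul_assoc)
  qed
  have inv: "matrix_inv g ** (g ** B ** matrix_inv g) ** g = B" for B
  proof -
    have "matrix_inv g ** (g ** B ** matrix_inv g) ** g = (matrix_inv g ** g) ** B ** (matrix_inv g ** g)"
      by (simp only: matrix_mul_assoc)
    then show ?thesis
      by (simp add: g)
  qed
  have inv': "g ** (matrix_inv g ** B ** g) ** matrix_inv g = B" for B
  proof -
    have "g ** (matrix_inv g ** B ** g) ** matrix_inv g = (g ** matrix_inv g) ** B ** (g ** matrix_inv g)"
      by (simp only: matrix_mul_assoc)
    then show ?thesis
      by (simp add: g)
  qed
  have tr: "trace (matrix_inv g ** A ** g) = trace A" for A
    using trace_mul_sym[of "matrix_inv g ** A" g] by (simp add: matrix_mul_assoc g)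
  have tr': "trace (g ** A ** matrix_inv g) = trace A" for A
    using trace_mul_sym[of "g ** A" "matrix_inv g"] by (simp add: matrix_mul_assoc g)
  show ?thesis
    unfolding sl_aut_def
  proof (intro conjI allI impI; (elim conjE)?)
    fix A B :: "complex ^ 'r ^ 'r" assume *: "trace A = 0" "trace B = 0"
    show "matrix_inv g ** \<phi> (A + B) ** g = matrix_inv g ** \<phi> A ** g + matrix_inv g ** \<phi> B ** g"
      using * by (simp add: sl_aut_add mat_ring_simps)
    show "matrix_inv g ** \<phi> (A ** B - B ** A) ** g =
        matrix_inv g ** \<phi> A ** g ** (matrix_inv g ** \<phi> B ** g) -
        matrix_inv g ** \<phi> B ** g ** (matrix_inv g ** \<phi> A ** g)"
      using * unfolding conj_mult by (simp add: sl_aut_bracket mat_ring_simps)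
  next
    fix A :: "complex ^ 'r ^ 'r" and c assume *: "trace A = 0"
    show "matrix_inv g ** \<phi> (mscale c A) ** g = mscale c (matrix_inv g ** \<phi> A ** g)"
      using * by (simp add: sl_aut_scale mat_ring_simps)
    show "trace (matrix_inv g ** \<phi> A ** g) = 0"
      using * by (simp add: tr sl_aut_trace)
    show "A = 0" if "matrix_inv g ** \<phi> A ** g = 0"
      using that * sl_aut_inj inv'[of "\<phi> A"] by simp
  next
    fix B :: "complex ^ 'r ^ 'r" assume *: "trace B = 0"
    then obtain A where "trace A = 0" "\<phi> A = g ** B ** matrix_inv g"
      using sl_aut_surj[of "g ** B ** matrix_inv g"] by (auto simp: tr')
    then show "\<exists>A. trace A = 0 \<and> matrix_inv g ** \<phi> A ** g = B"
      using inv by (intro exI[of _ A]) simp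
  qed
qed

lemma sl_aut_neg_transpose: "sl_aut (\<lambda>A. - transpose (\<phi> A))"
  unfolding sl_aut_def
proof (intro conjI allI impI; (elim conjE)?)
  fix A B :: "complex ^ 'r ^ 'r" assume *: "trace A = 0" "trace B = 0"
  show "- transpose (\<phi> (A + B)) = - transpose (\<phi> A) + - transpose (\<phi> B)"
    using * by (simp add: sl_aut_add transpose_add)
  show "- transpose (\<phi> (A ** B - B ** A)) =
        - transpose (\<phi> A) ** - transpose (\<phi> B) - - transpose (\<phi> B) ** - transpose (\<phi> A)"
    using * by (simp add: sl_aut_bracket mat_ring_simps transpose_diff matrix_transpose_mul)
next
  fix A :: "complex ^ 'r ^ 'r" and c assume *: "trace A = 0"
  show "- transpose (\<phi> (mscale c A)) = mscale c (- transpose (\<phi> A))"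
    using * by (simp add: sl_aut_scale transpose_mscale) (simp add: vec_eq_iff)
  show "trace (- transpose (\<phi> A)) = 0"
    using * by (simp add: trace_minus trace_transpose sl_aut_trace)
  show "A = 0" if "- transpose (\<phi> A) = 0"
  proof -
    have "transpose (transpose (\<phi> A)) = transpose 0"
      using that by simp
    then have "\<phi> A = 0"
      by (simp add: vec_eq_iff transpose_def)
    then show ?thesis
      using * sl_aut_inj by blast
  qed
next
  fix B :: "complex ^ 'r ^ 'r" assume *: "trace B = 0"
  then have "trace (- transpose B) = 0"
    by (simp add: trace_minus trace_transpose)
  then obtain A where "trace A = 0" "\<phi> A = - transpose B"
    using sl_aut_surj[of "- transpose B"] by auto
  then show "\<exists>A. trace A = 0 \<and> - transpose (\<phi> A) = B"
    by (intro exI[of _ A]) (simp add: transpose_minus)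
qed

end

lemma pairing_axis [simp]: "pairing (axis k 1) v = v $ k" "pairing v (axis k 1) = v $ k"
  by (simp_all add: pairing_def axis_def if_distrib if_distribR cong: if_cong)

lemma pairing_scale: "pairing (c *s v) w = c * pairing v w" "pairing v (c *s w) = c * pairing v w"
  by (simp_all add: pairing_def sum_distrib_left mult_ac)

lemma outer_eq_outer_nonzero: "f \<noteq> 0 \<Longrightarrow> outer a f = outer b f \<Longrightarrow> a = b"
  by (auto simp: vec_eq_iff)

lemma outer_eq_scale:
  assumes "outer a f = mscale c X" "a \<noteq> 0" "f \<noteq> 0"
  shows "\<exists>b k. X = outer b k"
proof -
  have "c \<noteq> 0"
    using assms by (metis mscale_zero outer_eq_0_iff)
  then have "X = mscale (1 / c) (outer a f)"
    by (simp add: assms(1) mscale_mscale)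
  also have "\<dots> = outer ((1 / c) *s a) f"
    by (rule mat_eqI) simp
  finally show ?thesis
    by blast
qed

text \<open>\<open>X\<close> is an extremal element: its double bracket maps everything into the
  line of \<open>X\<close>. For suitable \<open>Y\<close> of rank one the double bracket is itself
  nonzero of rank one, and \<open>X\<close> is then proportional to it. The relation with
  \<open>H\<close> provides the left kernel vector from which such a \<open>Y\<close> is
  built.\<close>

lemma rank_one_of_extremal:
  fixes X H :: "complex ^ 'r ^ 'r"
  assumes ext: "\<And>Y. trace Y = 0 \<Longrightarrow> \<exists>c. X ** (X ** Y - Y ** X) - (X ** Y - Y ** X) ** X = mscale c X"
    and H: "H ** X - X ** H = - X" and "X \<noteq> 0"
  shows "\<exists>a f. X = outer a f"
proof -
  \<comment> \<open>Multiplying the relation by the inverse would give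
    \<open>H - X ** H ** matrix_inv X = - mat 1\<close>, with trace 0 on the left and minus the size
    on the right.\<close>
  have sing: "\<not> invertible X"
  proof
    assume inv: "invertible X"
    have "(H ** X - X ** H) ** matrix_inv X = - X ** matrix_inv X"
      by (simp add: H)
    then have "H ** (X ** matrix_inv X) - X ** H ** matrix_inv X = - mat 1"
      by (simp add: mat_mult_diff_left mat_mult_minus_left matrix_inv[OF inv] flip: matrix_mul_assoc)
    then have "trace (H - X ** H ** matrix_inv X) = trace (- mat 1 :: complex ^ 'r ^ 'r)"
      by (simp add: matrix_inv[OF inv])
    moreover have "trace (X ** H ** matrix_inv X) = trace H"
      using trace_mul_sym[of "X ** H" "matrix_inv X"]
      by (simp add: matrix_mul_assoc) (simp add: matrix_inv[OF inv])
    ultimately show False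
      by (simp add: trace_sub trace_minus trace_I)
  qed
  have ext': "\<exists>c. X ** X ** Y - mscale 2 (X ** Y ** X) + Y ** X ** X = mscale c X" for Y
  proof -
    let ?Y = "traceless Y"
    have "X ** ?Y - ?Y ** X = X ** Y - Y ** X"
      by (simp add: traceless_def mat_ring_simps)
    then obtain c where c: "X ** (X ** Y - Y ** X) - (X ** Y - Y ** X) ** X = mscale c X"
      using ext[of ?Y] by auto
    have "X ** X ** Y - mscale 2 (X ** Y ** X) + Y ** X ** X = X ** (X ** Y - Y ** X) - (X ** Y - Y ** X) ** X"
      by (rule mat_eqI) (simp add: mat_ring_simps)
    then show ?thesis
      using c by auto
  qed
  obtain k where k: "k \<noteq> 0" "k v* X = 0"
    using not_invertible_left_kernel[OF sing] by blast
  show ?thesis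
  proof (cases "X ** X = 0")
    case False
    then obtain u where u: "X ** X *v u \<noteq> 0"
      using mat_nonzero_mult_vec by blast
    \<comment> \<open>Since \<open>k v* X = 0\<close>, both terms containing \<open>Y ** X\<close>
      vanish and only \<open>X ** X ** Y\<close> remains.\<close>
    obtain c where c: "X ** X ** outer u k - mscale 2 (X ** outer u k ** X) + outer u k ** X ** X = mscale c X"
      using ext'[of "outer u k"] by blast
    have z: "outer u k ** X = 0"
      by (simp add: outer_mult k)
    have "X ** outer u k ** X = X ** (outer u k ** X)"
      by (simp only: matrix_mul_assoc)
    with c z have "outer (X ** X *v u) k = mscale c X"
      by (simp add: mult_outer)
    with u k show ?thesis
      using outer_eq_scale by blast
  next
    case True
    obtain u where u: "X *v u \<noteq> 0"
      using mat_nonzero_mult_vec[OF \<open>X \<noteq> 0\<close>] by blast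
    obtain l where l: "l v* X \<noteq> 0"
      using mat_nonzero_vec_mult[OF \<open>X \<noteq> 0\<close>] by blast
    \<comment> \<open>Now the terms with the square of \<open>X\<close> vanish; the middle term
      \<open>X ** Y ** X\<close> survives and has rank one.\<close>
    obtain c where c: "X ** X ** outer u l - mscale 2 (X ** outer u l ** X) + outer u l ** X ** X = mscale c X"
      using ext'[of "outer u l"] by blast
    have "outer u l ** X ** X = outer u l ** (X ** X)"
      by (simp only: matrix_mul_assoc)
    then have "outer u l ** X ** X = 0"
      by (simp add: True)
    with c True have "- mscale 2 (X ** outer u l ** X) = mscale c X"
      by simp
    then have "- mscale 2 (outer (X *v u) (l v* X)) = mscale c X"
      by (simp add: mult_outer outer_mult)
    then have "outer ((- 2) *s (X *v u)) (l v* X) = mscale c X"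
      by (simp add: vec_eq_iff mult.assoc)
    moreover have "(- 2) *s (X *v u) \<noteq> 0"
      using u by (auto simp: vec_eq_iff)
    ultimately show ?thesis
      using l outer_eq_scale by blast
  qed
qed

text \<open>The \<open>2 \<times> 2\<close> minors of the sum factor into minors of \<open>(a, b)\<close> and \<open>(f, g)\<close>.\<close>

lemma outer_add_outer_rank_one:
  fixes a b c f g k :: "complex ^ 'r"
  assumes "outer a f + outer b g = outer c k" "a \<noteq> 0" "f \<noteq> 0"
  shows "(\<exists>s. b = s *s a) \<or> (\<exists>s. g = s *s f)"
proof -
  have minor: "(a $ l * b $ m - a $ m * b $ l) * (f $ i * g $ j - f $ j * g $ i) = 0" for l m i j
  proof -
    have e: "a $ x * f $ y + b $ x * g $ y = c $ x * k $ y" for x y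
      using assms(1) by (metis outer_nth vector_add_component)
    have "(a $ l * b $ m - a $ m * b $ l) * (f $ i * g $ j - f $ j * g $ i) =
       (a $ l * f $ i + b $ l * g $ i) * (a $ m * f $ j + b $ m * g $ j) -
       (a $ l * f $ j + b $ l * g $ j) * (a $ m * f $ i + b $ m * g $ i)"
      by (simp add: algebra_simps)
    also have "\<dots> = 0"
      unfolding e by simp
    finally show ?thesis .
  qed
  obtain l i where l: "a $ l \<noteq> 0" and i: "f $ i \<noteq> 0"
    using assms by (auto simp: vec_eq_iff)
  show ?thesis
  proof (cases "\<forall>m. a $ l * b $ m - a $ m * b $ l = 0")
    case True
    then have "b = (b $ l / a $ l) *s a"
      using l by (auto simp: vec_eq_iff field_simps)
    then show ?thesis by blast
  next
    case False
    then have "\<forall>j. f $ i * g $ j - f $ j * g $ i = 0"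
      using minor by (metis mult_eq_0_iff)
    then have "g = (g $ i / f $ i) *s f"
      using i by (auto simp: vec_eq_iff field_simps)
    then show ?thesis by blast
  qed
qed

abbreviation col_mat :: "'r \<Rightarrow> complex ^ 'r \<Rightarrow> complex ^ 'r ^ 'r" where
  "col_mat p w \<equiv> outer w (axis p 1)"

text \<open>The adjoint action of this matrix grades the traceless matrices: degree -1 is the
  off-diagonal part of column \<open>p\<close>, degree 1 the off-diagonal part of row
  \<open>p\<close>, degree 0 the rest. The scalar correction makes the trace vanish.\<close>

definition grading :: "'r \<Rightarrow> complex ^ 'r ^ 'r" where
  "grading p = outer (axis p 1) (axis p 1) - mscale (1 / of_nat CARD('r)) (mat 1)"

lemma trace_grading: "trace (grading p :: complex ^ 'r ^ 'r) = 0"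
  by (simp add: grading_def trace_sub trace_outer trace_mscale trace_I)

lemma grading_bracket:
  "grading p ** A - A ** grading p = outer (axis p 1) (axis p 1 v* A) - outer (A *v axis p 1) (axis p 1)"
  by (simp add: grading_def mat_ring_simps outer_mult mult_outer)

lemma axis_one_nth: "axis p 1 $ i = (if i = p then 1 else (0 :: complex))"
  by (simp add: axis_def)

lemma vec_mult_axis: "axis p 1 v* A = A $ p"
  by (simp add: vec_eq_iff vector_matrix_mult_def axis_def if_distrib if_distribR cong: if_cong)

lemma mult_vec_axis: "(A *v axis p 1) $ i = A $ i $ p"
  by (simp add: matrix_vector_mult_def axis_def if_distrib if_distribR cong: if_cong)

lemma mat_1_nth: "(mat 1 :: complex ^ 'r ^ 'r) $ i $ j = (if i = j then 1 else 0)"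
  by (simp add: mat_def)

lemma grading_bracket_nth:
  "(grading p ** A - A ** grading p) $ i $ j = (if i = p then A $ p $ j else 0) - (if j = p then A $ i $ p else 0)"
  unfolding grading_bracket vec_mult_axis by (simp add: mult_vec_axis axis_one_nth)

text \<open>Fixing the grading element forces \<open>\<phi>\<close> to preserve degrees. Degrees 0
  and 1 are then recovered from their brackets with degree -1: no nonzero traceless matrix of degree
  0 or 1 has zero bracket with all of degree -1.\<close>

lemma sl_aut_fixing_graded_part:
  fixes \<phi> :: "complex ^ 'r ^ 'r \<Rightarrow> complex ^ 'r ^ 'r"
  assumes aut: "sl_aut \<phi>" and h: "\<phi> (grading p) = grading p"
    and U: "\<And>w. w $ p = 0 \<Longrightarrow> \<phi> (col_mat p w) = col_mat p w"
    and A: "trace A = 0"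
  shows "\<phi> A = A"
proof -
  have trU: "w $ p = 0 \<Longrightarrow> trace (col_mat p w) = 0" for w
    by (simp add: trace_outer)
  \<comment> \<open>Degree 0: the error \<open>C\<close> commutes with all
    \<open>col_mat p w\<close>, hence acts as the scalar \<open>C $ p $ p\<close> on the vectors
    with \<open>w $ p = 0\<close>. So \<open>C\<close> is scalar, and being traceless it is
    0.\<close>
  have deg0: "\<phi> B = B" if B: "trace B = 0" "\<And>i. i \<noteq> p \<Longrightarrow> B $ i $ p = 0" "\<And>i. i \<noteq> p \<Longrightarrow> B $ p $ i = 0" for B
  proof -
    define C where "C = \<phi> B - B"
    have trC: "trace C = 0"
      using B by (simp add: C_def trace_sub sl_aut_trace[OF aut])
    have "grading p ** B - B ** grading p = 0"
      by (rule mat_eqI, simp only: grading_bracket_nth) (auto simp: B)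
    then have "grading p ** \<phi> B - \<phi> B ** grading p = 0"
      using sl_aut_bracket[OF aut trace_grading B(1), of p] h sl_aut_scale[OF aut, of 0 0]
      by (simp add: trace_zero)
    then have "i \<noteq> p \<Longrightarrow> \<phi> B $ i $ p = 0" "i \<noteq> p \<Longrightarrow> \<phi> B $ p $ i = 0" for i
      using grading_bracket_nth[of p "\<phi> B" i p] grading_bracket_nth[of p "\<phi> B" p i] by auto
    then have C0: "i \<noteq> p \<Longrightarrow> C $ i $ p = 0" "i \<noteq> p \<Longrightarrow> C $ p $ i = 0" for i
      using B by (auto simp: C_def)
    have Cw: "C *v w = C $ p $ p *s w" if w: "w $ p = 0" for w
    proof -
      let ?V = "B ** col_mat p w - col_mat p w ** B"
      have V: "?V = col_mat p (B *v w - B $ p $ p *s w)"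
        by (rule mat_eqI) (simp add: mult_outer outer_mult vec_mult_axis axis_one_nth B algebra_simps)
      have "(B *v w) $ p = (\<Sum>j\<in>UNIV. 0)"
        unfolding matrix_vector_mult_def using B(3) w
        by (simp, intro sum.neutral) (metis mult_eq_0_iff)
      then have "\<phi> ?V = ?V"
        unfolding V using w by (intro U) simp
      then have "\<phi> B ** col_mat p w - col_mat p w ** \<phi> B = ?V"
        using sl_aut_bracket[OF aut B(1) trU[OF w]] U[OF w] by simp
      then have "C ** col_mat p w - col_mat p w ** C = 0"
        by (simp add: C_def mat_ring_simps algebra_simps)
      then have *: "(C ** col_mat p w - col_mat p w ** C) $ i $ p = 0" for i
        by simp
      show ?thesis
        using * by (simp add: mult_outer outer_mult vec_mult_axis vec_eq_iff axis_one_nth mult.commute)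
    qed
    have "C $ i $ j = (if i = j then C $ p $ p else 0)" for i j
    proof (cases "j = p")
      case True then show ?thesis using C0 by auto
    next
      case False
      then have "(C *v axis j 1) $ i = (C $ p $ p *s axis j 1) $ i"
        by (subst Cw) (auto simp: axis_one_nth)
      then show ?thesis
        unfolding mult_vec_axis by (auto simp: axis_one_nth)
    qed
    then have C: "C = mscale (C $ p $ p) (mat 1)"
      by (intro mat_eqI) (metis mat_1_nth mscale_nth mult.right_neutral mult_zero_right)
    then have "trace C = C $ p $ p * of_nat CARD('r)"
      by (metis trace_I trace_mscale)
    with trC have "C $ p $ p = 0"
      by simp
    with C have "C = 0"
      by (metis mscale_zero)
    then show ?thesis
      by (simp add: C_def)
  qed
  \<comment> \<open>Degree 1: brackets with degree -1 land in degree 0, where \<open>\<phi>\<close>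
    is already known to be the identity.\<close>
  have deg1: "\<phi> B = B" if B: "trace B = 0" "\<And>i j. i \<noteq> p \<Longrightarrow> B $ i $ j = 0" for B
  proof -
    have Bp: "B $ p $ p = 0"
    proof -
      have "trace B = (\<Sum>i\<in>UNIV. if i = p then B $ p $ p else 0)"
        unfolding trace_def by (intro sum.cong) (auto simp: B)
      then show ?thesis using B by simp
    qed
    define C where "C = \<phi> B - B"
    have trC: "trace C = 0"
      using B by (simp add: C_def trace_sub sl_aut_trace[OF aut])
    have "grading p ** B - B ** grading p = B"
      by (rule mat_eqI, simp only: grading_bracket_nth) (auto simp: B Bp)
    then have *: "grading p ** \<phi> B - \<phi> B ** grading p = \<phi> B"
      using sl_aut_bracket[OF aut trace_grading B(1), of p] h by simp
    have "\<phi> B $ i $ j = 0" if "i \<noteq> p" for i j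
      using that grading_bracket_nth[of p "\<phi> B" i j] unfolding * by (auto split: if_splits)
    then have C0: "C $ i $ j = 0" if "i \<noteq> p" for i j
      using that B by (auto simp: C_def)
    have Cp: "C $ p $ p = 0"
      using Bp grading_bracket_nth[of p "\<phi> B" p p] unfolding * C_def by auto
    have Cw: "(C *v w) $ p = 0" if w: "w $ p = 0" for w
    proof -
      let ?V = "B ** col_mat p w - col_mat p w ** B"
      have trV: "trace ?V = 0"
        by (rule trace_bracket)
      have "\<phi> ?V = ?V"
        by (rule deg0) (use B Bp w trV in \<open>auto simp: mult_outer outer_mult vec_mult_axis axis_one_nth
          matrix_vector_mult_def\<close>)
      then have "\<phi> B ** col_mat p w - col_mat p w ** \<phi> B = ?V"
        using sl_aut_bracket[OF aut B(1) trU[OF w]] U[OF w] by simp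
      then have "C ** col_mat p w - col_mat p w ** C = 0"
        by (simp add: C_def mat_ring_simps algebra_simps)
      then have *: "(C ** col_mat p w - col_mat p w ** C) $ p $ p = 0"
        by simp
      show ?thesis
        using * w by (simp add: mult_outer outer_mult vec_mult_axis axis_one_nth)
    qed
    have "C $ i $ j = 0" for i j
    proof (cases "i = p \<and> j \<noteq> p")
      case True
      then have "(C *v axis j 1) $ p = 0"
        by (intro Cw) (auto simp: axis_one_nth)
      then show ?thesis
        using True unfolding mult_vec_axis by simp
    next
      case False then show ?thesis using C0 Cp by (cases "i = p") auto
    qed
    then have "C = 0"
      by (intro mat_eqI) simp
    then show ?thesis
      by (simp add: C_def)
  qed
  define w where "w = (\<chi> i. if i = p then 0 else A $ i $ p)"
  define R where "R = outer (axis p 1) (\<chi> j. if j = p then 0 else A $ p $ j)"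
  define M where "M = A - col_mat p w - R"
  have trR: "trace R = 0"
    by (simp add: R_def trace_outer)
  have trw: "trace (col_mat p w) = 0"
    by (simp add: trace_outer w_def)
  have trM: "trace M = 0"
    using A trR trw by (simp add: M_def trace_sub)
  have "\<phi> M = M"
    by (rule deg0[OF trM]) (auto simp: M_def R_def w_def axis_one_nth)
  moreover have "\<phi> R = R"
    by (rule deg1[OF trR]) (auto simp: R_def axis_one_nth)
  moreover have "\<phi> (col_mat p w) = col_mat p w"
    by (rule U) (simp add: w_def)
  moreover have "A = M + R + col_mat p w"
    by (simp add: M_def)
  moreover have "\<phi> (M + R + col_mat p w) = \<phi> M + \<phi> R + \<phi> (col_mat p w)"
    using trM trR trw sl_aut_add[OF aut, of "M + R"] sl_aut_add[OF aut, of M R] by (simp add: trace_add)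
  ultimately show ?thesis
    by simp
qed

lemma col_mat_mult_col_mat: "w $ p = 0 \<Longrightarrow> col_mat p v ** col_mat p w = 0"
  by (simp add: outer_mult vec_mult_outer)

lemma outer_zero [simp]: "outer 0 f = 0" "outer a 0 = 0"
  by simp_all

lemma grading_mult_col_mat:
  "w $ p = 0 \<Longrightarrow> grading p ** col_mat p w = mscale (- 1 / of_nat CARD('r)) (col_mat p w)"
  for w :: "complex ^ 'r"
  by (rule mat_eqI) (simp add: grading_def mat_ring_simps mult_outer[of "outer _ _"] outer_mult_vec)

lemma col_mat_mult_grading:
  "col_mat p w ** grading p = mscale (1 - 1 / of_nat CARD('r)) (col_mat p w)"
  for w :: "complex ^ 'r"
  by (rule mat_eqI) (simp add: grading_def mat_ring_simps outer_mult vec_mult_outer algebra_simps)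

text \<open>The image \<open>H\<close> of the grading element has the same brackets with the fixed
  columns as the grading element, so it differs from it by some \<open>col_mat p w\<close>.
  Conjugation by the unipotent matrix \<open>mat 1 + col_mat p w\<close> removes this difference and
  keeps the columns.\<close>

lemma sl_aut_fixing_columns:
  fixes \<phi> :: "complex ^ 'r ^ 'r \<Rightarrow> complex ^ 'r ^ 'r"
  assumes aut: "sl_aut \<phi>" and pq: "q \<noteq> p"
    and U: "\<And>w. w $ p = 0 \<Longrightarrow> \<phi> (col_mat p w) = col_mat p w"
  shows "\<exists>g. invertible g \<and> (\<forall>A. trace A = 0 \<longrightarrow> \<phi> A ** g = g ** A)"
proof -
  let ?n = "of_nat CARD('r) :: complex"
  have trU: "w $ p = 0 \<Longrightarrow> trace (col_mat p w) = 0" for w :: "complex ^ 'r"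
    by (simp add: trace_outer)
  define H where "H = \<phi> (grading p)"
  have HU: "H ** col_mat p w - col_mat p w ** H = - col_mat p w" if w: "w $ p = 0" for w
  proof -
    have "grading p ** col_mat p w - col_mat p w ** grading p = - col_mat p w"
      using w by (intro mat_eqI) (simp add: grading_mult_col_mat col_mat_mult_grading algebra_simps)
    then show ?thesis
      using sl_aut_bracket[OF aut trace_grading[of p] trU[OF w]] U[OF w] sl_aut_minus[OF aut trU[OF w]]
      by (simp add: H_def)
  qed
  have ent: "(if j = p then (H *v w) $ i else 0) - w $ i * H $ p $ j = - (if j = p then w $ i else 0)"
    if w: "w $ p = 0" for w i j
  proof -
    have "(H ** col_mat p w - col_mat p w ** H) $ i $ j = (- col_mat p w) $ i $ j"
      using HU[OF w] by simp
    then show ?thesis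
      by (simp add: mult_outer outer_mult vec_mult_axis axis_one_nth split: if_splits)
  qed
  \<comment> \<open>\<open>H\<close> acts on the vectors with \<open>w $ p = 0\<close> by this
    scalar; vanishing of the trace of \<open>H\<close> then determines it.\<close>
  define \<alpha> where "\<alpha> = H $ p $ p - 1"
  have Hp: "H $ p $ j = 0" if "j \<noteq> p" for j
    using ent[of "axis q 1" j q] pq that by (simp add: axis_one_nth)
  have Hw: "(H *v w) $ i = \<alpha> * w $ i" if "w $ p = 0" for w i
    using ent[OF that, of p i] by (simp add: \<alpha>_def algebra_simps)
  have Hij: "H $ i $ j = (if i = j then \<alpha> else 0)" if "j \<noteq> p" for i j
    using Hw[of "axis j 1" i] that by (simp add: axis_one_nth mult_vec_axis)
  have "trace H = (\<Sum>i\<in>UNIV. \<alpha> + (if i = p then 1 else 0))"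
    unfolding trace_def by (intro sum.cong) (auto simp: Hij \<alpha>_def)
  also have "\<dots> = \<alpha> * ?n + 1"
    by (simp add: sum.distrib)
  finally have "\<alpha> * ?n + 1 = 0"
    using sl_aut_trace[OF aut trace_grading, of p] by (simp add: H_def)
  then have \<alpha>: "\<alpha> = - 1 / ?n"
    by (simp add: field_simps eq_neg_iff_add_eq_0)
  define w where "w = (\<chi> i. if i = p then 0 else H $ i $ p)"
  have w: "w $ p = 0"
    by (simp add: w_def)
  have H: "H = grading p + col_mat p w"
  proof (rule mat_eqI)
    fix i j show "H $ i $ j = (grading p + col_mat p w) $ i $ j"
      using Hij[of j i] \<alpha> by (auto simp: grading_def w_def axis_one_nth mat_1_nth \<alpha>_def algebra_simps)
  qed
  have ww: "col_mat p w ** col_mat p w = 0"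
    using w by (rule col_mat_mult_col_mat)
  \<comment> \<open>The exponential of \<open>col_mat p w\<close>, whose square is 0;
    \<open>u'\<close> is its inverse.\<close>
  define u where "u = mat 1 + col_mat p w"
  define u' where "u' = mat 1 - col_mat p w"
  have "u ** u' = mat 1"
    by (simp add: u_def u'_def mat_ring_simps ww)
  from matrix_inv_eqI[OF this] have u: "invertible u" "matrix_inv u = u'"
    by auto
  define \<phi>' where "\<phi>' A = u' ** \<phi> A ** u" for A
  have aut': "sl_aut \<phi>'"
    using sl_aut_conj[OF aut u(1)] by (simp add: u(2) \<phi>'_def[abs_def])
  have "\<phi>' (grading p) = grading p"
  proof -
    have 1: "u' ** H = grading p + mscale (1 / ?n) (col_mat p w)"
      by (rule mat_eqI) (simp add: H u'_def mat_ring_simps ww col_mat_mult_grading algebra_simps)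
    have "u' ** H ** u = grading p"
      unfolding 1 u_def
      by (rule mat_eqI) (simp add: mat_ring_simps ww grading_mult_col_mat[OF w])
    then show ?thesis
      by (simp add: \<phi>'_def H_def)
  qed
  moreover have "\<phi>' (col_mat p v) = col_mat p v" if v: "v $ p = 0" for v
    using v w by (simp add: \<phi>'_def U u_def u'_def mat_ring_simps col_mat_mult_col_mat)
  ultimately have id: "\<phi>' A = A" if "trace A = 0" for A
    using sl_aut_fixing_graded_part[OF aut'] that by blast
  have "\<phi> A ** u = u ** A" if "trace A = 0" for A
  proof -
    have "u ** \<phi>' A = (u ** u') ** \<phi> A ** u"
      by (simp add: \<phi>'_def matrix_mul_assoc)
    then show ?thesis
      using id[OF that] \<open>u ** u' = mat 1\<close> by simp
  qed
  with u show ?thesis by blast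
qed

text \<open>When the images of the columns share the functional \<open>f\<close>, the vector
  \<open>w\<close> goes to \<open>\<gamma> w\<close> linearly and injectively, into the kernel of
  \<open>f\<close>. Completed by one vector outside this kernel, \<open>\<gamma>\<close> becomes an
  invertible matrix, and conjugation by it reduces to the case of fixed columns.\<close>

lemma sl_aut_columns_common_functional:
  fixes \<phi> :: "complex ^ 'r ^ 'r \<Rightarrow> complex ^ 'r ^ 'r"
  assumes aut: "sl_aut \<phi>" and pq: "q \<noteq> p"
    and U: "\<And>w. w $ p = 0 \<Longrightarrow> \<exists>v. \<phi> (col_mat p w) = outer v f"
  shows "\<exists>g. invertible g \<and> (\<forall>A. trace A = 0 \<longrightarrow> \<phi> A ** g = g ** A)"
proof -
  have trU: "w $ p = 0 \<Longrightarrow> trace (col_mat p w) = 0" for w :: "complex ^ 'r"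
    by (simp add: trace_outer)
  have nz: "\<phi> (col_mat p w) \<noteq> 0" if "w $ p = 0" "w \<noteq> 0" for w
  proof
    assume "\<phi> (col_mat p w) = 0"
    then have "col_mat p w = 0"
      using sl_aut_inj[OF aut trU] that by blast
    then show False using that by simp
  qed
  have f: "f \<noteq> 0"
    using U[of "axis q 1"] nz[of "axis q 1"] pq by (auto simp: axis_one_nth)
  obtain \<gamma> where \<gamma>: "\<And>w. w $ p = 0 \<Longrightarrow> \<phi> (col_mat p w) = outer (\<gamma> w) f"
    using U by metis
  have add: "\<gamma> (v + w) = \<gamma> v + \<gamma> w" if "v $ p = 0" "w $ p = 0" for v w
  proof (rule outer_eq_outer_nonzero[OF f])
    have "col_mat p (v + w) = col_mat p v + col_mat p w"
      by (rule mat_eqI) (simp add: algebra_simps)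
    then have "outer (\<gamma> (v + w)) f = outer (\<gamma> v) f + outer (\<gamma> w) f"
      using that sl_aut_add[OF aut trU trU, of v w] by (simp flip: \<gamma>)
    then show "outer (\<gamma> (v + w)) f = outer (\<gamma> v + \<gamma> w) f"
      by (simp add: vec_eq_iff algebra_simps)
  qed
  have scale: "\<gamma> (c *s w) = c *s \<gamma> w" if "w $ p = 0" for c w
  proof (rule outer_eq_outer_nonzero[OF f])
    have "col_mat p (c *s w) = mscale c (col_mat p w)"
      by (rule mat_eqI) simp
    then have "outer (\<gamma> (c *s w)) f = mscale c (outer (\<gamma> w) f)"
      using that sl_aut_scale[OF aut trU, of w c] by (simp flip: \<gamma>)
    then show "outer (\<gamma> (c *s w)) f = outer (c *s \<gamma> w) f"
      by (simp add: vec_eq_iff)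
  qed
  have inj: "w = 0" if "w $ p = 0" "\<gamma> w = 0" for w
    using nz \<gamma> that by auto
  have f\<gamma>: "pairing f (\<gamma> w) = 0" if "w $ p = 0" for w
    using sl_aut_trace[OF aut trU[OF that]] by (simp add: \<gamma> that trace_outer)
  obtain j where j: "f $ j \<noteq> 0"
    using f by (auto simp: vec_eq_iff)
  \<comment> \<open>The image chosen for \<open>axis p 1\<close>. It is normalized to have
    \<open>f\<close>-value 1, so that \<open>f v* g = axis p 1\<close> and the functionals match as
    well.\<close>
  define v1 where "v1 = (1 / f $ j) *s axis j 1"
  have v1: "pairing f v1 = 1"
    using j by (simp add: v1_def pairing_scale)
  define L where "L v = v $ p *s v1 + \<gamma> (v - v $ p *s axis p 1)" for v
  have L: "Vector_Spaces.linear (*s) (*s) L"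
  proof (unfold_locales)
    fix v w :: "complex ^ 'r"
    have "v + w - (v + w) $ p *s axis p 1 = (v - v $ p *s axis p 1) + (w - w $ p *s axis p 1)"
      by (simp add: vec_eq_iff ring_distribs)
    then have "\<gamma> (v + w - (v + w) $ p *s axis p 1) = \<gamma> (v - v $ p *s axis p 1) + \<gamma> (w - w $ p *s axis p 1)"
      by (simp only:) (rule add; simp add: axis_one_nth)
    then show "L (v + w) = L v + L w"
      unfolding L_def by (simp only: vec_eq_iff vector_add_component vector_smult_component) (simp add: ring_distribs)
  next
    fix c :: complex and v :: "complex ^ 'r"
    have "c *s v - (c *s v) $ p *s axis p 1 = c *s (v - v $ p *s axis p 1)"
      by (simp add: vec_eq_iff ring_distribs)
    then have "\<gamma> (c *s v - (c *s v) $ p *s axis p 1) = c *s \<gamma> (v - v $ p *s axis p 1)"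
      by (simp only:) (rule scale; simp add: axis_one_nth)
    then show "L (c *s v) = c *s L v"
      unfolding L_def by (simp only: vec_eq_iff vector_add_component vector_smult_component) (simp add: ring_distribs)
  qed
  define g where "g = matrix L"
  have g: "g *v v = L v" for v
    unfolding g_def by (rule matrix_works[OF L])
  have gw: "g *v w = \<gamma> w" if "w $ p = 0" for w
    using that by (simp add: g L_def)
  have fg': "pairing f (g *v v) = v $ p" for v
  proof -
    have "pairing f (L v) = v $ p * pairing f v1 + pairing f (\<gamma> (v - v $ p *s axis p 1))"
      by (simp add: L_def pairing_def sum.distrib sum_distrib_left algebra_simps)
    then show ?thesis
      by (simp add: g v1 f\<gamma> axis_one_nth)
  qed
  have fg: "f v* g = axis p 1"
  proof -
    have "(f v* g) $ k = pairing f (g *v axis k 1)" for k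
      by (simp add: pairing_def mult_vec_axis vector_matrix_mult_def mult.commute)
    then show ?thesis
      by (simp add: fg' vec_eq_iff axis_one_nth)
  qed
  have inv: "invertible g"
    unfolding invertible_left_inverse matrix_left_invertible_ker
  proof (intro allI impI)
    fix v assume *: "g *v v = 0"
    then have "v $ p = 0"
      using fg'[of v] by (simp add: pairing_def)
    then show "v = 0"
      using * gw inj by metis
  qed
  define \<phi>' where "\<phi>' A = matrix_inv g ** \<phi> A ** g" for A
  have aut': "sl_aut \<phi>'"
    using sl_aut_conj[OF aut inv] by (simp add: \<phi>'_def[abs_def])
  have "\<phi>' (col_mat p w) = col_mat p w" if w: "w $ p = 0" for w
    using matrix_inv_mult_vec(1)[OF inv, of w] w
    by (simp add: \<phi>'_def \<gamma> mult_outer outer_mult fg gw)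
  then obtain u where u: "invertible u" "\<And>A. trace A = 0 \<Longrightarrow> \<phi>' A ** u = u ** A"
    using sl_aut_fixing_columns[OF aut' pq] by blast
  have "\<phi> A ** (g ** u) = (g ** u) ** A" if "trace A = 0" for A
  proof -
    have "g ** (\<phi>' A ** u) = (g ** matrix_inv g) ** \<phi> A ** (g ** u)"
      by (simp add: \<phi>'_def matrix_mul_assoc)
    then show ?thesis
      using u(2)[OF that] matrix_inv[OF inv] by (simp add: matrix_mul_assoc)
  qed
  moreover have "invertible (g ** u)"
    using inv u(1) by (simp add: invertible_det_nz det_mul)
  ultimately show ?thesis by blast
qed

text \<open>The matrix \<open>U = col_mat p w\<close> has square 0, and \<open>U ** Z ** U\<close>
  is a multiple of \<open>U\<close>, so it is extremal. Extremality and the relation with the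
  grading element are expressed by brackets and therefore survive \<open>\<phi>\<close>.\<close>

lemma sl_aut_column_rank_one:
  fixes \<phi> :: "complex ^ 'r ^ 'r \<Rightarrow> complex ^ 'r ^ 'r"
  assumes aut: "sl_aut \<phi>" and w: "w $ p = 0" "w \<noteq> 0"
  shows "\<exists>a f. \<phi> (col_mat p w) = outer a f"
proof -
  let ?U = "col_mat p w" and ?X = "\<phi> (col_mat p w)"
  have trU: "trace ?U = 0"
    using w by (simp add: trace_outer)
  show ?thesis
  proof (rule rank_one_of_extremal)
    show "?X \<noteq> 0"
      using sl_aut_inj[OF aut trU] w by auto
    have "grading p ** ?U - ?U ** grading p = - ?U"
      using w by (intro mat_eqI) (simp add: grading_mult_col_mat col_mat_mult_grading algebra_simps)
    then show "\<phi> (grading p) ** ?X - ?X ** \<phi> (grading p) = - ?X"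
      using sl_aut_bracket[OF aut trace_grading[of p] trU] sl_aut_minus[OF aut trU] by simp
  next
    fix Y :: "complex ^ 'r ^ 'r" assume "trace Y = 0"
    then obtain Z where Z: "trace Z = 0" "\<phi> Z = Y"
      using sl_aut_surj[OF aut] by blast
    have UU: "?U ** ?U = 0"
      using w by (simp add: col_mat_mult_col_mat)
    have "?U ** Z ** ?U = mscale ((Z *v w) $ p) ?U"
      by (rule mat_eqI) (simp add: outer_mult mult_outer outer_mult_vec vec_mult_outer vec_mult_axis
        pairing_def matrix_vector_mult_def sum_distrib_left mult_ac flip: matrix_mul_assoc)
    then have "?U ** (?U ** Z - Z ** ?U) - (?U ** Z - Z ** ?U) ** ?U = mscale (- 2 * (Z *v w) $ p) ?U"
    proof -
      assume *: "?U ** Z ** ?U = mscale ((Z *v w) $ p) ?U"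
      have "?U ** (?U ** Z - Z ** ?U) - (?U ** Z - Z ** ?U) ** ?U =
          (?U ** ?U) ** Z - mscale 2 (?U ** Z ** ?U) + Z ** (?U ** ?U)"
        by (rule mat_eqI) (simp add: mat_mult_diff_left mat_mult_diff_right matrix_mul_assoc)
      then show ?thesis
        unfolding * UU by (simp add: vec_eq_iff)
    qed
    then have "\<phi> (?U ** (?U ** Z - Z ** ?U) - (?U ** Z - Z ** ?U) ** ?U) = mscale (- 2 * (Z *v w) $ p) ?X"
      using sl_aut_scale[OF aut trU] by simp
    moreover have "\<phi> (?U ** (?U ** Z - Z ** ?U) - (?U ** Z - Z ** ?U) ** ?U) =
        ?X ** (?X ** Y - Y ** ?X) - (?X ** Y - Y ** ?X) ** ?X"
      using trU Z sl_aut_bracket[OF aut] trace_bracket by metis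
    ultimately show "\<exists>c. ?X ** (?X ** Y - Y ** ?X) - (?X ** Y - Y ** ?X) ** ?X = mscale c ?X"
      by metis
  qed
qed

text \<open>The columns with \<open>w $ p = 0\<close> are sent to a linear space of matrices of rank
  at most one. In such a space either all functionals or all column vectors are proportional. The
  first alternative gives a conjugation; the second becomes the first after composition with the
  negative transpose.\<close>

theorem sl_aut_inner_or_neg_transpose:
  fixes \<phi> :: "complex ^ 'r ^ 'r \<Rightarrow> complex ^ 'r ^ 'r"
  assumes aut: "sl_aut \<phi>" and card: "CARD('r) \<ge> 2"
  obtains (inner) g where "invertible g" "\<And>A. trace A = 0 \<Longrightarrow> \<phi> A ** g = g ** A"
  | (neg_transpose) g where "invertible g" "\<And>A. trace A = 0 \<Longrightarrow> \<phi> A ** g = - (g ** transpose A)"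
proof -
  obtain p q :: 'r where pq: "q \<noteq> p"
    using card by (metis (full_types) UNIV_eq_I card_1_singleton_iff insert_iff not_less_eq_eq numeral_2_eq_2 order_refl)
  have trU: "w $ p = 0 \<Longrightarrow> trace (col_mat p w) = 0" for w :: "complex ^ 'r"
    by (simp add: trace_outer)
  have "\<exists>a f. \<phi> (col_mat p w) = outer a f \<and> (w \<noteq> 0 \<longrightarrow> a \<noteq> 0 \<and> f \<noteq> 0)" if w: "w $ p = 0" for w
  proof (cases "w = 0")
    case True
    then have "\<phi> (col_mat p w) = outer 0 0"
      using sl_aut_scale[OF aut, of 0 0] by (simp add: trace_zero)
    then show ?thesis using True by blast
  next
    case False
    then obtain a f where "\<phi> (col_mat p w) = outer a f"
      using sl_aut_column_rank_one[OF aut w] by blast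
    moreover have "\<phi> (col_mat p w) \<noteq> 0"
      using sl_aut_inj[OF aut trU[OF w]] False by auto
    ultimately show ?thesis by auto
  qed
  then obtain a f where af: "\<And>w. w $ p = 0 \<Longrightarrow> \<phi> (col_mat p w) = outer (a w) (f w)"
      "\<And>w. w $ p = 0 \<Longrightarrow> w \<noteq> 0 \<Longrightarrow> a w \<noteq> 0" "\<And>w. w $ p = 0 \<Longrightarrow> w \<noteq> 0 \<Longrightarrow> f w \<noteq> 0"
    by metis
  define K where "K = {w :: complex ^ 'r. w $ p = 0 \<and> w \<noteq> 0}"
  define par where "par x y \<longleftrightarrow> (\<exists>s. y = s *s x)" for x y :: "complex ^ 'r"
  have par_sym: "par y x" if xy: "par x y" "y \<noteq> 0" for x y :: "complex ^ 'r"
  proof -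
    obtain s where s: "y = s *s x" using xy by (auto simp: par_def)
    then have "s \<noteq> 0" using xy by auto
    then have "x = (1 / s) *s y" using s by (simp add: vec.scale_scale)
    then show ?thesis by (auto simp: par_def)
  qed
  have par_trans: "par x y \<Longrightarrow> par y z \<Longrightarrow> par x z" for x y z
    by (auto simp: par_def)
  have dich: "par (a v) (a w) \<or> par (f v) (f w)" if "v \<in> K" "w \<in> K" for v w
  proof -
    have vw: "v $ p = 0" "w $ p = 0" "(v + w) $ p = 0"
      using that by (auto simp: K_def)
    have "col_mat p (v + w) = col_mat p v + col_mat p w"
      by (rule mat_eqI) (simp add: algebra_simps)
    then have "outer (a v) (f v) + outer (a w) (f w) = outer (a (v + w)) (f (v + w))"
      using sl_aut_add[OF aut trU[OF vw(1)] trU[OF vw(2)]] vw by (simp flip: af(1))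
    then show ?thesis
      unfolding par_def by (rule outer_add_outer_rank_one) (use that af in \<open>auto simp: K_def\<close>)
  qed
  have nz: "a w \<noteq> 0" "f w \<noteq> 0" if "w \<in> K" for w
    using that af by (auto simp: K_def)
  let ?e = "axis q 1 :: complex ^ 'r"
  have e: "?e \<in> K"
    using pq by (auto simp: K_def axis_one_nth)
  \<comment> \<open>If some \<open>f w\<close> is not proportional to \<open>f ?e\<close>, then
    \<open>a w\<close> is proportional to \<open>a ?e\<close>; an \<open>x\<close> with
    \<open>a x\<close> not proportional to these would have \<open>f x\<close> proportional to both
    \<open>f ?e\<close> and \<open>f w\<close>.\<close>
  consider "\<forall>w\<in>K. par (f ?e) (f w)" | "\<exists>v\<in>K. \<forall>w\<in>K. par (a v) (a w)"
  proof (cases "\<forall>w\<in>K. par (f ?e) (f w)")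
    case False
    then obtain w where w: "w \<in> K" "\<not> par (f ?e) (f w)" by blast
    then have aw: "par (a ?e) (a w)" using dich e by blast
    have "par (a ?e) (a x)" if x: "x \<in> K" for x
    proof (rule ccontr)
      assume n: "\<not> par (a ?e) (a x)"
      then have "\<not> par (a w) (a x)" using aw par_trans by blast
      then have "par (f w) (f x)" "par (f ?e) (f x)"
        using n dich e w x by blast+
      then have "par (f ?e) (f w)"
        using par_sym nz x par_trans by blast
      then show False using w by blast
    qed
    then show ?thesis using that e by blast
  qed (use that in blast)
  then show ?thesis
  proof cases
    case 1
    have "\<exists>v. \<phi> (col_mat p w) = outer v (f ?e)" if w: "w $ p = 0" for w
    proof (cases "w = 0")
      case True
      then have "\<phi> (col_mat p w) = outer 0 (f ?e)"
        using sl_aut_scale[OF aut, of 0 0] by (simp add: trace_zero)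
      then show ?thesis by blast
    next
      case False
      then obtain s where "f w = s *s f ?e"
        using 1 w by (auto simp: K_def par_def)
      then have "\<phi> (col_mat p w) = outer (s *s a w) (f ?e)"
        using af(1)[OF w] by (simp add: vec_eq_iff)
      then show ?thesis by blast
    qed
    then show ?thesis
      using sl_aut_columns_common_functional[OF aut pq] that by blast
  next
    case 2
    then obtain v where v: "v \<in> K" "\<And>w. w \<in> K \<Longrightarrow> par (a v) (a w)" by blast
    have "\<exists>x. - transpose (\<phi> (col_mat p w)) = outer x (a v)" if w: "w $ p = 0" for w
    proof (cases "w = 0")
      case True
      then have "- transpose (\<phi> (col_mat p w)) = outer 0 (a v)"
        using sl_aut_scale[OF aut, of 0 0] by (simp add: trace_zero) (simp add: transpose_def vec_eq_iff)
      then show ?thesis by blast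
    next
      case False
      then obtain s where "a w = s *s a v"
        using v w by (auto simp: K_def par_def)
      then have "- transpose (\<phi> (col_mat p w)) = outer ((- s) *s f w) (a v)"
        using af(1)[OF w] by (simp add: vec_eq_iff transpose_def)
      then show ?thesis by blast
    qed
    then obtain g where g: "invertible g" "\<And>A. trace A = 0 \<Longrightarrow> - transpose (\<phi> A) ** g = g ** A"
      using sl_aut_columns_common_functional[OF sl_aut_neg_transpose[OF aut] pq] by blast
    \<comment> \<open>Transposing \<open>- transpose (\<phi> A) ** g = g ** A\<close> turns the
      intertwiner into its inverse transpose.\<close>
    let ?g = "matrix_inv (transpose g)"
    have ig: "invertible (transpose g)"
      using g(1) by (simp add: invertible_det_nz)
    have "\<phi> A ** ?g = - (?g ** transpose A)" if "trace A = 0" for A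
    proof -
      have "transpose (- transpose (\<phi> A) ** g) = transpose (g ** A)"
        using g(2)[OF that] by simp
      then have *: "transpose g ** \<phi> A = - (transpose A ** transpose g)"
        by (simp add: matrix_transpose_mul transpose_minus mat_ring_simps) (metis minus_minus)
      have "\<phi> A ** ?g = (?g ** transpose g) ** \<phi> A ** ?g"
        by (simp add: matrix_inv[OF ig])
      also have "\<dots> = ?g ** (transpose g ** \<phi> A) ** ?g"
        by (simp only: matrix_mul_assoc)
      also have "\<dots> = - (?g ** transpose A ** (transpose g ** ?g))"
        unfolding * by (simp add: mat_ring_simps)
      finally show ?thesis
        by (simp add: matrix_inv[OF ig])
    qed
    then show ?thesis
      using that(2) invertible_matrix_inv[OF ig] by blast
  qed
qed

text \<open>Multiplicativity modulo scalars is a closed condition which singles out the inner automorphisms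
  (for \<open>r = 2\<close> every automorphism is inner, and both conditions hold).\<close>

definition sl_mult :: "(complex ^ 'r ^ 'r \<Rightarrow> complex ^ 'r ^ 'r) \<Rightarrow> bool" where
  "sl_mult \<phi> \<longleftrightarrow> (\<forall>A B. trace A = 0 \<and> trace B = 0 \<longrightarrow>
     \<phi> (traceless (A ** B)) = traceless (\<phi> A ** \<phi> B))"

definition sl_antimult :: "(complex ^ 'r ^ 'r \<Rightarrow> complex ^ 'r ^ 'r) \<Rightarrow> bool" where
  "sl_antimult \<phi> \<longleftrightarrow> (\<forall>A B. trace A = 0 \<and> trace B = 0 \<longrightarrow>
     \<phi> (traceless (A ** B)) = - traceless (\<phi> B ** \<phi> A))"

lemma eq_conj_of_intertwine:
  assumes "invertible (g :: complex ^ 'r ^ 'r)" "B ** g = C"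
  shows "B = C ** matrix_inv g"
proof -
  have "C ** matrix_inv g = B ** (g ** matrix_inv g)"
    using assms(2) by (simp add: matrix_mul_assoc)
  then show ?thesis
    by (simp add: matrix_inv[OF assms(1)])
qed

lemma conj_mult_conj:
  assumes "invertible (g :: complex ^ 'r ^ 'r)"
  shows "(g ** A ** matrix_inv g) ** (g ** B ** matrix_inv g) = g ** (A ** B) ** matrix_inv g"
proof -
  have "(g ** A ** matrix_inv g) ** (g ** B ** matrix_inv g) = g ** A ** (matrix_inv g ** g) ** B ** matrix_inv g"
    by (simp only: matrix_mul_assoc)
  then show ?thesis
    by (simp add: matrix_inv[OF assms] matrix_mul_assoc)
qed

lemma trace_conj:
  assumes "invertible (g :: complex ^ 'r ^ 'r)"
  shows "trace (g ** A ** matrix_inv g) = trace A"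
  using trace_mul_sym[of "g ** A" "matrix_inv g"] by (simp add: matrix_mul_assoc matrix_inv[OF assms])

lemma traceless_conj:
  assumes "invertible (g :: complex ^ 'r ^ 'r)"
  shows "g ** traceless A ** matrix_inv g = traceless (g ** A ** matrix_inv g)"
  unfolding traceless_def trace_conj[OF assms]
  by (simp add: mat_ring_simps matrix_inv[OF assms])

lemma traceless_transpose: "transpose (traceless A) = traceless (transpose A)"
  by (simp add: traceless_def trace_transpose transpose_diff transpose_mscale)

text \<open>Read off from the two explicit forms. Invariance of the trace form comes along because
  the extension to all matrices needs it for the scalar part of a product.\<close>

lemma sl_aut_cases:
  fixes \<phi> :: "complex ^ 'r ^ 'r \<Rightarrow> complex ^ 'r ^ 'r"
  assumes aut: "sl_aut \<phi>" and card: "CARD('r) \<ge> 2"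
  shows "sl_mult \<phi> \<or> sl_antimult \<phi>"
    and "trace A = 0 \<Longrightarrow> trace B = 0 \<Longrightarrow> trace (\<phi> A ** \<phi> B) = trace (A ** B)"
proof -
  have *: "(sl_mult \<phi> \<or> sl_antimult \<phi>) \<and>
    (\<forall>A B. trace A = 0 \<longrightarrow> trace B = 0 \<longrightarrow> trace (\<phi> A ** \<phi> B) = trace (A ** B))"
    using aut card
  proof (cases rule: sl_aut_inner_or_neg_transpose)
    case (inner g)
    have e: "\<phi> A = g ** A ** matrix_inv g" if "trace A = 0" for A
      using eq_conj_of_intertwine[OF inner(1) inner(2)[OF that]] .
    show ?thesis
      by (auto simp: sl_mult_def e conj_mult_conj[OF inner(1)] trace_conj[OF inner(1)]
          traceless_conj[OF inner(1)])
  next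
    case (neg_transpose g)
    have e: "\<phi> A = - (g ** transpose A ** matrix_inv g)" if "trace A = 0" for A
      using eq_conj_of_intertwine[OF neg_transpose(1) neg_transpose(2)[OF that]]
      by (simp add: mat_mult_minus_left)
    have tr: "trace (transpose A ** transpose B) = trace (A ** B)" for A B :: "complex ^ 'r ^ 'r"
      by (metis matrix_transpose_mul trace_mul_sym trace_transpose)
    show ?thesis
      by (auto simp: sl_antimult_def e conj_mult_conj[OF neg_transpose(1)] trace_conj[OF neg_transpose(1)]
          traceless_conj[OF neg_transpose(1)] mat_mult_minus_left mat_mult_minus_right
          traceless_transpose matrix_transpose_mul tr)
  qed
  show "sl_mult \<phi> \<or> sl_antimult \<phi>"
    using * by blast
  show "trace A = 0 \<Longrightarrow> trace B = 0 \<Longrightarrow> trace (\<phi> A ** \<phi> B) = trace (A ** B)"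
    using * by blast
qed

text \<open>Diagonal matrix units are not traceless; extending by the identity on scalars makes them
  available to the Skolem-Noether argument.\<close>

definition gl_extension :: "(complex ^ 'r ^ 'r \<Rightarrow> complex ^ 'r ^ 'r) \<Rightarrow> complex ^ 'r ^ 'r \<Rightarrow> complex ^ 'r ^ 'r" where
  "gl_extension \<phi> A = \<phi> (traceless A) + mscale (trace A / of_nat CARD('r)) (mat 1)"

lemma traceless_decomp: "A = traceless A + mscale (trace A / of_nat CARD('r)) (mat 1)"
  for A :: "complex ^ 'r ^ 'r"
  by (simp add: traceless_def)

lemma traceless_add: "traceless (A + B) = traceless A + traceless B"
  by (rule mat_eqI) (simp add: traceless_def trace_add ring_distribs add_divide_distrib)

lemma traceless_mscale: "traceless (mscale c A) = mscale c (traceless A)"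
  by (rule mat_eqI) (simp add: traceless_def trace_mscale ring_distribs)

lemma traceless_mat_1 [simp]: "traceless (mat 1) = 0"
  by (simp add: traceless_def trace_I)

text \<open>Modulo scalars this is \<open>sl_mult\<close>; the scalar parts agree because the trace
  of a product of two traceless matrices is preserved.\<close>

lemma gl_extension_mult:
  fixes \<phi> :: "complex ^ 'r ^ 'r \<Rightarrow> complex ^ 'r ^ 'r"
  assumes aut: "sl_aut \<phi>" and card: "CARD('r) \<ge> 2" and mult: "sl_mult \<phi>"
  shows "gl_extension \<phi> A ** gl_extension \<phi> B = gl_extension \<phi> (A ** B)"
proof -
  let ?n = "of_nat CARD('r) :: complex"
  let ?A = "traceless A" and ?B = "traceless B"
  define a where "a = trace A / ?n"
  define b where "b = trace B / ?n"
  have AB: "A ** B = ?A ** ?B + mscale b ?A + mscale a ?B + mscale (a * b) (mat 1)"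
    by (subst traceless_decomp[of A], subst traceless_decomp[of B], fold a_def b_def)
      (rule mat_eqI, simp add: mat_ring_simps ring_distribs)
  have tr: "trace (A ** B) = trace (?A ** ?B) + a * b * ?n"
    unfolding AB by (simp add: trace_add trace_mscale trace_I)
  have "\<phi> (traceless (A ** B)) = \<phi> (traceless (?A ** ?B) + mscale b ?A + mscale a ?B)"
    unfolding AB by (simp add: traceless_add traceless_mscale traceless_id)
  also have "\<dots> = traceless (\<phi> ?A ** \<phi> ?B) + mscale b (\<phi> ?A) + mscale a (\<phi> ?B)"
    using mult by (simp add: sl_mult_def sl_aut_add[OF aut] sl_aut_scale[OF aut] trace_add trace_mscale)
  finally have "gl_extension \<phi> (A ** B) = traceless (\<phi> ?A ** \<phi> ?B) + mscale b (\<phi> ?A) + mscale a (\<phi> ?B)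
      + mscale (trace (\<phi> ?A ** \<phi> ?B) / ?n + a * b) (mat 1)"
    by (simp add: gl_extension_def tr sl_aut_cases(2)[OF aut card] add_divide_distrib)
  also have "\<dots> = (\<phi> ?A + mscale a (mat 1)) ** (\<phi> ?B + mscale b (mat 1))"
    by (rule mat_eqI) (simp add: mat_ring_simps traceless_def algebra_simps)
  finally show ?thesis
    by (simp add: gl_extension_def a_def b_def)
qed

lemma gl_extension_linear:
  assumes aut: "sl_aut \<phi>"
  shows "gl_extension \<phi> (A + B) = gl_extension \<phi> A + gl_extension \<phi> B"
    and "gl_extension \<phi> (mscale c A) = mscale c (gl_extension \<phi> A)"
  by (rule mat_eqI, simp add: gl_extension_def traceless_add traceless_mscale sl_aut_add[OF aut]
      sl_aut_scale[OF aut] trace_add trace_mscale add_divide_distrib ring_distribs)+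

text \<open>The matrices supported in column \<open>p\<close> form a left ideal isomorphic to the
  standard module. Letting this ideal act through the extension on a suitable vector
  \<open>v\<close> gives a map \<open>g\<close> which intertwines the two actions; it is injective
  because the standard module is simple.\<close>

theorem skolem_noether:
  fixes \<phi> :: "complex ^ 'r ^ 'r \<Rightarrow> complex ^ 'r ^ 'r"
  assumes aut: "sl_aut \<phi>" and card: "CARD('r) \<ge> 2" and mult: "sl_mult \<phi>"
  shows "\<exists>g. invertible g \<and> (\<forall>A. trace A = 0 \<longrightarrow> \<phi> A = g ** A ** matrix_inv g)"
proof -
  let ?\<psi> = "gl_extension \<phi>"
  fix p :: 'r
  have "?\<psi> (col_mat p (axis p 1)) \<noteq> 0"
  proof
    assume *: "?\<psi> (col_mat p (axis p 1)) = 0"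
    have "trace (?\<psi> (col_mat p (axis p 1))) = 1"
      by (simp add: gl_extension_def trace_add trace_mscale trace_I trace_outer axis_one_nth sl_aut_trace[OF aut])
    then show False
      using * by (simp add: trace_zero)
  qed
  \<comment> \<open>The image of the idempotent at \<open>p\<close> has trace 1, so it is not
    0.\<close>
  then obtain v where v: "?\<psi> (col_mat p (axis p 1)) *v v \<noteq> 0"
    using mat_nonzero_mult_vec by blast
  define L where "L w = ?\<psi> (col_mat p w) *v v" for w
  have L: "Vector_Spaces.linear (*s) (*s) L"
  proof unfold_locales
    fix w w' :: "complex ^ 'r"
    have "col_mat p (w + w') = col_mat p w + col_mat p w'"
      by (rule mat_eqI) (simp add: ring_distribs)
    then show "L (w + w') = L w + L w'"
      by (simp add: L_def gl_extension_linear[OF aut] matrix_vector_mult_add_rdistrib)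
  next
    fix c and w :: "complex ^ 'r"
    have "col_mat p (c *s w) = mscale c (col_mat p w)"
      by (rule mat_eqI) simp
    then show "L (c *s w) = c *s L w"
      by (simp add: L_def gl_extension_linear[OF aut] mscale_mult_vec)
  qed
  define g where "g = matrix L"
  have g: "g *v w = L w" for w
    unfolding g_def by (rule matrix_works[OF L])
  have gA: "?\<psi> A *v (g *v w) = g *v (A *v w)" for A w
  proof -
    have "?\<psi> A *v (g *v w) = ?\<psi> A ** ?\<psi> (col_mat p w) *v v"
      by (simp only: g L_def matrix_vector_mul_assoc)
    then show ?thesis
      by (simp only: gl_extension_mult[OF assms] mult_outer g L_def)
  qed
  have inv: "invertible g"
    unfolding invertible_left_inverse matrix_left_invertible_ker
  proof (intro allI impI, rule ccontr)
    fix w assume w: "g *v w = 0" "w \<noteq> 0"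
    then obtain i where i: "w $ i \<noteq> 0"
      by (auto simp: vec_eq_iff)
    \<comment> \<open>Simplicity in matrix form: a nonzero \<open>w\<close> in the kernel can be
      moved to \<open>axis p 1\<close>, but \<open>g *v axis p 1\<close> is nonzero by the choice of
      \<open>v\<close>.\<close>
    have "outer (axis p 1) ((1 / w $ i) *s axis i 1) *v w = axis p 1"
      using i by (simp add: outer_mult_vec pairing_scale)
    then have "g *v axis p 1 = ?\<psi> (outer (axis p 1) ((1 / w $ i) *s axis i 1)) *v (g *v w)"
      by (simp add: gA)
    then show False
      using v w by (simp add: g L_def)
  qed
  have "\<phi> A = g ** A ** matrix_inv g" if "trace A = 0" for A
  proof (rule eq_conj_of_intertwine[OF inv])
    show "\<phi> A ** g = g ** A"
      unfolding matrix_eq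
    proof
      fix w show "\<phi> A ** g *v w = g ** A *v w"
        using gA[of A w] that by (simp add: gl_extension_def traceless_id matrix_vector_mul_assoc)
    qed
  qed
  with inv show ?thesis
    by blast
qed

section \<open>Zariski topology and germs of regular functions\<close>

lemma pairing_diff: "pairing (x - y) v = pairing x v - pairing y v"
  by (simp add: pairing_def sum_subtractf algebra_simps)

lemma cpolynomial_sum: "finite I \<Longrightarrow> (\<And>i. i \<in> I \<Longrightarrow> cpolynomial (f i)) \<Longrightarrow> cpolynomial (\<lambda>v. \<Sum>i\<in>I. f i v)"
  by (induction I rule: finite_induct) (auto intro: cpolynomial.intros)

lemma form_add: "form d F \<Longrightarrow> form d G \<Longrightarrow> form d (\<lambda>v. F v + G v)"
  by (auto simp: form_def distrib_left intro: cpolynomial.add)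

lemma form_mult: "form d F \<Longrightarrow> form e G \<Longrightarrow> form (d + e) (\<lambda>v. F v * G v)"
  by (auto simp: form_def power_add intro: cpolynomial.mult)

lemma form_const: "form 0 (\<lambda>_. c)"
  by (auto simp: form_def intro: cpolynomial.const)

lemma form_coord: "form 1 (\<lambda>v. v $ i)"
  by (auto simp: form_def intro: cpolynomial.coord)

lemma form_pairing: "form 1 (pairing w)" for w :: "complex ^ 'n"
proof -
  have "cpolynomial (\<lambda>v. \<Sum>i\<in>UNIV. w $ i * v $ i)"
    by (intro cpolynomial_sum cpolynomial.mult cpolynomial.const cpolynomial.coord) auto
  then show ?thesis
    by (simp add: form_def pairing_scale) (simp add: pairing_def[abs_def])
qed

lemma proj_space_nonzero: "p \<in> proj_space \<Longrightarrow> \<exists>v. v \<in> p - {0}"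
  unfolding proj_space_def by (auto simp: image_iff intro: exI[of _ 1] vec.scale_one[symmetric])

lemma proj_space_eq_range:
  assumes "p \<in> proj_space" "v \<in> p - {0}"
  shows "p = range (\<lambda>c. c *s v)"
proof -
  obtain u where u: "p = range (\<lambda>c. c *s u)"
    using assms by (auto simp: proj_space_def)
  then obtain c where c: "v = c *s u"
    using assms by auto
  with assms have "c \<noteq> 0" by auto
  then have "d *s u = (d / c) *s v" for d
    by (simp add: c vec.scale_scale)
  moreover have "d *s v = (d * c) *s u" for d
    by (simp add: c vec.scale_scale)
  ultimately show ?thesis
    unfolding u by (metis (no_types, lifting) rangeE rangeI subset_antisym subsetI)
qed

lemma proj_space_proportional:
  assumes "p \<in> proj_space" "v \<in> p - {0}" "w \<in> p - {0}"
  obtains c where "c \<noteq> 0" "w = c *s v"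
proof -
  obtain c where "w = c *s v"
    using proj_space_eq_range[OF assms(1,2)] assms(3) by auto
  moreover from this assms have "c \<noteq> 0" by auto
  ultimately show ?thesis using that by blast
qed

lemma form_vanish_iff:
  assumes "form d F" "p \<in> proj_space" "v \<in> p - {0}" "w \<in> p - {0}"
  shows "F w = 0 \<longleftrightarrow> F v = 0"
  by (rule proj_space_proportional[OF assms(2-4)]) (use assms(1) in \<open>simp add: form_def\<close>)

lemma zclosed_subset: "zclosed Z \<Longrightarrow> Z \<subseteq> proj_space"
  by (auto simp: zclosed_def)

lemma zclosed_form: "form d F \<Longrightarrow> zclosed {p \<in> proj_space. \<forall>v\<in>p - {0}. F v = 0}"
  unfolding zclosed_def by (intro exI[of _ "{F}"]) auto

lemma zclosed_Int:
  assumes "zclosed A" "zclosed B" shows "zclosed (A \<inter> B)"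
proof -
  obtain S T where "\<forall>F\<in>S. \<exists>d. form d F" "A = {p \<in> proj_space. \<forall>F\<in>S. \<forall>v\<in>p - {0}. F v = 0}"
    "\<forall>F\<in>T. \<exists>d. form d F" "B = {p \<in> proj_space. \<forall>F\<in>T. \<forall>v\<in>p - {0}. F v = 0}"
    using assms unfolding zclosed_def by auto
  then show ?thesis
    unfolding zclosed_def by (intro exI[of _ "S \<union> T"]) auto
qed

text \<open>Products of forms cut out the union. A point outside both sets is detected because
  vanishing of a form does not depend on the representing vector.\<close>

lemma zclosed_Un:
  assumes "zclosed A" "zclosed B" shows "zclosed (A \<union> B)"
proof -
  obtain S T where S: "\<forall>F\<in>S. \<exists>d. form d F" "A = {p \<in> proj_space. \<forall>F\<in>S. \<forall>v\<in>p - {0}. F v = 0}"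
    and T: "\<forall>F\<in>T. \<exists>d. form d F" "B = {p \<in> proj_space. \<forall>F\<in>T. \<forall>v\<in>p - {0}. F v = 0}"
    using assms unfolding zclosed_def by auto
  define R where "R = {\<lambda>v. F v * G v | F G. F \<in> S \<and> G \<in> T}"
  have "p \<in> A \<union> B" if p: "p \<in> proj_space" and 0: "\<forall>F\<in>R. \<forall>v\<in>p - {0}. F v = 0" for p
  proof (rule ccontr)
    assume "p \<notin> A \<union> B"
    then obtain F G v w where FG: "F \<in> S" "G \<in> T" "v \<in> p - {0}" "w \<in> p - {0}" "F v \<noteq> 0" "G w \<noteq> 0"
      using S T p by auto
    moreover have "(\<lambda>v. F v * G v) \<in> R" using FG unfolding R_def by blast
    then have "F v * G v = 0"
      using 0 FG(3) by meson
    moreover have "G v \<noteq> 0"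
    proof -
      obtain d where "form d G"
        using T(1) FG(2) by blast
      then show ?thesis
        using form_vanish_iff[OF _ p FG(3,4)] FG(6) by blast
    qed
    ultimately show False by simp
  qed
  moreover have "p \<in> proj_space \<and> (\<forall>F\<in>R. \<forall>v\<in>p - {0}. F v = 0)" if "p \<in> A \<union> B" for p
    using that unfolding S(2) T(2) R_def by fastforce
  ultimately have "A \<union> B = {p \<in> proj_space. \<forall>F\<in>R. \<forall>v\<in>p - {0}. F v = 0}"
    by blast
  moreover have "\<forall>F\<in>R. \<exists>d. form d F"
    unfolding R_def using S(1) T(1) form_mult by blast
  ultimately show ?thesis
    unfolding zclosed_def by blast
qed

lemma zclosed_empty: "zclosed ({} :: 'n::finite point set)"
proof -
  have "\<not> (\<forall>v\<in>p - {0}. (1 :: complex) = 0)" if "p \<in> proj_space" for p :: "'n point"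
    using proj_space_nonzero[OF that] by auto
  then have "{p \<in> proj_space :: 'n point set. \<forall>v\<in>p - {0}. (1 :: complex) = 0} = {}"
    by blast
  moreover have "zclosed {p \<in> proj_space :: 'n point set. \<forall>v\<in>p - {0}. (1 :: complex) = 0}"
    by (rule zclosed_form[OF form_const])
  ultimately show ?thesis
    by (simp only:)
qed

text \<open>Among the linear forms vanishing at \<open>a\<close> are those given by 2 x 2 minors,
  and these already force proportionality to \<open>a\<close>.\<close>

lemma zclosed_point:
  assumes "p \<in> proj_space" shows "zclosed {p}"
proof -
  obtain a where a: "a \<in> p - {0}" 
    using proj_space_nonzero[OF assms] by blast
  then obtain i where i: "a $ i \<noteq> 0" by (auto simp: vec_eq_iff)
  let ?S = "{pairing w | w. pairing w a = 0}"
  have "q = p" if q: "q \<in> proj_space" and 0: "\<forall>F\<in>?S. \<forall>v\<in>q - {0}. F v = 0" for q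
  proof -
    obtain v where v: "v \<in> q - {0}" 
      using proj_space_nonzero[OF q] by blast
    have "v $ j * a $ i = a $ j * v $ i" for j
    proof -
      let ?w = "a $ i *s axis j 1 - a $ j *s axis i 1 :: complex ^ 'a"
      have w: "pairing ?w u = a $ i * u $ j - a $ j * u $ i" for u
        by (simp add: pairing_diff pairing_scale)
      then have "pairing ?w a = 0" by simp
      then have "pairing ?w v = 0"
        using 0 v by blast
      then show ?thesis using w by (simp add: mult.commute)
    qed
    then have va: "v = (v $ i / a $ i) *s a"
      using i by (simp add: vec_eq_iff field_simps)
    have "v \<in> range (\<lambda>c. c *s a)"
      by (rule range_eqI, rule va)
    then have "v \<in> p - {0}"
      using v unfolding proj_space_eq_range[OF assms a, symmetric] by auto
    from proj_space_eq_range[OF assms this] proj_space_eq_range[OF q v] show ?thesis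
      by simp
  qed
  moreover have "\<forall>v\<in>p - {0}. pairing w v = 0" if "pairing w a = 0" for w
    using that form_vanish_iff[OF form_pairing assms a] by blast
  ultimately have "{p} = {q \<in> proj_space. \<forall>F\<in>?S. \<forall>v\<in>q - {0}. F v = 0}"
    using assms by blast
  moreover have "\<forall>F\<in>?S. \<exists>d. form d F"
    using form_pairing by blast
  ultimately show ?thesis
    unfolding zclosed_def by blast
qed

lemma zclosed_finite: "finite S \<Longrightarrow> S \<subseteq> proj_space \<Longrightarrow> zclosed S"
proof (induction S rule: finite_induct)
  case empty
  show ?case by (rule zclosed_empty)
next
  case (insert x S)
  then have "zclosed ({x} \<union> S)"
    by (intro zclosed_Un zclosed_point) auto
  then show ?case by simp
qed

locale marked =
  fixes X D :: "'n::finite point set"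
  assumes marked: "marked_curve X D"
begin

lemma closed_X: "zclosed X" and irred_X: "zirreducible X" and dim_X: "zdim X = 1" and smooth_X: "smooth X"
  and finite_D: "finite D" and D_subset: "D \<subseteq> X"
  using marked by (auto simp: marked_curve_def smooth_projective_curve_def)

lemma X_subset: "X \<subseteq> proj_space"
  using closed_X by (rule zclosed_subset)

lemma zopen_subset: "zopen X U \<Longrightarrow> U \<subseteq> X"
  by (simp add: zopen_def)

lemma zopen_X: "zopen X X"
  by (simp add: zopen_def zclosed_empty)

lemma zopen_Int: "zopen X U \<Longrightarrow> zopen X V \<Longrightarrow> zopen X (U \<inter> V)"
  by (auto simp: zopen_def Diff_Int intro: zclosed_Un)

lemma zopen_nonvanishing:
  assumes "form d F" shows "zopen X {p \<in> X. \<forall>v\<in>p - {0}. F v \<noteq> 0}"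
proof -
  have "(\<exists>v\<in>p - {0}. F v = 0) \<longleftrightarrow> (\<forall>v\<in>p - {0}. F v = 0)" if "p \<in> X" for p
    using that X_subset form_vanish_iff[OF assms] proj_space_nonzero by (meson subsetD)
  then have "X - {p \<in> X. \<forall>v\<in>p - {0}. F v \<noteq> 0} = X \<inter> {p \<in> proj_space. \<forall>v\<in>p - {0}. F v = 0}"
    using X_subset by blast
  then show ?thesis
    using zclosed_Int[OF closed_X zclosed_form[OF assms]] by (auto simp: zopen_def)
qed

lemma zopen_Diff_finite:
  assumes "finite S" "zopen X U" shows "zopen X (U - S)"
proof -
  have "zclosed (X \<inter> S)"
    using assms X_subset by (intro zclosed_finite) auto
  then have "zopen X (X - S)"
    by (auto simp: zopen_def Diff_Diff_Int)
  moreover have "U - S = U \<inter> (X - S)"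
    using zopen_subset[OF assms(2)] by auto
  ultimately show ?thesis
    using zopen_Int assms by auto
qed

lemma zopen_meet:
  assumes "zopen X U" "zopen X V" "U \<noteq> {}" "V \<noteq> {}" shows "U \<inter> V \<noteq> {}"
proof
  assume "U \<inter> V = {}"
  then have "X \<subseteq> (X - U) \<union> (X - V)" by auto
  then have "X \<subseteq> X - U \<or> X \<subseteq> X - V"
    using irred_X assms unfolding zirreducible_def zopen_def by blast
  then show False
    using assms zopen_subset by blast
qed

lemma X_not_singleton: "\<not> X \<subseteq> {x}"
proof
  assume X: "X \<subseteq> {x}"
  have "k = 0" if "\<forall>i\<le>k. zclosed (Z i) \<and> zirreducible (Z i) \<and> Z i \<subseteq> X" "\<forall>i<k. Z i \<subset> Z (Suc i)" 
    for k and Z :: "nat \<Rightarrow> 'n point set"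
  proof (rule ccontr)
    assume "k \<noteq> 0"
    then have "Z 0 \<noteq> {}" "Z 0 \<subset> Z 1" "Z 1 \<subseteq> X"
      using that by (auto simp: zirreducible_def)
    then show False using X by blast
  qed
  then have "zdim X \<le> 0"
    unfolding zdim_def by (intro Sup_least) (force simp: zero_enat_def)
  then show False using dim_X by simp
qed

text \<open>A finite set is a finite union of closed points, so irreducibility would put
  \<open>X\<close> inside one of them, against its dimension.\<close>

lemma infinite_X: "\<not> X \<subseteq> S" if "finite S"
  using that
proof (induction S rule: finite_induct)
  case empty
  then show ?case using X_not_singleton by blast
next
  case (insert x S)
  show ?case
  proof
    assume "X \<subseteq> insert x S"
    then have "X \<subseteq> (X \<inter> {x}) \<union> (X \<inter> S)" by auto
    moreover have "zclosed (X \<inter> {x})" "zclosed (X \<inter> S)"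
      using insert X_subset by (auto intro!: zclosed_finite)
    ultimately have "X \<subseteq> X \<inter> {x} \<or> X \<subseteq> X \<inter> S"
      using irred_X unfolding zirreducible_def by blast
    then show False using insert X_not_singleton by blast
  qed
qed

text \<open>The Zariski neighbourhood filter, with \<open>p\<close> itself included: statements
  about germs become \<open>eventually\<close> statements, and the value at \<open>p\<close> is
  never lost (\<open>near_self\<close>).\<close>

definition near :: "'n point \<Rightarrow> 'n point filter" where
  "near p = (INF V\<in>{V. zopen X V \<and> p \<in> V}. principal V)"

lemma eventually_near:
  assumes "p \<in> X"
  shows "eventually P (near p) \<longleftrightarrow> (\<exists>V. zopen X V \<and> p \<in> V \<and> (\<forall>q\<in>V. P q))"
  unfolding near_def
proof (subst eventually_INF_base)
  show "{V. zopen X V \<and> p \<in> V} \<noteq> {}"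
    using zopen_X assms by auto
  show "\<exists>x\<in>{V. zopen X V \<and> p \<in> V}. principal x \<le> inf (principal a) (principal b)"
    if "a \<in> {V. zopen X V \<and> p \<in> V}" "b \<in> {V. zopen X V \<and> p \<in> V}" for a b
    using that zopen_Int by (intro bexI[of _ "a \<inter> b"]) auto
qed (auto simp: eventually_principal)

lemma near_self: "p \<in> X \<Longrightarrow> eventually P (near p) \<Longrightarrow> P p"
  using eventually_near by blast

lemma near_open: "zopen X U \<Longrightarrow> p \<in> U \<Longrightarrow> eventually (\<lambda>q. q \<in> U) (near p)"
  using eventually_near zopen_subset by blast

lemma near_near:
  assumes "p \<in> X" "eventually P (near p)"
  shows "eventually (\<lambda>q. eventually P (near q)) (near p)"
proof -
  obtain V where V: "zopen X V" "p \<in> V" "\<forall>q\<in>V. P q"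
    using assms eventually_near by blast
  then have "\<forall>q\<in>V. eventually P (near q)"
    using eventually_near zopen_subset by (metis subsetD)
  then show ?thesis
    using V assms eventually_near by blast
qed

lemma near_in_X: "p \<in> X \<Longrightarrow> eventually (\<lambda>q. q \<in> X) (near p)"
  using near_open zopen_X by blast

lemma near_not_D: "p \<in> X \<Longrightarrow> eventually (\<lambda>q. q \<in> D \<longrightarrow> q = p) (near p)"
  using near_open[OF zopen_Diff_finite[OF _ zopen_X, of "D - {p}"], of p] finite_D
  by (auto elim: eventually_mono)

text \<open>Regularity of a germ. Unlike the members of \<open>regular X U\<close>, such functions
  need not vanish outside an open set, so no restrictions have to be carried along.\<close>

definition reg :: "'n point \<Rightarrow> ('n point \<Rightarrow> complex) \<Rightarrow> bool" where
  "reg p f \<longleftrightarrow> (\<exists>d G H. form d G \<and> form d H \<and>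
     eventually (\<lambda>q. \<forall>v\<in>q - {0}. H v \<noteq> 0 \<and> f q = G v / H v) (near p))"

lemma reg_cong: 
  assumes "eventually (\<lambda>q. f q = g q) (near p)" "reg p f" shows "reg p g"
proof -
  obtain d G H where *: "form d G" "form d H"
    "eventually (\<lambda>q. \<forall>v\<in>q - {0}. H v \<noteq> 0 \<and> f q = G v / H v) (near p)"
    using assms by (auto simp: reg_def)
  have "eventually (\<lambda>q. \<forall>v\<in>q - {0}. H v \<noteq> 0 \<and> g q = G v / H v) (near p)"
    using *(3) assms(1) by eventually_elim auto
  then show ?thesis
    using * by (auto simp: reg_def)
qed

lemma reg_near: 
  assumes "p \<in> X" "reg p f" shows "eventually (\<lambda>q. reg q f) (near p)"
proof -
  obtain d G H where *: "form d G" "form d H"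
    "eventually (\<lambda>q. \<forall>v\<in>q - {0}. H v \<noteq> 0 \<and> f q = G v / H v) (near p)"
    using assms by (auto simp: reg_def)
  from near_near[OF assms(1) *(3)] show ?thesis
    by (rule eventually_mono) (use *(1,2) in \<open>auto simp: reg_def\<close>)
qed

lemma regular_iff:
  assumes U: "zopen X U"
  shows "f \<in> regular X U \<longleftrightarrow> (\<forall>p. p \<notin> U \<longrightarrow> f p = 0) \<and> (\<forall>p\<in>U. reg p f)"
proof -
  have "(\<exists>V d G H. zopen X V \<and> p \<in> V \<and> V \<subseteq> U \<and> form d G \<and> form d H \<and>
        (\<forall>q\<in>V. \<forall>v\<in>q - {0}. H v \<noteq> 0 \<and> f q = G v / H v)) \<longleftrightarrow> reg p f" if p: "p \<in> U" for p
  proof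
    have pX: "p \<in> X" using p U zopen_subset by blast
    show "reg p f" if "\<exists>V d G H. zopen X V \<and> p \<in> V \<and> V \<subseteq> U \<and> form d G \<and> form d H \<and>
        (\<forall>q\<in>V. \<forall>v\<in>q - {0}. H v \<noteq> 0 \<and> f q = G v / H v)"
      using that unfolding reg_def eventually_near[OF pX] by blast
    assume "reg p f"
    then obtain d G H V where *: "form d G" "form d H" "zopen X V" "p \<in> V"
      "\<forall>q\<in>V. \<forall>v\<in>q - {0}. H v \<noteq> 0 \<and> f q = G v / H v"
      unfolding reg_def eventually_near[OF pX] by blast
    then show "\<exists>V d G H. zopen X V \<and> p \<in> V \<and> V \<subseteq> U \<and> form d G \<and> form d H \<and>
        (\<forall>q\<in>V. \<forall>v\<in>q - {0}. H v \<noteq> 0 \<and> f q = G v / H v)"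
      using zopen_Int[OF *(3) U] p
      by (intro exI[of _ "V \<inter> U"] exI[of _ d] exI[of _ G] exI[of _ H]) auto
  qed
  then show ?thesis
    unfolding regular_def by auto
qed

lemma reg_const: "reg p (\<lambda>_. c)"
  unfolding reg_def using form_const[of c] form_const[of 1]
  by (intro exI[of _ 0] exI[of _ "\<lambda>_. c"] exI[of _ "\<lambda>_. 1"]) auto

lemma reg_add: 
  assumes "reg p f" "reg p g" shows "reg p (\<lambda>q. f q + g q)"
proof -
  obtain d G H e G' H' where *: "form d G" "form d H"
    "eventually (\<lambda>q. \<forall>v\<in>q - {0}. H v \<noteq> 0 \<and> f q = G v / H v) (near p)"
    "form e G'" "form e H'"
    "eventually (\<lambda>q. \<forall>v\<in>q - {0}. H' v \<noteq> 0 \<and> g q = G' v / H' v) (near p)"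
    using assms unfolding reg_def by blast
  have "eventually (\<lambda>q. \<forall>v\<in>q - {0}. H v * H' v \<noteq> 0 \<and>
      f q + g q = (G v * H' v + H v * G' v) / (H v * H' v)) (near p)"
    using *(3,6) by eventually_elim (metis add_frac_eq mult.commute no_zero_divisors)
  moreover have "form (d + e) (\<lambda>v. G v * H' v + H v * G' v)" "form (d + e) (\<lambda>v. H v * H' v)"
    using *(1,2,4,5) by (auto intro: form_add form_mult)
  ultimately show ?thesis
    unfolding reg_def by (intro exI conjI)
qed

lemma reg_mult: 
  assumes "reg p f" "reg p g" shows "reg p (\<lambda>q. f q * g q)"
proof -
  obtain d G H e G' H' where *: "form d G" "form d H"
    "eventually (\<lambda>q. \<forall>v\<in>q - {0}. H v \<noteq> 0 \<and> f q = G v / H v) (near p)"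
    "form e G'" "form e H'"
    "eventually (\<lambda>q. \<forall>v\<in>q - {0}. H' v \<noteq> 0 \<and> g q = G' v / H' v) (near p)"
    using assms unfolding reg_def by blast
  have "eventually (\<lambda>q. \<forall>v\<in>q - {0}. H v * H' v \<noteq> 0 \<and> f q * g q = (G v * G' v) / (H v * H' v)) (near p)"
    using *(3,6) by eventually_elim (simp add: times_divide_times_eq)
  moreover have "form (d + e) (\<lambda>v. G v * G' v)" "form (d + e) (\<lambda>v. H v * H' v)"
    using *(1,2,4,5) by (auto intro: form_mult)
  ultimately show ?thesis
    unfolding reg_def by (intro exI conjI)
qed

lemma reg_minus: "reg p f \<Longrightarrow> reg p (\<lambda>q. - f q)"
  using reg_mult[OF reg_const[of p "- 1"], of f] by simp

lemma reg_diff: "reg p f \<Longrightarrow> reg p g \<Longrightarrow> reg p (\<lambda>q. f q - g q)"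
  using reg_add[OF _ reg_minus, of p f g] by simp

lemma reg_sum: "(\<And>i. i \<in> I \<Longrightarrow> reg p (f i)) \<Longrightarrow> reg p (\<lambda>q. \<Sum>i\<in>I. f i q)"
  by (induction I rule: infinite_finite_induct) (auto intro: reg_const reg_add)

lemma reg_prod: "(\<And>i. i \<in> I \<Longrightarrow> reg p (f i)) \<Longrightarrow> reg p (\<lambda>q. \<Prod>i\<in>I. f i q)"
  by (induction I rule: infinite_finite_induct) (auto intro: reg_const reg_mult)

lemma reg_nonzero_inverse:
  assumes p: "p \<in> X" and "reg p f" "f p \<noteq> 0"
  shows "eventually (\<lambda>q. f q \<noteq> 0) (near p)" "reg p (\<lambda>q. inverse (f q))"
proof -
  obtain d G H where *: "form d G" "form d H"
    "eventually (\<lambda>q. \<forall>v\<in>q - {0}. H v \<noteq> 0 \<and> f q = G v / H v) (near p)"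
    using assms by (auto simp: reg_def)
  have "\<forall>v\<in>p - {0}. H v \<noteq> 0 \<and> f p = G v / H v"
    using near_self[OF p *(3)] .
  then have "\<forall>v\<in>p - {0}. G v \<noteq> 0"
    using assms by auto
  then have G: "eventually (\<lambda>q. q \<in> {p \<in> X. \<forall>v\<in>p - {0}. G v \<noteq> 0}) (near p)"
    using near_open[OF zopen_nonvanishing[OF *(1)]] p by auto
  show "eventually (\<lambda>q. f q \<noteq> 0) (near p)"
    using G *(3)
  proof eventually_elim
    case (elim q)
    moreover obtain v where "v \<in> q - {0}"
      using elim X_subset proj_space_nonzero by blast
    ultimately show ?case by auto
  qed
  have "eventually (\<lambda>q. \<forall>v\<in>q - {0}. G v \<noteq> 0 \<and> inverse (f q) = H v / G v) (near p)"
    using G *(3) by eventually_elim simp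
  then show "reg p (\<lambda>q. inverse (f q))"
    using *(1,2) unfolding reg_def by blast
qed

lemma near_dense_point:
  assumes p: "p \<in> X" and "finite S" and "eventually (\<lambda>q. q \<notin> S \<longrightarrow> P q) (near p)"
  shows "\<exists>q\<in>X - S. P q"
proof -
  obtain V where V: "zopen X V" "p \<in> V" "\<forall>q\<in>V. q \<notin> S \<longrightarrow> P q"
    using assms eventually_near by blast
  have "X - S \<noteq> {}"
    using infinite_X[OF assms(2)] by auto
  then have "V \<inter> (X - S) \<noteq> {}"
    using V zopen_meet[OF V(1) zopen_Diff_finite[OF assms(2) zopen_X]] by blast
  then show ?thesis using V by blast
qed

text \<open>The set where \<open>f\<close> is nonzero is open near \<open>p\<close>, and a nonempty
  open set is never contained in the finite set \<open>S\<close>. With \<open>S\<close> equal to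
  \<open>D\<close> or to a single point, this is how identities proved away from marked points are
  extended to them.\<close>

lemma reg_zero_off_finite:
  assumes p: "p \<in> X" and S: "finite S" and f: "reg p f"
    and 0: "eventually (\<lambda>q. q \<notin> S \<longrightarrow> f q = 0) (near p)"
  shows "eventually (\<lambda>q. f q = 0) (near p)"
  using reg_near[OF p f] near_near[OF p 0] near_in_X[OF p]
proof eventually_elim
  case (elim q)
  show ?case
  proof (rule ccontr)
    assume "f q \<noteq> 0"
    then have "eventually (\<lambda>q. f q \<noteq> 0) (near q)"
      using reg_nonzero_inverse elim by blast
    with elim(2) have "eventually (\<lambda>q. q \<notin> S \<longrightarrow> False) (near q)"
      by eventually_elim auto
    then show False
      using near_dense_point[OF elim(3) S, of "\<lambda>_. False"] by blast
  qed
qed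

end

section \<open>Tangent spaces and uniformizers\<close>

lemma pairing_sum_left: "pairing (x + y) v = pairing x v + pairing y v"
  by (simp add: pairing_def sum.distrib algebra_simps)

lemma pairing_sum_right: "pairing v (x + y) = pairing v x + pairing v y"
  by (simp add: pairing_def sum.distrib algebra_simps)

text \<open>First-order expansion in Hadamard form: \<open>c\<close> is the gradient at
  \<open>a\<close>, and the remainder is kept as polynomial coefficients \<open>h i\<close>
  vanishing at \<open>a\<close>. It can thus be evaluated on regular functions without any
  estimate.\<close>

definition taylor :: "(complex ^ 'n::finite \<Rightarrow> complex) \<Rightarrow> complex ^ 'n \<Rightarrow> complex ^ 'n \<Rightarrow>
    ('n \<Rightarrow> complex ^ 'n \<Rightarrow> complex) \<Rightarrow> bool" where
  "taylor F a c h \<longleftrightarrow> (\<forall>i. cpolynomial (h i) \<and> h i a = 0) \<and>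
     (\<forall>v. F v = F a + (\<Sum>i\<in>UNIV. (c $ i + h i v) * (v $ i - a $ i)))"

lemma taylorD: "taylor F a c h \<Longrightarrow> cpolynomial (h i)" "taylor F a c h \<Longrightarrow> h i a = 0"
  unfolding taylor_def by blast+

lemma cpolynomial_taylor: "cpolynomial F \<Longrightarrow> \<exists>c h. taylor F a c h"
proof (induction rule: cpolynomial.induct)
  case (const c)
  then show ?case
    unfolding taylor_def by (intro exI[of _ 0] exI[of _ "\<lambda>_ _. 0"]) (auto intro: cpolynomial.const)
next
  case (coord i)
  then show ?case
    unfolding taylor_def 
    by (intro exI[of _ "axis i 1"] exI[of _ "\<lambda>_ _. 0"])
      (auto intro: cpolynomial.const simp: axis_def if_distrib if_distribR cong: if_cong)
next
  case (add F G)
  then obtain c h c' h' where *: "taylor F a c h" "taylor G a c' h'" by blast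
  have "taylor (\<lambda>v. F v + G v) a (c + c') (\<lambda>i v. h i v + h' i v)"
    unfolding taylor_def
  proof (intro conjI allI)
    fix v 
    have F: "F v = F a + (\<Sum>i\<in>UNIV. (c $ i + h i v) * (v $ i - a $ i))"
      and G: "G v = G a + (\<Sum>i\<in>UNIV. (c' $ i + h' i v) * (v $ i - a $ i))"
      using * unfolding taylor_def by blast+
    show "F v + G v = F a + G a + (\<Sum>i\<in>UNIV. ((c + c') $ i + (h i v + h' i v)) * (v $ i - a $ i))"
      unfolding F G by (simp add: sum.distrib[symmetric] algebra_simps)
  qed (auto simp: *[THEN taylorD(2)] intro: cpolynomial.add *[THEN taylorD(1)])
  then show ?case by blast
next
  case (mult F G)
  then obtain c h c' h' where *: "taylor F a c h" "taylor G a c' h'" by blast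
  note h = *[THEN taylorD(1)]
  have "taylor (\<lambda>v. F v * G v) a (\<chi> i. c $ i * G a + F a * c' $ i)
      (\<lambda>i v. c $ i * (G v - G a) + h i v * G v + F a * h' i v)"
    unfolding taylor_def
  proof (intro conjI allI)
    fix v i
    have "cpolynomial (\<lambda>v. c $ i * (G v + - G a) + h i v * G v + F a * h' i v)"
      by (rule cpolynomial.add[OF cpolynomial.add[OF cpolynomial.mult[OF cpolynomial.const
            cpolynomial.add[OF mult.hyps(2) cpolynomial.const]] cpolynomial.mult[OF h(1) mult.hyps(2)]]
            cpolynomial.mult[OF cpolynomial.const h(2)]])
    then show "cpolynomial (\<lambda>v. c $ i * (G v - G a) + h i v * G v + F a * h' i v)"
      by simp
    show "c $ i * (G a - G a) + h i a * G a + F a * h' i a = 0"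
      by (simp add: *[THEN taylorD(2)])
    have "F v = F a + (\<Sum>i\<in>UNIV. (c $ i + h i v) * (v $ i - a $ i))"
      and "G v = G a + (\<Sum>i\<in>UNIV. (c' $ i + h' i v) * (v $ i - a $ i))"
      using * unfolding taylor_def by blast+
    then have F: "(\<Sum>i\<in>UNIV. (c $ i + h i v) * (v $ i - a $ i)) = F v - F a"
      and G: "(\<Sum>i\<in>UNIV. (c' $ i + h' i v) * (v $ i - a $ i)) = G v - G a"
      by (metis add_diff_cancel_left')+
    have "(\<Sum>i\<in>UNIV. ((\<chi> i. c $ i * G a + F a * c' $ i) $ i +
        (c $ i * (G v - G a) + h i v * G v + F a * h' i v)) * (v $ i - a $ i)) =
      (\<Sum>i\<in>UNIV. (c $ i + h i v) * (v $ i - a $ i)) * G v + 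
      F a * (\<Sum>i\<in>UNIV. (c' $ i + h' i v) * (v $ i - a $ i))"
      by (simp add: sum_distrib_left sum_distrib_right sum.distrib[symmetric] algebra_simps)
    also have "\<dots> = F v * G v - F a * G a"
      unfolding F G by (simp add: algebra_simps)
    finally show "F v * G v = F a * G a + (\<Sum>i\<in>UNIV. ((\<chi> i. c $ i * G a + F a * c' $ i) $ i +
        (c $ i * (G v - G a) + h i v * G v + F a * h' i v)) * (v $ i - a $ i))"
      by simp
  qed
  then show ?case by blast
qed

lemma cpolynomial_continuous_on_line: "cpolynomial F \<Longrightarrow> isCont (\<lambda>t. F (a + t *s w)) 0"
  by (induction rule: cpolynomial.induct) auto

lemma taylor_deriv:
  assumes "taylor F a c h"
  shows "deriv (\<lambda>t::complex. F (a + t *s w)) 0 = pairing c w"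
proof -
  define k where "k t = (\<Sum>i\<in>UNIV. (c $ i + h i (a + t *s w)) * w $ i)" for t
  have "((\<lambda>t. F (a + t *s w)) has_field_derivative pairing c w) (at 0)"
    unfolding CARAT_DERIV
  proof (intro exI[of _ k] conjI allI)
    fix z
    have "F (a + z *s w) = F a + (\<Sum>i\<in>UNIV. (c $ i + h i (a + z *s w)) * ((a + z *s w) $ i - a $ i))"
      using assms unfolding taylor_def by blast
    then show "F (a + z *s w) - F (a + 0 *s w) = k z * (z - 0)"
      by (simp add: k_def sum_distrib_left mult_ac)
    have "isCont (\<lambda>t. h i (a + t *s w)) 0" for i
      by (intro cpolynomial_continuous_on_line taylorD(1)[OF assms])
    then show "isCont k 0"
      unfolding k_def by (intro continuous_intros) auto
    show "k 0 = pairing c w"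
      by (simp add: k_def taylorD(2)[OF assms] pairing_def)
  qed
  then show ?thesis
    by (rule DERIV_imp_deriv)
qed

text \<open>A basis of \<open>V\<close>, padded by zero rows, gives a square matrix whose rows span
  a proper subspace; it is not left invertible and so has a kernel vector.\<close>

lemma proper_subspace_annihilator:
  assumes V: "vec.subspace V" and "V \<noteq> (UNIV :: (complex ^ 'n::finite) set)"
  shows "\<exists>w. w \<noteq> 0 \<and> (\<forall>v\<in>V. pairing v w = 0)"
proof -
  obtain B where B: "B \<subseteq> V" "vec.independent B" "V \<subseteq> vec.span B" "card B = vec.dim V"
    using vec.basis_exists by blast
  have "finite B"
    using B(2) by (rule vec.finiteI_independent)
  moreover have "card B \<le> card (UNIV :: 'n set)"
    using vec.dim_subset[OF subset_UNIV, of V] B(4) by (simp only: vec_dim_card)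
  ultimately obtain g :: "complex ^ 'n \<Rightarrow> 'n" where g: "inj_on g B"
    using card_le_inj[of B "UNIV :: 'n set"] by auto
  define A where "A = (\<chi> i. if i \<in> g ` B then inv_into B g i else 0)"
  have "rows A \<subseteq> V"
    using B(1) vec.subspace_0[OF V] by (auto simp: rows_def row_def A_def vec_lambda_eta inv_into_into subset_iff)
  then have "vec.span (rows A) \<subseteq> V"
    using V vec.span_minimal by blast
  then have "vec.span (rows A) \<noteq> UNIV"
    using assms(2) by auto
  then obtain w where w: "w \<noteq> 0" "A *v w = 0"
    using matrix_left_invertible_span_rows_gen[of A] matrix_left_invertible_ker[of A] by blast
  have Bw: "pairing b w = 0" if "b \<in> B" for b
  proof -
    have "A $ g b = b"
      using that g by (simp add: A_def)
    then have "pairing b w = (A *v w) $ g b"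
      by (simp add: pairing_def matrix_vector_mult_def)
    then show ?thesis using w by simp
  qed
  have "pairing v w = 0" if "v \<in> vec.span B" for v
    using that
  proof (induction rule: vec.span_induct)
    case base
    show ?case
      by (auto simp: vec.subspace_def pairing_sum_left pairing_scale pairing_def[of 0])
  qed (use Bw in auto)
  then show ?thesis
    using w B by blast
qed

lemma independent_functional:
  fixes a w :: "complex ^ 'n::finite"
  assumes "a \<noteq> 0" "\<And>s. w \<noteq> s *s a"
  shows "\<exists>f. pairing f a = 0 \<and> pairing f w = 1"
proof -
  obtain i where i: "a $ i \<noteq> 0" using assms by (auto simp: vec_eq_iff)
  obtain j where j: "a $ i * w $ j - a $ j * w $ i \<noteq> 0"
  proof (rule ccontr)
    assume "\<not> thesis"
    then have "\<forall>j. a $ i * w $ j - a $ j * w $ i = 0" using that by blast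
    then have "w = (w $ i / a $ i) *s a"
      using i by (auto simp: vec_eq_iff field_simps)
    then show False using assms by blast
  qed
  let ?f = "(1 / (a $ i * w $ j - a $ j * w $ i)) *s (a $ i *s axis j 1 - a $ j *s axis i 1)"
  have "pairing ?f v = (a $ i * v $ j - a $ j * v $ i) / (a $ i * w $ j - a $ j * w $ i)" for v
    by (simp only: pairing_scale pairing_diff pairing_axis) simp
  then have "pairing ?f a = 0 \<and> pairing ?f w = 1"
    using j by simp
  then show ?thesis by blast
qed

context marked
begin

definition regv :: "'n point \<Rightarrow> ('n point \<Rightarrow> complex ^ 'r::finite) \<Rightarrow> bool" where
  "regv p f \<longleftrightarrow> (\<forall>i. reg p (\<lambda>q. f q $ i))"

definition regm :: "'n point \<Rightarrow> ('n point \<Rightarrow> complex ^ 'r::finite ^ 'r) \<Rightarrow> bool" where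
  "regm p A \<longleftrightarrow> (\<forall>i j. reg p (\<lambda>q. A q $ i $ j))"

lemma regm_entry: "regm p A \<Longrightarrow> reg p (\<lambda>q. A q $ i $ j)"
  by (simp add: regm_def)

lemma regv_entry: "regv p f \<Longrightarrow> reg p (\<lambda>q. f q $ i)"
  by (simp add: regv_def)

lemma regv_const: "regv p (\<lambda>_. v)"
  by (simp add: regv_def reg_const)

lemma regm_const: "regm p (\<lambda>_. A)"
  by (simp add: regm_def reg_const)

lemma regm_mult: "regm p A \<Longrightarrow> regm p B \<Longrightarrow> regm p (\<lambda>q. A q ** B q)"
  unfolding regm_def matrix_matrix_mult_def by (auto intro!: reg_sum reg_mult)

lemma regm_add: "regm p A \<Longrightarrow> regm p B \<Longrightarrow> regm p (\<lambda>q. A q + B q)"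
  unfolding regm_def by (auto intro!: reg_add)

lemma regm_mscale: "reg p f \<Longrightarrow> regm p A \<Longrightarrow> regm p (\<lambda>q. mscale (f q) (A q))"
  unfolding regm_def by (auto intro!: reg_mult)

lemma regv_mult: "regm p A \<Longrightarrow> regv p f \<Longrightarrow> regv p (\<lambda>q. A q *v f q)"
  unfolding regm_def regv_def matrix_vector_mult_def by (auto intro!: reg_sum reg_mult)

lemma regv_add: "regv p f \<Longrightarrow> regv p g \<Longrightarrow> regv p (\<lambda>q. f q + g q)"
  unfolding regv_def by (auto intro!: reg_add)

lemma regv_scale: "reg p f \<Longrightarrow> regv p g \<Longrightarrow> regv p (\<lambda>q. f q *s g q)"
  unfolding regv_def by (auto intro!: reg_mult)

lemma reg_pairing: "regv p f \<Longrightarrow> regv p g \<Longrightarrow> reg p (\<lambda>q. pairing (f q) (g q))"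
  unfolding regv_def pairing_def by (auto intro!: reg_sum reg_mult)

lemma reg_trace: "regm p A \<Longrightarrow> reg p (\<lambda>q. trace (A q))"
  unfolding regm_def trace_def by (auto intro!: reg_sum)

lemma regv_cong: "eventually (\<lambda>q. f q = g q) (near p) \<Longrightarrow> regv p f \<Longrightarrow> regv p g"
  unfolding regv_def by (intro allI, rule reg_cong[rotated], blast) (auto elim: eventually_mono)

lemma regm_cong: "eventually (\<lambda>q. A q = B q) (near p) \<Longrightarrow> regm p A \<Longrightarrow> regm p B"
  unfolding regm_def by (intro allI, rule reg_cong[rotated], blast) (auto elim: eventually_mono)

lemma regv_near: "p \<in> X \<Longrightarrow> regv p f \<Longrightarrow> eventually (\<lambda>q. regv q f) (near p)"
  unfolding regv_def by (intro eventually_all_finite reg_near) auto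

lemma regm_near: "p \<in> X \<Longrightarrow> regm p A \<Longrightarrow> eventually (\<lambda>q. regm q A) (near p)"
  unfolding regm_def by (intro eventually_all_finite reg_near) auto

lemma reg_det: "regm p A \<Longrightarrow> reg p (\<lambda>q. det (A q))"
  unfolding regm_def det_def by (auto intro!: reg_sum reg_mult reg_prod reg_const)

text \<open>Cramer's rule expresses the entries of the inverse by determinants.\<close>

lemma regm_inverse:
  fixes A :: "'n point \<Rightarrow> complex ^ 'r::finite ^ 'r"
  assumes p: "p \<in> X" and A: "regm p A" and inv: "invertible (A p)"
  shows "eventually (\<lambda>q. invertible (A q)) (near p)" "regm p (\<lambda>q. matrix_inv (A q))"
proof -
  have d: "det (A p) \<noteq> 0" using inv by (simp add: invertible_det_nz)
  show ev: "eventually (\<lambda>q. invertible (A q)) (near p)"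
    unfolding invertible_det_nz using reg_nonzero_inverse(1)[OF p reg_det[OF A] d] .
  define B where "B i j q = (\<chi> k l. if l = i then axis j 1 $ k else A q $ k $ l)" for i j q
  have 1: "reg p (\<lambda>q. det (B i j q) * inverse (det (A q)))" for i j
  proof (intro reg_mult reg_nonzero_inverse(2) p reg_det A)
    show "regm p (B i j)"
      unfolding regm_def
    proof (intro allI)
      fix k l show "reg p (\<lambda>q. B i j q $ k $ l)"
        using A by (cases "l = i") (auto simp: B_def regm_def reg_const)
    qed
  qed (use d in auto)
  have 2: "eventually (\<lambda>q. det (B i j q) * inverse (det (A q)) = matrix_inv (A q) $ i $ j) (near p)" for i j
    using ev
  proof eventually_elim
    case (elim q)
    then have "A q *v (matrix_inv (A q) *v axis j 1) = axis j 1"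
      by (rule matrix_inv_mult_vec)
    moreover have "det (A q) \<noteq> 0"
      using elim by (simp add: invertible_det_nz)
    ultimately have "matrix_inv (A q) *v axis j 1 = 
        (\<chi> k. det (\<chi> i l. if l = k then axis j 1 $ i else A q $ i $ l) / det (A q))"
      by (subst (asm) cramer)
    then have "(matrix_inv (A q) *v axis j 1) $ i = det (B i j q) / det (A q)"
      by (simp add: B_def)
    then show ?case
      by (simp add: mult_vec_axis field_simps)
  qed
  have "reg p (\<lambda>q. matrix_inv (A q) $ i $ j)" for i j
    by (rule reg_cong[OF 2 1])
  then show "regm p (\<lambda>q. matrix_inv (A q))"
    by (simp add: regm_def)
qed

lemma regv_zero_off_finite:
  assumes "p \<in> X" "finite S" "regv p f" "regv p g" "eventually (\<lambda>q. q \<notin> S \<longrightarrow> f q = g q) (near p)"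
  shows "eventually (\<lambda>q. f q = g q) (near p)"
proof -
  have "eventually (\<lambda>q. \<forall>i. f q $ i - g q $ i = 0) (near p)"
    using assms
    by (intro eventually_all_finite reg_zero_off_finite[OF assms(1,2)] reg_diff)
      (auto simp: regv_def elim: eventually_mono)
  then show ?thesis
    by eventually_elim (simp add: vec_eq_iff)
qed

lemma regm_zero_off_finite:
  assumes "p \<in> X" "finite S" "regm p A" "regm p B" "eventually (\<lambda>q. q \<notin> S \<longrightarrow> A q = B q) (near p)"
  shows "eventually (\<lambda>q. A q = B q) (near p)"
proof -
  have "eventually (\<lambda>q. \<forall>i j. A q $ i $ j - B q $ i $ j = 0) (near p)"
    using assms
    by (intro eventually_all_finite reg_zero_off_finite[OF assms(1,2)] reg_diff)
      (auto simp: regm_def elim: eventually_mono)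
  then show ?thesis
    by eventually_elim (simp add: vec_eq_iff)
qed

end

context marked
begin

text \<open>Derivatives along lines are pairings with gradients, so the tangent space is an
  annihilator and accessible to linear duality.\<close>

lemma cone_tangent_eq:
  "cone_tangent X a = {w. \<forall>c. (\<exists>d F h. form d F \<and> (\<forall>p\<in>X. \<forall>v\<in>p - {0}. F v = 0) \<and> taylor F a c h) \<longrightarrow>
      pairing c w = 0}"
proof (intro set_eqI iffI)
  fix w assume w: "w \<in> cone_tangent X a"
  show "w \<in> {w. \<forall>c. (\<exists>d F h. form d F \<and> (\<forall>p\<in>X. \<forall>v\<in>p - {0}. F v = 0) \<and> taylor F a c h) \<longrightarrow>
      pairing c w = 0}"
  proof (intro CollectI allI impI, elim exE conjE)
    fix c d F h assume "form d F" "\<forall>p\<in>X. \<forall>v\<in>p - {0}. F v = 0" "taylor F a c h"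
    then show "pairing c w = 0"
      using w taylor_deriv[of F a c h w] unfolding cone_tangent_def by force
  qed
next
  fix w assume w: "w \<in> {w. \<forall>c. (\<exists>d F h. form d F \<and> (\<forall>p\<in>X. \<forall>v\<in>p - {0}. F v = 0) \<and> taylor F a c h) \<longrightarrow>
      pairing c w = 0}"
  show "w \<in> cone_tangent X a"
    unfolding cone_tangent_def
  proof (intro CollectI allI impI, elim conjE)
    fix F d assume F: "form d F" "\<forall>p\<in>X. \<forall>v\<in>p - {0}. F v = 0"
    then obtain c h where "taylor F a c h"
      using cpolynomial_taylor unfolding form_def by blast
    moreover from this w F have "pairing c w = 0"
      by blast
    ultimately show "deriv (\<lambda>t. F (a + t *s w)) 0 = 0"
      using taylor_deriv by metis
  qed
qed

text \<open>Smoothness in dimension one makes the cone tangent space two-dimensional. It contains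
  \<open>a\<close>, since the equations vanish along the line of \<open>a\<close>; one direction
  \<open>w\<close> is left for the curve itself.\<close>

lemma cone_tangent_basis:
  assumes x: "x \<in> X" and a: "a \<in> x - {0}"
  obtains w where "cone_tangent X a \<subseteq> vec.span {a, w}" "\<And>s. w \<noteq> s *s a"
proof -
  let ?T = "cone_tangent X a"
  have "enat (vec.dim ?T) = 1 + 1"
    using smooth_X x a dim_X by (simp add: smooth_def)
  then have dim: "vec.dim ?T = 2"
    by (simp add: one_enat_def)
  have aT: "a \<in> ?T"
    unfolding cone_tangent_def
  proof (intro CollectI allI impI, elim conjE)
    fix F d assume F: "form d F" "\<forall>p\<in>X. \<forall>v\<in>p - {0}. F v = 0"
    have "F (a + t *s a) = 0" for t
    proof -
      have "a + t *s a = (1 + t) *s a"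
        by (simp add: vec.scale_left_distrib)
      moreover have "F ((1 + t) *s a) = (1 + t) ^ d * F a"
        using F(1) unfolding form_def by blast
      ultimately have "F (a + t *s a) = (1 + t) ^ d * F a"
        by (simp only:)
      then show ?thesis
        using F(2) x a by simp
    qed
    then show "deriv (\<lambda>t. F (a + t *s a)) 0 = 0"
      by simp
  qed
  have "vec.independent {a}"
    using a by (simp add: vec.dependent_single)
  then obtain B where B: "{a} \<subseteq> B" "B \<subseteq> ?T" "vec.independent B" "?T \<subseteq> vec.span B"
    using vec.maximal_independent_subset_extend[of "{a}" ?T] aT by auto
  then have "card B = 2"
    using vec.basis_card_eq_dim dim by metis
  then obtain b c where bc: "B = {b, c}" "b \<noteq> c"
    by (auto simp: card_2_iff)
  then obtain w where w: "B = {a, w}" "w \<noteq> a"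
  proof (cases "a = b")
    case False
    then have "a = c" using B(1) bc by auto
    then show ?thesis using that[of b] bc by auto
  qed auto
  have "w \<noteq> s *s a" for s
  proof
    assume "w = s *s a"
    then have "w \<in> vec.span {a}"
      unfolding vec.span_singleton by blast
    then show False
      using B(3) w vec.independent_insert[of w "{a}"] by (simp add: insert_commute)
  qed
  then show ?thesis
    using that B w by auto
qed

text \<open>In the chart \<open>pairing l v = 1\<close> all coordinate differences at
  \<open>x\<close> are multiples of one function \<open>t\<close>, modulo their own products with
  functions vanishing at \<open>x\<close>. A Nakayama argument, here the inversion of a matrix that
  is the identity at \<open>x\<close>, turns this into divisibility by \<open>t\<close>, first for
  coordinates and then for every regular function vanishing at \<open>x\<close>.\<close>

theorem uniformizer_exists:
  assumes x: "x \<in> X"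
  shows "\<exists>t. reg x t \<and> t x = 0 \<and> eventually (\<lambda>q. q \<noteq> x \<longrightarrow> t q \<noteq> 0) (near x) \<and>
    (\<forall>f. reg x f \<and> f x = 0 \<longrightarrow> (\<exists>h. reg x h \<and> eventually (\<lambda>q. f q = t q * h q) (near x)))"
proof -
  have xP: "x \<in> proj_space" using x X_subset by blast
  obtain a where a: "a \<in> x - {0}" using proj_space_nonzero[OF xP] by blast
  obtain w where w: "cone_tangent X a \<subseteq> vec.span {a, w}" "\<And>s. w \<noteq> s *s a"
    using cone_tangent_basis[OF x a] by blast
  \<comment> \<open>\<open>\<tau>\<close> vanishes on \<open>a\<close> and not on the direction
    \<open>w\<close> of the curve, so it restricts to a coordinate of the tangent line.\<close>
  obtain \<tau> where \<tau>: "pairing \<tau> a = 0" "pairing \<tau> w = 1"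
    using independent_functional[of a w] a w by auto
  obtain i0 where i0: "a $ i0 \<noteq> 0" using a by (auto simp: vec_eq_iff)
  define l where "l = (1 / a $ i0) *s axis i0 (1 :: complex)"
  have l: "pairing l a = 1" using i0 by (simp add: l_def pairing_scale)
  define S where "S = {c. \<exists>d F h. form d F \<and> (\<forall>p\<in>X. \<forall>v\<in>p - {0}. F v = 0) \<and> taylor F a c h}"
  \<comment> \<open>By duality: a vector annihilated by all gradients is tangent, hence a
    combination of \<open>a\<close> and \<open>w\<close>, and annihilation by \<open>\<tau>\<close>
    and \<open>l\<close> forces both coefficients to be 0.\<close>
  have span: "vec.span (S \<union> {l, \<tau>}) = UNIV"
  proof (rule ccontr)
    assume "vec.span (S \<union> {l, \<tau>}) \<noteq> UNIV"
    then obtain u where u: "u \<noteq> 0" "\<And>v. v \<in> vec.span (S \<union> {l, \<tau>}) \<Longrightarrow> pairing v u = 0"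
      using proper_subspace_annihilator[OF vec.subspace_span] by blast
    have u': "pairing v u = 0" if "v \<in> S \<union> {l, \<tau>}" for v
      by (rule u(2)[OF vec.span_base[OF that]])
    have "cone_tangent X a = {w. \<forall>c. c \<in> S \<longrightarrow> pairing c w = 0}"
      unfolding cone_tangent_eq S_def mem_Collect_eq ..
    then have "u \<in> cone_tangent X a"
      using u' by blast
    then have "u \<in> vec.span {a, w}" using w by blast
    then obtain k where "u - k *s a \<in> vec.span {w}"
      unfolding vec.span_breakdown_eq by blast
    then obtain m where "u - k *s a = m *s w"
      by (auto simp: vec.span_singleton)
    then have "u = k *s a + m *s w"
      by (simp add: algebra_simps)
    moreover from this have "m = 0"
      using u'[of \<tau>] \<tau> by (simp add: pairing_sum_right pairing_scale)
    moreover from calculation have "k = 0"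
      using u'[of l] l by (simp add: pairing_sum_right pairing_scale)
    ultimately show False using u(1) by simp
  qed
  \<comment> \<open>The representative of \<open>q\<close> in the chart where \<open>l\<close> is 1;
    polynomials in it are regular functions near \<open>x\<close>.\<close>
  define nv where "nv q = (SOME v. v \<in> q \<and> pairing l v = 1)" for q
  have nv: "nv q \<in> q - {0}" "pairing l (nv q) = 1" "\<And>v. v \<in> q - {0} \<Longrightarrow> nv q = (1 / pairing l v) *s v"
    if q: "q \<in> X" "\<forall>v\<in>q - {0}. pairing l v \<noteq> 0" for q
  proof -
    have qP: "q \<in> proj_space" using q X_subset by blast
    obtain v where v: "v \<in> q - {0}" using proj_space_nonzero[OF qP] by blast
    have "(1 / pairing l v) *s v \<in> q \<and> pairing l ((1 / pairing l v) *s v) = 1"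
      using v q proj_space_eq_range[OF qP v] by (auto simp: pairing_scale)
    then have *: "nv q \<in> q \<and> pairing l (nv q) = 1"
      unfolding nv_def by (rule someI)
    then show 1: "nv q \<in> q - {0}" "pairing l (nv q) = 1"
      by (auto simp: pairing_def)
    show "nv q = (1 / pairing l v) *s v" if v: "v \<in> q - {0}" for v
    proof -
      obtain c where c: "nv q = c *s v"
        using proj_space_proportional[OF qP v 1(1)] by blast
      then have "c * pairing l v = 1" using 1(2) by (simp add: pairing_scale)
      then have "c = 1 / pairing l v" by (metis mult_zero_right nonzero_eq_divide_eq zero_neq_one)
      then show ?thesis using c by simp
    qed
  qed
  have lx: "\<forall>v\<in>x - {0}. pairing l v \<noteq> 0"
    using form_vanish_iff[OF form_pairing xP a] l by (metis zero_neq_one)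
  have near_N: "eventually (\<lambda>q. q \<in> X \<and> (\<forall>v\<in>q - {0}. pairing l v \<noteq> 0)) (near x)"
    using near_open[OF zopen_nonvanishing[OF form_pairing[of l]], of x] x lx by simp
  have nvx: "nv x = a"
    using nv(3)[OF x lx a] l by simp
  have reg_nv: "reg x (\<lambda>q. F (nv q))" if "cpolynomial F" for F
    using that
  proof (induction rule: cpolynomial.induct)
    case (coord i)
    have "eventually (\<lambda>q. \<forall>v\<in>q - {0}. pairing l v \<noteq> 0 \<and> nv q $ i = v $ i / pairing l v) (near x)"
      using near_N by eventually_elim (use nv(3) in force)
    then show ?case
      unfolding reg_def using form_coord form_pairing by blast
  qed (auto intro: reg_const reg_add reg_mult)
  define \<delta> where "\<delta> q = nv q - a" for q
  have \<delta>x: "\<delta> x = 0" by (simp add: \<delta>_def nvx)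
  have reg_\<delta>: "reg x (\<lambda>q. \<delta> q $ i)" for i
    unfolding \<delta>_def using reg_nv[OF cpolynomial.coord] by (auto intro!: reg_diff reg_const)
  define t where "t q = pairing \<tau> (\<delta> q)" for q
  have reg_t: "reg x t"
    unfolding t_def[abs_def] pairing_def by (intro reg_sum reg_mult reg_const reg_\<delta>)
  have tx: "t x = 0"
    by (simp add: t_def \<delta>x pairing_def)
  \<comment> \<open>Expand \<open>y\<close> in the spanning set. A gradient contributes higher-order
    terms only, by the Taylor expansion of an equation of \<open>X\<close>; \<open>l\<close>
    contributes 0, being constant on the chart; \<open>\<tau>\<close> contributes
    \<open>t\<close>.\<close>
  have rel: "\<exists>\<beta> k. (\<forall>j. reg x (k j) \<and> k j x = 0) \<and>
      eventually (\<lambda>q. pairing y (\<delta> q) = \<beta> * t q + (\<Sum>j\<in>UNIV. k j q * \<delta> q $ j)) (near x)" for y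
  proof -
    have "y \<in> vec.span (S \<union> {l, \<tau>})" unfolding span by simp
    then show ?thesis
    proof (induction rule: vec.span_induct_alt)
      case base
      show ?case
        by (intro exI[of _ 0] exI[of _ "\<lambda>_ _. 0"]) (simp add: reg_const pairing_def)
    next
      case (step c y z)
      then obtain \<beta> k where 1: "\<And>j. reg x (k j)" "\<And>j. k j x = 0"
        "eventually (\<lambda>q. pairing z (\<delta> q) = \<beta> * t q + (\<Sum>j\<in>UNIV. k j q * \<delta> q $ j)) (near x)"
        by blast
      have "\<exists>\<beta> k. (\<forall>j. reg x (k j) \<and> k j x = 0) \<and>
        eventually (\<lambda>q. pairing y (\<delta> q) = \<beta> * t q + (\<Sum>j\<in>UNIV. k j q * \<delta> q $ j)) (near x)"
      proof -
        consider "y \<in> S" | "y = l" | "y = \<tau>" using step by blast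
        then show ?thesis
        proof cases
          case 1
          then obtain d F h where F: "form d F" "\<forall>p\<in>X. \<forall>v\<in>p - {0}. F v = 0" "taylor F a y h"
            unfolding S_def by blast
          have "eventually (\<lambda>q. pairing y (\<delta> q) = 0 * t q + (\<Sum>j\<in>UNIV. - h j (nv q) * \<delta> q $ j)) (near x)"
            using near_N
          proof eventually_elim
            case (elim q)
            have "F (nv q) = F a + (\<Sum>j\<in>UNIV. (y $ j + h j (nv q)) * (nv q $ j - a $ j))"
              using F(3) unfolding taylor_def by blast
            moreover have "F (nv q) = 0" "F a = 0"
              using F(2) nv(1) elim x a by blast+
            ultimately have "(\<Sum>j\<in>UNIV. (y $ j + h j (nv q)) * \<delta> q $ j) = 0"
              by (simp add: \<delta>_def)
            then have "pairing y (\<delta> q) + (\<Sum>j\<in>UNIV. h j (nv q) * \<delta> q $ j) = 0"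
              by (simp add: pairing_def sum.distrib[symmetric] ring_distribs)
            then show ?case
              by (simp add: sum_negf eq_neg_iff_add_eq_0)
          qed
          moreover have "reg x (\<lambda>q. - h j (nv q))" for j
            by (rule reg_minus[OF reg_nv[OF taylorD(1)[OF F(3)]]])
          ultimately show ?thesis
            by (intro exI[of _ 0] exI[of _ "\<lambda>j q. - h j (nv q)"]) (simp add: nvx taylorD(2)[OF F(3)])
        next
          case 2
          have "eventually (\<lambda>q. pairing y (\<delta> q) = 0 * t q + (\<Sum>j\<in>UNIV. 0 * \<delta> q $ j)) (near x)"
            using near_N
          proof eventually_elim
            case (elim q)
            then have "pairing l (nv q) = 1" using nv by blast
            then show ?case 
              using pairing_sum_right[of l "nv q - a" a] l by (simp add: 2 \<delta>_def)
          qed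
          then show ?thesis
            by (intro exI[of _ 0] exI[of _ "\<lambda>_ _. 0"]) (auto simp: reg_const)
        next
          case 3
          then show ?thesis
            by (intro exI[of _ 1] exI[of _ "\<lambda>_ _. 0"]) (auto simp: reg_const t_def)
        qed
      qed
      then obtain \<beta>' k' where 2: "\<And>j. reg x (k' j)" "\<And>j. k' j x = 0"
        "eventually (\<lambda>q. pairing y (\<delta> q) = \<beta>' * t q + (\<Sum>j\<in>UNIV. k' j q * \<delta> q $ j)) (near x)"
        by blast
      have "eventually (\<lambda>q. pairing (c *s y + z) (\<delta> q) = (c * \<beta>' + \<beta>) * t q + 
          (\<Sum>j\<in>UNIV. (c * k' j q + k j q) * \<delta> q $ j)) (near x)"
        using 1(3) 2(3)
        by eventually_elim (simp add: pairing_sum_left pairing_scale sum.distrib sum_distrib_left algebra_simps)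
      then show ?case
        using 1 2 by (intro exI[of _ "c * \<beta>' + \<beta>"] exI[of _ "\<lambda>j q. c * k' j q + k j q"])
          (auto intro!: reg_add reg_mult reg_const)
    qed
  qed
  have "\<forall>i. \<exists>\<beta> k. (\<forall>j. reg x (k j) \<and> k j x = 0) \<and>
      eventually (\<lambda>q. \<delta> q $ i = \<beta> * t q + (\<Sum>j\<in>UNIV. k j q * \<delta> q $ j)) (near x)"
    using rel[of "axis _ 1"] by simp
  then have "\<exists>\<beta>. \<forall>i. \<exists>k. (\<forall>j. reg x (k j) \<and> k j x = 0) \<and>
      eventually (\<lambda>q. \<delta> q $ i = \<beta> i * t q + (\<Sum>j\<in>UNIV. k j q * \<delta> q $ j)) (near x)"
    by (rule choice)
  then obtain \<beta> where "\<forall>i. \<exists>k. (\<forall>j. reg x (k j) \<and> k j x = 0) \<and>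
      eventually (\<lambda>q. \<delta> q $ i = \<beta> i * t q + (\<Sum>j\<in>UNIV. k j q * \<delta> q $ j)) (near x)" ..
  then have "\<exists>k. \<forall>i. (\<forall>j. reg x (k i j) \<and> k i j x = 0) \<and>
      eventually (\<lambda>q. \<delta> q $ i = \<beta> i * t q + (\<Sum>j\<in>UNIV. k i j q * \<delta> q $ j)) (near x)"
    by (rule choice)
  then obtain k where k: "\<And>i j. reg x (k i j)" "\<And>i j. k i j x = 0"
      "\<And>i. eventually (\<lambda>q. \<delta> q $ i = \<beta> i * t q + (\<Sum>j\<in>UNIV. k i j q * \<delta> q $ j)) (near x)"
    by blast
  \<comment> \<open>The relations say that \<open>M q\<close> maps \<open>\<delta> q\<close> to
    \<open>t q\<close> times the constant vector \<open>\<beta>\<close>, and \<open>M x\<close> is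
    the unit matrix.\<close>
  define M :: "'n point \<Rightarrow> complex ^ 'n ^ 'n" where "M q = (\<chi> i j. (if i = j then 1 else 0) - k i j q)" for q
  have regM: "regm x M"
    unfolding regm_def M_def by (auto intro!: reg_diff reg_minus reg_const k)
  have "M x = mat 1"
    by (simp add: M_def k mat_def)
  then have invM: "invertible (M x)"
    by (simp add: invertible_det_nz)
  define u where "u q = matrix_inv (M q) *v (\<chi> i. \<beta> i)" for q
  have regu: "regv x u"
    unfolding u_def[abs_def] by (intro regv_mult regm_inverse(2) regv_const x regM invM)
  have k3: "eventually (\<lambda>q. \<forall>i. \<delta> q $ i = \<beta> i * t q + (\<Sum>j\<in>UNIV. k i j q * \<delta> q $ j)) (near x)"
    by (intro eventually_all_finite k(3))
  have \<delta>u: "eventually (\<lambda>q. \<delta> q = t q *s u q) (near x)"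
    using k3 regm_inverse(1)[OF x regM invM]
  proof eventually_elim
    case (elim q)
    have "(M q *v \<delta> q) $ i = t q * \<beta> i" for i
    proof -
      have "(M q *v \<delta> q) $ i = (\<Sum>j\<in>UNIV. (if i = j then \<delta> q $ j else 0) - k i j q * \<delta> q $ j)"
        unfolding matrix_vector_mult_def M_def by (simp, intro sum.cong) (auto simp: left_diff_distrib)
      then have "(M q *v \<delta> q) $ i = \<delta> q $ i - (\<Sum>j\<in>UNIV. k i j q * \<delta> q $ j)"
        by (simp add: sum_subtractf)
      then show ?thesis
        using elim(1) by (metis add_diff_cancel_right' mult.commute)
    qed
    then have "M q *v \<delta> q = t q *s (\<chi> i. \<beta> i)"
      by (simp add: vec_eq_iff)
    then have "matrix_inv (M q) *v (M q *v \<delta> q) = t q *s u q"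
      by (simp add: u_def vector_scalar_commute)
    then show ?case
      using matrix_inv_mult_vec(1)[OF elim(2)] by simp
  qed
  \<comment> \<open>If \<open>t q = 0\<close>, then all coordinate differences vanish, so
    \<open>q\<close> and \<open>x\<close> have the same normalized representative.\<close>
  have "eventually (\<lambda>q. q \<noteq> x \<longrightarrow> t q \<noteq> 0) (near x)"
    using \<delta>u near_N
  proof eventually_elim
    case (elim q)
    show ?case
    proof (intro impI notI)
      assume q: "q \<noteq> x" "t q = 0"
      then have "nv q = a"
        using elim by (simp add: \<delta>_def)
      then have "q = range (\<lambda>c. c *s a)"
        using nv(1)[of q] elim proj_space_eq_range[of q a] X_subset by auto
      then show False
        using q proj_space_eq_range[OF xP a] by simp
    qed
  qed
  moreover have "\<exists>h. reg x h \<and> eventually (\<lambda>q. f q = t q * h q) (near x)" if f: "reg x f" "f x = 0" for f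
  proof -
    obtain d G H where G: "form d G" "form d H"
      "eventually (\<lambda>q. \<forall>v\<in>q - {0}. H v \<noteq> 0 \<and> f q = G v / H v) (near x)"
      using f by (auto simp: reg_def)
    have "H a \<noteq> 0" "G a = 0"
      using near_self[OF x G(3)] a f(2) by auto
    obtain c h where h: "taylor G a c h"
      using cpolynomial_taylor G(1) unfolding form_def by blast
    \<comment> \<open>The expansion of the numerator \<open>G\<close> at \<open>a\<close>, whose
      constant term is 0, with each difference written as \<open>t q * u q $ i\<close> and
      \<open>t q\<close> taken out.\<close>
    define k where "k q = (\<Sum>i\<in>UNIV. (c $ i + h i (nv q)) * u q $ i) * inverse (H (nv q))" for q
    have "reg x k"
      unfolding k_def[abs_def]
    proof (intro reg_mult reg_sum reg_add reg_const reg_nonzero_inverse(2) x)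
      show "reg x (\<lambda>q. h i (nv q))" for i by (intro reg_nv taylorD(1)[OF h])
      show "reg x (\<lambda>q. u q $ i)" for i using regu by (simp add: regv_def)
      show "reg x (\<lambda>q. H (nv q))" using G(2) by (intro reg_nv) (simp add: form_def)
      show "H (nv x) \<noteq> 0" using \<open>H a \<noteq> 0\<close> by (simp add: nvx)
    qed
    moreover have "eventually (\<lambda>q. f q = t q * k q) (near x)"
      using G(3) near_N \<delta>u
    proof eventually_elim
      case (elim q)
      have "f q = G (nv q) * inverse (H (nv q))"
        using elim(1,2) nv(1) by (auto simp: divide_inverse)
      moreover have "G (nv q) = G a + (\<Sum>i\<in>UNIV. (c $ i + h i (nv q)) * (nv q $ i - a $ i))"
        using h unfolding taylor_def by blast
      moreover have "nv q $ i - a $ i = t q * u q $ i" for i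
        using elim(3) by (metis \<delta>_def vector_minus_component vector_smult_component)
      ultimately show ?case
        using \<open>G a = 0\<close> by (simp add: k_def sum_distrib_left sum_distrib_right mult_ac)
    qed
    ultimately show ?thesis by blast
  qed
  ultimately show ?thesis
    using reg_t tx by blast
qed

end

section \<open>Standard flags\<close>

text \<open>An arbitrary enumeration of the index type orders the standard basis.\<close>

definition ix :: "'r::finite \<Rightarrow> nat" where
  "ix = (SOME f. bij_betw f UNIV {..<CARD('r)})"

lemma bij_ix: "bij_betw (ix :: 'r::finite \<Rightarrow> nat) UNIV {..<CARD('r)}"
proof -
  have "\<exists>f. bij_betw f (UNIV :: 'r set) {..<CARD('r)}"
    using ex_bij_betw_finite_nat[of "UNIV :: 'r set"] by (simp add: atLeast0LessThan)
  then show ?thesis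
    unfolding ix_def by (rule someI_ex)
qed

lemma ix_less: "ix (i :: 'r::finite) < CARD('r)"
  using bij_ix[where 'r = 'r] by (auto simp: bij_betw_def)

lemma ix_inj: "ix i = ix j \<longleftrightarrow> i = j"
  using bij_ix by (auto simp: bij_betw_def inj_on_def)

lemma ix_surj: "m < CARD('r) \<Longrightarrow> \<exists>i :: 'r::finite. ix i = m"
  using bij_ix[where 'r = 'r] unfolding bij_betw_def by (metis imageE lessThan_iff)

definition stdV :: "nat \<Rightarrow> (complex ^ 'r::finite) set" where
  "stdV m = {v. \<forall>k. m \<le> ix k \<longrightarrow> v $ k = 0}"

definition upper :: "complex ^ 'r::finite ^ 'r \<Rightarrow> bool" where
  "upper A \<longleftrightarrow> (\<forall>i j. ix j < ix i \<longrightarrow> A $ i $ j = 0)"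

lemma subspace_stdV: "vec.subspace (stdV m)"
  by (auto simp: vec.subspace_def stdV_def)

lemma stdV_0: "stdV 0 = {0}"
  by (auto simp: stdV_def vec_eq_iff)

lemma stdV_UNIV: "stdV CARD('r) = (UNIV :: (complex ^ 'r::finite) set)"
  using ix_less by (auto simp: stdV_def not_le[symmetric])

lemma dim_stdV:
  assumes "m \<le> CARD('r)" shows "vec.dim (stdV m :: (complex ^ 'r::finite) set) = m"
proof -
  have "stdV m = {v :: complex ^ 'r. \<forall>k. k \<notin> {k. ix k < m} \<longrightarrow> v $ k = 0}"
    by (auto simp: stdV_def)
  then have "vec.dim (stdV m :: (complex ^ 'r) set) = card {k :: 'r. ix k < m}"
    by (simp only: dim_substandard_cart)
  also have "card {k :: 'r. ix k < m} = card (ix ` {k :: 'r. ix k < m})"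
    by (rule card_image[symmetric]) (auto simp: inj_on_def ix_inj)
  also have "ix ` {k :: 'r. ix k < m} = {..<m}"
  proof (intro set_eqI iffI)
    fix n assume "n \<in> {..<m}"
    then obtain i :: 'r where "ix i = n" 
      using ix_surj[of n, where 'r = 'r] assms by auto
    then show "n \<in> ix ` {k :: 'r. ix k < m}"
      using \<open>n \<in> {..<m}\<close> by auto
  qed auto
  finally show ?thesis by simp
qed

lemma upper_stdV: "upper A \<Longrightarrow> v \<in> stdV m \<Longrightarrow> A *v v \<in> stdV m"
  unfolding stdV_def upper_def matrix_vector_mult_def
  by (auto intro!: sum.neutral) (metis le_trans linorder_not_le)

lemma upper_iff: "upper A \<longleftrightarrow> (\<forall>m\<le>CARD('r). (*v) A ` stdV m \<subseteq> stdV m)"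
  for A :: "complex ^ 'r::finite ^ 'r"
proof
  show "upper A \<Longrightarrow> \<forall>m\<le>CARD('r). (*v) A ` stdV m \<subseteq> stdV m"
    using upper_stdV by blast
  assume *: "\<forall>m\<le>CARD('r). (*v) A ` stdV m \<subseteq> stdV m"
  have "A $ i $ j = 0" if "ix j < ix i" for i j
  proof -
    have "axis j 1 \<in> stdV (Suc (ix j))"
      by (auto simp: stdV_def axis_one_nth Suc_le_eq)
    moreover have "(*v) A ` stdV (Suc (ix j)) \<subseteq> stdV (Suc (ix j))"
      using *[rule_format, of "Suc (ix j)"] ix_less[of j] by (simp add: Suc_le_eq)
    ultimately have "A *v axis j 1 \<in> stdV (Suc (ix j))"
      by blast
    then show ?thesis
      using that by (auto simp: stdV_def mult_vec_axis Suc_le_eq)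
  qed
  then show "upper A" by (simp add: upper_def)
qed

text \<open>The columns of \<open>c\<close> are vectors picked from the successive differences of
  the flag. Flags decrease while \<open>stdV\<close> increases, which accounts for the index
  \<open>CARD('r) + 1 - i\<close> here and later.\<close>

lemma full_flag_standard:
  fixes F :: "nat \<Rightarrow> (complex ^ 'r::finite) set"
  assumes F: "full_flag F"
  shows "\<exists>c :: complex ^ 'r ^ 'r. invertible c \<and> (\<forall>i\<in>{1..CARD('r) + 1}. F i = (*v) c ` stdV (CARD('r) + 1 - i))"
proof -
  let ?r = "CARD('r)"
  have sub: "vec.subspace (F i)" if "i \<in> {1..?r + 1}" for i
    using F that by (simp add: full_flag_def)
  have anti: "F j \<subseteq> F i" if "1 \<le> i" "i \<le> j" "j \<le> ?r + 1" for i j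
    using that(2,1,3)
  proof (induction rule: dec_induct)
    case (step n)
    then have "F (n + 1) \<subset> F n"
      using F by (auto simp: full_flag_def)
    then show ?case using step by auto
  qed auto
  have "\<forall>i. \<exists>v. i \<in> {1..?r} \<longrightarrow> v \<in> F i \<and> v \<notin> F (i + 1)"
    using F unfolding full_flag_def by blast
  then obtain v where v: "\<And>i. i \<in> {1..?r} \<Longrightarrow> v i \<in> F i" "\<And>i. i \<in> {1..?r} \<Longrightarrow> v i \<notin> F (i + 1)"
    by metis
  define c :: "complex ^ 'r ^ 'r" where "c = (\<chi> i j. v (?r - ix j) $ i)"
  have cw: "c *v w = (\<Sum>j\<in>UNIV. w $ j *s v (?r - ix j))" for w
    by (simp add: vec_eq_iff c_def matrix_vector_mult_def mult.commute)
  have vF: "v (?r - ix j) \<in> F (?r + 1 - m)" if "ix j < m" "m \<le> ?r" for j :: 'r and m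
  proof -
    have "v (?r - ix j) \<in> F (?r - ix j)"
      using v(1)[of "?r - ix j"] ix_less[of j] by auto
    moreover have "F (?r - ix j) \<subseteq> F (?r + 1 - m)"
      using that ix_less[of j] by (intro anti) auto
    ultimately show ?thesis by blast
  qed
  have sum_F: "(\<Sum>j\<in>J. w $ j *s v (?r - ix j)) \<in> F (?r + 1 - m)" 
    if "\<And>j. j \<in> J \<Longrightarrow> ix j < m \<or> w $ j = 0" "m \<le> ?r" for J m and w :: "complex ^ 'r"
  proof (rule vec.subspace_sum)
    show S: "vec.subspace (F (?r + 1 - m))" using that by (intro sub) auto
    fix j assume "j \<in> J"
    then show "w $ j *s v (?r - ix j) \<in> F (?r + 1 - m)"
      using that vF[of j m] vec.subspace_scale[OF S] vec.subspace_0[OF S] by fastforce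
  qed
  \<comment> \<open>If \<open>w\<close> had a nonzero coordinate at index \<open>m\<close> or
    beyond, take the last one, \<open>k\<close>: all other summands lie in the flag step below,
    hence so does the vector belonging to \<open>k\<close>, against its choice.\<close>
  have key: "w \<in> stdV m" if m: "m \<le> ?r" and w: "c *v w \<in> F (?r + 1 - m)" for m w
  proof (rule ccontr)
    assume "w \<notin> stdV m"
    then obtain k0 where k0: "m \<le> ix k0" "w $ k0 \<noteq> 0"
      by (auto simp: stdV_def)
    define K where "K = {k. w $ k \<noteq> 0}"
    have "K \<noteq> {}" using k0 by (auto simp: K_def)
    then have "Max (ix ` K) \<in> ix ` K" by (intro Max_in) auto
    then obtain k where k': "k \<in> K" "ix k = Max (ix ` K)" by auto
    then have k: "k \<in> K" "\<And>j. j \<in> K \<Longrightarrow> ix j \<le> ix k" by auto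
    have mk: "m \<le> ix k" using k(2)[of k0] k0 by (auto simp: K_def)
    let ?i = "?r - ix k"
    have i: "?i \<in> {1..?r}" using ix_less[of k] by auto
    have i1: "?i + 1 = ?r + 1 - ix k" using ix_less[of k] by simp
    have S: "vec.subspace (F (?i + 1))" using i by (intro sub) auto
    have "?i + 1 \<le> ?r + 1 - m"
      using mk ix_less[of k] by linarith
    then have "F (?r + 1 - m) \<subseteq> F (?i + 1)"
      by (intro anti) auto
    then have "c *v w \<in> F (?i + 1)"
      using w by blast
    moreover have "(\<Sum>j\<in>UNIV - {k}. w $ j *s v (?r - ix j)) \<in> F (?i + 1)"
      unfolding i1
    proof (rule sum_F)
      fix j assume "j \<in> UNIV - {k}"
      then show "ix j < ix k \<or> w $ j = 0"
        using k(2)[of j] ix_inj[of j k] by (auto simp: K_def)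
    qed (use ix_less[of k] in simp)
    ultimately have "c *v w - (\<Sum>j\<in>UNIV - {k}. w $ j *s v (?r - ix j)) \<in> F (?i + 1)"
      using vec.subspace_diff[OF S] by blast
    moreover have "c *v w = w $ k *s v ?i + (\<Sum>j\<in>UNIV - {k}. w $ j *s v (?r - ix j))"
      unfolding cw by (rule sum.remove) auto
    ultimately have "w $ k *s v ?i \<in> F (?i + 1)"
      by simp
    then have "(1 / w $ k) *s (w $ k *s v ?i) \<in> F (?i + 1)"
      using vec.subspace_scale[OF S] by blast
    then have "v ?i \<in> F (?i + 1)"
      using k(1) by (simp add: K_def)
    then show False using v(2)[OF i] by blast
  qed
  have inv: "invertible c"
    unfolding invertible_left_inverse matrix_left_invertible_ker
  proof (intro allI impI)
    fix w assume "c *v w = 0"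
    then have "w \<in> stdV 0"
      using F by (intro key) (auto simp: full_flag_def)
    then show "w = 0" by (simp add: stdV_0)
  qed
  moreover have "F i = (*v) c ` stdV (?r + 1 - i)" if i: "i \<in> {1..?r + 1}" for i
  proof (intro set_eqI iffI)
    fix u assume u: "u \<in> F i"
    let ?w = "matrix_inv c *v u"
    have cw: "c *v ?w = u" using matrix_inv_mult_vec[OF inv] by simp
    have "?w \<in> stdV (?r + 1 - i)"
      by (rule key) (use i u cw in auto)
    then show "u \<in> (*v) c ` stdV (?r + 1 - i)"
      using cw by (metis image_eqI)
  next
    fix u assume "u \<in> (*v) c ` stdV (?r + 1 - i)"
    then obtain w where w: "w \<in> stdV (?r + 1 - i)" "u = c *v w" by blast
    have "(\<Sum>j\<in>UNIV. w $ j *s v (?r - ix j)) \<in> F (?r + 1 - (?r + 1 - i))"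
      using w(1) i by (intro sum_F) (auto simp: stdV_def not_le[symmetric])
    then show "u \<in> F i"
      using i w by (simp add: cw)
  qed
  ultimately show ?thesis by (intro exI[of _ c] conjI ballI)
qed

text \<open>Only the largest index occurring in \<open>U\<close> matters: upper matrix units carry a
  vector with this coordinate to the basis vector of that index and to every earlier one.\<close>

lemma upper_stable_subspace:
  fixes U :: "(complex ^ 'r::finite) set"
  assumes U: "vec.subspace U" and stable: "\<And>A v. upper A \<Longrightarrow> v \<in> U \<Longrightarrow> A *v v \<in> U"
  shows "\<exists>M\<le>CARD('r). U = stdV M"
proof (cases "U = {0}")
  case True
  then show ?thesis using stdV_0 by (intro exI[of _ 0]) auto
next
  case False
  define K where "K = {k. \<exists>v\<in>U. v $ k \<noteq> 0}"
  have "\<exists>v\<in>U. v \<noteq> 0" using False vec.subspace_0[OF U] by blast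
  then have "K \<noteq> {}" by (auto simp: K_def vec_eq_iff)
  then have "Max (ix ` K) \<in> ix ` K" by (intro Max_in) auto
  then obtain k where k: "k \<in> K" "ix k = Max (ix ` K)" by auto
  have kmax: "ix j \<le> ix k" if "j \<in> K" for j
    using k(2) that by auto
  obtain v where v: "v \<in> U" "v $ k \<noteq> 0" using k(1) by (auto simp: K_def)
  have ax: "axis i 1 \<in> U" if "ix i \<le> ix k" for i
  proof -
    have "upper (outer (axis i 1) (axis k (1 / v $ k)))"
      using that by (auto simp: upper_def axis_def)
    then have "outer (axis i 1) (axis k (1 / v $ k)) *v v \<in> U"
      using v stable by blast
    moreover have "pairing (axis k (1 / v $ k)) v = 1"
    proof -
      have "axis k (1 / v $ k) = (1 / v $ k) *s axis k 1" by (simp add: vec_eq_iff axis_def)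
      then show ?thesis using v by (simp add: pairing_scale)
    qed
    ultimately show ?thesis by (simp add: outer_mult_vec)
  qed
  have "U = stdV (Suc (ix k))"
  proof (intro set_eqI iffI)
    fix u assume "u \<in> U"
    then show "u \<in> stdV (Suc (ix k))"
      using kmax by (force simp: stdV_def K_def Suc_le_eq)
  next
    fix u :: "complex ^ 'r" assume u: "u \<in> stdV (Suc (ix k))"
    have "u = (\<Sum>j\<in>UNIV. u $ j *s axis j 1)"
      by (simp add: basis_expansion)
    also have "\<dots> \<in> U"
    proof (rule vec.subspace_sum[OF U])
      fix j
      show "u $ j *s axis j 1 \<in> U"
        using u ax[of j] vec.subspace_scale[OF U] vec.subspace_0[OF U]
        by (cases "ix j \<le> ix k") (auto simp: stdV_def)
    qed
    finally show "u \<in> U" .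
  qed
  then show ?thesis using ix_less[of k] by (intro exI[of _ "Suc (ix k)"]) (auto simp: Suc_le_eq)
qed

text \<open>The image of a standard subspace is again stable under all upper matrices, hence
  standard, and its dimension identifies it. In this way a matrix normalizing the algebra of the
  flag is seen to preserve the flag.\<close>

lemma upper_normalizer_stdV:
  fixes k :: "complex ^ 'r::finite ^ 'r"
  assumes inv: "invertible k" and norm: "\<And>A. upper A \<Longrightarrow> \<exists>A'. upper A' \<and> A ** k = k ** A'"
    and m: "m \<le> CARD('r)"
  shows "(*v) k ` stdV m = stdV m" "(*v) (matrix_inv k) ` stdV m = stdV m"
proof -
  have inj: "inj ((*v) k)"
    using matrix_inv_mult_vec(1)[OF inv] by (metis injI)
  have "vec.subspace ((*v) k ` stdV m)"
    by (intro vec.linear_subspace_image matrix_vector_mul_linear_gen subspace_stdV)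
  moreover have "A *v v \<in> (*v) k ` stdV m" if A: "upper A" and v: "v \<in> (*v) k ` stdV m" for A v
  proof -
    obtain u where u: "u \<in> stdV m" "v = k *v u" using v by blast
    obtain A' where "upper A'" "A ** k = k ** A'" using norm A by blast
    then have "A *v v = k *v (A' *v u)" "A' *v u \<in> stdV m"
      using u upper_stdV by (auto simp: matrix_vector_mul_assoc)
    then show ?thesis by blast
  qed
  ultimately obtain M where M: "M \<le> CARD('r)" "(*v) k ` stdV m = stdV M"
    using upper_stable_subspace[of "(*v) k ` stdV m"] by blast
  have "vec.dim ((*v) k ` stdV m) = vec.dim (stdV m :: (complex ^ 'r) set)"
    using inj by (intro vec.dim_image_eq matrix_vector_mul_linear_gen) (auto intro: inj_on_subset)
  then have "M = m"
    using dim_stdV[OF M(1)] dim_stdV[OF m] M(2) by simp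
  then show 1: "(*v) k ` stdV m = stdV m"
    using M by simp
  have "(*v) (matrix_inv k) ` ((*v) k ` stdV m) = stdV m"
    by (simp add: image_image matrix_inv_mult_vec(1)[OF inv])
  then show "(*v) (matrix_inv k) ` stdV m = stdV m"
    by (simp add: 1)
qed

section \<open>Stalks and local frames\<close>

context marked
begin

lemma res_res: "res V (res U s) = res (V \<inter> U) s"
  by (auto simp: res_def)

text \<open>Membership in the stalk, for functions which need not vanish outside an open set; for a
  sheaf only the germ of \<open>s\<close> at \<open>p\<close> matters
  (\<open>sect_cong\<close>).\<close>

definition sect :: "('n, 'v::zero) fsheaf \<Rightarrow> 'n point \<Rightarrow> ('n point \<Rightarrow> 'v) \<Rightarrow> bool" where
  "sect M p s \<longleftrightarrow> (\<exists>V. zopen X V \<and> p \<in> V \<and> res V s \<in> M V)"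

lemma is_sheaf_res: "is_sheaf X M \<Longrightarrow> zopen X U \<Longrightarrow> zopen X V \<Longrightarrow> V \<subseteq> U \<Longrightarrow> s \<in> M U \<Longrightarrow> res V s \<in> M V"
  unfolding is_sheaf_def by blast

lemma is_sheaf_supp: "is_sheaf X M \<Longrightarrow> zopen X U \<Longrightarrow> s \<in> M U \<Longrightarrow> p \<notin> U \<Longrightarrow> s p = 0"
  unfolding is_sheaf_def by blast

lemma is_sheaf_glue:
  assumes M: "is_sheaf X M" and U: "zopen X U" and s: "\<forall>p. p \<notin> U \<longrightarrow> s p = 0"
    "\<forall>p\<in>U. \<exists>V. zopen X V \<and> p \<in> V \<and> V \<subseteq> U \<and> res V s \<in> M V"
  shows "s \<in> M U"
  using M[unfolded is_sheaf_def, THEN spec[of _ U], THEN mp, OF U, THEN conjunct2, THEN conjunct2,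
      THEN spec[of _ s], THEN mp, OF conjI, OF s] .

lemma res_supp: "(\<And>p. p \<notin> U \<Longrightarrow> s p = 0) \<Longrightarrow> res U s = s"
  by (auto simp: res_def)

lemma sheaf_iff:
  assumes M: "is_sheaf X M" and U: "zopen X U"
  shows "s \<in> M U \<longleftrightarrow> (\<forall>p. p \<notin> U \<longrightarrow> s p = 0) \<and> (\<forall>p\<in>U. sect M p s)"
proof (intro iffI conjI)
  assume s: "s \<in> M U"
  show *: "\<forall>p. p \<notin> U \<longrightarrow> s p = 0"
    using is_sheaf_supp[OF M U s] by blast
  then have "res U s = s" by (intro res_supp) auto
  then show "\<forall>p\<in>U. sect M p s"
    using s U unfolding sect_def by metis
next
  assume s: "(\<forall>p. p \<notin> U \<longrightarrow> s p = 0) \<and> (\<forall>p\<in>U. sect M p s)"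
  have "\<exists>V. zopen X V \<and> p \<in> V \<and> V \<subseteq> U \<and> res V s \<in> M V" if p: "p \<in> U" for p
  proof -
    obtain V where V: "zopen X V" "p \<in> V" "res V s \<in> M V"
      using s p unfolding sect_def by blast
    have W: "zopen X (U \<inter> V)" using U V zopen_Int by blast
    have "res (U \<inter> V) (res V s) \<in> M (U \<inter> V)"
      by (rule is_sheaf_res[OF M V(1) W _ V(3)]) auto
    then have "res (U \<inter> V) s \<in> M (U \<inter> V)"
      by (simp add: res_res Int_assoc)
    then show ?thesis using W V p by blast
  qed
  then show "s \<in> M U"
    using s by (intro is_sheaf_glue[OF M U]) auto
qed

lemma sect_cong:
  assumes M: "is_sheaf X M" and p: "p \<in> X" and eq: "eventually (\<lambda>q. s q = s' q) (near p)" and s: "sect M p s"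
  shows "sect M p s'"
proof -
  obtain V where V: "zopen X V" "p \<in> V" "res V s \<in> M V"
    using s unfolding sect_def by blast
  obtain V' where V': "zopen X V'" "p \<in> V'" "\<forall>q\<in>V'. s q = s' q"
    using eq eventually_near[OF p] by blast
  have W: "zopen X (V \<inter> V')" using V V' zopen_Int by blast
  have "res (V \<inter> V') (res V s) \<in> M (V \<inter> V')"
    by (rule is_sheaf_res[OF M V(1) W _ V(3)]) auto
  moreover have "res (V \<inter> V') (res V s) = res (V \<inter> V') s'"
    using V' by (auto simp: res_def fun_eq_iff)
  ultimately show ?thesis
    using W V V' unfolding sect_def by auto
qed

lemma sect_near:
  assumes p: "p \<in> X" and s: "sect M p s" shows "eventually (\<lambda>q. sect M q s) (near p)"
proof -
  obtain V where V: "zopen X V" "p \<in> V" "res V s \<in> M V"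
    using s unfolding sect_def by blast
  then have "\<forall>q\<in>V. sect M q s" unfolding sect_def by blast
  then show ?thesis using V eventually_near[OF p] by blast
qed

lemma sect_of_mem: "is_sheaf X M \<Longrightarrow> zopen X U \<Longrightarrow> s \<in> M U \<Longrightarrow> p \<in> U \<Longrightarrow> sect M p s"
  using sheaf_iff by blast

text \<open>A condition on germs defines a sheaf for free, and its stalks are given by the condition
  as soon as this passes to nearby points. Hecke transforms, the twisting line bundle and duals are
  all treated in this way.\<close>

lemma is_sheaf_of_germs:
  assumes M: "\<And>U. zopen X U \<Longrightarrow> M U = {s. (\<forall>p. p \<notin> U \<longrightarrow> s p = 0) \<and> (\<forall>p\<in>U. S p s)}"
    and cong: "\<And>p s s'. p \<in> X \<Longrightarrow> eventually (\<lambda>q. s q = s' q) (near p) \<Longrightarrow> S p s \<Longrightarrow> S p s'"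
  shows "is_sheaf X M"
    and "p \<in> X \<Longrightarrow> eventually (\<lambda>q. S q s) (near p) \<Longrightarrow> sect M p s"
    and "p \<in> X \<Longrightarrow> sect M p s \<Longrightarrow> S p s"
proof -
  have res_eq: "eventually (\<lambda>q. res V s q = s q) (near p)" if "zopen X V" "p \<in> V" for V p and s :: "'n point \<Rightarrow> 'a"
    using near_open[OF that] by eventually_elim (simp add: res_def)
  have res_eq': "eventually (\<lambda>q. s q = res V s q) (near p)" if "zopen X V" "p \<in> V" for V p and s :: "'n point \<Rightarrow> 'a"
    using near_open[OF that] by eventually_elim (simp add: res_def)
  show "is_sheaf X M"
    unfolding is_sheaf_def
  proof (intro allI impI conjI ballI; (elim conjE)?)
    fix U s p assume "zopen X U" "s \<in> M U" "p \<notin> U"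
    then show "s p = 0" using M by auto
  next
    fix U V s assume U: "zopen X U" "zopen X V" "V \<subseteq> U" "s \<in> M U"
    have "S p (res V s)" if "p \<in> V" for p
      using cong[OF _ res_eq'[OF U(2) that]] that U zopen_subset M[OF U(1)] by blast
    then show "res V s \<in> M V"
      using M[OF U(2)] by (auto simp: res_def)
  next
    fix U s assume U: "zopen X U" and 0: "\<forall>p. p \<notin> U \<longrightarrow> s p = 0"
      and loc: "\<forall>p\<in>U. \<exists>V. zopen X V \<and> p \<in> V \<and> V \<subseteq> U \<and> res V s \<in> M V"
    have "S p s" if p: "p \<in> U" for p
    proof -
      obtain V where V: "zopen X V" "p \<in> V" "res V s \<in> M V" using loc p by blast
      then have "S p (res V s)" using M by blast
      then show ?thesis
        using cong[OF _ res_eq[OF V(1,2)]] p U zopen_subset by blast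
    qed
    then show "s \<in> M U" using M[OF U] 0 by blast
  qed
  show "sect M p s" if p: "p \<in> X" and ev: "eventually (\<lambda>q. S q s) (near p)"
  proof -
    obtain V where V: "zopen X V" "p \<in> V" "\<forall>q\<in>V. S q s"
      using ev eventually_near[OF p] by blast
    have "S q (res V s)" if "q \<in> V" for q
      using cong[OF _ res_eq'[OF V(1) that]] V that zopen_subset by blast
    then have "res V s \<in> M V" using M[OF V(1)] by (auto simp: res_def)
    then show ?thesis using V unfolding sect_def by blast
  qed
  show "S p s" if p: "p \<in> X" and s: "sect M p s"
  proof -
    obtain V where V: "zopen X V" "p \<in> V" "res V s \<in> M V" using s unfolding sect_def by blast
    then have "S p (res V s)" using M by blast
    then show ?thesis
      using cong[OF p res_eq[OF V(1,2)]] by blast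
  qed
qed

text \<open>The columns of \<open>a q\<close> form a local basis of sections. Regularity of
  \<open>a\<close> itself would be meaningless, since the bases of different fibres are unrelated.
  The condition is imposed at all points near \<open>p\<close>, so that a frame at \<open>p\<close>
  is also one nearby.\<close>

definition frame :: "('n, complex ^ 'r::finite) fsheaf \<Rightarrow> 'n point \<Rightarrow> ('n point \<Rightarrow> complex ^ 'r ^ 'r) \<Rightarrow> bool" where
  "frame M p a \<longleftrightarrow> eventually (\<lambda>q. invertible (a q) \<and>
     (\<forall>s. sect M q s \<longleftrightarrow> regv q (\<lambda>q'. matrix_inv (a q') *v s q'))) (near p)"

lemma frame_near: "p \<in> X \<Longrightarrow> frame M p a \<Longrightarrow> eventually (\<lambda>q. frame M q a) (near p)"
  unfolding frame_def by (rule near_near)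

lemma frame_invertible: "frame M p a \<Longrightarrow> eventually (\<lambda>q. invertible (a q)) (near p)"
  unfolding frame_def by (auto elim: eventually_mono)

lemma frame_sect:
  assumes "p \<in> X" "frame M p a"
  shows "sect M p s \<longleftrightarrow> regv p (\<lambda>q. matrix_inv (a q) *v s q)"
  using near_self[OF assms(1) assms(2)[unfolded frame_def]] by blast

lemma frame_sectI:
  assumes p: "p \<in> X" and a: "frame M p a" and f: "regv p f"
  shows "sect M p (\<lambda>q. a q *v f q)"
proof -
  have "eventually (\<lambda>q. f q = matrix_inv (a q) *v (a q *v f q)) (near p)"
    using frame_invertible[OF a] by eventually_elim (simp add: matrix_inv_mult_vec)
  then have "regv p (\<lambda>q. matrix_inv (a q) *v (a q *v f q))"
    using f by (rule regv_cong)
  then show ?thesis using frame_sect[OF p a] by blast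
qed

lemma vector_bundle_frame:
  fixes M :: "('n, complex ^ 'r::finite) fsheaf"
  assumes M: "vector_bundle X M" and p: "p \<in> X"
  shows "\<exists>a. frame M p a"
proof -
  have sh: "is_sheaf X M" using M by (simp add: vector_bundle_def)
  obtain U and g :: "'n point \<Rightarrow> complex ^ 'r ^ 'r" where *: "zopen X U \<and> p \<in> U \<and> (\<forall>q\<in>U. invertible (g q)) \<and>
      (\<forall>V. zopen X V \<and> V \<subseteq> U \<longrightarrow> M V = {res V (\<lambda>q. g q *v f q) | f. \<forall>i. (\<lambda>q. f q $ i) \<in> regular X V})"
    using M[unfolded vector_bundle_def, THEN conjunct2, THEN bspec, OF p] by (elim exE)
  then have U: "zopen X U" "p \<in> U" and inv: "\<forall>q\<in>U. invertible (g q)"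
    by simp_all
  have E: "M V = {res V (\<lambda>q. g q *v f q) | f. \<forall>i. (\<lambda>q. f q $ i) \<in> regular X V}" if "zopen X V" "V \<subseteq> U" for V
    using * that by simp
  have "sect M q s \<longleftrightarrow> regv q (\<lambda>q'. matrix_inv (g q') *v s q')" if q: "q \<in> U" for q s
  proof
    have qX: "q \<in> X" using q U zopen_subset by blast
    assume "sect M q s"
    then obtain V where V: "zopen X V" "q \<in> V" "res V s \<in> M V" unfolding sect_def by blast
    define W where "W = V \<inter> U"
    have W: "zopen X W" "q \<in> W" "W \<subseteq> U" "W \<subseteq> V" using V U q zopen_Int by (auto simp: W_def)
    have "res W (res V s) \<in> M W"
      by (rule is_sheaf_res[OF sh V(1) W(1) W(4) V(3)])
    then obtain f where f: "res W (res V s) = res W (\<lambda>q. g q *v f q)" "\<And>i. (\<lambda>q. f q $ i) \<in> regular X W"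
      using E[OF W(1,3)] by blast
    have rf: "regv q f"
      using f(2) W regular_iff[OF W(1)] unfolding regv_def by blast
    have "f q' = matrix_inv (g q') *v s q'" if "q' \<in> W" for q'
    proof -
      have "s q' = g q' *v f q'"
        using f(1) that W(4) by (auto simp: res_def fun_eq_iff split: if_splits)
      then show ?thesis using inv W(3) that by (simp add: matrix_inv_mult_vec subset_iff)
    qed
    then have "eventually (\<lambda>q'. f q' = matrix_inv (g q') *v s q') (near q)"
      using eventually_near[OF qX] W by blast
    then show "regv q (\<lambda>q'. matrix_inv (g q') *v s q')"
      using rf by (rule regv_cong)
  next
    have qX: "q \<in> X" using q U zopen_subset by blast
    let ?f = "\<lambda>q'. matrix_inv (g q') *v s q'"
    assume "regv q ?f"
    then have "eventually (\<lambda>q'. regv q' ?f) (near q)" by (rule regv_near[OF qX])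
    then obtain V where V: "zopen X V" "q \<in> V" "\<forall>q'\<in>V. regv q' ?f"
      using eventually_near[OF qX] by blast
    define W where "W = V \<inter> U"
    have W: "zopen X W" "q \<in> W" "W \<subseteq> U" "W \<subseteq> V" using V U q zopen_Int by (auto simp: W_def)
    have "(\<lambda>q'. res W ?f q' $ i) \<in> regular X W" for i
    proof -
      have "reg q' (\<lambda>q'. res W ?f q' $ i)" if q': "q' \<in> W" for q'
      proof (rule reg_cong)
        show "eventually (\<lambda>q'. ?f q' $ i = res W ?f q' $ i) (near q')"
          using near_open[OF W(1) q'] by eventually_elim (simp add: res_def)
        show "reg q' (\<lambda>q'. ?f q' $ i)" using V(3) W(4) q' unfolding regv_def by blast
      qed
      then show ?thesis
        unfolding regular_iff[OF W(1)] by (simp add: res_def)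
    qed
    moreover have "res W s = res W (\<lambda>q. g q *v res W ?f q)"
      using inv W(3) by (auto simp: res_def fun_eq_iff matrix_inv_mult_vec subset_iff)
    ultimately have "res W s \<in> M W"
      using E[OF W(1,3)] by blast
    then show "sect M q s" using W unfolding sect_def by blast
  qed
  then have "frame M p g"
    unfolding frame_def eventually_near[OF p] using U inv by blast
  then show ?thesis by blast
qed

lemma vector_bundleI:
  fixes M :: "('n, complex ^ 'r::finite) fsheaf"
  assumes sh: "is_sheaf X M" and fr: "\<And>p. p \<in> X \<Longrightarrow> \<exists>a. frame M p a"
  shows "vector_bundle X M"
  unfolding vector_bundle_def
proof (intro conjI ballI sh)
  fix p assume p: "p \<in> X"
  then obtain a where "frame M p a" using fr by blast
  then obtain U where U: "zopen X U" "p \<in> U" and inv: "\<forall>q\<in>U. invertible (a q)"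
    and s: "\<And>q s. q \<in> U \<Longrightarrow> sect M q s \<longleftrightarrow> regv q (\<lambda>q'. matrix_inv (a q') *v s q')"
    unfolding frame_def eventually_near[OF p] by blast
  have E: "M V = {res V (\<lambda>q. a q *v f q) | f. \<forall>i. (\<lambda>q. f q $ i) \<in> regular X V}" if V: "zopen X V" "V \<subseteq> U" for V
  proof (intro set_eqI iffI)
    fix t assume t: "t \<in> M V"
    let ?f = "\<lambda>q'. matrix_inv (a q') *v t q'"
    have t0: "\<And>q. q \<notin> V \<Longrightarrow> t q = 0" using is_sheaf_supp[OF sh V(1) t] .
    have "(\<lambda>q'. ?f q' $ i) \<in> regular X V" for i
    proof -
      have "regv q ?f" if "q \<in> V" for q
        using s[of q t] sect_of_mem[OF sh V(1) t that] V(2) that by blast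
      then show ?thesis unfolding regular_iff[OF V(1)] regv_def by (simp add: t0)
    qed
    moreover have "t = res V (\<lambda>q. a q *v ?f q)"
      using inv V(2) t0 by (auto simp: res_def fun_eq_iff matrix_inv_mult_vec subset_iff)
    ultimately show "t \<in> {res V (\<lambda>q. a q *v f q) | f. \<forall>i. (\<lambda>q. f q $ i) \<in> regular X V}"
      by (intro CollectI exI[of _ ?f] conjI allI)
  next
    fix t assume "t \<in> {res V (\<lambda>q. a q *v f q) | f. \<forall>i. (\<lambda>q. f q $ i) \<in> regular X V}"
    then obtain f where f: "t = res V (\<lambda>q. a q *v f q)" "\<And>i. (\<lambda>q. f q $ i) \<in> regular X V" by blast
    show "t \<in> M V"
      unfolding sheaf_iff[OF sh V(1)]
    proof (intro conjI ballI)
      show "\<forall>q. q \<notin> V \<longrightarrow> t q = 0" by (simp add: f res_def)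
      fix q assume q: "q \<in> V"
      have "eventually (\<lambda>q'. f q' = matrix_inv (a q') *v t q') (near q)"
        using near_open[OF V(1) q]
        by eventually_elim (use inv V(2) in \<open>auto simp: f(1) res_def matrix_inv_mult_vec subset_iff\<close>)
      moreover have "regv q f" using f(2) q unfolding regular_iff[OF V(1)] regv_def by blast
      ultimately have "regv q (\<lambda>q'. matrix_inv (a q') *v t q')" by (rule regv_cong)
      then show "sect M q t" using s q V(2) by blast
    qed
  qed
  show "\<exists>U (g :: 'n point \<Rightarrow> complex ^ 'r ^ 'r). zopen X U \<and> p \<in> U \<and> (\<forall>q\<in>U. invertible (g q)) \<and> (\<forall>V. zopen X V \<and> V \<subseteq> U \<longrightarrow>
      M V = {res V (\<lambda>q. g q *v f q) | f. \<forall>i. (\<lambda>q. f q $ i) \<in> regular X V})"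
    by (intro exI[of _ U] exI[of _ a] conjI allI impI U inv E) simp_all
qed

lemma matrix_inv_mult:
  assumes "invertible (A :: complex ^ 'r ^ 'r)" "invertible (B :: complex ^ 'r ^ 'r)"
  shows "matrix_inv (A ** B) = matrix_inv B ** matrix_inv A"
proof (rule matrix_inv_eqI(2))
  have "A ** B ** (matrix_inv B ** matrix_inv A) = A ** (B ** matrix_inv B) ** matrix_inv A"
    by (simp only: matrix_mul_assoc)
  then show "A ** B ** (matrix_inv B ** matrix_inv A) = mat 1"
    by (simp add: matrix_inv[OF assms(1)] matrix_inv[OF assms(2)])
qed

lemma invertible_mult_complex: "invertible A \<Longrightarrow> invertible B \<Longrightarrow> invertible (A ** B)"
  for A B :: "complex ^ 'r ^ 'r"
  by (simp add: invertible_det_nz det_mul)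

lemma frame_change:
  assumes p: "p \<in> X" and a: "frame M p a" and k: "regm p k" "invertible (k p)"
    and b: "eventually (\<lambda>q. b q = a q ** k q) (near p)"
  shows "frame M p b"
proof -
  have ev: "eventually (\<lambda>q. (\<forall>s. sect M q s \<longleftrightarrow> regv q (\<lambda>q'. matrix_inv (a q') *v s q')) \<and>
      invertible (a q) \<and> regm q k \<and> invertible (k q) \<and> b q = a q ** k q \<and> q \<in> X) (near p)"
    using a[unfolded frame_def] frame_invertible[OF a] regm_near[OF p k(1)] regm_inverse(1)[OF p k] b near_in_X[OF p]
    by eventually_elim blast
  from near_near[OF p ev] ev show ?thesis
    unfolding frame_def
  proof eventually_elim
    case (elim q)
    then have q: "q \<in> X" by blast
    let ?f = "\<lambda>s q'. matrix_inv (a q') *v s q'" and ?g = "\<lambda>s q'. matrix_inv (b q') *v s q'"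
    have 1: "eventually (\<lambda>q'. matrix_inv (k q') *v ?f s q' = ?g s q') (near q)" for s
      using elim(1) by eventually_elim (simp add: matrix_inv_mult matrix_vector_mul_assoc)
    have 2: "eventually (\<lambda>q'. k q' *v ?g s q' = ?f s q') (near q)" for s
      using elim(1) by eventually_elim (simp add: matrix_inv_mult matrix_inv_mult_vec flip: matrix_vector_mul_assoc)
    have "regv q (?f s) \<longleftrightarrow> regv q (?g s)" for s
    proof
      assume "regv q (?f s)"
      then have "regv q (\<lambda>q'. matrix_inv (k q') *v ?f s q')"
        by (rule regv_mult[rotated]) (use elim(2) regm_inverse(2)[OF q] in blast)
      then show "regv q (?g s)" by (rule regv_cong[OF 1])
    next
      assume "regv q (?g s)"
      then have "regv q (\<lambda>q'. k q' *v ?g s q')"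
        by (rule regv_mult[rotated]) (use elim(2) in blast)
      then show "regv q (?f s)" by (rule regv_cong[OF 2])
    qed
    then show ?case
      using elim(2) by (simp add: invertible_mult_complex)
  qed
qed

text \<open>A frame adapted to the flag: at a marked point its value carries the standard flag to
  the flag of \<open>P\<close>. In such frames parabolic structure becomes a condition on the value
  of a matrix at a single point.\<close>

definition aframe :: "('n, 'r::finite) qpar \<Rightarrow> 'n point \<Rightarrow> ('n point \<Rightarrow> complex ^ 'r ^ 'r) \<Rightarrow> bool" where
  "aframe P p a \<longleftrightarrow> frame (sheaf_of P) p a \<and>
     (p \<in> D \<longrightarrow> (\<forall>i\<in>{1..CARD('r) + 1}. flag P p i = (*v) (a p) ` stdV (CARD('r) + 1 - i)))"

lemma quasi_parabolic_sheaf: "quasi_parabolic X D P \<Longrightarrow> is_sheaf X (sheaf_of P)"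
  by (simp add: quasi_parabolic_def vector_bundle_def)

lemma aframe_exists:
  fixes P :: "('n, 'r::finite) qpar"
  assumes P: "quasi_parabolic X D P" and p: "p \<in> X"
  shows "\<exists>a. aframe P p a"
proof -
  obtain a where a: "frame (sheaf_of P) p a"
    using P p vector_bundle_frame unfolding quasi_parabolic_def by blast
  show ?thesis
  proof (cases "p \<in> D")
    case False
    then show ?thesis using a unfolding aframe_def by blast
  next
    case True
    then have "full_flag (flag P p)" using P by (simp add: quasi_parabolic_def)
    then obtain c :: "complex ^ 'r ^ 'r" where c: "invertible c"
      "\<And>i. i \<in> {1..CARD('r) + 1} \<Longrightarrow> flag P p i = (*v) c ` stdV (CARD('r) + 1 - i)"
      using full_flag_standard by blast
    have ap: "invertible (a p)" using near_self[OF p frame_invertible[OF a]] .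
    \<comment> \<open>A constant change of basis corrects the value at \<open>p\<close> from
      \<open>a p\<close> to \<open>c\<close>.\<close>
    have "frame (sheaf_of P) p (\<lambda>q. a q ** (matrix_inv (a p) ** c))"
      by (rule frame_change[OF p a regm_const[of p "matrix_inv (a p) ** c"]])
        (simp_all add: invertible_mult_complex invertible_matrix_inv ap c)
    moreover have "a p ** (matrix_inv (a p) ** c) = c"
      by (simp add: matrix_mul_assoc matrix_inv[OF ap])
    ultimately have "aframe P p (\<lambda>q. a q ** (matrix_inv (a p) ** c))"
      unfolding aframe_def using c by simp
    then show ?thesis by blast
  qed
qed

lemma full_flag_of_standard:
  fixes c :: "complex ^ 'r::finite ^ 'r"
  assumes c: "invertible c" and F: "\<And>i. i \<in> {1..CARD('r) + 1} \<Longrightarrow> F i = (*v) c ` stdV (CARD('r) + 1 - i)"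
  shows "full_flag F"
proof -
  have inj: "inj ((*v) c)"
    using matrix_inv_mult_vec(1)[OF c] by (metis injI)
  have sub: "vec.subspace (F i)" if "i \<in> {1..CARD('r) + 1}" for i
    unfolding F[OF that] by (intro vec.linear_subspace_image matrix_vector_mul_linear_gen subspace_stdV)
  have "F 1 = UNIV"
    using F[of 1] matrix_inv_mult_vec(2)[OF c] by (simp add: stdV_UNIV) (metis surjI)
  moreover have "F (CARD('r) + 1) = {0}"
    using F[of "CARD('r) + 1"] by (simp add: stdV_0)
  moreover have "F (i + 1) \<subset> F i" if i: "i \<in> {1..CARD('r)}" for i
  proof -
    obtain k :: 'r where k: "ix k = CARD('r) - i"
      using ix_surj[of "CARD('r) - i", where 'r = 'r] i by auto
    have "stdV (CARD('r) - i) \<subset> (stdV (CARD('r) + 1 - i) :: (complex ^ 'r) set)"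
    proof
      show "stdV (CARD('r) - i) \<subseteq> (stdV (CARD('r) + 1 - i) :: (complex ^ 'r) set)"
        by (auto simp: stdV_def)
      have "axis k 1 \<in> (stdV (CARD('r) + 1 - i) :: (complex ^ 'r) set)" "axis k 1 \<notin> (stdV (CARD('r) - i) :: (complex ^ 'r) set)"
        using k i by (auto simp: stdV_def axis_one_nth)
      then show "stdV (CARD('r) - i) \<noteq> (stdV (CARD('r) + 1 - i) :: (complex ^ 'r) set)" by blast
    qed
    then have "(*v) c ` stdV (CARD('r) - i) \<subset> (*v) c ` stdV (CARD('r) + 1 - i)"
      using inj by (simp add: image_strict_mono inj_on_subset)
    then show ?thesis using F[of i] F[of "i + 1"] i by simp
  qed
  ultimately show ?thesis
    using sub by (simp add: full_flag_def)
qed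

lemma quasi_parabolicI:
  assumes sh: "is_sheaf X (sheaf_of P)" and fr: "\<And>p. p \<in> X \<Longrightarrow> \<exists>a. aframe P p a"
  shows "quasi_parabolic X D P"
  unfolding quasi_parabolic_def
proof (intro conjI ballI)
  show "vector_bundle X (sheaf_of P)"
    using fr unfolding aframe_def by (intro vector_bundleI sh) blast
  fix x assume x: "x \<in> D"
  then obtain a where a: "aframe P x a" using fr D_subset by blast
  then have "invertible (a x)"
    using near_self[OF _ frame_invertible] x D_subset unfolding aframe_def by blast
  then show "full_flag (flag P x)"
    using a x by (intro full_flag_of_standard[of "a x"]) (auto simp: aframe_def)
qed

end

section \<open>Hecke transformations\<close>

text \<open>The cyclic shift; its \<open>r\<close>-th power is multiplication by \<open>t\<close>. With a uniformizer for \<open>t\<close>, it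
  carries each lattice of the standard chain to the next one.\<close>

definition nxt :: "'r::finite \<Rightarrow> 'r" where
  "nxt k = (SOME j. ix j = Suc (ix k) mod CARD('r))"

lemma ix_nxt: "ix (nxt (k :: 'r::finite)) = Suc (ix k) mod CARD('r)"
  unfolding nxt_def by (rule someI_ex) (intro ix_surj mod_less_divisor zero_less_card_finite)

lemma ix_nxt_less: "Suc (ix k) < CARD('r) \<Longrightarrow> ix (nxt (k :: 'r::finite)) = Suc (ix k)"
  by (simp add: ix_nxt)

lemma ix_nxt_last: "Suc (ix k) = CARD('r) \<Longrightarrow> ix (nxt (k :: 'r::finite)) = 0"
  by (simp add: ix_nxt)

lemma ix_nxt_cases: "(Suc (ix k) < CARD('r) \<and> ix (nxt k) = Suc (ix k)) \<or> (Suc (ix k) = CARD('r) \<and> ix (nxt k) = 0)"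
  for k :: "'r::finite"
  using ix_less[of k] ix_nxt_less[of k] ix_nxt_last[of k] by linarith

lemma nxt_inj: "nxt (k :: 'r::finite) = nxt l \<longleftrightarrow> k = l"
  using ix_nxt_cases[of k] ix_nxt_cases[of l] ix_inj[of k l] by auto

lemma bij_nxt: "bij (nxt :: 'r::finite \<Rightarrow> 'r)"
  by (metis finite_UNIV_inj_surj finite injI nxt_inj bij_def)

definition cyc :: "complex \<Rightarrow> complex ^ 'r::finite ^ 'r" where
  "cyc t = (\<chi> k j. if j = nxt k then if ix j = 0 then t else 1 else 0)"

lemma cyc_nth: "cyc t $ k $ j = (if j = nxt k then if ix j = 0 then t else 1 else 0)"
  by (simp add: cyc_def)

lemma cyc_mult_vec: "(cyc t *v f) $ k = (if ix (nxt k) = 0 then t else 1) * f $ nxt k"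
proof -
  have "(cyc t *v f) $ k = (\<Sum>j\<in>UNIV. if j = nxt k then (if ix j = 0 then t else 1) * f $ j else 0)"
    unfolding matrix_vector_mult_def by (simp only: vec_lambda_beta cyc_nth, intro sum.cong) auto
  then show ?thesis by (simp only: sum.delta finite UNIV_I if_True)
qed

lemma cyc_mult_nth: "(cyc t ** A) $ k $ j = (if ix (nxt k) = 0 then t else 1) * A $ nxt k $ j"
proof -
  have "(cyc t ** A) $ k $ j = (\<Sum>l\<in>UNIV. if l = nxt k then (if ix l = 0 then t else 1) * A $ l $ j else 0)"
    unfolding matrix_matrix_mult_def by (simp only: vec_lambda_beta cyc_nth, intro sum.cong) auto
  then show ?thesis by (simp only: sum.delta finite UNIV_I if_True)
qed

lemma mult_cyc_nth: "(A ** cyc t) $ k $ nxt j = A $ k $ j * (if ix (nxt j) = 0 then t else 1)"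
proof -
  have "(A ** cyc t) $ k $ nxt j = (\<Sum>l\<in>UNIV. if l = j then A $ k $ l * (if ix (nxt l) = 0 then t else 1) else 0)"
    unfolding matrix_matrix_mult_def by (simp only: vec_lambda_beta cyc_nth nxt_inj, intro sum.cong) auto
  then show ?thesis by (simp only: sum.delta finite UNIV_I if_True)
qed

lemma invertible_cyc: "t \<noteq> 0 \<Longrightarrow> invertible (cyc t :: complex ^ 'r::finite ^ 'r)"
  unfolding invertible_left_inverse matrix_left_invertible_ker
proof (intro allI impI)
  fix v :: "complex ^ 'r" assume t: "t \<noteq> 0" and v: "cyc t *v v = 0"
  have "v $ j = 0" for j
  proof -
    obtain k where "j = nxt k" using bij_nxt by (metis bij_pointE)
    then show ?thesis using cyc_mult_vec[of t v k] t v by (simp split: if_splits)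
  qed
  then show "v = 0" by (simp add: vec_eq_iff)
qed

text \<open>At \<open>t = 0\<close> the shift is nilpotent and moves coordinates one place towards
  the first. The truncated subtraction is right for \<open>m = 0\<close>, where both subspaces are
  0.\<close>

lemma cyc_0_stdV:
  fixes v :: "complex ^ 'r::finite"
  assumes "v \<in> stdV m" shows "cyc 0 *v v \<in> stdV (m - 1)"
proof -
  have "(cyc 0 *v v) $ k = 0" if "m - 1 \<le> ix k" for k
    using ix_nxt_cases[of k] assms that by (auto simp: cyc_mult_vec stdV_def)
  then show ?thesis by (simp add: stdV_def)
qed

context marked
begin

definition unif :: "'n point \<Rightarrow> ('n point \<Rightarrow> complex) \<Rightarrow> bool" where
  "unif x t \<longleftrightarrow> reg x t \<and> t x = 0 \<and> eventually (\<lambda>q. q \<noteq> x \<longrightarrow> t q \<noteq> 0) (near x) \<and>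
    (\<forall>f. reg x f \<and> f x = 0 \<longrightarrow> (\<exists>h. reg x h \<and> eventually (\<lambda>q. f q = t q * h q) (near x)))"

lemma regm_cyc:
  assumes "reg p t" shows "regm p (\<lambda>q. cyc (t q))"
  unfolding regm_def
proof (intro allI)
  fix i j show "reg p (\<lambda>q. cyc (t q) $ i $ j)"
    using assms by (cases "j = nxt i"; cases "ix j = 0") (simp_all add: cyc_nth reg_const)
qed

text \<open>Undoing the shift permutes the coordinates, and only the last coordinate of
  \<open>f\<close> has to be divided by \<open>t\<close>. It vanishes at \<open>x\<close> because
  \<open>m - 1\<close> is less than the rank.\<close>

lemma cyc_divide:
  fixes f :: "'n point \<Rightarrow> complex ^ 'r::finite"
  assumes t: "unif x t" and f: "regv x f" and fx: "f x \<in> stdV (m - 1)" and m: "1 \<le> m" "m \<le> CARD('r)"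
  shows "\<exists>g. regv x g \<and> g x \<in> stdV m \<and> eventually (\<lambda>q. f q = cyc (t q) *v g q) (near x)"
proof -
  obtain l :: 'r where l: "ix l = CARD('r) - 1"
    using ix_surj[of "CARD('r) - 1", where 'r = 'r] by auto
  then have "f x $ l = 0" using fx m by (auto simp: stdV_def)
  then obtain h where h: "reg x h" "eventually (\<lambda>q. f q $ l = t q * h q) (near x)"
    using t f unfolding unif_def regv_def by blast
  define prv where "prv = inv (nxt :: 'r \<Rightarrow> 'r)"
  have prv: "prv (nxt k) = k" for k by (simp add: prv_def inv_f_f[OF bij_is_inj[OF bij_nxt]])
  define g where "g q = (\<chi> j. if ix j = 0 then h q else f q $ prv j)" for q
  have "reg x (\<lambda>q. g q $ j)" for j
    using h(1) f by (cases "ix j = 0") (simp_all add: g_def regv_def)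
  then have "regv x g"
    by (simp add: regv_def)
  moreover have "g x \<in> stdV m"
  proof -
    have "g x $ j = 0" if j: "m \<le> ix j" for j
    proof -
      obtain k where k: "j = nxt k" using bij_nxt by (metis bij_pointE)
      have "ix j = Suc (ix k)" using ix_nxt_cases[of k] k j m by auto
      then show ?thesis using fx j by (simp add: g_def k prv stdV_def)
    qed
    then show ?thesis by (simp add: stdV_def)
  qed
  moreover have "eventually (\<lambda>q. f q = cyc (t q) *v g q) (near x)"
    using h(2)
  proof eventually_elim
    case (elim q)
    have "f q $ k = (cyc (t q) *v g q) $ k" for k
    proof (cases "ix (nxt k) = 0")
      case True
      then have "k = l" using ix_nxt_cases[of k] l ix_inj[of k l] by auto
      then show ?thesis using True elim by (simp add: cyc_mult_vec g_def)
    next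
      case False
      then show ?thesis by (simp add: cyc_mult_vec g_def prv)
    qed
    then show ?case by (simp add: vec_eq_iff)
  qed
  ultimately show ?thesis by blast
qed

lemma near_not_point:
  assumes "p \<in> X" "p \<noteq> x" shows "eventually (\<lambda>q. q \<noteq> x) (near p)"
proof -
  have "zopen X (X - {x})" by (rule zopen_Diff_finite[OF _ zopen_X]) simp
  moreover have "p \<in> X - {x}" using assms by simp
  ultimately have "eventually (\<lambda>q. q \<in> X - {x}) (near p)" by (rule near_open)
  then show ?thesis by eventually_elim simp
qed

lemma mem_image_matrix:
  assumes "invertible (A :: complex ^ 'b ^ 'b)"
  shows "v \<in> (*v) A ` S \<longleftrightarrow> matrix_inv A *v v \<in> S"
proof
  show "matrix_inv A *v v \<in> S" if "v \<in> (*v) A ` S"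
    using that by (auto simp: matrix_inv_mult_vec[OF assms])
  show "v \<in> (*v) A ` S" if "matrix_inv A *v v \<in> S"
    using imageI[OF that, of "(*v) A"] by (simp add: matrix_inv_mult_vec[OF assms])
qed

context
  fixes P :: "('n, 'r::finite) qpar" and x a t
  assumes P: "quasi_parabolic X D P" and x: "x \<in> D" and a: "aframe P x a" and t: "unif x t"
begin

text \<open>\<open>a q ** cyc (t q)\<close> is a basis of the Hecke subsheaf, but its value at
  \<open>x\<close> is singular in the fibre of the old bundle. The new bundle has a fibre of its own
  at \<open>x\<close>, and coordinates there are chosen such that the frame takes the value
  \<open>a x\<close>.\<close>

definition hecke_frame :: "'n point \<Rightarrow> complex ^ 'r ^ 'r" where
  "hecke_frame q = (if q = x then a x else a q ** cyc (t q))"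

definition hecke_germ :: "'n point \<Rightarrow> ('n point \<Rightarrow> complex ^ 'r) \<Rightarrow> bool" where
  "hecke_germ p s \<longleftrightarrow> (if p = x then regv x (\<lambda>q. matrix_inv (hecke_frame q) *v s q) else sect (sheaf_of P) p s)"

text \<open>With this choice of coordinates the flag at \<open>x\<close> is given by the same
  formula as the old one, although it lives in a different fibre.\<close>

definition hecke_qpar :: "('n, 'r) qpar" where
  "hecke_qpar = \<lparr>sheaf_of = (\<lambda>U. {s. (\<forall>p. p \<notin> U \<longrightarrow> s p = 0) \<and> (\<forall>p\<in>U. hecke_germ p s)}),
    flag = (\<lambda>y i. if y = x then (*v) (a x) ` stdV (CARD('r) + 1 - i) else flag P y i)\<rparr>"

lemma xX: "x \<in> X"
  using x D_subset by blast

lemma reg_t: "reg x t" "t x = 0" and t_nonzero: "eventually (\<lambda>q. q \<noteq> x \<longrightarrow> t q \<noteq> 0) (near x)"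
  using t by (auto simp: unif_def)

lemma a_frame: "frame (sheaf_of P) x a"
  using a by (simp add: aframe_def)

lemma sheaf_P: "is_sheaf X (sheaf_of P)"
  using P by (rule quasi_parabolic_sheaf)

lemma hecke_frame_near:
  "eventually (\<lambda>q. invertible (hecke_frame q) \<and> (q \<noteq> x \<longrightarrow> frame (sheaf_of P) q hecke_frame)) (near x)"
  using frame_near[OF xX a_frame] frame_invertible[OF a_frame] t_nonzero reg_near[OF xX reg_t(1)] near_in_X[OF xX]
proof eventually_elim
  case (elim q)
  have "frame (sheaf_of P) q hecke_frame" if q: "q \<noteq> x"
  proof (rule frame_change[OF elim(5,1)])
    show "regm q (\<lambda>q. cyc (t q))" using elim by (intro regm_cyc)
    show "invertible (cyc (t q))" using elim q by (intro invertible_cyc) simp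
    show "eventually (\<lambda>q. hecke_frame q = a q ** cyc (t q)) (near q)"
      using near_not_point[OF elim(5) q] by eventually_elim (simp add: hecke_frame_def)
  qed
  moreover have "invertible (hecke_frame q)"
    using elim by (cases "q = x") (simp_all add: hecke_frame_def invertible_mult_complex invertible_cyc)
  ultimately show ?case by simp
qed

lemma hecke_germ_cong:
  assumes "p \<in> X" "eventually (\<lambda>q. s q = s' q) (near p)" "hecke_germ p s"
  shows "hecke_germ p s'"
proof (cases "p = x")
  case True
  have "eventually (\<lambda>q. matrix_inv (hecke_frame q) *v s q = matrix_inv (hecke_frame q) *v s' q) (near x)"
    using assms(2) unfolding True by eventually_elim simp
  then show ?thesis
    using assms(3) True regv_cong by (simp add: hecke_germ_def)
next
  case False
  then show ?thesis using assms sect_cong[OF sheaf_P] by (simp add: hecke_germ_def)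
qed

lemma hecke_germ_near:
  assumes "p \<in> X" "hecke_germ p s" shows "eventually (\<lambda>q. hecke_germ q s) (near p)"
proof (cases "p = x")
  case True
  then have "regv x (\<lambda>q. matrix_inv (hecke_frame q) *v s q)"
    using assms by (simp add: hecke_germ_def)
  from regv_near[OF xX this] hecke_frame_near near_in_X[OF xX] show ?thesis
    unfolding True
  proof eventually_elim
    case (elim q)
    then show ?case
      using frame_sect[of q "sheaf_of P" hecke_frame s] by (auto simp: hecke_germ_def)
  qed
next
  case False
  then have "sect (sheaf_of P) p s" using assms by (simp add: hecke_germ_def)
  from sect_near[OF assms(1) this] near_not_point[OF assms(1) False] show ?thesis
    by eventually_elim (simp add: hecke_germ_def)
qed

lemma hecke_sheaf_eq:
  "zopen X U \<Longrightarrow> sheaf_of hecke_qpar U = {s. (\<forall>p. p \<notin> U \<longrightarrow> s p = 0) \<and> (\<forall>p\<in>U. hecke_germ p s)}"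
  by (simp add: hecke_qpar_def)

lemma is_sheaf_hecke: "is_sheaf X (sheaf_of hecke_qpar)"
  using hecke_sheaf_eq hecke_germ_cong by (rule is_sheaf_of_germs(1))

lemma sect_hecke:
  assumes p: "p \<in> X" shows "sect (sheaf_of hecke_qpar) p s \<longleftrightarrow> hecke_germ p s"
proof
  show "hecke_germ p s" if "sect (sheaf_of hecke_qpar) p s"
    using hecke_sheaf_eq hecke_germ_cong p that by (rule is_sheaf_of_germs(3))
  show "sect (sheaf_of hecke_qpar) p s" if "hecke_germ p s"
    using hecke_sheaf_eq hecke_germ_cong p hecke_germ_near[OF p that] by (rule is_sheaf_of_germs(2))
qed

lemma aframe_hecke_point: "aframe hecke_qpar x hecke_frame"
proof -
  have "frame (sheaf_of hecke_qpar) x hecke_frame"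
    unfolding frame_def using hecke_frame_near near_in_X[OF xX]
  proof eventually_elim
    case (elim q)
    then show ?case
      using frame_sect[of q "sheaf_of P" hecke_frame] sect_hecke[of q]
      by (cases "q = x") (auto simp: hecke_germ_def)
  qed
  then show ?thesis
    by (simp add: aframe_def hecke_qpar_def hecke_frame_def)
qed

lemma aframe_hecke_other:
  assumes p: "p \<in> X" "p \<noteq> x" and b: "aframe P p b"
  shows "aframe hecke_qpar p b"
proof -
  have "frame (sheaf_of P) p b" using b by (simp add: aframe_def)
  then have "frame (sheaf_of hecke_qpar) p b"
    using near_not_point[OF p] near_in_X[OF p(1)] unfolding frame_def
    by eventually_elim (simp add: sect_hecke hecke_germ_def)
  then show ?thesis
    using b p by (simp add: aframe_def hecke_qpar_def)
qed

lemma quasi_parabolic_hecke: "quasi_parabolic X D hecke_qpar"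
proof (rule quasi_parabolicI[OF is_sheaf_hecke])
  fix p assume p: "p \<in> X"
  show "\<exists>a. aframe hecke_qpar p a"
  proof (cases "p = x")
    case True
    then show ?thesis using aframe_hecke_point by blast
  next
    case False
    then show ?thesis using aframe_hecke_other[OF p] aframe_exists[OF P p] by blast
  qed
qed

definition hecke_matrix :: "complex ^ 'r ^ 'r" where
  "hecke_matrix = a x ** cyc 0 ** matrix_inv (a x)"

text \<open>The inclusion of the Hecke subsheaf into the old bundle. At \<open>x\<close> it is a
  singular map between two different fibres, given in frames by \<open>cyc 0\<close>.\<close>

definition hecke_map :: "('n point \<Rightarrow> complex ^ 'r) \<Rightarrow> 'n point \<Rightarrow> complex ^ 'r" where
  "hecke_map s = (\<lambda>q. if q = x then hecke_matrix *v s x else s q)"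

lemma inv_ax: "invertible (a x)"
  using near_self[OF xX frame_invertible[OF a_frame]] .

lemma hecke_frame_x: "hecke_frame x = a x"
  by (simp add: hecke_frame_def)

lemma hecke_map_frame:
  "eventually (\<lambda>q. matrix_inv (a q) *v hecke_map s q = cyc (t q) *v (matrix_inv (hecke_frame q) *v s q)) (near x)"
  using frame_invertible[OF a_frame] t_nonzero
proof eventually_elim
  case (elim q)
  show ?case
  proof (cases "q = x")
    case True
    then show ?thesis
      using matrix_inv_mult_vec(1)[OF inv_ax]
      by (simp add: hecke_map_def hecke_matrix_def hecke_frame_x reg_t(2) flip: matrix_vector_mul_assoc)
  next
    case False
    then have "invertible (cyc (t q) :: complex ^ 'r ^ 'r)" using elim invertible_cyc by blast
    then show ?thesis
      using False elim(1)
      by (simp add: hecke_map_def hecke_frame_def matrix_inv_mult matrix_inv_mult_vec flip: matrix_vector_mul_assoc)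
  qed
qed

lemma flag_P_x: "i \<in> {1..CARD('r) + 1} \<Longrightarrow> flag P x i = (*v) (a x) ` stdV (CARD('r) + 1 - i)"
  using a x by (simp add: aframe_def)

lemma mem_flag_P_x: "i \<in> {1..CARD('r) + 1} \<Longrightarrow> v \<in> flag P x i \<longleftrightarrow> matrix_inv (a x) *v v \<in> stdV (CARD('r) + 1 - i)"
  by (simp only: flag_P_x mem_image_matrix[OF inv_ax])

lemma mem_flag_hecke_x: "v \<in> flag hecke_qpar x i \<longleftrightarrow> matrix_inv (a x) *v v \<in> stdV (CARD('r) + 1 - i)"
  by (simp add: hecke_qpar_def mem_image_matrix[OF inv_ax])

text \<open>In frames this says that the shift carries each lattice of the standard chain onto the
  next: one inclusion is \<open>cyc_0_stdV\<close>, the other \<open>cyc_divide\<close>.\<close>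

lemma hecke_map_image:
  assumes U: "zopen X U" and i: "i \<in> {1..CARD('r)}"
  shows "hecke_map ` flag_kernel hecke_qpar x i U = flag_kernel P x (i + 1) U"
proof (intro set_eqI iffI)
  have m: "CARD('r) + 1 - (i + 1) = (CARD('r) + 1 - i) - 1" by simp
  {
    fix s assume "s \<in> hecke_map ` flag_kernel hecke_qpar x i U"
    then obtain s' where s: "s = hecke_map s'" and s': "s' \<in> sheaf_of hecke_qpar U" "x \<in> U \<Longrightarrow> s' x \<in> flag hecke_qpar x i"
      by (auto simp: flag_kernel_def)
    have germ: "hecke_germ p s'" if "p \<in> U" for p
      using s'(1) that by (simp add: hecke_sheaf_eq[OF U])
    have supp: "s' p = 0" if "p \<notin> U" for p
      using s'(1) that by (simp add: hecke_sheaf_eq[OF U])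
    have "sect (sheaf_of P) p s" if p: "p \<in> U" for p
    proof (cases "p = x")
      case True
      then have "regv x (\<lambda>q. matrix_inv (hecke_frame q) *v s' q)"
        using germ[OF p] by (simp add: hecke_germ_def)
      then have "regv x (\<lambda>q. cyc (t q) *v (matrix_inv (hecke_frame q) *v s' q))"
        by (rule regv_mult[OF regm_cyc[OF reg_t(1)]])
      then have "regv x (\<lambda>q. matrix_inv (a q) *v s q)"
        unfolding s by (rule regv_cong[rotated]) (use hecke_map_frame[of s'] in \<open>auto elim: eventually_mono\<close>)
      then show ?thesis using frame_sect[OF xX a_frame] True by blast
    next
      case False
      have pX: "p \<in> X" using p U zopen_subset by blast
      have "sect (sheaf_of P) p s'" using germ[OF p] False by (simp add: hecke_germ_def)
      moreover have "eventually (\<lambda>q. s' q = s q) (near p)"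
        using near_not_point[OF pX False] by eventually_elim (simp add: s hecke_map_def)
      ultimately show ?thesis using sect_cong[OF sheaf_P pX] by blast
    qed
    moreover have "s p = 0" if "p \<notin> U" for p
      using supp[OF that] by (cases "p = x") (simp_all add: s hecke_map_def)
    moreover have "s x \<in> flag P x (i + 1)" if "x \<in> U"
    proof -
      have "matrix_inv (a x) *v s' x \<in> stdV (CARD('r) + 1 - i)"
        using s'(2)[OF that] by (simp only: mem_flag_hecke_x)
      from cyc_0_stdV[OF this] have "matrix_inv (a x) *v s x \<in> stdV (CARD('r) + 1 - i - 1)"
        using near_self[OF xX hecke_map_frame[of s']] by (simp add: s reg_t(2) hecke_frame_x)
      then show ?thesis using i by (subst mem_flag_P_x) auto
    qed
    ultimately show "s \<in> flag_kernel P x (i + 1) U"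
      using sheaf_iff[OF sheaf_P U] by (simp add: flag_kernel_def)
  }
  fix s assume "s \<in> flag_kernel P x (i + 1) U"
  then have s: "s \<in> sheaf_of P U" "x \<in> U \<Longrightarrow> s x \<in> flag P x (i + 1)"
    by (auto simp: flag_kernel_def)
  show "s \<in> hecke_map ` flag_kernel hecke_qpar x i U"
  proof (cases "x \<in> U")
    case False
    then have "hecke_germ p s" if "p \<in> U" for p
      using that s(1) sheaf_iff[OF sheaf_P U] by (auto simp: hecke_germ_def)
    moreover have supp: "s p = 0" if "p \<notin> U" for p
      using that s(1) sheaf_iff[OF sheaf_P U] by auto
    ultimately have "s \<in> flag_kernel hecke_qpar x i U"
      using False by (simp add: flag_kernel_def hecke_sheaf_eq[OF U])
    moreover have "hecke_map s = s"
      using supp False by (auto simp: hecke_map_def)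
    ultimately show ?thesis by (metis image_eqI)
  next
    case True
    have 1: "regv x (\<lambda>q. matrix_inv (a q) *v s q)"
      using s(1) sheaf_iff[OF sheaf_P U] True frame_sect[OF xX a_frame] by blast
    have "matrix_inv (a x) *v s x \<in> stdV (CARD('r) + 1 - (i + 1))"
      using s(2)[OF True] i by (subst (asm) mem_flag_P_x) auto
    moreover have "1 \<le> CARD('r) + 1 - i" "CARD('r) + 1 - i \<le> CARD('r)"
      using i unfolding atLeastAtMost_iff by linarith+
    ultimately obtain g where g: "regv x g" "g x \<in> stdV (CARD('r) + 1 - i)"
      "eventually (\<lambda>q. matrix_inv (a q) *v s q = cyc (t q) *v g q) (near x)"
      using cyc_divide[OF t 1, of "CARD('r) + 1 - i"] unfolding m by blast
    \<comment> \<open>Only the value at \<open>x\<close> has to be supplied: the coordinate vector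
      \<open>g x\<close> found by division, read in the fibre of the new bundle.\<close>
    define s' where "s' q = (if q = x then a x *v g x else s q)" for q
    have ev: "eventually (\<lambda>q. g q = matrix_inv (hecke_frame q) *v s' q) (near x)"
      using g(3) frame_invertible[OF a_frame] t_nonzero
    proof eventually_elim
      case (elim q)
      show ?case
      proof (cases "q = x")
        case True
        then show ?thesis by (simp add: s'_def hecke_frame_x matrix_inv_mult_vec(1)[OF inv_ax])
      next
        case False
        then have c: "invertible (cyc (t q) :: complex ^ 'r ^ 'r)" using elim invertible_cyc by blast
        have "matrix_inv (hecke_frame q) *v s' q = matrix_inv (cyc (t q)) *v (matrix_inv (a q) *v s q)"
          using False elim(2) c by (simp add: s'_def hecke_frame_def matrix_inv_mult matrix_vector_mul_assoc)
        also have "\<dots> = g q"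
          unfolding elim(1) by (rule matrix_inv_mult_vec(1)[OF c])
        finally show ?thesis by simp
      qed
    qed
    have germ: "hecke_germ p s'" if p: "p \<in> U" for p
    proof (cases "p = x")
      case True
      then show ?thesis using regv_cong[OF ev g(1)] by (simp add: hecke_germ_def)
    next
      case False
      have pX: "p \<in> X" using p U zopen_subset by blast
      have "sect (sheaf_of P) p s" using s(1) p sheaf_iff[OF sheaf_P U] by blast
      moreover have "eventually (\<lambda>q. s q = s' q) (near p)"
        using near_not_point[OF pX False] by eventually_elim (simp add: s'_def)
      ultimately have "sect (sheaf_of P) p s'" using sect_cong[OF sheaf_P pX] by blast
      then show ?thesis using False by (simp add: hecke_germ_def)
    qed
    have supp: "s' p = 0" if "p \<notin> U" for p
      using that True s(1) sheaf_iff[OF sheaf_P U] by (auto simp: s'_def)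
    have "s' x \<in> flag hecke_qpar x i"
      using g(2) by (simp add: mem_flag_hecke_x s'_def matrix_inv_mult_vec(1)[OF inv_ax])
    then have "s' \<in> flag_kernel hecke_qpar x i U"
      using germ supp by (simp add: flag_kernel_def hecke_sheaf_eq[OF U])
    moreover have "hecke_map s' = s"
    proof
      fix q show "hecke_map s' q = s q"
      proof (cases "q = x")
        case True
        have "matrix_inv (a x) *v s x = cyc 0 *v g x"
          using near_self[OF xX g(3)] reg_t(2) by simp
        then have "s x = a x *v (cyc 0 *v g x)"
          using matrix_inv_mult_vec(2)[OF inv_ax] by metis
        then show ?thesis
          using True matrix_inv_mult_vec(1)[OF inv_ax]
          by (simp add: hecke_map_def s'_def hecke_matrix_def flip: matrix_vector_mul_assoc)
      qed (simp add: hecke_map_def s'_def)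
    qed
    ultimately show ?thesis by (metis image_eqI)
  qed
qed

text \<open>The singular value at \<open>x\<close> does no harm: two sections which agree off
  \<open>x\<close> have regular coordinates, and these agree at \<open>x\<close> by density.\<close>

lemma hecke_map_inj:
  assumes U: "zopen X U"
  shows "inj_on hecke_map (sheaf_of hecke_qpar U)"
proof (rule inj_onI)
  fix s s' assume s: "s \<in> sheaf_of hecke_qpar U" "s' \<in> sheaf_of hecke_qpar U" "hecke_map s = hecke_map s'"
  have eq: "s q = s' q" if "q \<noteq> x" for q
    using fun_cong[OF s(3), of q] that by (simp add: hecke_map_def)
  have "s x = s' x"
  proof (cases "x \<in> U")
    case False
    then show ?thesis using s by (simp add: hecke_sheaf_eq[OF U])
  next
    case True
    let ?f = "\<lambda>s q. matrix_inv (hecke_frame q) *v s q"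
    have "hecke_germ x s" "hecke_germ x s'"
      using s True by (simp_all add: hecke_sheaf_eq[OF U])
    then have "regv x (?f s)" "regv x (?f s')" by (simp_all add: hecke_germ_def)
    then have "eventually (\<lambda>q. ?f s q = ?f s' q) (near x)"
      by (rule regv_zero_off_finite[OF xX, of "{x}", rotated]) (simp_all add: eq)
    from near_self[OF xX this] have "matrix_inv (a x) *v s x = matrix_inv (a x) *v s' x"
      by (simp only: hecke_frame_x)
    then show ?thesis using matrix_inv_mult_vec(2)[OF inv_ax] by metis
  qed
  then show "s = s'" using eq by (metis ext)
qed

lemma hecke_transform_hecke_qpar: "hecke_transform X D x P hecke_qpar"
  unfolding hecke_transform_def
proof (intro conjI quasi_parabolic_hecke exI[of _ "\<lambda>U. hecke_map"])
  have full: "flag_kernel hecke_qpar x 1 U = sheaf_of hecke_qpar U" for U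
    unfolding flag_kernel_def mem_flag_hecke_x by (simp add: stdV_UNIV)
  have im: "hecke_map ` sheaf_of hecke_qpar U = flag_kernel P x 2 U" if "zopen X U" for U
  proof -
    have "1 \<in> {1..CARD('r)}" by simp
    from hecke_map_image[OF that this] show ?thesis unfolding full by (simp add: numeral_2_eq_2)
  qed
  show "sheaf_iso X (*s) (*s) (sheaf_of hecke_qpar) (flag_kernel P x 2) (\<lambda>U. hecke_map)"
    unfolding sheaf_iso_def
  proof (intro allI impI conjI ballI; (elim conjE)?)
    fix U assume U: "zopen X U"
    show "bij_betw hecke_map (sheaf_of hecke_qpar U) (flag_kernel P x 2 U)"
      using hecke_map_inj[OF U] im[OF U] by (simp add: bij_betw_def)
    show "hecke_map (\<lambda>p. s p + s' p) = (\<lambda>p. hecke_map s p + hecke_map s' p)" for s s'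
      by (auto simp: hecke_map_def matrix_vector_right_distrib)
    show "hecke_map (\<lambda>p. f p *s s p) = (\<lambda>p. f p *s hecke_map s p)" for f s
      by (auto simp: hecke_map_def vector_scalar_commute)
    show "hecke_map (res V s) = res V (hecke_map s)" for V s
      by (auto simp: hecke_map_def res_def)
  qed
  show "\<forall>U. zopen X U \<longrightarrow> (\<forall>i\<in>{1..CARD('r)}. hecke_map ` flag_kernel hecke_qpar x i U = flag_kernel P x (i + 1) U) \<and>
      (\<forall>y\<in>D - {x}. \<forall>i\<in>{1..CARD('r) + 1}.
        hecke_map ` flag_kernel hecke_qpar y i U = flag_kernel P x 2 U \<inter> flag_kernel P y i U)"
  proof (intro allI impI conjI ballI)
    fix U assume U: "zopen X U"
    show "hecke_map ` flag_kernel hecke_qpar x i U = flag_kernel P x (i + 1) U" if "i \<in> {1..CARD('r)}" for i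
      using hecke_map_image[OF U that] .
    fix y i assume y: "y \<in> D - {x}"
    have "flag hecke_qpar y i = flag P y i" "hecke_map s y = s y" for s
      using y by (simp_all add: hecke_qpar_def hecke_map_def)
    then have 1: "flag_kernel hecke_qpar y i U = {s \<in> sheaf_of hecke_qpar U. y \<in> U \<longrightarrow> hecke_map s y \<in> flag P y i}"
      by (simp add: flag_kernel_def)
    have "flag_kernel P x 2 U \<inter> flag_kernel P y i U = {s \<in> flag_kernel P x 2 U. y \<in> U \<longrightarrow> s y \<in> flag P y i}"
      by (auto simp: flag_kernel_def)
    then have 2: "flag_kernel P x 2 U \<inter> flag_kernel P y i U =
        {s \<in> hecke_map ` sheaf_of hecke_qpar U. y \<in> U \<longrightarrow> s y \<in> flag P y i}"
      by (simp only: im[OF U])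
    show "hecke_map ` flag_kernel hecke_qpar y i U = flag_kernel P x 2 U \<inter> flag_kernel P y i U"
      unfolding 1 2 by blast
  qed
qed

text \<open>The form in which Hecke transformations are used: at \<open>x\<close> the adapted frame
  \<open>a\<close> is traded for \<open>a\<close> times the shift, and adapted frames elsewhere stay
  as they are.\<close>

lemma hecke_step:
  "\<exists>Q. hecke_transform X D x P Q \<and> quasi_parabolic X D Q \<and>
    aframe Q x (\<lambda>q. if q = x then a x else a q ** cyc (t q)) \<and>
    (\<forall>p\<in>X - {x}. \<forall>b. aframe P p b \<longrightarrow> aframe Q p b)"
  using hecke_transform_hecke_qpar quasi_parabolic_hecke aframe_hecke_point aframe_hecke_other
  unfolding hecke_frame_def[abs_def] by blast

end

end

section \<open>Twisting by a line bundle\<close>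

context marked
begin

lemma frame_sect_add:
  assumes "p \<in> X" "frame M p a" "sect M p s" "sect M p s'"
  shows "sect M p (\<lambda>q. s q + s' q)"
  using assms(3,4) regv_add unfolding frame_sect[OF assms(1,2)] matrix_vector_right_distrib by blast

lemma frame_sect_zero: "p \<in> X \<Longrightarrow> frame M p a \<Longrightarrow> sect M p (\<lambda>_. 0)"
  unfolding frame_sect by (simp add: regv_const)

lemma frame_sect_sum:
  assumes "p \<in> X" "frame M p a" "\<And>j. j \<in> J \<Longrightarrow> sect M p (s j)"
  shows "sect M p (\<lambda>q. \<Sum>j\<in>J. s j q)"
  using assms(3)
proof (induction J rule: infinite_finite_induct)
  case (insert j J)
  then show ?case using frame_sect_add[OF assms(1,2)] by simp
qed (simp_all add: frame_sect_zero[OF assms(1,2)])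

context
  fixes P Q :: "('n, 'r::finite) qpar" and g :: "'n point \<Rightarrow> complex ^ 'r ^ 'r"
  assumes P: "quasi_parabolic X D P" and Q: "quasi_parabolic X D Q"
    and match: "\<And>p. p \<in> X \<Longrightarrow> \<exists>a b c. aframe P p a \<and> aframe Q p b \<and>
      eventually (\<lambda>q. c q \<noteq> 0 \<and> mscale (c q) (g q) ** a q = b q) (near p)"
begin

text \<open>The family \<open>g\<close> is known only up to scalars varying arbitrarily with the
  point. The functions \<open>l\<close> for which \<open>l\<close> times \<open>g\<close> maps
  sections of \<open>P\<close> to sections of \<open>Q\<close> form a line bundle with local
  generator \<open>c\<close>, and this is the bundle to twist by.\<close>

definition hom_germ :: "'n point \<Rightarrow> ('n point \<Rightarrow> complex ^ 1) \<Rightarrow> bool" where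
  "hom_germ p l \<longleftrightarrow> (\<forall>s. sect (sheaf_of P) p s \<longrightarrow> sect (sheaf_of Q) p (\<lambda>q. l q $ 1 *s (g q *v s q)))"

definition hom_line :: "('n, complex ^ 1) fsheaf" where
  "hom_line U = {l. (\<forall>p. p \<notin> U \<longrightarrow> l p = 0) \<and> (\<forall>p\<in>U. hom_germ p l)}"

lemma sheaves: "is_sheaf X (sheaf_of P)" "is_sheaf X (sheaf_of Q)"
  using P Q quasi_parabolic_sheaf by auto

lemma hom_germ_cong:
  assumes p: "p \<in> X" and "eventually (\<lambda>q. l q = l' q) (near p)" "hom_germ p l"
  shows "hom_germ p l'"
  unfolding hom_germ_def
proof (intro allI impI)
  fix s assume "sect (sheaf_of P) p s"
  then have "sect (sheaf_of Q) p (\<lambda>q. l q $ 1 *s (g q *v s q))"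
    using assms(3) by (simp add: hom_germ_def)
  moreover have "eventually (\<lambda>q. l q $ 1 *s (g q *v s q) = l' q $ 1 *s (g q *v s q)) (near p)"
    using assms(2) by eventually_elim simp
  ultimately show "sect (sheaf_of Q) p (\<lambda>q. l' q $ 1 *s (g q *v s q))"
    by (rule sect_cong[OF sheaves(2) p, rotated])
qed

text \<open>In the frames \<open>a\<close> and \<open>b\<close> the map \<open>l\<close> times
  \<open>g\<close> is the scalar matrix with entry \<open>l / c\<close>, so one basis vector
  suffices to test it.\<close>

lemma hom_germ_iff:
  assumes p: "p \<in> X" and a: "frame (sheaf_of P) p a" and b: "frame (sheaf_of Q) p b"
    and c: "eventually (\<lambda>q. c q \<noteq> 0 \<and> mscale (c q) (g q) ** a q = b q) (near p)"
  shows "hom_germ p l \<longleftrightarrow> reg p (\<lambda>q. l q $ 1 / c q)"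
proof
  assume l: "hom_germ p l"
  fix i :: 'r
  have "sect (sheaf_of P) p (\<lambda>q. a q *v axis i 1)"
    by (rule frame_sectI[OF p a regv_const])
  then have "sect (sheaf_of Q) p (\<lambda>q. l q $ 1 *s (g q *v (a q *v axis i 1)))"
    using l by (simp add: hom_germ_def)
  then have 1: "regv p (\<lambda>q. matrix_inv (b q) *v (l q $ 1 *s (g q *v (a q *v axis i 1))))"
    by (rule iffD1[OF frame_sect[OF p b]])
  have "eventually (\<lambda>q. (matrix_inv (b q) *v (l q $ 1 *s (g q *v (a q *v axis i 1)))) $ i = l q $ 1 / c q) (near p)"
    using c frame_invertible[OF b]
  proof eventually_elim
    case (elim q)
    have "b q *v axis i 1 = c q *s (g q *v (a q *v axis i 1))"
      using elim(1) by (metis matrix_vector_mul_assoc mscale_mult_vec)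
    then have "l q $ 1 *s (g q *v (a q *v axis i 1)) = b q *v ((l q $ 1 / c q) *s axis i 1)"
      using elim(1) by (simp add: vector_scalar_commute vec.scale_scale)
    then show ?case
      using matrix_inv_mult_vec(1)[OF elim(2)] by (simp add: axis_one_nth)
  qed
  then show "reg p (\<lambda>q. l q $ 1 / c q)"
    using regv_entry[OF 1, of i] by (rule reg_cong)
next
  assume l: "reg p (\<lambda>q. l q $ 1 / c q)"
  show "hom_germ p l"
    unfolding hom_germ_def
  proof (intro allI impI)
    fix s assume "sect (sheaf_of P) p s"
    then have "regv p (\<lambda>q. (l q $ 1 / c q) *s (matrix_inv (a q) *v s q))"
      by (intro regv_scale[OF l] iffD1[OF frame_sect[OF p a]])
    moreover have "eventually (\<lambda>q. (l q $ 1 / c q) *s (matrix_inv (a q) *v s q) =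
        matrix_inv (b q) *v (l q $ 1 *s (g q *v s q))) (near p)"
      using c frame_invertible[OF b] frame_invertible[OF a]
    proof eventually_elim
      case (elim q)
      let ?f = "matrix_inv (a q) *v s q"
      have "b q *v ?f = c q *s (g q *v (a q *v ?f))"
        using elim(1) by (metis matrix_vector_mul_assoc mscale_mult_vec)
      also have "a q *v ?f = s q" by (rule matrix_inv_mult_vec(2)[OF elim(3)])
      finally have "l q $ 1 *s (g q *v s q) = b q *v ((l q $ 1 / c q) *s ?f)"
        using elim(1) by (simp add: vector_scalar_commute vec.scale_scale)
      then show ?case
        using matrix_inv_mult_vec(1)[OF elim(2)] by simp
    qed
    ultimately have "regv p (\<lambda>q. matrix_inv (b q) *v (l q $ 1 *s (g q *v s q)))"
      by (rule regv_cong[rotated])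
    then show "sect (sheaf_of Q) p (\<lambda>q. l q $ 1 *s (g q *v s q))"
      by (rule iffD2[OF frame_sect[OF p b]])
  qed
qed

lemma hom_germ_iff_near:
  assumes p: "p \<in> X"
  obtains c where "eventually (\<lambda>q. c q \<noteq> 0 \<and> (\<forall>l. hom_germ q l \<longleftrightarrow> reg q (\<lambda>q. l q $ 1 / c q))) (near p)"
proof -
  obtain a b c where a: "aframe P p a" and b: "aframe Q p b"
    and c: "eventually (\<lambda>q. c q \<noteq> 0 \<and> mscale (c q) (g q) ** a q = b q) (near p)"
    using match[OF p] by blast
  have a: "frame (sheaf_of P) p a" and b: "frame (sheaf_of Q) p b"
    using a b by (auto simp: aframe_def)
  have "eventually (\<lambda>q. c q \<noteq> 0 \<and> (\<forall>l. hom_germ q l \<longleftrightarrow> reg q (\<lambda>q. l q $ 1 / c q))) (near p)"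
    using frame_near[OF p a] frame_near[OF p b] near_near[OF p c] c near_in_X[OF p]
  proof eventually_elim
    case (elim q)
    show ?case using hom_germ_iff[OF elim(5,1,2,3)] elim(4) by simp
  qed
  then show ?thesis by (rule that)
qed

lemma hom_germ_near:
  assumes p: "p \<in> X" and l: "hom_germ p l" shows "eventually (\<lambda>q. hom_germ q l) (near p)"
proof -
  obtain c where c: "eventually (\<lambda>q. c q \<noteq> 0 \<and> (\<forall>l. hom_germ q l \<longleftrightarrow> reg q (\<lambda>q. l q $ 1 / c q))) (near p)"
    using hom_germ_iff_near[OF p] .
  have "reg p (\<lambda>q. l q $ 1 / c q)" using near_self[OF p c] l by blast
  from reg_near[OF p this] c show ?thesis by eventually_elim blast
qed

lemma hom_line_eq: "zopen X U \<Longrightarrow> hom_line U = {l. (\<forall>p. p \<notin> U \<longrightarrow> l p = 0) \<and> (\<forall>p\<in>U. hom_germ p l)}"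
  by (simp add: hom_line_def)

lemma sect_hom_line:
  assumes p: "p \<in> X" shows "sect hom_line p l \<longleftrightarrow> hom_germ p l"
proof
  show "hom_germ p l" if "sect hom_line p l"
    using hom_line_eq hom_germ_cong p that by (rule is_sheaf_of_germs(3))
  show "sect hom_line p l" if "hom_germ p l"
    using hom_line_eq hom_germ_cong p hom_germ_near[OF p that] by (rule is_sheaf_of_germs(2))
qed

lemma is_sheaf_hom_line: "is_sheaf X hom_line"
  using hom_line_eq hom_germ_cong by (rule is_sheaf_of_germs(1))

lemma line_bundle_hom_line: "line_bundle X hom_line"
proof (rule vector_bundleI[OF is_sheaf_hom_line])
  fix p assume p: "p \<in> X"
  obtain c where c: "eventually (\<lambda>q. c q \<noteq> 0 \<and> (\<forall>l. hom_germ q l \<longleftrightarrow> reg q (\<lambda>q. l q $ 1 / c q))) (near p)"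
    using hom_germ_iff_near[OF p] .
  let ?a = "\<lambda>q. mat (c q) :: complex ^ 1 ^ 1"
  have v: "mat z *v v = z *s v" for z and v :: "complex ^ 1"
    by (simp add: vec_eq_iff mat_def matrix_vector_mult_def)
  have m: "?a q ** mat (1 / c q) = mat 1" if "c q \<noteq> 0" for q
    using that by (simp add: vec_eq_iff mat_def matrix_matrix_mult_def)
  have "frame hom_line p ?a"
    unfolding frame_def using near_near[OF p c] c near_in_X[OF p]
  proof eventually_elim
    case (elim q)
    have eq: "eventually (\<lambda>q. (matrix_inv (?a q) *v l q) $ i = l q $ 1 / c q) (near q)" for l i
      using elim(1)
    proof eventually_elim
      case (elim q)
      have "l q $ i = l q $ 1" by (metis num1_eq1)
      then show ?case using matrix_inv_eqI(2)[OF m[of q]] elim by (simp add: v)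
    qed
    then have eq': "eventually (\<lambda>q. l q $ 1 / c q = (matrix_inv (?a q) *v l q) $ i) (near q)" for l i
      by (auto elim: eventually_mono simp: eq_commute)
    have "regv q (\<lambda>q'. matrix_inv (?a q') *v l q') \<longleftrightarrow> reg q (\<lambda>q. l q $ 1 / c q)" for l
      unfolding regv_def using reg_cong[OF eq[of l]] reg_cong[OF eq'[of l]] by blast
    then show ?case
      using elim matrix_inv_eqI(1)[OF m] by (simp add: sect_hom_line)
  qed
  then show "\<exists>a. frame hom_line p a" by blast
qed

text \<open>A pure tensor is identified with the product of \<open>l\<close> and a section of
  \<open>P\<close>, which \<open>g\<close> maps to a section of \<open>Q\<close> by the choice of
  \<open>hom_line\<close>. Conversely, near each point a single pure tensor suffices.\<close>

lemma tensor_line_iff: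
  assumes U: "zopen X U"
  shows "s \<in> tensor_line X (sheaf_of P) hom_line U \<longleftrightarrow>
    (\<forall>p. p \<notin> U \<longrightarrow> s p = 0) \<and> (\<forall>p\<in>U. sect (sheaf_of Q) p (\<lambda>q. g q *v s q))"
proof -
  have "(\<exists>V (k::nat) f l. zopen X V \<and> p \<in> V \<and> V \<subseteq> U \<and> (\<forall>j<k. f j \<in> sheaf_of P V \<and> l j \<in> hom_line V) \<and>
        (\<forall>q\<in>V. s q = (\<Sum>j<k. (l j q $ 1) *s f j q))) \<longleftrightarrow> sect (sheaf_of Q) p (\<lambda>q. g q *v s q)"
    if p: "p \<in> U" for p
  proof -
    have pX: "p \<in> X" using p U zopen_subset by blast
    obtain a b c where a: "aframe P p a" and b: "aframe Q p b"
      and c: "eventually (\<lambda>q. c q \<noteq> 0 \<and> mscale (c q) (g q) ** a q = b q) (near p)"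
      using match[OF pX] by blast
    have a: "frame (sheaf_of P) p a" and b: "frame (sheaf_of Q) p b"
      using a b by (auto simp: aframe_def)
    show ?thesis
    proof
      assume "\<exists>V (k::nat) f l. zopen X V \<and> p \<in> V \<and> V \<subseteq> U \<and> (\<forall>j<k. f j \<in> sheaf_of P V \<and> l j \<in> hom_line V) \<and>
        (\<forall>q\<in>V. s q = (\<Sum>j<k. (l j q $ 1) *s f j q))"
      then obtain V k f l where V: "zopen X V" "p \<in> V" "\<And>j. j < (k::nat) \<Longrightarrow> f j \<in> sheaf_of P V"
        "\<And>j. j < k \<Longrightarrow> l j \<in> hom_line V" "\<And>q. q \<in> V \<Longrightarrow> s q = (\<Sum>j<k. (l j q $ 1) *s f j q)"
        by blast
      have "sect (sheaf_of Q) p (\<lambda>q. l j q $ 1 *s (g q *v f j q))" if "j < k" for j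
        using sect_of_mem[OF sheaves(1) V(1) V(3)[OF that] V(2)] V(4)[OF that] V(2)
        by (simp add: hom_line_def hom_germ_def)
      then have "sect (sheaf_of Q) p (\<lambda>q. \<Sum>j<k. l j q $ 1 *s (g q *v f j q))"
        by (intro frame_sect_sum[OF pX b]) auto
      moreover have "eventually (\<lambda>q. (\<Sum>j<k. l j q $ 1 *s (g q *v f j q)) = g q *v s q) (near p)"
        using near_open[OF V(1,2)]
      proof eventually_elim
        case (elim q)
        have "g q *v (\<Sum>j<k. (l j q $ 1) *s f j q) = (\<Sum>j<k. g q *v ((l j q $ 1) *s f j q))"
          by (simp add: vec_eq_iff matrix_vector_mult_def sum_distrib_left sum.swap[of _ _ UNIV])
        then show ?case
          using V(5)[OF elim] by (simp add: vector_scalar_commute)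
      qed
      ultimately show "sect (sheaf_of Q) p (\<lambda>q. g q *v s q)"
        by (rule sect_cong[OF sheaves(2) pX, rotated])
    next
      assume "sect (sheaf_of Q) p (\<lambda>q. g q *v s q)"
      then have 1: "regv p (\<lambda>q. matrix_inv (b q) *v (g q *v s q))"
        by (rule iffD1[OF frame_sect[OF pX b]])
      have "eventually (\<lambda>q. matrix_inv (b q) *v (g q *v s q) = matrix_inv (a q) *v ((1 / c q) *s s q)) (near p)"
        using c frame_invertible[OF b] frame_invertible[OF a]
      proof eventually_elim
        case (elim q)
        let ?f = "matrix_inv (a q) *v ((1 / c q) *s s q)"
        have "b q *v ?f = c q *s (g q *v (a q *v ?f))"
          using elim(1) by (metis matrix_vector_mul_assoc mscale_mult_vec)
        also have "a q *v ?f = (1 / c q) *s s q" by (rule matrix_inv_mult_vec(2)[OF elim(3)])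
        finally have "g q *v s q = b q *v ?f"
          using elim(1) by (simp add: vector_scalar_commute vec.scale_scale)
        then show ?case
          using matrix_inv_mult_vec(1)[OF elim(2)] by simp
      qed
      then have "regv p (\<lambda>q. matrix_inv (a q) *v ((1 / c q) *s s q))"
        using 1 by (rule regv_cong)
      \<comment> \<open>\<open>s\<close> is the product of the generator \<open>c\<close> of the
        line bundle and the section \<open>s / c\<close> of \<open>P\<close>.\<close>
      then have "sect (sheaf_of P) p (\<lambda>q. (1 / c q) *s s q)"
        by (rule iffD2[OF frame_sect[OF pX a]])
      moreover have "eventually (\<lambda>q. 1 = c q / c q) (near p)"
        using c by eventually_elim simp
      then have "reg p (\<lambda>q. c q / c q)"
        by (rule reg_cong[OF _ reg_const])
      then have "reg p (\<lambda>q. (vec (c q) :: complex ^ 1) $ 1 / c q)"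
        by (simp only: vec_component)
      then have "sect hom_line p (\<lambda>q. vec (c q))"
        unfolding sect_hom_line[OF pX] by (rule iffD2[OF hom_germ_iff[OF pX a b c]])
      ultimately have "eventually (\<lambda>q. sect (sheaf_of P) q (\<lambda>q. (1 / c q) *s s q) \<and>
          sect hom_line q (\<lambda>q. vec (c q)) \<and> c q \<noteq> 0) (near p)"
        using c by (intro eventually_conj sect_near pX) (auto elim: eventually_mono)
      then obtain V' where V': "zopen X V'" "p \<in> V'" "\<And>q. q \<in> V' \<Longrightarrow> sect (sheaf_of P) q (\<lambda>q. (1 / c q) *s s q)"
        "\<And>q. q \<in> V' \<Longrightarrow> sect hom_line q (\<lambda>q. vec (c q))" "\<And>q. q \<in> V' \<Longrightarrow> c q \<noteq> 0"
        unfolding eventually_near[OF pX] by blast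
      define V where "V = V' \<inter> U"
      have V: "zopen X V" "p \<in> V" "V \<subseteq> U" "V \<subseteq> V'" using V' U p zopen_Int by (auto simp: V_def)
      have res_sect: "sect M q (res V f)" if "is_sheaf X M" "q \<in> V" "sect M q f" for M and f :: "'n point \<Rightarrow> complex ^ 'k" and q
      proof (rule sect_cong[OF that(1) _ _ that(3)])
        show "q \<in> X" using that V zopen_subset by blast
        show "eventually (\<lambda>q. f q = res V f q) (near q)"
          using near_open[OF V(1) that(2)] by eventually_elim (simp add: res_def)
      qed
      have "res V (\<lambda>q. (1 / c q) *s s q) \<in> sheaf_of P V"
        unfolding sheaf_iff[OF sheaves(1) V(1)] using V(4) V'(3) res_sect[OF sheaves(1)] by (auto simp: res_def)
      moreover have "res V (\<lambda>q. vec (c q)) \<in> hom_line V"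
        unfolding sheaf_iff[OF is_sheaf_hom_line V(1)] using V(4) V'(4) res_sect[OF is_sheaf_hom_line]
        by (auto simp: res_def)
      moreover have "s q = (\<Sum>j<1::nat. (res V (\<lambda>q. vec (c q)) q $ (1 :: 1)) *s res V (\<lambda>q. (1 / c q) *s s q) q)" if "q \<in> V" for q
        using that V(4) V'(5) by (simp add: res_def vec.scale_scale subset_iff)
      ultimately show "\<exists>V (k::nat) f l. zopen X V \<and> p \<in> V \<and> V \<subseteq> U \<and> (\<forall>j<k. f j \<in> sheaf_of P V \<and> l j \<in> hom_line V) \<and>
        (\<forall>q\<in>V. s q = (\<Sum>j<k. (l j q $ 1) *s f j q))"
        using V by (intro exI[of _ V] exI[of _ "1::nat"] exI[of _ "\<lambda>_. res V (\<lambda>q. (1 / c q) *s s q)"]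
          exI[of _ "\<lambda>_. res V (\<lambda>q. vec (c q))"] conjI allI impI ballI) auto
    qed
  qed
  then show ?thesis
    unfolding tensor_line_def by simp
qed

lemma invertible_match: 
  assumes p: "p \<in> X" shows "invertible (g p)"
proof -
  obtain a b c where a: "aframe P p a" and b: "aframe Q p b"
    and c: "eventually (\<lambda>q. c q \<noteq> 0 \<and> mscale (c q) (g q) ** a q = b q) (near p)"
    using match[OF p] by blast
  have bp: "invertible (b p)"
    using near_self[OF p frame_invertible] b unfolding aframe_def by blast
  have "g p ** (mscale (c p) (a p)) = b p"
    using near_self[OF p c] by (simp add: mscale_mult_left mscale_mult_right)
  then have "det (g p) * det (mscale (c p) (a p)) = det (b p)"
    by (metis det_mul)
  then have "det (g p) \<noteq> 0"
    using bp by (auto simp: invertible_det_nz)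
  then show ?thesis by (simp add: invertible_det_nz)
qed

lemma qpar_isomorphic_tensor: "qpar_isomorphic X D (tensor_qpar X P hom_line) Q"
  unfolding qpar_isomorphic_def
proof (intro exI[of _ g] conjI ballI allI impI)
  show "invertible (g p)" if "p \<in> X" for p using invertible_match that .
next
  fix U assume U: "zopen X U"
  let ?T = "tensor_line X (sheaf_of P) hom_line U"
  have inv: "invertible (g p)" if "p \<in> U" for p using that invertible_match zopen_subset[OF U] by blast
  have "bij_betw (\<lambda>s p. g p *v s p) ?T (sheaf_of Q U)"
  proof (rule bij_betwI[where g = "\<lambda>s p. matrix_inv (g p) *v s p"])
    show "(\<lambda>s p. g p *v s p) \<in> ?T \<rightarrow> sheaf_of Q U"
      by (auto simp: tensor_line_iff[OF U] sheaf_iff[OF sheaves(2) U])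
    show "(\<lambda>s p. matrix_inv (g p) *v s p) \<in> sheaf_of Q U \<rightarrow> ?T"
    proof
      fix s assume s: "s \<in> sheaf_of Q U"
      have "sect (sheaf_of Q) p (\<lambda>q. g q *v (matrix_inv (g q) *v s q))" if p: "p \<in> U" for p
      proof (rule sect_cong[OF sheaves(2)])
        show "p \<in> X" using p U zopen_subset by blast
        show "sect (sheaf_of Q) p s" using s p sheaf_iff[OF sheaves(2) U] by blast
        show "eventually (\<lambda>q. s q = g q *v (matrix_inv (g q) *v s q)) (near p)"
          using near_open[OF U p] by eventually_elim (simp add: matrix_inv_mult_vec inv)
      qed
      then show "(\<lambda>p. matrix_inv (g p) *v s p) \<in> ?T"
        using s sheaf_iff[OF sheaves(2) U] by (simp add: tensor_line_iff[OF U])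
    qed
    show "(\<lambda>p. matrix_inv (g p) *v (g p *v s p)) = s" if "s \<in> ?T" for s
    proof
      fix p show "matrix_inv (g p) *v (g p *v s p) = s p"
        using that inv[of p] by (cases "p \<in> U") (simp_all add: matrix_inv_mult_vec tensor_line_iff[OF U])
    qed
    show "(\<lambda>p. g p *v (matrix_inv (g p) *v s p)) = s" if "s \<in> sheaf_of Q U" for s
    proof
      fix p show "g p *v (matrix_inv (g p) *v s p) = s p"
        using that inv[of p] by (cases "p \<in> U") (simp_all add: matrix_inv_mult_vec sheaf_iff[OF sheaves(2) U])
    qed
  qed
  then show "bij_betw (\<lambda>s p. g p *v s p) (sheaf_of (tensor_qpar X P hom_line) U) (sheaf_of Q U)"
    by (simp add: tensor_qpar_def)
next
  fix x i assume x: "x \<in> D" and i: "i \<in> {1..CARD('r) + 1}"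
  have xX: "x \<in> X" using x D_subset by blast
  obtain a b c where a: "aframe P x a" and b: "aframe Q x b"
    and c: "eventually (\<lambda>q. c q \<noteq> 0 \<and> mscale (c q) (g q) ** a q = b q) (near x)"
    using match[OF xX] by blast
  have cx: "c x \<noteq> 0" "mscale (c x) (g x) ** a x = b x"
    using near_self[OF xX c] by auto
  have bv: "b x *v v = g x *v (a x *v (c x *s v))" for v
    using cx(2) by (metis matrix_vector_mul_assoc mscale_mult_vec vector_scalar_commute)
  \<comment> \<open>The scalar relating \<open>g x ** a x\<close> to \<open>b x\<close> does not
    move the standard subspaces, so the flags correspond under \<open>g x\<close> itself.\<close>
  have sc: "(\<lambda>v. c x *s v) ` stdV m = (stdV m :: (complex ^ 'r) set)" for m
  proof (intro set_eqI iffI)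
    fix v :: "complex ^ 'r" assume "v \<in> stdV m"
    then have "(1 / c x) *s v \<in> stdV m" using vec.subspace_scale[OF subspace_stdV] by blast
    moreover have "v = c x *s ((1 / c x) *s v)" using cx by simp
    ultimately show "v \<in> (\<lambda>v. c x *s v) ` stdV m" by blast
  qed (use vec.subspace_scale[OF subspace_stdV] in blast)
  have "flag Q x i = (*v) (b x) ` stdV (CARD('r) + 1 - i)"
    using b x i by (simp add: aframe_def)
  also have "\<dots> = (*v) (g x) ` (*v) (a x) ` (\<lambda>v. c x *s v) ` stdV (CARD('r) + 1 - i)"
    unfolding image_image bv ..
  also have "\<dots> = (*v) (g x) ` flag P x i"
    using a x i by (simp add: sc aframe_def)
  finally show "(*v) (g x) ` flag (tensor_qpar X P hom_line) x i = flag Q x i"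
    by (simp add: tensor_qpar_def)
qed

lemma obtainable_of_match: "obtainable X D E P \<Longrightarrow> obtainable X D E Q"
  using obtainable.iso[OF obtainable.tensor[OF _ line_bundle_hom_line] Q qpar_isomorphic_tensor] .

end

end

section \<open>Reduction of shifted matchings to iterated Hecke transformations\<close>

fun cycpow :: "complex \<Rightarrow> nat \<Rightarrow> complex ^ 'r::finite ^ 'r" where
  "cycpow t 0 = mat 1"
| "cycpow t (Suc m) = cyc t ** cycpow t m"

lemma cycpow_Suc': "cycpow t (Suc m) = (cycpow t m ** cyc t :: complex ^ 'r::finite ^ 'r)"
proof (induction m)
  case (Suc m)
  have "cycpow t (Suc (Suc m)) = (cyc t ** cycpow t (Suc m) :: complex ^ 'r ^ 'r)"
    by simp
  also have "\<dots> = cyc t ** (cycpow t m ** cyc t)"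
    unfolding Suc ..
  finally show ?case by (simp add: matrix_mul_assoc)
qed simp

context marked
begin

text \<open>Induction on the total exponent: a Hecke transformation at \<open>x\<close> moves one
  shift into the frame of \<open>P\<close> and so lowers \<open>m x\<close> by one. Once all
  exponents are 0, only a twist remains. Matching is asked off \<open>D\<close> because the shifts
  are singular at the marked points.\<close>

lemma obtainable_of_shifted_match:
  fixes P Q :: "('n, 'r::finite) qpar" and g :: "'n point \<Rightarrow> complex ^ 'r ^ 'r" and m :: "'n point \<Rightarrow> nat"
  assumes Q: "quasi_parabolic X D Q" and "obtainable X D E P" "quasi_parabolic X D P"
    and "\<And>p. p \<in> X \<Longrightarrow> \<exists>a b c t. aframe P p a \<and> aframe Q p b \<and> (p \<in> D \<longrightarrow> unif p t) \<and>
      eventually (\<lambda>q. q \<notin> D \<longrightarrow> c q \<noteq> 0 \<and>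
        mscale (c q) (g q) ** (a q ** cycpow (t q) (if p \<in> D then m p else 0)) = b q) (near p)"
  shows "obtainable X D E Q"
  using assms(2-)
proof (induction "\<Sum>x\<in>D. m x" arbitrary: P m rule: less_induct)
  case less
  note match = less.prems(3)
  show ?case
  proof (cases "\<exists>x\<in>D. m x \<noteq> 0")
    case False
    have "\<forall>p\<in>X. \<exists>a b c. aframe P p a \<and> aframe Q p b \<and>
      eventually (\<lambda>q. q \<notin> D \<longrightarrow> c q \<noteq> 0 \<and> mscale (c q) (g q) ** a q = b q) (near p)"
    proof
      fix p assume "p \<in> X"
      then obtain a b c t where *: "aframe P p a" "aframe Q p b"
        "eventually (\<lambda>q. q \<notin> D \<longrightarrow> c q \<noteq> 0 \<and>
          mscale (c q) (g q) ** (a q ** cycpow (t q) (if p \<in> D then m p else 0)) = b q) (near p)"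
        using match by blast
      have "(if p \<in> D then m p else 0) = 0" using False by simp
      with *(3) have "eventually (\<lambda>q. q \<notin> D \<longrightarrow> c q \<noteq> 0 \<and> mscale (c q) (g q) ** a q = b q) (near p)"
        by simp
      with * show "\<exists>a b c. aframe P p a \<and> aframe Q p b \<and>
        eventually (\<lambda>q. q \<notin> D \<longrightarrow> c q \<noteq> 0 \<and> mscale (c q) (g q) ** a q = b q) (near p)" by blast
    qed
    then obtain A where "\<forall>p\<in>X. \<exists>b c. aframe P p (A p) \<and> aframe Q p b \<and>
      eventually (\<lambda>q. q \<notin> D \<longrightarrow> c q \<noteq> 0 \<and> mscale (c q) (g q) ** A p q = b q) (near p)"
      by (rule bchoice[THEN exE])
    then obtain B where "\<forall>p\<in>X. \<exists>c. aframe P p (A p) \<and> aframe Q p (B p) \<and>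
      eventually (\<lambda>q. q \<notin> D \<longrightarrow> c q \<noteq> 0 \<and> mscale (c q) (g q) ** A p q = B p q) (near p)"
      by (rule bchoice[THEN exE])
    then obtain C where AB: "\<forall>p\<in>X. aframe P p (A p) \<and> aframe Q p (B p) \<and>
      eventually (\<lambda>q. q \<notin> D \<longrightarrow> C p q \<noteq> 0 \<and> mscale (C p q) (g q) ** A p q = B p q) (near p)"
      by (rule bchoice[THEN exE])
    \<comment> \<open>The matching leaves the values of \<open>g\<close> at marked points open; they
      are redefined here by the frames belonging to the point itself. Near \<open>p\<close> no other
      point of \<open>D\<close> occurs, so these are the frames at \<open>p\<close>.\<close>
    define g' where "g' q = (if q \<in> D then B q q ** matrix_inv (A q q) else g q)" for q
    show ?thesis
    proof (rule obtainable_of_match[OF less.prems(2) Q _ less.prems(1), of g'])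
      fix p assume p: "p \<in> X"
      let ?c = "\<lambda>q. if q \<in> D then 1 else C p q"
      have *: "aframe P p (A p)" "aframe Q p (B p)"
        "eventually (\<lambda>q. q \<notin> D \<longrightarrow> C p q \<noteq> 0 \<and> mscale (C p q) (g q) ** A p q = B p q) (near p)"
        using AB p by blast+
      have inv: "eventually (\<lambda>q. invertible (A p q)) (near p)"
        using * by (intro frame_invertible) (auto simp: aframe_def)
      have "eventually (\<lambda>q. ?c q \<noteq> 0 \<and> mscale (?c q) (g' q) ** A p q = B p q) (near p)"
        using *(3) near_not_D[OF p] inv
      proof eventually_elim
        case (elim q)
        show ?case
        proof (cases "q \<in> D")
          case True
          then have "q = p" using elim(2) by blast
          then have "g' q ** A p q = B p q ** (matrix_inv (A p q) ** A p q)"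
            using True by (simp add: g'_def matrix_mul_assoc)
          then show ?thesis using True by (simp add: matrix_inv[OF elim(3)])
        next
          case False
          then show ?thesis using elim(1) by (simp add: g'_def)
        qed
      qed
      then show "\<exists>a b c. aframe P p a \<and> aframe Q p b \<and>
          eventually (\<lambda>q. c q \<noteq> 0 \<and> mscale (c q) (g' q) ** a q = b q) (near p)"
        using * by (intro exI[of _ "A p"] exI[of _ "B p"] exI[of _ ?c] conjI)
    qed
  next
    case True
    then obtain x where x: "x \<in> D" "m x \<noteq> 0" by blast
    then obtain k where k: "m x = Suc k" using not0_implies_Suc by blast
    have xX: "x \<in> X" using x D_subset by blast
    obtain a b c t where *: "aframe P x a" "aframe Q x b" "unif x t"
        "eventually (\<lambda>q. q \<notin> D \<longrightarrow> c q \<noteq> 0 \<and>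
          mscale (c q) (g q) ** (a q ** cycpow (t q) (Suc k)) = b q) (near x)"
      using match[OF xX] x(1) k by (auto simp del: cycpow.simps)
    let ?a = "\<lambda>q. if q = x then a x else a q ** cyc (t q)"
    obtain P' where P': "hecke_transform X D x P P'" "quasi_parabolic X D P'" "aframe P' x ?a"
      and other: "\<And>p b. p \<in> X \<Longrightarrow> p \<noteq> x \<Longrightarrow> aframe P p b \<Longrightarrow> aframe P' p b"
      using hecke_step[OF less.prems(2) x(1) *(1,3)] by auto
    let ?m = "m(x := k)"
    have "(\<Sum>y\<in>D. ?m y) < (\<Sum>y\<in>D. m y)"
      by (rule sum_strict_mono_ex1[OF finite_D]) (use x k in auto)
    moreover have "obtainable X D E P'"
      using obtainable.hecke[OF less.prems(1) x(1) P'(1)] .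
    moreover have "\<exists>a b c t. aframe P' p a \<and> aframe Q p b \<and> (p \<in> D \<longrightarrow> unif p t) \<and>
      eventually (\<lambda>q. q \<notin> D \<longrightarrow> c q \<noteq> 0 \<and>
        mscale (c q) (g q) ** (a q ** cycpow (t q) (if p \<in> D then ?m p else 0)) = b q) (near p)" if p: "p \<in> X" for p
    proof (cases "p = x")
      case True
      have "eventually (\<lambda>q. q \<notin> D \<longrightarrow> c q \<noteq> 0 \<and> mscale (c q) (g q) ** (?a q ** cycpow (t q) k) = b q) (near x)"
        using *(4)
      proof eventually_elim
        case (elim q)
        have "?a q ** cycpow (t q) k = a q ** cycpow (t q) (Suc k)" if "q \<notin> D"
        proof -
          have "q \<noteq> x" using that x by blast
          then show ?thesis by (simp add: matrix_mul_assoc)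
        qed
        then show ?case using elim by simp
      qed
      then show ?thesis
        unfolding True using P'(3) *(2,3) x(1)
        by (intro exI[of _ ?a] exI[of _ b] exI[of _ c] exI[of _ t]) simp
    next
      case False
      then have m: "?m p = m p" by simp
      show ?thesis
        unfolding m using match[OF p] other[OF p False] by blast
    qed
    ultimately show ?thesis
      using less.hyps[of ?m P'] P'(2) by blast
  qed
qed

end

section \<open>Parabolic endomorphisms\<close>

lemma upper_add: "upper A \<Longrightarrow> upper B \<Longrightarrow> upper (A + B)"
  by (simp add: upper_def)

lemma upper_mscale: "upper A \<Longrightarrow> upper (mscale c A)"
  by (simp add: upper_def)

lemma upper_mat_1: "upper (mat 1)"
  by (auto simp: upper_def mat_def)

lemma mat_mult_sum_left: "(\<Sum>k\<in>K. f k) ** B = (\<Sum>k\<in>K. f k ** (B :: complex ^ 'r ^ 'r))"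
  by (induction K rule: infinite_finite_induct) (simp_all add: mat_mult_add_left)

lemma mat_mult_sum_right: "B ** (\<Sum>k\<in>K. f k) = (\<Sum>k\<in>K. B ** (f k :: complex ^ 'r ^ 'r))"
  by (induction K rule: infinite_finite_induct) (simp_all add: matrix_add_ldistrib)

lemma conj_inverse_conj:
  assumes "invertible (a :: complex ^ 'r ^ 'r)"
  shows "matrix_inv a ** (a ** A ** matrix_inv a) ** a = A" "a ** (matrix_inv a ** A ** a) ** matrix_inv a = A"
proof -
  have "matrix_inv a ** (a ** A ** matrix_inv a) ** a = (matrix_inv a ** a) ** A ** (matrix_inv a ** a)"
    by (simp only: matrix_mul_assoc)
  then show "matrix_inv a ** (a ** A ** matrix_inv a) ** a = A"
    by (simp add: matrix_inv[OF assms])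
  have "a ** (matrix_inv a ** A ** a) ** matrix_inv a = (a ** matrix_inv a) ** A ** (a ** matrix_inv a)"
    by (simp only: matrix_mul_assoc)
  then show "a ** (matrix_inv a ** A ** a) ** matrix_inv a = A"
    by (simp add: matrix_inv[OF assms])
qed

lemma trace_conj': 
  assumes "invertible (a :: complex ^ 'r ^ 'r)" shows "trace (matrix_inv a ** A ** a) = trace A"
  using trace_mul_sym[of "matrix_inv a ** A" a] by (simp add: matrix_mul_assoc matrix_inv[OF assms])

context marked
begin

lemma aframe_invertible: "p \<in> X \<Longrightarrow> aframe P p a \<Longrightarrow> invertible (a p)"
  using near_self[OF _ frame_invertible] unfolding aframe_def by blast

lemma aframe_flag_stable:
  fixes P :: "('n, 'r::finite) qpar"
  assumes x: "x \<in> D" and a: "aframe P x a"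
  shows "(\<forall>i\<in>{1..CARD('r) + 1}. (*v) A ` flag P x i \<subseteq> flag P x i) \<longleftrightarrow> upper (matrix_inv (a x) ** A ** a x)"
proof -
  have inv: "invertible (a x)" using aframe_invertible a x D_subset by blast
  have "(*v) A ` flag P x i \<subseteq> flag P x i \<longleftrightarrow>
      (*v) (matrix_inv (a x) ** A ** a x) ` stdV (CARD('r) + 1 - i) \<subseteq> stdV (CARD('r) + 1 - i)"
    if "i \<in> {1..CARD('r) + 1}" for i
  proof -
    have "flag P x i = (*v) (a x) ` stdV (CARD('r) + 1 - i)"
      using a x that by (simp add: aframe_def)
    then show ?thesis
      by (auto simp: image_subset_iff mem_image_matrix[OF inv] matrix_vector_mul_assoc)
  qed
  moreover have "(\<forall>i\<in>{1..CARD('r) + 1}. S (CARD('r) + 1 - i)) \<longleftrightarrow> (\<forall>m\<le>CARD('r). S m)" for S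
  proof (intro iffI allI impI ballI)
    fix m assume *: "\<forall>i\<in>{1..CARD('r) + 1}. S (CARD('r) + 1 - i)" "m \<le> CARD('r)"
    then have "CARD('r) + 1 - m \<in> {1..CARD('r) + 1}" "CARD('r) + 1 - (CARD('r) + 1 - m) = m" by auto
    then show "S m" using *(1) by metis
  qed auto
  ultimately show ?thesis
    unfolding upper_iff by simp
qed

text \<open>The local shape of the sheaf: in adapted frames its sections are the traceless part of
  the Iwahori order, regular matrices that are upper triangular at the marked point. All adapted
  frames are allowed, so any convenient one may be inserted.\<close>

lemma PEnd0_iff:
  fixes P :: "('n, 'r::finite) qpar"
  assumes P: "quasi_parabolic X D P" and U: "zopen X U"
  shows "S \<in> PEnd0 X D P U \<longleftrightarrow> (\<forall>p. p \<notin> U \<longrightarrow> S p = 0) \<and> (\<forall>p\<in>U. trace (S p) = 0 \<and>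
    (\<forall>a. aframe P p a \<longrightarrow> regm p (\<lambda>q. matrix_inv (a q) ** S q ** a q) \<and>
      (p \<in> D \<longrightarrow> upper (matrix_inv (a p) ** S p ** a p))))" (is "_ \<longleftrightarrow> ?R")
proof
  have sh: "is_sheaf X (sheaf_of P)" by (rule quasi_parabolic_sheaf[OF P])
  assume S: "S \<in> PEnd0 X D P U"
  have supp: "S p = 0" if "p \<notin> U" for p using S that by (simp add: PEnd0_def)
  have pres: "(\<lambda>p. S p *v s p) \<in> sheaf_of P V" if "zopen X V" "V \<subseteq> U" "s \<in> sheaf_of P V" for V s
    using S that by (simp add: PEnd0_def)
  have "regm p (\<lambda>q. matrix_inv (a q) ** S q ** a q)" if p: "p \<in> U" and a: "aframe P p a" for p a
    unfolding regm_def
  proof (intro allI)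
    fix i j
    have pX: "p \<in> X" using p U zopen_subset by blast
    have fr: "frame (sheaf_of P) p a" using a by (simp add: aframe_def)
    have "sect (sheaf_of P) p (\<lambda>q. a q *v axis j 1)"
      by (rule frame_sectI[OF pX fr regv_const])
    then obtain V where V: "zopen X V" "p \<in> V" "res V (\<lambda>q. a q *v axis j 1) \<in> sheaf_of P V"
      unfolding sect_def by blast
    define W where "W = V \<inter> U"
    have W: "zopen X W" "p \<in> W" "W \<subseteq> U" "W \<subseteq> V" using V U p zopen_Int by (auto simp: W_def)
    have "res W (res V (\<lambda>q. a q *v axis j 1)) \<in> sheaf_of P W"
      by (rule is_sheaf_res[OF sh V(1) W(1,4) V(3)])
    from pres[OF W(1,3) this]
    have "sect (sheaf_of P) p (\<lambda>q. S q *v res W (res V (\<lambda>q. a q *v axis j 1)) q)"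
      using sect_of_mem[OF sh W(1) _ W(2)] by blast
    then have 1: "regv p (\<lambda>q. matrix_inv (a q) *v (S q *v res W (res V (\<lambda>q. a q *v axis j 1)) q))"
      by (rule iffD1[OF frame_sect[OF pX fr]])
    show "reg p (\<lambda>q. (matrix_inv (a q) ** S q ** a q) $ i $ j)"
    proof (rule reg_cong[OF _ regv_entry[OF 1, of i]])
      show "eventually (\<lambda>q. (matrix_inv (a q) *v (S q *v res W (res V (\<lambda>q. a q *v axis j 1)) q)) $ i =
          (matrix_inv (a q) ** S q ** a q) $ i $ j) (near p)"
        using near_open[OF W(1,2)]
      proof eventually_elim
        case (elim q)
        then have "res W (res V (\<lambda>q. a q *v axis j 1)) q = a q *v axis j 1"
          using W by (auto simp: res_def)
        then show ?case
          by (simp add: matrix_vector_mul_assoc matrix_mul_assoc mult_vec_axis)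
      qed
    qed
  qed
  moreover have "upper (matrix_inv (a p) ** S p ** a p)" if "p \<in> U" "p \<in> D" "aframe P p a" for p a
  proof -
    have "\<forall>i\<in>{1..CARD('r) + 1}. (*v) (S p) ` flag P p i \<subseteq> flag P p i"
      using S that unfolding PEnd0_def by blast
    then show ?thesis by (rule iffD1[OF aframe_flag_stable[OF that(2,3)]])
  qed
  moreover have "trace (S p) = 0" if "p \<in> U" for p using S that by (simp add: PEnd0_def)
  ultimately show ?R using supp by blast
next
  have sh: "is_sheaf X (sheaf_of P)" by (rule quasi_parabolic_sheaf[OF P])
  assume R: ?R
  have "(\<lambda>p. S p *v s p) \<in> sheaf_of P V" if V: "zopen X V" "V \<subseteq> U" and s: "s \<in> sheaf_of P V" for V s
    unfolding sheaf_iff[OF sh V(1)]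
  proof (intro conjI allI impI ballI)
    show "S p *v s p = 0" if "p \<notin> V" for p using is_sheaf_supp[OF sh V(1) s that] by simp
    fix p assume p: "p \<in> V"
    have pX: "p \<in> X" using p V zopen_subset by blast
    obtain a where a: "aframe P p a" using aframe_exists[OF P pX] by blast
    then have fr: "frame (sheaf_of P) p a" by (simp add: aframe_def)
    have "regm p (\<lambda>q. matrix_inv (a q) ** S q ** a q)"
      using R a p V(2) by blast
    moreover have "regv p (\<lambda>q. matrix_inv (a q) *v s q)"
      using sect_of_mem[OF sh V(1) s p] by (rule iffD1[OF frame_sect[OF pX fr]])
    ultimately have "regv p (\<lambda>q. (matrix_inv (a q) ** S q ** a q) *v (matrix_inv (a q) *v s q))"
      by (rule regv_mult)
    moreover have "eventually (\<lambda>q. (matrix_inv (a q) ** S q ** a q) *v (matrix_inv (a q) *v s q) =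
        matrix_inv (a q) *v (S q *v s q)) (near p)"
      using frame_invertible[OF fr]
      by eventually_elim (simp add: matrix_inv_mult_vec flip: matrix_vector_mul_assoc)
    ultimately have "regv p (\<lambda>q. matrix_inv (a q) *v (S q *v s q))"
      by (rule regv_cong[rotated])
    then show "sect (sheaf_of P) p (\<lambda>q. S q *v s q)"
      by (rule iffD2[OF frame_sect[OF pX fr]])
  qed
  moreover have "\<forall>i\<in>{1..CARD('r) + 1}. (*v) (S x) ` flag P x i \<subseteq> flag P x i" if x: "x \<in> D \<inter> U" for x
  proof -
    obtain a where a: "aframe P x a" using aframe_exists[OF P] x D_subset by blast
    then have "upper (matrix_inv (a x) ** S x ** a x)" using R x by blast
    then show ?thesis using aframe_flag_stable[OF _ a] x by blast
  qed
  ultimately show "S \<in> PEnd0 X D P U"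
    using R by (simp add: PEnd0_def)
qed

lemma PEnd0_combination:
  fixes P :: "('n, 'r::finite) qpar"
  assumes P: "quasi_parabolic X D P" and U: "zopen X U" and K: "finite K"
    and f: "\<And>k. k \<in> K \<Longrightarrow> f k \<in> regular X U" and T: "\<And>k. k \<in> K \<Longrightarrow> T k \<in> PEnd0 X D P U"
  shows "(\<lambda>p. \<Sum>k\<in>K. mscale (f k p) (T k p)) \<in> PEnd0 X D P U"
  using K f T
proof (induction K rule: finite_induct)
  case empty
  then show ?case
    by (simp add: PEnd0_iff[OF P U] trace_zero regm_const upper_def)
next
  case (insert k K)
  let ?S = "\<lambda>p. \<Sum>k\<in>K. mscale (f k p) (T k p)"
  have S: "?S \<in> PEnd0 X D P U" using insert by blast
  have Tk: "T k \<in> PEnd0 X D P U" and fk: "f k \<in> regular X U" using insert by auto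
  have "(\<lambda>p. mscale (f k p) (T k p) + ?S p) \<in> PEnd0 X D P U"
    unfolding PEnd0_iff[OF P U]
  proof (intro conjI allI impI ballI)
    show "mscale (f k p) (T k p) + ?S p = 0" if "p \<notin> U" for p
      using S Tk that unfolding PEnd0_iff[OF P U] by simp
    fix p assume p: "p \<in> U"
    show "trace (mscale (f k p) (T k p) + ?S p) = 0"
      using S Tk p unfolding PEnd0_iff[OF P U] by (simp add: trace_add trace_mscale)
    fix a assume a: "aframe P p a"
    have eq: "matrix_inv (a q) ** (mscale (f k q) (T k q) + ?S q) ** a q =
      mscale (f k q) (matrix_inv (a q) ** T k q ** a q) + matrix_inv (a q) ** ?S q ** a q" for q
      by (simp add: mat_ring_simps)
    have "reg p (f k)" using fk p unfolding regular_iff[OF U] by blast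
    moreover have "regm p (\<lambda>q. matrix_inv (a q) ** T k q ** a q)" "regm p (\<lambda>q. matrix_inv (a q) ** ?S q ** a q)"
      using S Tk p a unfolding PEnd0_iff[OF P U] by blast+
    ultimately show "regm p (\<lambda>q. matrix_inv (a q) ** (mscale (f k q) (T k q) + ?S q) ** a q)"
      unfolding eq by (intro regm_add regm_mscale)
    assume "p \<in> D"
    then have "upper (matrix_inv (a p) ** T k p ** a p)" "upper (matrix_inv (a p) ** ?S p ** a p)"
      using S Tk p a unfolding PEnd0_iff[OF P U] by blast+
    then show "upper (matrix_inv (a p) ** (mscale (f k p) (T k p) + ?S p) ** a p)"
      unfolding eq by (intro upper_add upper_mscale)
  qed
  then show ?case using insert(1,2) by simp
qed

lemma PEnd0_res:
  fixes P :: "('n, 'r::finite) qpar"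
  assumes P: "quasi_parabolic X D P" and U: "zopen X U" "zopen X V" "V \<subseteq> U" and S: "S \<in> PEnd0 X D P U"
  shows "res V S \<in> PEnd0 X D P V"
  unfolding PEnd0_iff[OF P U(2)]
proof (intro conjI allI impI ballI)
  show "res V S p = 0" if "p \<notin> V" for p using that by (simp add: res_def)
  fix p assume p: "p \<in> V"
  then have pU: "p \<in> U" using U by blast
  show "trace (res V S p) = 0" using S p pU unfolding PEnd0_iff[OF P U(1)] by (simp add: res_def)
  fix a assume a: "aframe P p a"
  show "regm p (\<lambda>q. matrix_inv (a q) ** res V S q ** a q)"
  proof (rule regm_cong)
    show "regm p (\<lambda>q. matrix_inv (a q) ** S q ** a q)"
      using S pU a unfolding PEnd0_iff[OF P U(1)] by blast
    show "eventually (\<lambda>q. matrix_inv (a q) ** S q ** a q = matrix_inv (a q) ** res V S q ** a q) (near p)"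
      using near_open[OF U(2) p] by eventually_elim (simp add: res_def)
  qed
  assume "p \<in> D"
  then show "upper (matrix_inv (a p) ** res V S p ** a p)"
    using S p pU a unfolding PEnd0_iff[OF P U(1)] by (simp add: res_def)
qed

text \<open>The characterization runs over all adapted frames \<open>b\<close>. The transition
  matrix \<open>k\<close> from the given frame is regular with regular inverse, and stability of the
  flag does not depend on the frame, so one frame is enough to check.\<close>

lemma PEnd0_frameI:
  fixes P :: "('n, 'r::finite) qpar"
  assumes P: "quasi_parabolic X D P" and V: "zopen X V"
    and loc: "\<And>q. q \<in> V \<Longrightarrow> aframe P q a \<and> regm q A \<and> trace (A q) = 0 \<and> (q \<in> D \<longrightarrow> upper (A q))"
  shows "res V (\<lambda>q. a q ** A q ** matrix_inv (a q)) \<in> PEnd0 X D P V"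
  unfolding PEnd0_iff[OF P V]
proof (intro conjI allI impI ballI)
  let ?S = "res V (\<lambda>q. a q ** A q ** matrix_inv (a q))"
  show "?S q = 0" if "q \<notin> V" for q using that by (simp add: res_def)
  fix q assume q: "q \<in> V"
  have VX: "q' \<in> X" if "q' \<in> V" for q' using that V zopen_subset by blast
  have Sq: "?S q' = a q' ** A q' ** matrix_inv (a q')" if "q' \<in> V" for q' using that by (simp add: res_def)
  have qX: "q \<in> X" using q VX by blast
  have a: "aframe P q a" and aq: "invertible (a q)" using loc[OF q] aframe_invertible[OF qX] by auto
  have inv: "invertible (a q')" if "q' \<in> V" for q' using loc[OF that] aframe_invertible[OF VX[OF that]] by blast
  show "trace (?S q) = 0" using loc[OF q] by (simp add: Sq[OF q] trace_conj[OF aq])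
  have fq: "frame (sheaf_of P) q a" using a by (simp add: aframe_def)
  fix b assume b: "aframe P q b"
  have fb: "frame (sheaf_of P) q b" using b by (simp add: aframe_def)
  define k where "k q' = matrix_inv (b q') ** a q'" for q'
  have "reg q (\<lambda>q'. k q' $ i $ j)" for i j
  proof -
    have "sect (sheaf_of P) q (\<lambda>q'. a q' *v axis j 1)" by (rule frame_sectI[OF qX fq regv_const])
    then have "regv q (\<lambda>q'. matrix_inv (b q') *v (a q' *v axis j 1))" by (rule iffD1[OF frame_sect[OF qX fb]])
    from regv_entry[OF this, of i] show ?thesis
      by (simp add: k_def matrix_vector_mul_assoc mult_vec_axis)
  qed
  then have k: "regm q k" by (simp add: regm_def)
  have bq: "invertible (b q)" using aframe_invertible[OF qX b] .
  have kq: "invertible (k q)" using aq bq by (simp add: k_def invertible_mult_complex invertible_matrix_inv)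
  have eq: "k q' ** A q' ** matrix_inv (k q') = matrix_inv (b q') ** ?S q' ** b q'"
    if "q' \<in> V" "invertible (b q')" for q'
  proof -
    have "matrix_inv (k q') = matrix_inv (a q') ** b q'"
    proof (rule matrix_inv_eqI(2))
      have "k q' ** (matrix_inv (a q') ** b q') = matrix_inv (b q') ** (a q' ** matrix_inv (a q')) ** b q'"
        by (simp add: k_def matrix_mul_assoc)
      then show "k q' ** (matrix_inv (a q') ** b q') = mat 1"
        using inv[OF that(1)] matrix_inv[OF that(2)] by (simp add: matrix_inv(2))
    qed
    then show ?thesis using Sq[OF that(1)] by (simp add: k_def matrix_mul_assoc)
  qed
  show "regm q (\<lambda>q'. matrix_inv (b q') ** ?S q' ** b q')"
  proof (rule regm_cong)
    show "eventually (\<lambda>q'. k q' ** A q' ** matrix_inv (k q') = matrix_inv (b q') ** ?S q' ** b q') (near q)"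
      using near_open[OF V q] frame_invertible[OF fb] by eventually_elim (rule eq)
    show "regm q (\<lambda>q'. k q' ** A q' ** matrix_inv (k q'))"
      using loc[OF q] by (intro regm_mult k regm_inverse(2)[OF qX k kq]) blast
  qed
  assume qD: "q \<in> D"
  then have "upper (matrix_inv (a q) ** ?S q ** a q)"
    using loc[OF q] unfolding Sq[OF q] by (simp add: conj_inverse_conj[OF aq])
  then show "upper (matrix_inv (b q) ** ?S q ** b q)"
    using aframe_flag_stable[OF qD b, of "?S q"] aframe_flag_stable[OF qD a, of "?S q"] by blast
qed

lemma aframe_near:
  assumes p: "p \<in> X" and a: "aframe P p a"
  shows "eventually (\<lambda>q. aframe P q a) (near p)"
proof -
  have "frame (sheaf_of P) p a" using a by (simp add: aframe_def)
  from frame_near[OF p this] near_not_D[OF p] show ?thesis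
  proof eventually_elim
    case (elim q)
    show ?case
    proof (cases "q \<in> D")
      case True
      then have "q = p" using elim by blast
      then show ?thesis using a by simp
    next
      case False
      then show ?thesis using elim by (simp add: aframe_def)
    qed
  qed
qed

lemma PEnd0_of_frame:
  fixes P :: "('n, 'r::finite) qpar"
  assumes P: "quasi_parabolic X D P" and p: "p \<in> X" and a: "aframe P p a" and A: "regm p A"
    and tr: "eventually (\<lambda>q. trace (A q) = 0) (near p)" and up: "p \<in> D \<Longrightarrow> upper (A p)"
  shows "\<exists>V. zopen X V \<and> p \<in> V \<and> res V (\<lambda>q. a q ** A q ** matrix_inv (a q)) \<in> PEnd0 X D P V"
proof -
  have "eventually (\<lambda>q. aframe P q a \<and> regm q A \<and> trace (A q) = 0 \<and> (q \<in> D \<longrightarrow> upper (A q))) (near p)"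
    using aframe_near[OF p a] regm_near[OF p A] tr near_not_D[OF p]
    by eventually_elim (use up in blast)
  then obtain V where "zopen X V" "p \<in> V" "\<forall>q\<in>V. aframe P q a \<and> regm q A \<and> trace (A q) = 0 \<and> (q \<in> D \<longrightarrow> upper (A q))"
    unfolding eventually_near[OF p] by blast
  then show ?thesis using PEnd0_frameI[OF P, of V a A] by blast
qed

end

section \<open>The isomorphism on fibres away from the marked points\<close>

lemma upper_mult: "upper A \<Longrightarrow> upper B \<Longrightarrow> upper (A ** B)"
proof -
  assume *: "upper A" "upper B"
  have "(A ** B) $ i $ j = 0" if "ix j < ix i" for i j
    unfolding matrix_matrix_mult_def vec_lambda_beta
  proof (rule sum.neutral, rule ballI)
    fix k show "A $ i $ k * B $ k $ j = 0"
      using * that by (cases "ix k < ix i") (auto simp: upper_def)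
  qed
  then show ?thesis by (simp add: upper_def)
qed

text \<open>\<open>lie_isomorphic_PEnd0\<close> with the isomorphism named, since the fibre maps and
  the dualized isomorphism depend on it.\<close>

definition lie_sheaf_iso :: "'n::finite point set \<Rightarrow> 'n point set \<Rightarrow> ('n, 'r::finite) qpar \<Rightarrow> ('n, 'r) qpar \<Rightarrow>
    ('n point set \<Rightarrow> ('n point \<Rightarrow> complex ^ 'r ^ 'r) \<Rightarrow> 'n point \<Rightarrow> complex ^ 'r ^ 'r) \<Rightarrow> bool" where
  "lie_sheaf_iso X D P Q \<Phi> \<longleftrightarrow> sheaf_iso X mscale mscale (PEnd0 X D P) (PEnd0 X D Q) \<Phi> \<and>
     (\<forall>U. zopen X U \<longrightarrow> (\<forall>A\<in>PEnd0 X D P U. \<forall>B\<in>PEnd0 X D P U.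
        \<Phi> U (\<lambda>p. A p ** B p - B p ** A p) = (\<lambda>p. \<Phi> U A p ** \<Phi> U B p - \<Phi> U B p ** \<Phi> U A p)))"

context marked
begin

lemma PEnd0_scale:
  assumes P: "quasi_parabolic X D P" "zopen X U" and "f \<in> regular X U" "T \<in> PEnd0 X D P U"
  shows "(\<lambda>p. mscale (f p) (T p)) \<in> PEnd0 X D P U"
  using PEnd0_combination[OF P, of "{()}" "\<lambda>_. f" "\<lambda>_. T"] assms by simp

lemma PEnd0_add:
  assumes P: "quasi_parabolic X D P" "zopen X U" and T: "S \<in> PEnd0 X D P U" "T \<in> PEnd0 X D P U"
  shows "(\<lambda>p. S p + T p) \<in> PEnd0 X D P U"
proof -
  have one: "res U (\<lambda>_. 1) \<in> regular X U"
    unfolding regular_iff[OF P(2)]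
  proof (intro conjI ballI)
    fix p assume "p \<in> U"
    then show "reg p (res U (\<lambda>_. 1))"
      by (intro reg_cong[OF _ reg_const[of p 1]] eventually_mono[OF near_open[OF P(2)]]) (simp_all add: res_def)
  qed (simp add: res_def)
  have "(\<lambda>p. \<Sum>k\<in>{True, False}. mscale (res U (\<lambda>_. 1) p) ((if k then S else T) p)) \<in> PEnd0 X D P U"
    by (rule PEnd0_combination[OF P]) (use one T in auto)
  moreover have "(\<lambda>p. \<Sum>k\<in>{True, False}. mscale (res U (\<lambda>_. 1) p) ((if k then S else T) p)) = (\<lambda>p. S p + T p)"
    using T unfolding PEnd0_iff[OF P] by (auto simp: res_def)
  ultimately show ?thesis by simp
qed

lemma const_regular: "zopen X U \<Longrightarrow> res U (\<lambda>_. c) \<in> regular X U"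
  unfolding regular_iff
proof (intro conjI ballI)
  assume U: "zopen X U"
  fix p assume "p \<in> U"
  then show "reg p (res U (\<lambda>_. c))"
    by (intro reg_cong[OF _ reg_const[of p c]] eventually_mono[OF near_open[OF U]]) (simp_all add: res_def)
qed (simp add: res_def)

lemma regular_res:
  assumes V: "zopen X V" and f: "\<And>p. p \<in> V \<Longrightarrow> reg p f"
  shows "res V f \<in> regular X V"
  unfolding regular_iff[OF V]
proof (intro conjI ballI)
  fix p assume p: "p \<in> V"
  show "reg p (res V f)"
    by (rule reg_cong[OF eventually_mono[OF near_open[OF V p]] f[OF p]]) (simp add: res_def)
qed (simp add: res_def)

lemma PEnd0_bracket:
  assumes P: "quasi_parabolic X D P" "zopen X U" and ST: "S \<in> PEnd0 X D P U" "T \<in> PEnd0 X D P U"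
  shows "(\<lambda>p. S p ** T p - T p ** S p) \<in> PEnd0 X D P U"
  unfolding PEnd0_iff[OF P]
proof (intro conjI allI impI ballI)
  show "S p ** T p - T p ** S p = 0" if "p \<notin> U" for p
    using ST that unfolding PEnd0_iff[OF P] by simp
  fix p assume p: "p \<in> U"
  have pX: "p \<in> X" using p P(2) zopen_subset by blast
  show "trace (S p ** T p - T p ** S p) = 0" by (rule trace_bracket)
  fix a assume a: "aframe P p a"
  let ?c = "\<lambda>S q. matrix_inv (a q) ** S q ** a q"
  have reg: "regm p (?c S)" "regm p (?c T)" and up: "p \<in> D \<Longrightarrow> upper (?c S p)" "p \<in> D \<Longrightarrow> upper (?c T p)"
    using ST p a unfolding PEnd0_iff[OF P] by blast+
  have eq: "?c S q ** ?c T q + mscale (- 1) (?c T q ** ?c S q) = matrix_inv (a q) ** (S q ** T q - T q ** S q) ** a q"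
    if "invertible (a q)" for q
  proof -
    have "?c S q ** ?c T q = matrix_inv (a q) ** (S q ** T q) ** a q" for S T
    proof -
      have "?c S q ** ?c T q = matrix_inv (a q) ** S q ** (a q ** matrix_inv (a q)) ** T q ** a q"
        by (simp only: matrix_mul_assoc)
      then show ?thesis by (simp add: matrix_inv[OF that] matrix_mul_assoc)
    qed
    then show ?thesis by (simp add: mat_ring_simps)
  qed
  have inv: "eventually (\<lambda>q. invertible (a q)) (near p)"
    using a by (intro frame_invertible) (auto simp: aframe_def)
  show "regm p (\<lambda>q. matrix_inv (a q) ** (S q ** T q - T q ** S q) ** a q)"
  proof (rule regm_cong)
    show "eventually (\<lambda>q. ?c S q ** ?c T q + mscale (- 1) (?c T q ** ?c S q) =
        matrix_inv (a q) ** (S q ** T q - T q ** S q) ** a q) (near p)"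
      using inv by eventually_elim (rule eq)
    show "regm p (\<lambda>q. ?c S q ** ?c T q + mscale (- 1) (?c T q ** ?c S q))"
      by (intro regm_add regm_mscale[OF reg_const] regm_mult reg)
  qed
  assume "p \<in> D"
  then have "upper (?c S p ** ?c T p + mscale (- 1) (?c T p ** ?c S p))"
    by (intro upper_add upper_mscale upper_mult up)
  then show "upper (matrix_inv (a p) ** (S p ** T p - T p ** S p) ** a p)"
    using eq[OF near_self[OF pX inv]] by simp
qed

text \<open>Constant matrices in an adapted frame do it: away from \<open>D\<close> there is no
  triangularity to respect. The neighbourhood is the same for all \<open>A\<close>.\<close>

lemma PEnd0_extend:
  fixes P :: "('n, 'r::finite) qpar"
  assumes P: "quasi_parabolic X D P" and q: "q \<in> X" "q \<notin> D"
  shows "\<exists>V. zopen X V \<and> q \<in> V \<and> (\<forall>A. trace A = 0 \<longrightarrow> (\<exists>S\<in>PEnd0 X D P V. S q = A))"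
proof -
  obtain a where a: "aframe P q a" using aframe_exists[OF P q(1)] by blast
  have "eventually (\<lambda>q'. aframe P q' a \<and> q' \<notin> D) (near q)"
    using aframe_near[OF q(1) a] near_not_D[OF q(1)] by eventually_elim (use q in blast)
  then obtain V where V: "zopen X V" "q \<in> V" "\<And>q'. q' \<in> V \<Longrightarrow> aframe P q' a \<and> q' \<notin> D"
    unfolding eventually_near[OF q(1)] by blast
  have inv: "invertible (a q)" using aframe_invertible[OF q(1) a] .
  have "\<exists>S\<in>PEnd0 X D P V. S q = A" if A: "trace A = 0" for A
  proof
    show "res V (\<lambda>q'. a q' ** (matrix_inv (a q) ** A ** a q) ** matrix_inv (a q')) \<in> PEnd0 X D P V"
      by (rule PEnd0_frameI[OF P V(1)]) (use V(3) A in \<open>simp add: regm_const trace_conj'[OF inv]\<close>)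
    show "res V (\<lambda>q'. a q' ** (matrix_inv (a q) ** A ** a q) ** matrix_inv (a q')) q = A"
      using V(2) by (simp add: res_def conj_inverse_conj[OF inv])
  qed
  then show ?thesis using V by blast
qed

text \<open>The matrix coefficients in a frame vanish at \<open>q\<close>, and the sections they
  multiply are constant matrices in this frame. Linearity over regular functions then lets an
  isomorphism of sheaves descend to the fibre at \<open>q\<close>.\<close>

lemma PEnd0_vanishing:
  fixes P :: "('n, 'r::finite) qpar"
  assumes P: "quasi_parabolic X D P" and q: "q \<in> X" "q \<notin> D" and U: "zopen X U" "q \<in> U"
    and S: "S \<in> PEnd0 X D P U" "S q = 0"
  obtains V f T where "zopen X V" "q \<in> V" "V \<subseteq> U" "\<And>k :: 'r \<times> 'r. f k \<in> regular X V" "\<And>k. f k q = 0"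
    "\<And>k. T k \<in> PEnd0 X D P V" "res V S = (\<lambda>p. \<Sum>k\<in>UNIV. mscale (f k p) (T k p))"
proof -
  obtain a where a: "aframe P q a" using aframe_exists[OF P q(1)] by blast
  define M where "M q' = matrix_inv (a q') ** S q' ** a q'" for q'
  have M: "regm q M"
    using S(1) U(2) a unfolding PEnd0_iff[OF P U(1)] M_def[abs_def] by blast
  have "eventually (\<lambda>q'. aframe P q' a \<and> q' \<notin> D \<and> regm q' M \<and> q' \<in> U) (near q)"
    using aframe_near[OF q(1) a] near_not_D[OF q(1)] regm_near[OF q(1) M] near_open[OF U]
    by eventually_elim (use q in blast)
  then obtain V where V: "zopen X V" "q \<in> V" and loc: "\<And>q'. q' \<in> V \<Longrightarrow> aframe P q' a \<and> q' \<notin> D \<and> regm q' M \<and> q' \<in> U"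
    unfolding eventually_near[OF q(1)] by blast
  define E where "E k = traceless (outer (axis (fst k) 1) (axis (snd k) 1) :: complex ^ 'r ^ 'r)" for k
  define f where "f k = res V (\<lambda>q'. M q' $ fst k $ snd k)" for k
  define T where "T k = res V (\<lambda>q'. a q' ** E k ** matrix_inv (a q'))" for k
  have 1: "f k \<in> regular X V" for k
    unfolding f_def by (rule regular_res[OF V(1)]) (use loc in \<open>auto simp: regm_def\<close>)
  have 2: "f k q = 0" for k
    using S(2) by (simp add: f_def res_def M_def)
  have 3: "T k \<in> PEnd0 X D P V" for k
    unfolding T_def by (rule PEnd0_frameI[OF P V(1)]) (use loc in \<open>simp add: regm_const E_def\<close>)
  \<comment> \<open>The traceless parts \<open>E k\<close> of the matrix units are linearly
    dependent, but they still reproduce a traceless \<open>A\<close>: the scalar corrections add up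
    to the trace of \<open>A\<close> divided by the rank.\<close>
  have sum: "(\<Sum>k\<in>UNIV. mscale (A $ fst k $ snd k) (E k)) = A" if A: "trace A = 0" for A
  proof -
    have ent: "(\<Sum>k\<in>UNIV. A $ fst k $ snd k * outer (axis (fst k) 1) (axis (snd k) 1) $ i $ j) = A $ i $ j" for i j
    proof -
      have "(\<Sum>k\<in>UNIV. A $ fst k $ snd k * outer (axis (fst k) 1) (axis (snd k) 1) $ i $ j) =
          (\<Sum>k\<in>UNIV. if k = (i, j) then A $ i $ j else 0)"
        by (intro sum.cong) (auto simp: axis_one_nth split: if_splits)
      then show ?thesis by simp
    qed
    have tr: "(\<Sum>k\<in>UNIV. A $ fst k $ snd k * trace (outer (axis (fst k) 1) (axis (snd k) 1) :: complex ^ 'r ^ 'r)) = trace A"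
      unfolding trace_def sum_distrib_left by (subst sum.swap) (simp only: ent)
    have "(\<Sum>k\<in>UNIV. A $ fst k $ snd k * E k $ i $ j) = A $ i $ j - trace A / of_nat CARD('r) * mat 1 $ i $ j" for i j
      unfolding tr[symmetric] ent[of i j, symmetric]
      by (simp add: E_def traceless_def right_diff_distrib sum_subtractf sum_distrib_left sum_divide_distrib mult_ac)
    then show ?thesis
      by (intro mat_eqI) (simp add: A)
  qed
  have "res V S = (\<lambda>p. \<Sum>k\<in>UNIV. mscale (f k p) (T k p))"
  proof
    fix p show "res V S p = (\<Sum>k\<in>UNIV. mscale (f k p) (T k p))"
    proof (cases "p \<in> V")
      case False
      then show ?thesis by (simp add: res_def f_def)
    next
      case True
      have pX: "p \<in> X" using True V zopen_subset by blast
      have inv: "invertible (a p)" using loc[OF True] aframe_invertible[OF pX] by blast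
      have "trace (M p) = 0"
        using S(1) loc[OF True] unfolding PEnd0_iff[OF P U(1)] M_def by (simp add: trace_conj'[OF inv])
      then have "S p = a p ** (\<Sum>k\<in>UNIV. mscale (M p $ fst k $ snd k) (E k)) ** matrix_inv (a p)"
        by (simp add: sum) (simp add: M_def conj_inverse_conj[OF inv])
      also have "\<dots> = (\<Sum>k\<in>UNIV. mscale (M p $ fst k $ snd k) (a p ** E k ** matrix_inv (a p)))"
        by (simp add: mat_mult_sum_left mat_mult_sum_right mscale_mult_left mscale_mult_right)
      finally show ?thesis
        using True by (simp add: res_def f_def T_def)
    qed
  qed
  then show ?thesis
    using that[of V f T] V loc 1 2 3 by blast
qed

definition sl_germ :: "'n point \<Rightarrow> ('n point \<Rightarrow> complex ^ 'r::finite ^ 'r) \<Rightarrow> bool" where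
  "sl_germ p A \<longleftrightarrow> regm p A \<and> eventually (\<lambda>q. trace (A q) = 0) (near p) \<and> (p \<in> D \<longrightarrow> upper (A p))"

context
  fixes P Q :: "('n, 'r::finite) qpar" and \<Phi>
  assumes P: "quasi_parabolic X D P" and Q: "quasi_parabolic X D Q" and iso: "lie_sheaf_iso X D P Q \<Phi>"
begin

lemma bij_\<Phi>: "zopen X U \<Longrightarrow> bij_betw (\<Phi> U) (PEnd0 X D P U) (PEnd0 X D Q U)"
  and \<Phi>_add: "zopen X U \<Longrightarrow> S \<in> PEnd0 X D P U \<Longrightarrow> T \<in> PEnd0 X D P U \<Longrightarrow>
    \<Phi> U (\<lambda>p. S p + T p) = (\<lambda>p. \<Phi> U S p + \<Phi> U T p)"
  and \<Phi>_scale: "zopen X U \<Longrightarrow> f \<in> regular X U \<Longrightarrow> S \<in> PEnd0 X D P U \<Longrightarrow>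
    \<Phi> U (\<lambda>p. mscale (f p) (S p)) = (\<lambda>p. mscale (f p) (\<Phi> U S p))"
  and \<Phi>_res: "zopen X U \<Longrightarrow> zopen X V \<Longrightarrow> V \<subseteq> U \<Longrightarrow> S \<in> PEnd0 X D P U \<Longrightarrow> \<Phi> V (res V S) = res V (\<Phi> U S)"
  and \<Phi>_bracket: "zopen X U \<Longrightarrow> S \<in> PEnd0 X D P U \<Longrightarrow> T \<in> PEnd0 X D P U \<Longrightarrow>
    \<Phi> U (\<lambda>p. S p ** T p - T p ** S p) = (\<lambda>p. \<Phi> U S p ** \<Phi> U T p - \<Phi> U T p ** \<Phi> U S p)"
  using iso unfolding lie_sheaf_iso_def sheaf_iso_def by blast+

lemma \<Phi>_mem: "zopen X U \<Longrightarrow> S \<in> PEnd0 X D P U \<Longrightarrow> \<Phi> U S \<in> PEnd0 X D Q U"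
  using bij_\<Phi> by (auto simp: bij_betw_def)

lemma \<Phi>_inj: "zopen X U \<Longrightarrow> S \<in> PEnd0 X D P U \<Longrightarrow> T \<in> PEnd0 X D P U \<Longrightarrow> \<Phi> U S = \<Phi> U T \<Longrightarrow> S = T"
  using bij_\<Phi> unfolding bij_betw_def inj_on_def by blast

lemma \<Phi>_surj: "zopen X U \<Longrightarrow> T \<in> PEnd0 X D Q U \<Longrightarrow> \<exists>S\<in>PEnd0 X D P U. \<Phi> U S = T"
  using bij_\<Phi>[of U] unfolding bij_betw_def by (metis imageE)

lemma \<Phi>_combination:
  assumes U: "zopen X U" and K: "finite K" and f: "\<And>k. k \<in> K \<Longrightarrow> f k \<in> regular X U"
    and T: "\<And>k. k \<in> K \<Longrightarrow> T k \<in> PEnd0 X D P U"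
  shows "\<Phi> U (\<lambda>p. \<Sum>k\<in>K. mscale (f k p) (T k p)) = (\<lambda>p. \<Sum>k\<in>K. mscale (f k p) (\<Phi> U (T k) p))"
  using K f T
proof (induction K rule: finite_induct)
  case empty
  have "(\<lambda>p. 0) \<in> PEnd0 X D P U"
    using PEnd0_combination[OF P U, of "{}"] by simp
  from \<Phi>_scale[OF U const_regular[OF U, of 0] this] show ?case
    by (simp add: res_def)
next
  case (insert k K)
  have "(\<lambda>p. mscale (f k p) (T k p)) \<in> PEnd0 X D P U"
    using insert by (intro PEnd0_scale[OF P U]) auto
  moreover have "(\<lambda>p. \<Sum>k\<in>K. mscale (f k p) (T k p)) \<in> PEnd0 X D P U"
    using insert by (intro PEnd0_combination[OF P U]) auto
  ultimately have "\<Phi> U (\<lambda>p. mscale (f k p) (T k p) + (\<Sum>k\<in>K. mscale (f k p) (T k p))) =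
      (\<lambda>p. \<Phi> U (\<lambda>p. mscale (f k p) (T k p)) p + \<Phi> U (\<lambda>p. \<Sum>k\<in>K. mscale (f k p) (T k p)) p)"
    by (rule \<Phi>_add[OF U])
  moreover have "\<Phi> U (\<lambda>p. mscale (f k p) (T k p)) = (\<lambda>p. mscale (f k p) (\<Phi> U (T k) p))"
    using insert by (intro \<Phi>_scale[OF U]) auto
  ultimately show ?case using insert by simp
qed

text \<open>The coefficients vanishing at \<open>q\<close> pass through \<open>\<Phi>\<close> by
  linearity. For the converse the sections of the target sheaf are first lifted by
  surjectivity.\<close>

lemma \<Phi>_vanish:
  assumes q: "q \<in> X" "q \<notin> D" and U: "zopen X U" "q \<in> U" and S: "S \<in> PEnd0 X D P U"
  shows "S q = 0 \<longleftrightarrow> \<Phi> U S q = 0"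
proof
  assume "S q = 0"
  then obtain V f T where V: "zopen X V" "q \<in> V" "V \<subseteq> U" "\<And>k :: 'r \<times> 'r. f k \<in> regular X V" "\<And>k. f k q = 0"
    "\<And>k. T k \<in> PEnd0 X D P V" "res V S = (\<lambda>p. \<Sum>k\<in>UNIV. mscale (f k p) (T k p))"
    using PEnd0_vanishing[OF P q U S] by blast
  have "\<Phi> V (\<lambda>p. \<Sum>k\<in>UNIV. mscale (f k p) (T k p)) = (\<lambda>p. \<Sum>k\<in>UNIV. mscale (f k p) (\<Phi> V (T k) p))"
    by (rule \<Phi>_combination[OF V(1)]) (use V in auto)
  from fun_cong[OF this, of q] have "res V (\<Phi> U S) q = (\<Sum>k\<in>UNIV. mscale (f k q) (\<Phi> V (T k) q))"
    unfolding V(7)[symmetric] \<Phi>_res[OF U(1) V(1,3) S] .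
  then show "\<Phi> U S q = 0"
    using V(2,5) by (simp add: res_def)
next
  assume "\<Phi> U S q = 0"
  then obtain V f T where V: "zopen X V" "q \<in> V" "V \<subseteq> U" "\<And>k :: 'r \<times> 'r. f k \<in> regular X V" "\<And>k. f k q = 0"
    "\<And>k. T k \<in> PEnd0 X D Q V" "res V (\<Phi> U S) = (\<lambda>p. \<Sum>k\<in>UNIV. mscale (f k p) (T k p))"
    using PEnd0_vanishing[OF Q q U \<Phi>_mem[OF U(1) S]] by blast
  have "\<forall>k. \<exists>S'. S' \<in> PEnd0 X D P V \<and> \<Phi> V S' = T k"
    using \<Phi>_surj[OF V(1) V(6)] by blast
  then obtain S' where S': "\<And>k. S' k \<in> PEnd0 X D P V" "\<And>k. \<Phi> V (S' k) = T k"
    by metis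
  have "\<Phi> V (\<lambda>p. \<Sum>k\<in>UNIV. mscale (f k p) (S' k p)) = (\<lambda>p. \<Sum>k\<in>UNIV. mscale (f k p) (\<Phi> V (S' k) p))"
    by (rule \<Phi>_combination[OF V(1)]) (use V S' in auto)
  then have "\<Phi> V (\<lambda>p. \<Sum>k\<in>UNIV. mscale (f k p) (S' k p)) = \<Phi> V (res V S)"
    using \<Phi>_res[OF U(1) V(1,3) S] V(7) S'(2) by simp
  moreover have "(\<lambda>p. \<Sum>k\<in>UNIV. mscale (f k p) (S' k p)) \<in> PEnd0 X D P V"
    by (rule PEnd0_combination[OF P V(1)]) (use V(4) S'(1) in simp_all)
  ultimately have "(\<lambda>p. \<Sum>k\<in>UNIV. mscale (f k p) (S' k p)) = res V S"
    using \<Phi>_inj[OF V(1) _ PEnd0_res[OF P U(1) V(1,3) S]] by blast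
  from fun_cong[OF this, of q] have "res V S q = (\<Sum>k\<in>UNIV. mscale (f k q) (S' k q))"
    by simp
  then show "S q = 0"
    using V(2,5) by (simp add: res_def)
qed

text \<open>A choice among the values at \<open>q\<close> of images of sections through
  \<open>A\<close>. For \<open>q\<close> off \<open>D\<close> it is independent of the section by
  \<open>fibre_map_eq\<close>, and it is applied only there.\<close>

definition fibre_map :: "'n point \<Rightarrow> complex ^ 'r ^ 'r \<Rightarrow> complex ^ 'r ^ 'r" where
  "fibre_map q A = (SOME B. \<exists>U S. zopen X U \<and> q \<in> U \<and> S \<in> PEnd0 X D P U \<and> S q = A \<and> B = \<Phi> U S q)"

lemma fibre_map_eq:
  assumes q: "q \<in> X" "q \<notin> D" and U: "zopen X U" "q \<in> U" and S: "S \<in> PEnd0 X D P U"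
  shows "fibre_map q (S q) = \<Phi> U S q"
  unfolding fibre_map_def
proof (rule someI2_ex)
  show "\<exists>B U' S'. zopen X U' \<and> q \<in> U' \<and> S' \<in> PEnd0 X D P U' \<and> S' q = S q \<and> B = \<Phi> U' S' q"
    using U S by blast
next
  fix B assume "\<exists>U' S'. zopen X U' \<and> q \<in> U' \<and> S' \<in> PEnd0 X D P U' \<and> S' q = S q \<and> B = \<Phi> U' S' q"
  then obtain U' S' where U': "zopen X U'" "q \<in> U'" and S': "S' \<in> PEnd0 X D P U'" "S' q = S q" "B = \<Phi> U' S' q"
    by blast
  define W where "W = U \<inter> U'"
  have W: "zopen X W" "q \<in> W" "W \<subseteq> U" "W \<subseteq> U'" using U U' zopen_Int by (auto simp: W_def)
  have 1: "res W S \<in> PEnd0 X D P W" "res W S' \<in> PEnd0 X D P W"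
    using PEnd0_res[OF P U(1) W(1,3) S] PEnd0_res[OF P U'(1) W(1,4) S'(1)] .
  have 2: "(\<lambda>p. mscale (res W (\<lambda>_. - 1) p) (res W S' p)) \<in> PEnd0 X D P W"
    by (rule PEnd0_scale[OF P W(1) const_regular[OF W(1)] 1(2)])
  \<comment> \<open>The difference of the two sections vanishes at \<open>q\<close>; it is written
    as a sum with the multiple by -1 because only sums and multiples are known to pass through
    \<open>\<Phi>\<close>.\<close>
  have "\<Phi> W (\<lambda>p. res W S p + mscale (res W (\<lambda>_. - 1) p) (res W S' p)) q = 0"
    using \<Phi>_vanish[OF q W(1,2) PEnd0_add[OF P W(1) 1(1) 2]] S'(2) W(2) by (simp add: res_def)
  then have "\<Phi> U S q = \<Phi> U' S' q"
    using \<Phi>_add[OF W(1) 1(1) 2] \<Phi>_scale[OF W(1) const_regular[OF W(1), of "- 1"] 1(2)]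
      \<Phi>_res[OF U(1) W(1,3) S] \<Phi>_res[OF U'(1) W(1,4) S'(1)] W(2) by (simp add: res_def)
  then show "B = \<Phi> U S q" using S'(3) by simp
qed

lemma sl_aut_fibre_map:
  assumes q: "q \<in> X" "q \<notin> D" shows "sl_aut (fibre_map q)"
proof -
  obtain V where V: "zopen X V" "q \<in> V" "\<And>A. trace A = 0 \<Longrightarrow> \<exists>S\<in>PEnd0 X D P V. S q = A"
    using PEnd0_extend[OF P q] by blast
  obtain V' where V': "zopen X V'" "q \<in> V'" "\<And>A. trace A = 0 \<Longrightarrow> \<exists>S\<in>PEnd0 X D Q V'. S q = A"
    using PEnd0_extend[OF Q q] by blast
  note eq = fibre_map_eq[OF q V(1,2)]
  show ?thesis
    unfolding sl_aut_def
  proof (intro conjI allI impI; (elim conjE)?)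
    fix A B :: "complex ^ 'r ^ 'r" assume *: "trace A = 0" "trace B = 0"
    obtain S T where S: "S \<in> PEnd0 X D P V" "S q = A" and T: "T \<in> PEnd0 X D P V" "T q = B"
      using V(3)[OF *(1)] V(3)[OF *(2)] by blast
    show "fibre_map q (A + B) = fibre_map q A + fibre_map q B"
      using eq[OF PEnd0_add[OF P V(1) S(1) T(1)]] eq[OF S(1)] eq[OF T(1)] \<Phi>_add[OF V(1) S(1) T(1)] S T by simp
    show "fibre_map q (A ** B - B ** A) = fibre_map q A ** fibre_map q B - fibre_map q B ** fibre_map q A"
      using eq[OF PEnd0_bracket[OF P V(1) S(1) T(1)]] eq[OF S(1)] eq[OF T(1)] \<Phi>_bracket[OF V(1) S(1) T(1)] S T by simp
  next
    fix A :: "complex ^ 'r ^ 'r" and c assume *: "trace A = 0"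
    obtain S where S: "S \<in> PEnd0 X D P V" "S q = A" using V(3)[OF *] by blast
    have reg: "res V (\<lambda>_. c) \<in> regular X V" by (rule const_regular[OF V(1)])
    show "fibre_map q (mscale c A) = mscale c (fibre_map q A)"
      using eq[OF PEnd0_scale[OF P V(1) reg S(1)]] eq[OF S(1)] \<Phi>_scale[OF V(1) reg S(1)] S V(2) by (simp add: res_def)
    show "trace (fibre_map q A) = 0"
      using \<Phi>_mem[OF V(1) S(1)] V(2) eq[OF S(1)] S(2) unfolding PEnd0_iff[OF Q V(1)] by simp
    show "A = 0" if "fibre_map q A = 0"
      using that \<Phi>_vanish[OF q V(1,2) S(1)] eq[OF S(1)] S(2) by simp
  next
    fix B :: "complex ^ 'r ^ 'r" assume "trace B = 0"
    then obtain T where T: "T \<in> PEnd0 X D Q V'" "T q = B" using V'(3) by blast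
    then obtain S where S: "S \<in> PEnd0 X D P V'" "\<Phi> V' S = T" using \<Phi>_surj[OF V'(1)] by blast
    have "trace (S q) = 0" using S(1) V'(2) unfolding PEnd0_iff[OF P V'(1)] by blast
    moreover have "fibre_map q (S q) = B" using fibre_map_eq[OF q V'(1,2) S(1)] S(2) T(2) by simp
    ultimately show "\<exists>A. trace A = 0 \<and> fibre_map q A = B" by blast
  qed
qed

text \<open>Correspondence under the isomorphism, written in coordinates. It is required off
  \<open>D\<close>, where the fibre maps make sense; for regular germs density carries its
  consequences to \<open>D\<close>.\<close>

definition germ_related :: "'n point \<Rightarrow> ('n point \<Rightarrow> complex ^ 'r ^ 'r) \<Rightarrow> ('n point \<Rightarrow> complex ^ 'r ^ 'r) \<Rightarrow>
    ('n point \<Rightarrow> complex ^ 'r ^ 'r) \<Rightarrow> ('n point \<Rightarrow> complex ^ 'r ^ 'r) \<Rightarrow> bool" where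
  "germ_related p a b A B \<longleftrightarrow> eventually (\<lambda>q. q \<notin> D \<longrightarrow>
    fibre_map q (a q ** A q ** matrix_inv (a q)) = b q ** B q ** matrix_inv (b q)) (near p)"

lemma PEnd0_sl_germ:
  assumes R: "quasi_parabolic X D R" and V: "zopen X V" "p \<in> V" and T: "T \<in> PEnd0 X D R V" and b: "aframe R p b"
  shows "sl_germ p (\<lambda>q. matrix_inv (b q) ** T q ** b q)"
proof -
  have inv: "eventually (\<lambda>q. invertible (b q)) (near p)"
    using b by (intro frame_invertible) (auto simp: aframe_def)
  have "eventually (\<lambda>q. trace (matrix_inv (b q) ** T q ** b q) = 0) (near p)"
    using inv near_open[OF V]
  proof eventually_elim
    case (elim q)
    then show ?case using T unfolding PEnd0_iff[OF R V(1)] by (simp add: trace_conj')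
  qed
  then show ?thesis
    using T V(2) b unfolding PEnd0_iff[OF R V(1)] sl_germ_def by blast
qed

lemma germ_related_forward:
  assumes p: "p \<in> X" and a: "aframe P p a" and b: "aframe Q p b" and A: "sl_germ p A"
  shows "\<exists>B. sl_germ p B \<and> germ_related p a b A B"
proof -
  obtain V where V: "zopen X V" "p \<in> V" and S: "res V (\<lambda>q. a q ** A q ** matrix_inv (a q)) \<in> PEnd0 X D P V"
    using PEnd0_of_frame[OF P p a] A unfolding sl_germ_def by blast
  let ?S = "res V (\<lambda>q. a q ** A q ** matrix_inv (a q))"
  define B where "B q = matrix_inv (b q) ** \<Phi> V ?S q ** b q" for q
  have inv: "eventually (\<lambda>q. invertible (b q)) (near p)"
    using b by (intro frame_invertible) (auto simp: aframe_def)
  have "germ_related p a b A B"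
    unfolding germ_related_def using near_open[OF V] inv near_in_X[OF p]
  proof eventually_elim
    case (elim q)
    show ?case
    proof
      assume q: "q \<notin> D"
      have "?S q = a q ** A q ** matrix_inv (a q)" using elim(1) by (simp add: res_def)
      then show "fibre_map q (a q ** A q ** matrix_inv (a q)) = b q ** B q ** matrix_inv (b q)"
        using fibre_map_eq[OF elim(3) q V(1) elim(1) S] elim(2) by (simp add: B_def conj_inverse_conj)
    qed
  qed
  then show ?thesis
    using PEnd0_sl_germ[OF Q V \<Phi>_mem[OF V(1) S] b] unfolding B_def[abs_def] by blast
qed

lemma germ_related_backward:
  assumes p: "p \<in> X" and a: "aframe P p a" and b: "aframe Q p b" and B: "sl_germ p B"
  shows "\<exists>A. sl_germ p A \<and> germ_related p a b A B"
proof -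
  obtain V where V: "zopen X V" "p \<in> V" and T: "res V (\<lambda>q. b q ** B q ** matrix_inv (b q)) \<in> PEnd0 X D Q V"
    using PEnd0_of_frame[OF Q p b] B unfolding sl_germ_def by blast
  let ?T = "res V (\<lambda>q. b q ** B q ** matrix_inv (b q))"
  obtain S where S: "S \<in> PEnd0 X D P V" "\<Phi> V S = ?T" using \<Phi>_surj[OF V(1) T] by blast
  define A where "A q = matrix_inv (a q) ** S q ** a q" for q
  have inv: "eventually (\<lambda>q. invertible (a q)) (near p)"
    using a by (intro frame_invertible) (auto simp: aframe_def)
  have "germ_related p a b A B"
    unfolding germ_related_def using near_open[OF V] inv near_in_X[OF p]
  proof eventually_elim
    case (elim q)
    show ?case
    proof
      assume q: "q \<notin> D"
      have "a q ** A q ** matrix_inv (a q) = S q" using elim(2) by (simp add: A_def conj_inverse_conj)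
      then show "fibre_map q (a q ** A q ** matrix_inv (a q)) = b q ** B q ** matrix_inv (b q)"
        using fibre_map_eq[OF elim(3) q V(1) elim(1) S(1)] elim(1) S(2) by (simp add: res_def)
    qed
  qed
  then show ?thesis
    using PEnd0_sl_germ[OF P V S(1) a] unfolding A_def[abs_def] by blast
qed

end

end

section \<open>Normal form of matrices normalizing the Iwahori order\<close>

context marked
begin

definition gl_germ :: "'n point \<Rightarrow> ('n point \<Rightarrow> complex ^ 'r::finite ^ 'r) \<Rightarrow> bool" where
  "gl_germ p A \<longleftrightarrow> regm p A \<and> (p \<in> D \<longrightarrow> upper (A p))"

lemma unif_divide: "unif x t \<Longrightarrow> reg x f \<Longrightarrow> f x = 0 \<Longrightarrow> \<exists>h. reg x h \<and> eventually (\<lambda>q. f q = t q * h q) (near x)"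
  unfolding unif_def by blast

text \<open>Conjugation by the shift moves both indices of an entry by one place, and multiplies or
  divides the entry by \<open>t\<close> when exactly one index wraps round. Division concerns only
  entries of the last row left of the diagonal, and these vanish at \<open>x\<close>.\<close>

lemma cyc_normalizes:
  fixes A :: "'n point \<Rightarrow> complex ^ 'r::finite ^ 'r"
  assumes x: "x \<in> D" and t: "unif x t" and A: "gl_germ x A"
  shows "\<exists>B. gl_germ x B \<and> eventually (\<lambda>q. A q ** cyc (t q) = cyc (t q) ** B q) (near x)"
proof -
  have regA: "reg x (\<lambda>q. A q $ k $ j)" for k j using A by (simp add: gl_germ_def regm_def)
  have upA: "ix j < ix k \<Longrightarrow> A x $ k $ j = 0" for k j using A x by (simp add: gl_germ_def upper_def)
  have t': "reg x t" "t x = 0" using t by (auto simp: unif_def)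
  have "\<exists>h. reg x h \<and> (ix (nxt j) < ix (nxt k) \<longrightarrow> h x = 0) \<and> eventually (\<lambda>q.
      (if ix (nxt k) = 0 then t q else 1) * h q = A q $ k $ j * (if ix (nxt j) = 0 then t q else 1)) (near x)" for k j :: 'r
  proof -
    consider "ix (nxt k) = 0" "ix (nxt j) = 0" | "ix (nxt k) = 0" "ix (nxt j) \<noteq> 0" | "ix (nxt k) \<noteq> 0"
      by blast
    then show ?thesis
    proof cases
      case 1
      then show ?thesis using regA by (intro exI[of _ "\<lambda>q. A q $ k $ j"]) simp
    next
      case 2
      then have "ix j < ix k" using ix_nxt_cases[of k] ix_nxt_cases[of j] by auto
      then obtain h where h: "reg x h" "eventually (\<lambda>q. A q $ k $ j = t q * h q) (near x)"
        using unif_divide[OF t regA upA] by blast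
      have "eventually (\<lambda>q. t q * h q = A q $ k $ j) (near x)"
        using h(2) by eventually_elim simp
      then show ?thesis using 2 h(1) by (intro exI[of _ h]) simp
    next
      case 3
      have "A x $ k $ j * (if ix (nxt j) = 0 then t x else 1) = 0" if "ix (nxt j) < ix (nxt k)"
        using that 3 upA[of j k] t'(2) ix_nxt_cases[of k] ix_nxt_cases[of j] by auto
      moreover have "reg x (\<lambda>q. A q $ k $ j * (if ix (nxt j) = 0 then t q else 1))"
        using regA t'(1) by (cases "ix (nxt j) = 0") (auto intro: reg_mult)
      ultimately show ?thesis
        using 3 by (intro exI[of _ "\<lambda>q. A q $ k $ j * (if ix (nxt j) = 0 then t q else 1)"]) simp
    qed
  qed
  then have "\<forall>k. \<forall>j. \<exists>h. reg x h \<and> (ix (nxt j) < ix (nxt k) \<longrightarrow> h x = 0) \<and> eventually (\<lambda>q.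
      (if ix (nxt k) = 0 then t q else 1) * h q = A q $ k $ j * (if ix (nxt j) = 0 then t q else 1)) (near x)"
    by blast
  then have "\<forall>k. \<exists>h. \<forall>j. reg x (h j) \<and> (ix (nxt j) < ix (nxt k) \<longrightarrow> h j x = 0) \<and> eventually (\<lambda>q.
      (if ix (nxt k) = 0 then t q else 1) * h j q = A q $ k $ j * (if ix (nxt j) = 0 then t q else 1)) (near x)"
    by (intro allI choice) blast
  then have "\<exists>h. \<forall>k j. reg x (h k j) \<and> (ix (nxt j) < ix (nxt k) \<longrightarrow> h k j x = 0) \<and> eventually (\<lambda>q.
      (if ix (nxt k) = 0 then t q else 1) * h k j q = A q $ k $ j * (if ix (nxt j) = 0 then t q else 1)) (near x)"
    by (rule choice)
  then obtain h where h: "\<And>k j. reg x (h k j)" "\<And>k j. ix (nxt j) < ix (nxt k) \<Longrightarrow> h k j x = 0"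
    "\<And>k j. eventually (\<lambda>q. (if ix (nxt k) = 0 then t q else 1) * h k j q =
        A q $ k $ j * (if ix (nxt j) = 0 then t q else 1)) (near x)"
    by blast
  define prv where "prv = inv (nxt :: 'r \<Rightarrow> 'r)"
  have prv: "prv (nxt k) = k" for k by (simp add: prv_def inv_f_f[OF bij_is_inj[OF bij_nxt]])
  have nxt: "\<exists>k. j = nxt k" for j :: 'r using bij_nxt by (metis bij_pointE)
  define B :: "'n point \<Rightarrow> complex ^ 'r ^ 'r" where "B q = (\<chi> k j. h (prv k) (prv j) q)" for q
  have B: "B q $ nxt k $ nxt j = h k j q" for q k j by (simp add: B_def prv)
  have "regm x B" unfolding regm_def B_def using h(1) by simp
  moreover have "upper (B x)"
    unfolding upper_def
  proof (intro allI impI)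
    fix i j :: 'r assume "ix j < ix i"
    then show "B x $ i $ j = 0" using nxt[of i] nxt[of j] B h(2) by auto
  qed
  moreover have "eventually (\<lambda>q. A q ** cyc (t q) = cyc (t q) ** B q) (near x)"
  proof -
    have "eventually (\<lambda>q. \<forall>k j. (if ix (nxt k) = 0 then t q else 1) * h k j q =
        A q $ k $ j * (if ix (nxt j) = 0 then t q else 1)) (near x)"
      by (intro eventually_all_finite h(3))
    then show ?thesis
    proof eventually_elim
      case (elim q)
      have "(A q ** cyc (t q)) $ k $ nxt j = (cyc (t q) ** B q) $ k $ nxt j" for k j
        using elim by (simp add: mult_cyc_nth cyc_mult_nth B)
      then have "(A q ** cyc (t q)) $ k $ j = (cyc (t q) ** B q) $ k $ j" for k j
        using nxt[of j] by auto
      then show ?case by (rule mat_eqI)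
    qed
  qed
  ultimately show ?thesis unfolding gl_germ_def by blast
qed

text \<open>Since \<open>G\<close> vanishes at \<open>x\<close>, it can be divided by
  \<open>t\<close>, and the quotient \<open>k\<close> has the left inverse \<open>H\<close>. It
  inherits the normalizing property, so \<open>k x\<close> preserves the standard flag.\<close>

lemma lattice_normal_form_zero:
  fixes G H :: "'n point \<Rightarrow> complex ^ 'r::finite ^ 'r"
  assumes x: "x \<in> D" and t: "unif x t" and G: "regm x G" and H: "regm x H"
    and HG: "eventually (\<lambda>q. H q ** G q = mscale (t q) (mat 1)) (near x)"
    and norm: "\<And>A. gl_germ x A \<Longrightarrow> \<exists>B. gl_germ x B \<and> eventually (\<lambda>q. A q ** G q = G q ** B q) (near x)"
    and zero: "G x = 0"
  shows "\<exists>k. regm x k \<and> invertible (k x) \<and> (\<forall>M\<le>CARD('r). (*v) (matrix_inv (k x)) ` stdV M = stdV M) \<and>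
    eventually (\<lambda>q. G q = mscale (t q) (k q)) (near x)"
proof -
  have xX: "x \<in> X" using x D_subset by blast
  have t0: "eventually (\<lambda>q. q \<noteq> x \<longrightarrow> t q \<noteq> 0) (near x)" using t by (simp add: unif_def)
  have "\<forall>i. \<forall>j. \<exists>h. reg x h \<and> eventually (\<lambda>q. G q $ i $ j = t q * h q) (near x)"
    using unif_divide[OF t regm_entry[OF G]] zero by simp
  then have "\<forall>i. \<exists>h. \<forall>j. reg x (h j) \<and> eventually (\<lambda>q. G q $ i $ j = t q * h j q) (near x)"
    by (intro allI choice) blast
  then have "\<exists>h. \<forall>i j. reg x (h i j) \<and> eventually (\<lambda>q. G q $ i $ j = t q * h i j q) (near x)"
    by (rule choice)
  then obtain h where h: "\<And>i j. reg x (h i j)" "\<And>i j. eventually (\<lambda>q. G q $ i $ j = t q * h i j q) (near x)"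
    by blast
  define k :: "'n point \<Rightarrow> complex ^ 'r ^ 'r" where "k q = (\<chi> i j. h i j q)" for q
  have k: "regm x k" unfolding regm_def k_def using h(1) by simp
  have "eventually (\<lambda>q. \<forall>i j. G q $ i $ j = t q * h i j q) (near x)"
    by (intro eventually_all_finite h(2))
  then have Gk: "eventually (\<lambda>q. G q = mscale (t q) (k q)) (near x)"
    by eventually_elim (rule mat_eqI, simp add: k_def)
  \<comment> \<open>Off \<open>x\<close> the factor \<open>t\<close> can be cancelled; density gives
    the identity at \<open>x\<close>.\<close>
  have "eventually (\<lambda>q. H q ** k q = mat 1) (near x)"
  proof (rule regm_zero_off_finite[OF xX, of "{x}"])
    show "eventually (\<lambda>q. q \<notin> {x} \<longrightarrow> H q ** k q = mat 1) (near x)"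
      using HG Gk t0
    proof eventually_elim
      case (elim q)
      show ?case
      proof
        assume q: "q \<notin> {x}"
        have "mscale (t q) (H q ** k q - mat 1) = 0"
          using elim(1,2) by (simp add: mscale_mult_right mscale_diff)
        then show "H q ** k q = mat 1" using elim(3) q by simp
      qed
    qed
  qed (simp_all add: regm_mult H k regm_const)
  from near_self[OF xX this] have inv: "invertible (k x)"
    using invertible_left_inverse by blast
  have "\<exists>B. upper B \<and> A ** k x = k x ** B" if A: "upper A" for A
  proof -
    have "gl_germ x (\<lambda>_. A)" using A by (simp add: gl_germ_def regm_const)
    then obtain B where B: "gl_germ x B" "eventually (\<lambda>q. A ** G q = G q ** B q) (near x)"
      using norm by blast
    have "eventually (\<lambda>q. A ** k q = k q ** B q) (near x)"
    proof (rule regm_zero_off_finite[OF xX, of "{x}"])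
      show "eventually (\<lambda>q. q \<notin> {x} \<longrightarrow> A ** k q = k q ** B q) (near x)"
        using B(2) Gk t0
      proof eventually_elim
        case (elim q)
        show ?case
        proof
          assume q: "q \<notin> {x}"
          have "mscale (t q) (A ** k q - k q ** B q) = 0"
            using elim(1,2) by (simp add: mscale_mult_right mscale_mult_left mscale_diff)
          then show "A ** k q = k q ** B q" using elim(3) q by simp
        qed
      qed
    qed (use B(1) in \<open>simp_all add: regm_mult k regm_const gl_germ_def\<close>)
    from near_self[OF xX this] show ?thesis using B(1) x by (auto simp: gl_germ_def)
  qed
  then have "\<forall>M\<le>CARD('r). (*v) (matrix_inv (k x)) ` stdV M = stdV M"
    using upper_normalizer_stdV(2)[OF inv] by blast
  then show ?thesis using k inv Gk by blast
qed

text \<open>A matrix with poles of order at most one (here multiplied by \<open>t\<close>) which normalizes the algebra of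
  the standard chain is, up to a unit normalizing this algebra, a power of the inverse of the shift. The
  number \<open>N\<close> bounds the nonzero rows of its value at \<open>x\<close>; a shift lowers it by one.\<close>

lemma lattice_normal_form:
  fixes G H :: "'n point \<Rightarrow> complex ^ 'r::finite ^ 'r"
  assumes x: "x \<in> D" and t: "unif x t" and "regm x G" "regm x H"
    and "eventually (\<lambda>q. H q ** G q = mscale (t q) (mat 1)) (near x)"
    and "\<And>A. gl_germ x A \<Longrightarrow> \<exists>B. gl_germ x B \<and> eventually (\<lambda>q. A q ** G q = G q ** B q) (near x)"
    and "\<And>i j. N \<le> ix i \<Longrightarrow> G x $ i $ j = 0"
  shows "\<exists>m k. regm x k \<and> invertible (k x) \<and> (\<forall>M\<le>CARD('r). (*v) (matrix_inv (k x)) ` stdV M = stdV M) \<and>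
    eventually (\<lambda>q. cycpow (t q) m ** G q = mscale (t q) (k q)) (near x)"
  using assms(3-)
proof (induction N arbitrary: G H)
  case (0 G H)
  have "G x = 0" by (rule mat_eqI) (simp add: 0(5))
  from lattice_normal_form_zero[OF x t 0(1-4) this] obtain k where "regm x k \<and> invertible (k x) \<and>
    (\<forall>M\<le>CARD('r). (*v) (matrix_inv (k x)) ` stdV M = stdV M) \<and> eventually (\<lambda>q. G q = mscale (t q) (k q)) (near x)"
    by blast
  then show ?case by (intro exI[of _ 0] exI[of _ k]) simp
next
  case (Suc N G H)
  note G = Suc.prems(1) and H = Suc.prems(2) and HG = Suc.prems(3) and norm = Suc.prems(4)
  have xX: "x \<in> X" using x D_subset by blast
  have t': "reg x t" "t x = 0" using t by (auto simp: unif_def)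
  show ?case
  proof (cases "G x = 0")
    case True
    from lattice_normal_form_zero[OF x t G H HG norm True] obtain k where "regm x k \<and> invertible (k x) \<and>
      (\<forall>M\<le>CARD('r). (*v) (matrix_inv (k x)) ` stdV M = stdV M) \<and> eventually (\<lambda>q. G q = mscale (t q) (k q)) (near x)"
      by blast
    then show ?thesis by (intro exI[of _ 0] exI[of _ k]) simp
  next
    case False
    obtain e where e: "ix (e :: 'r) = 0" using ix_surj[of 0, where 'r = 'r] by auto
    obtain v where v: "G x *v v \<noteq> 0" using mat_nonzero_mult_vec[OF False] by blast
    then obtain j where j: "(G x *v v) $ j \<noteq> 0" by (auto simp: vec_eq_iff)
    \<comment> \<open>The matrix unit in the first row and column \<open>j\<close> lies in the
      order, so its product with \<open>G\<close> is \<open>G ** B\<close> for some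
      \<open>B\<close>. Multiplied by \<open>H\<close> from the left this becomes \<open>t\<close>
      times \<open>B\<close> and vanishes at \<open>x\<close>; since row \<open>j\<close> of
      \<open>G x\<close> is not 0, the first column of \<open>H x\<close> must vanish.\<close>
    have "upper (outer (axis e 1) (axis j 1))"
      using e by (auto simp: upper_def axis_one_nth)
    then have "gl_germ x (\<lambda>_. outer (axis e 1) (axis j 1))" by (simp add: gl_germ_def regm_const)
    then obtain B where B: "eventually (\<lambda>q. outer (axis e 1) (axis j 1) ** G q = G q ** B q) (near x)"
      using norm by blast
    have "H x ** (outer (axis e 1) (axis j 1) ** G x) = (H x ** G x) ** B x"
      using near_self[OF xX B] by (simp add: matrix_mul_assoc)
    also have "\<dots> = 0"
      using near_self[OF xX HG] t'(2) by simp
    finally have "(H x ** (outer (axis e 1) (axis j 1) ** G x)) *v v = 0" by simp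
    then have "H x *v (outer (axis e 1) (axis j 1) *v (G x *v v)) = 0"
      by (simp add: matrix_vector_mul_assoc)
    then have "(G x *v v) $ j *s (H x *v axis e 1) = 0"
      by (simp add: outer_mult_vec vector_scalar_commute)
    then have "H x *v axis e 1 = 0" using j by simp
    then have Ho: "H x $ i $ e = 0" for i by (metis mult_vec_axis zero_index)
    have "\<forall>i. \<exists>h. reg x h \<and> eventually (\<lambda>q. H q $ i $ e = t q * h q) (near x)"
      using unif_divide[OF t regm_entry[OF H] Ho] by blast
    then have "\<exists>h. \<forall>i. reg x (h i) \<and> eventually (\<lambda>q. H q $ i $ e = t q * h i q) (near x)"
      by (rule choice)
    then obtain h where h: "\<And>i. reg x (h i)" "\<And>i. eventually (\<lambda>q. H q $ i $ e = t q * h i q) (near x)"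
      by blast
    \<comment> \<open>\<open>H\<close> times the inverse of the shift: columns move by one place,
      and the first one, just seen to vanish at \<open>x\<close>, is divided by
      \<open>t\<close>.\<close>
    define H' :: "'n point \<Rightarrow> complex ^ 'r ^ 'r" where "H' q = (\<chi> i k. if nxt k = e then h i q else H q $ i $ nxt k)" for q
    define G' where "G' q = cyc (t q) ** G q" for q
    have regH': "regm x H'"
      unfolding regm_def
    proof (intro allI)
      fix i k show "reg x (\<lambda>q. H' q $ i $ k)"
        using h(1) regm_entry[OF H] by (cases "nxt k = e") (simp_all add: H'_def)
    qed
    have regG': "regm x G'" unfolding G'_def[abs_def] by (intro regm_mult regm_cyc t' G)
    have ev_h: "eventually (\<lambda>q. \<forall>i. H q $ i $ e = t q * h i q) (near x)"
      by (intro eventually_all_finite h(2))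
    have "eventually (\<lambda>q. H' q ** G' q = mscale (t q) (mat 1)) (near x)"
      using ev_h HG
    proof eventually_elim
      case (elim q)
      have "(H' q ** cyc (t q)) $ i $ nxt k = H q $ i $ nxt k" for i k
        using elim(1) e ix_inj[of "nxt k" e] by (simp add: mult_cyc_nth H'_def)
      then have "(H' q ** cyc (t q)) $ i $ k = H q $ i $ k" for i k
        using bij_nxt by (metis bij_pointE)
      then have "H' q ** cyc (t q) = H q" by (rule mat_eqI)
      then show ?case using elim(2) by (simp add: G'_def matrix_mul_assoc)
    qed
    moreover have "\<exists>B. gl_germ x B \<and> eventually (\<lambda>q. A q ** G' q = G' q ** B q) (near x)" if A: "gl_germ x A" for A
    proof -
      obtain A1 where A1: "gl_germ x A1" "eventually (\<lambda>q. A q ** cyc (t q) = cyc (t q) ** A1 q) (near x)"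
        using cyc_normalizes[OF x t A] by blast
      obtain B where B: "gl_germ x B" "eventually (\<lambda>q. A1 q ** G q = G q ** B q) (near x)"
        using norm[OF A1(1)] by blast
      have "eventually (\<lambda>q. A q ** G' q = G' q ** B q) (near x)"
        using A1(2) B(2)
      proof eventually_elim
        case (elim q)
        have "A q ** G' q = (A q ** cyc (t q)) ** G q" by (simp only: G'_def matrix_mul_assoc)
        also have "\<dots> = cyc (t q) ** (A1 q ** G q)" by (simp only: elim(1) matrix_mul_assoc)
        also have "\<dots> = G' q ** B q" by (simp only: elim(2) G'_def matrix_mul_assoc)
        finally show ?case .
      qed
      then show ?thesis using B(1) by blast
    qed
    \<comment> \<open>The rows of \<open>G x\<close> move up by one, and the first row goes to the
      bottom with the factor \<open>t\<close>, which is 0 at \<open>x\<close>. So the bound drops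
      from \<open>Suc N\<close> to \<open>N\<close>.\<close>
    moreover have "G' x $ i $ j = 0" if "N \<le> ix i" for i j
      using ix_nxt_cases[of i] Suc.prems(5)[of "nxt i" j] that t'(2) by (auto simp: G'_def cyc_mult_nth)
    ultimately obtain m k where k: "regm x k" "invertible (k x)"
      "\<forall>M\<le>CARD('r). (*v) (matrix_inv (k x)) ` stdV M = stdV M"
      "eventually (\<lambda>q. cycpow (t q) m ** G' q = mscale (t q) (k q)) (near x)"
      using Suc.IH[OF regG' regH'] by blast
    have "eventually (\<lambda>q. cycpow (t q) (Suc m) ** G q = mscale (t q) (k q)) (near x)"
      using k(4) by eventually_elim (simp only: G'_def cycpow_Suc' matrix_mul_assoc)
    then show ?thesis using k(1-3) by blast
  qed
qed

end

section \<open>The case of inner fibre maps\<close>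

lemma intertwine_conj:
  fixes a b g A B :: "complex ^ 'r ^ 'r"
  assumes "invertible a" "invertible b" "invertible g"
    and eq: "g ** (a ** A ** matrix_inv a) ** matrix_inv g = b ** B ** matrix_inv b"
  shows "B ** (matrix_inv b ** g ** a) = (matrix_inv b ** g ** a) ** A"
proof -
  have "B ** (matrix_inv b ** g ** a) = (matrix_inv b ** b) ** B ** (matrix_inv b ** g ** a)"
    by (simp add: matrix_inv[OF assms(2)])
  also have "\<dots> = matrix_inv b ** (b ** B ** matrix_inv b) ** g ** a"
    by (simp only: matrix_mul_assoc)
  also have "\<dots> = matrix_inv b ** g ** a ** A ** matrix_inv a ** (matrix_inv g ** g) ** a"
    unfolding eq[symmetric] by (simp only: matrix_mul_assoc)
  also have "\<dots> = matrix_inv b ** g ** a ** A ** (matrix_inv a ** a)"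
    by (simp add: matrix_inv[OF assms(3)] flip: matrix_mul_assoc)
  finally show ?thesis
    by (simp add: matrix_inv[OF assms(1)])
qed

lemma upper_traceless: "upper A \<Longrightarrow> upper (traceless A)"
  by (auto simp: upper_def traceless_def mat_def)

context marked
begin

lemma regm_traceless: "regm p A \<Longrightarrow> regm p (\<lambda>q. traceless (A q))"
proof -
  assume A: "regm p A"
  have "traceless (A q) = A q + mscale (- (trace (A q) * (1 / of_nat CARD('a)))) (mat 1)" for q
    by (rule mat_eqI) (simp add: traceless_def)
  then show ?thesis
    by (simp only:) (intro regm_add A regm_mscale reg_minus reg_mult reg_trace regm_const reg_const)
qed

context
  fixes P Q :: "('n, 'r::finite) qpar" and \<Phi> and g :: "'n point \<Rightarrow> complex ^ 'r ^ 'r"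
  assumes P: "quasi_parabolic X D P" and Q: "quasi_parabolic X D Q" and iso: "lie_sheaf_iso X D P Q \<Phi>"
    and inv_g: "\<And>q. q \<in> X \<Longrightarrow> q \<notin> D \<Longrightarrow> invertible (g q)"
    and inner: "\<And>q A. q \<in> X \<Longrightarrow> q \<notin> D \<Longrightarrow> trace A = 0 \<Longrightarrow> fibre_map P \<Phi> q A = g q ** A ** matrix_inv (g q)"
begin

lemma germ_related_intertwine:
  assumes p: "p \<in> X" and a: "aframe P p a" and b: "aframe Q p b"
    and A: "sl_germ p A" and rel: "germ_related P \<Phi> p a b A B"
  shows "eventually (\<lambda>q. q \<notin> D \<longrightarrow> B q ** (matrix_inv (b q) ** g q ** a q) = (matrix_inv (b q) ** g q ** a q) ** A q) (near p)"
proof -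
  have ia: "eventually (\<lambda>q. invertible (a q)) (near p)" and ib: "eventually (\<lambda>q. invertible (b q)) (near p)"
    using a b by (auto intro: frame_invertible simp: aframe_def)
  have tr: "eventually (\<lambda>q. trace (A q) = 0) (near p)" using A by (simp add: sl_germ_def)
  show ?thesis
    using rel[unfolded germ_related_def[OF P Q iso]] ia ib tr near_in_X[OF p]
  proof eventually_elim
    case (elim q)
    show ?case
    proof
      assume q: "q \<notin> D"
      have "trace (a q ** A q ** matrix_inv (a q)) = 0" using elim(4) by (simp add: trace_conj[OF elim(2)])
      then have "g q ** (a q ** A q ** matrix_inv (a q)) ** matrix_inv (g q) = b q ** B q ** matrix_inv (b q)"
        using inner[OF elim(5) q] elim(1) q by simp
      then show "B q ** (matrix_inv (b q) ** g q ** a q) = (matrix_inv (b q) ** g q ** a q) ** A q"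
        by (rule intertwine_conj[OF elim(2,3) inv_g[OF elim(5) q]])
    qed
  qed
qed

lemma gl_germ_traceless: "gl_germ p A \<Longrightarrow> sl_germ p (\<lambda>q. traceless (A q))"
  by (simp add: gl_germ_def sl_germ_def regm_traceless upper_traceless)

lemma gl_germ_add_scalar:
  assumes "sl_germ p B" "regm p A"
  shows "gl_germ p (\<lambda>q. B q + mscale (trace (A q) / of_nat CARD('r)) (mat 1))"
proof -
  have "regm p (\<lambda>q. B q + mscale (trace (A q) * (1 / of_nat CARD('r))) (mat 1))"
    using assms unfolding sl_germ_def by (intro regm_add regm_mscale reg_mult reg_trace regm_const reg_const) auto
  then show ?thesis
    using assms(1) by (auto simp: gl_germ_def sl_germ_def intro: upper_add upper_mscale upper_mat_1)
qed

text \<open>The isomorphism knows traceless matrices only. Scalar parts commute with the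
  intertwiner, so they are split off and put back; this makes the whole Iwahori order available,
  diagonal matrix units included.\<close>

lemma gl_germ_forward:
  assumes p: "p \<in> X" and a: "aframe P p a" and b: "aframe Q p b" and A: "gl_germ p A"
  shows "\<exists>B. gl_germ p B \<and> eventually (\<lambda>q. q \<notin> D \<longrightarrow>
      B q ** (matrix_inv (b q) ** g q ** a q) = (matrix_inv (b q) ** g q ** a q) ** A q) (near p)"
proof -
  let ?\<gamma> = "\<lambda>q. matrix_inv (b q) ** g q ** a q"
  obtain B where B: "sl_germ p B" "germ_related P \<Phi> p a b (\<lambda>q. traceless (A q)) B"
    using germ_related_forward[OF P Q iso p a b gl_germ_traceless[OF A]] by blast
  let ?B = "\<lambda>q. B q + mscale (trace (A q) / of_nat CARD('r)) (mat 1)"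
  have "gl_germ p ?B" by (rule gl_germ_add_scalar[OF B(1)]) (use A in \<open>simp add: gl_germ_def\<close>)
  moreover have "eventually (\<lambda>q. q \<notin> D \<longrightarrow> ?B q ** ?\<gamma> q = ?\<gamma> q ** A q) (near p)"
    using germ_related_intertwine[OF p a b gl_germ_traceless[OF A] B(2)]
  proof eventually_elim
    case (elim q)
    have "?\<gamma> q ** A q = ?\<gamma> q ** traceless (A q) + mscale (trace (A q) / of_nat CARD('r)) (?\<gamma> q)"
      by (subst traceless_decomp[of "A q"]) (simp add: mat_ring_simps)
    then show ?case using elim by (simp add: mat_ring_simps)
  qed
  ultimately show ?thesis by blast
qed

lemma gl_germ_backward:
  assumes p: "p \<in> X" and a: "aframe P p a" and b: "aframe Q p b" and B: "gl_germ p B"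
  shows "\<exists>A. gl_germ p A \<and> eventually (\<lambda>q. q \<notin> D \<longrightarrow>
      B q ** (matrix_inv (b q) ** g q ** a q) = (matrix_inv (b q) ** g q ** a q) ** A q) (near p)"
proof -
  let ?\<gamma> = "\<lambda>q. matrix_inv (b q) ** g q ** a q"
  obtain A where A: "sl_germ p A" "germ_related P \<Phi> p a b A (\<lambda>q. traceless (B q))"
    using germ_related_backward[OF P Q iso p a b gl_germ_traceless[OF B]] by blast
  let ?A = "\<lambda>q. A q + mscale (trace (B q) / of_nat CARD('r)) (mat 1)"
  have "gl_germ p ?A" by (rule gl_germ_add_scalar[OF A(1)]) (use B in \<open>simp add: gl_germ_def\<close>)
  moreover have "eventually (\<lambda>q. q \<notin> D \<longrightarrow> B q ** ?\<gamma> q = ?\<gamma> q ** ?A q) (near p)"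
    using germ_related_intertwine[OF p a b A]
  proof eventually_elim
    case (elim q)
    have "B q ** ?\<gamma> q = traceless (B q) ** ?\<gamma> q + mscale (trace (B q) / of_nat CARD('r)) (?\<gamma> q)"
      by (subst traceless_decomp[of "B q"]) (simp add: mat_ring_simps)
    then show ?case using elim by (simp add: mat_ring_simps)
  qed
  ultimately show ?thesis by blast
qed

text \<open>The conjugating matrix, defined up to scalars, is normalized so that it is regular: its columns
  are the images of a fixed vector under the (rescaled) images of the matrix units in one column.\<close>

lemma regular_intertwiner:
  assumes p: "p \<in> X" and a: "aframe P p a" and b: "aframe Q p b"
    and u: "reg p u" "p \<in> D \<Longrightarrow> u p = 0"
  shows "\<exists>G H c. regm p G \<and> regm p H \<and> eventually (\<lambda>q. H q ** G q = mscale (u q) (mat 1)) (near p) \<and>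
    eventually (\<lambda>q. q \<notin> D \<longrightarrow> c q \<noteq> 0 \<and> G q = mscale (u q * c q) (matrix_inv (b q) ** g q ** a q)) (near p)"
proof -
  define \<gamma> where "\<gamma> q = matrix_inv (b q) ** g q ** a q" for q
  have inv\<gamma>: "eventually (\<lambda>q. q \<notin> D \<longrightarrow> invertible (\<gamma> q)) (near p)"
  proof -
    have ia: "eventually (\<lambda>q. invertible (a q)) (near p)" and ib: "eventually (\<lambda>q. invertible (b q)) (near p)"
      using a b by (auto intro: frame_invertible simp: aframe_def)
    show ?thesis
      using ia ib near_in_X[OF p]
      by eventually_elim (simp add: \<gamma>_def invertible_mult_complex invertible_matrix_inv inv_g)
  qed
  obtain e where e: "ix (e :: 'r) = 0" using ix_surj[of 0, where 'r = 'r] by auto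
  \<comment> \<open>Apart from the corner, matrix units in the first column lie below the diagonal;
    the factor \<open>u\<close>, which is 0 at a marked point, brings them into the order.\<close>
  have "gl_germ p (\<lambda>q. mscale (u q) (outer (axis i 1) (axis e 1)))" for i
    using u by (auto simp: gl_germ_def regm_mscale regm_const upper_def)
  then have "\<forall>i. \<exists>B. gl_germ p B \<and> eventually (\<lambda>q. q \<notin> D \<longrightarrow>
      B q ** \<gamma> q = \<gamma> q ** mscale (u q) (outer (axis i 1) (axis e 1))) (near p)"
    using gl_germ_forward[OF p a b] unfolding \<gamma>_def by blast
  then obtain R where "\<forall>i. gl_germ p (R i) \<and> eventually (\<lambda>q. q \<notin> D \<longrightarrow>
      R i q ** \<gamma> q = \<gamma> q ** mscale (u q) (outer (axis i 1) (axis e 1))) (near p)"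
    by (rule choice[THEN exE])
  then have R: "\<And>i. gl_germ p (R i)" "\<And>i. eventually (\<lambda>q. q \<notin> D \<longrightarrow>
      R i q ** \<gamma> q = \<gamma> q ** mscale (u q) (outer (axis i 1) (axis e 1))) (near p)"
    by blast+
  \<comment> \<open>Matrix units in the first row are upper triangular as they stand.\<close>
  have "gl_germ p (\<lambda>q. outer (axis e 1) (axis i 1))" for i
    using e by (auto simp: gl_germ_def regm_const upper_def axis_one_nth)
  then have "\<forall>i. \<exists>B. gl_germ p B \<and> eventually (\<lambda>q. q \<notin> D \<longrightarrow>
      B q ** \<gamma> q = \<gamma> q ** outer (axis e 1) (axis i 1)) (near p)"
    using gl_germ_forward[OF p a b] unfolding \<gamma>_def by blast
  then obtain S where "\<forall>i. gl_germ p (S i) \<and> eventually (\<lambda>q. q \<notin> D \<longrightarrow>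
      S i q ** \<gamma> q = \<gamma> q ** outer (axis e 1) (axis i 1)) (near p)"
    by (rule choice[THEN exE])
  then have S: "\<And>i. gl_germ p (S i)" "\<And>i. eventually (\<lambda>q. q \<notin> D \<longrightarrow>
      S i q ** \<gamma> q = \<gamma> q ** outer (axis e 1) (axis i 1)) (near p)"
    by blast+
  have regS: "regm p (S i)" and regR: "regm p (R i)" for i
    using S(1) R(1) by (simp_all add: gl_germ_def)
  have Se: "S i q = outer (\<gamma> q *v axis e 1) (axis i 1 v* matrix_inv (\<gamma> q))"
    if "S i q ** \<gamma> q = \<gamma> q ** outer (axis e 1) (axis i 1)" "invertible (\<gamma> q)" for i q
    using eq_conj_of_intertwine[OF that(2,1)] by (simp add: mult_outer outer_mult)
  have Re: "R i q = mscale (u q) (outer (\<gamma> q *v axis i 1) (axis e 1 v* matrix_inv (\<gamma> q)))"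
    if "R i q ** \<gamma> q = \<gamma> q ** mscale (u q) (outer (axis i 1) (axis e 1))" "invertible (\<gamma> q)" for i q
    using eq_conj_of_intertwine[OF that(2,1)] by (simp add: mult_outer outer_mult mscale_mult_left mscale_mult_right)
  have dual_basis: "pairing (axis i 1 v* matrix_inv (\<gamma> q)) (\<gamma> q *v axis j 1) = (if i = j then 1 else 0)"
    if "invertible (\<gamma> q)" for i j q
  proof -
    have "pairing (axis i 1 v* matrix_inv (\<gamma> q)) (\<gamma> q *v axis j 1) = trace (outer (\<gamma> q *v axis j 1) (axis i 1 v* matrix_inv (\<gamma> q)))"
      by (simp add: trace_outer)
    also have "outer (\<gamma> q *v axis j 1) (axis i 1 v* matrix_inv (\<gamma> q)) = \<gamma> q ** outer (axis j 1) (axis i 1) ** matrix_inv (\<gamma> q)"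
      by (simp add: mult_outer outer_mult)
    finally show ?thesis
      by (simp add: trace_conj[OF that] trace_outer axis_one_nth)
  qed
  \<comment> \<open>Off \<open>D\<close> the matrix \<open>S e q\<close> is conjugate to an
    idempotent of rank one. Its trace is regular, hence equal to 1 at \<open>p\<close> too, and
    \<open>S e p\<close> is not 0; this supplies the vector \<open>v\<close> and the row
    \<open>l\<close> used for the normalization.\<close>
  have "eventually (\<lambda>q. trace (S e q) - 1 = 0) (near p)"
  proof (rule reg_zero_off_finite[OF p finite_D])
    show "reg p (\<lambda>q. trace (S e q) - 1)" by (intro reg_diff reg_trace regS reg_const)
    show "eventually (\<lambda>q. q \<notin> D \<longrightarrow> trace (S e q) - 1 = 0) (near p)"
      using S(2)[of e] inv\<gamma>
    proof eventually_elim
      case (elim q)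
      show ?case
      proof
        assume q: "q \<notin> D"
        then have "S e q = outer (\<gamma> q *v axis e 1) (axis e 1 v* matrix_inv (\<gamma> q))"
          using elim by (intro Se) auto
        then show "trace (S e q) - 1 = 0"
          using elim(2) q by (simp add: trace_outer dual_basis)
      qed
    qed
  qed
  from near_self[OF p this] have "S e p \<noteq> 0" by (auto simp: trace_zero)
  then obtain v where "S e p *v v \<noteq> 0" using mat_nonzero_mult_vec by blast
  then obtain l where l: "(S e p *v v) $ l \<noteq> 0" by (auto simp: vec_eq_iff)
  define s where "s q = (S e q *v v) $ l" for q
  have s: "reg p s" unfolding s_def[abs_def] by (rule regv_entry[OF regv_mult[OF regS regv_const]])
  have "s p \<noteq> 0" using l by (simp add: s_def)
  note s' = reg_nonzero_inverse[OF p s this]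
  \<comment> \<open>Off \<open>D\<close>, column \<open>j\<close> of \<open>G\<close> is
    \<open>u * \<alpha>\<close> times column \<open>j\<close> of \<open>\<gamma>\<close>, and row
    \<open>i\<close> of \<open>H\<close> is row \<open>l\<close> of \<open>S i\<close> divided by
    \<open>s = \<beta> * \<alpha>\<close>, that is row \<open>i\<close> of the inverse of
    \<open>\<gamma>\<close> divided by \<open>\<alpha>\<close>. The uncontrolled scalar
    \<open>\<alpha>\<close> cancels in the product.\<close>
  define G where "G q = (\<chi> i j. (R j q *v v) $ i)" for q
  define H where "H q = (\<chi> i j. S i q $ l $ j * inverse (s q))" for q
  define \<alpha> where "\<alpha> q = pairing (axis e 1 v* matrix_inv (\<gamma> q)) v" for q
  define \<beta> where "\<beta> q = (\<gamma> q *v axis e 1) $ l" for q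
  have regG: "regm p G"
    unfolding regm_def G_def using regv_entry[OF regv_mult[OF regR regv_const]] by simp
  have regH: "regm p H"
    unfolding regm_def H_def using reg_mult[OF regm_entry[OF regS] s'(2)] by simp
  have ev: "eventually (\<lambda>q. \<forall>i. q \<notin> D \<longrightarrow> R i q ** \<gamma> q = \<gamma> q ** mscale (u q) (outer (axis i 1) (axis e 1))) (near p)"
    "eventually (\<lambda>q. \<forall>i. q \<notin> D \<longrightarrow> S i q ** \<gamma> q = \<gamma> q ** outer (axis e 1) (axis i 1)) (near p)"
    by (intro eventually_all_finite R(2) S(2))+
  have main: "eventually (\<lambda>q. q \<notin> D \<longrightarrow> \<alpha> q \<noteq> 0 \<and> G q = mscale (u q * \<alpha> q) (\<gamma> q) \<and>
      H q ** G q = mscale (u q) (mat 1)) (near p)"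
    using ev inv\<gamma> s'(1)
  proof eventually_elim
    case (elim q)
    show ?case
    proof
      assume q: "q \<notin> D"
      have inv: "invertible (\<gamma> q)" and Rq: "\<And>i. R i q ** \<gamma> q = \<gamma> q ** mscale (u q) (outer (axis i 1) (axis e 1))"
        and Sq: "\<And>i. S i q ** \<gamma> q = \<gamma> q ** outer (axis e 1) (axis i 1)" using elim q by auto
      have sq: "s q = \<beta> q * \<alpha> q"
        by (simp add: s_def Se[OF Sq inv] outer_mult_vec \<alpha>_def \<beta>_def)
      then have nz: "\<alpha> q \<noteq> 0" "\<beta> q \<noteq> 0" using elim(4) by auto
      have G: "G q = mscale (u q * \<alpha> q) (\<gamma> q)"
        by (rule mat_eqI) (simp add: G_def Re[OF Rq inv] mscale_mult_vec outer_mult_vec \<alpha>_def mult_vec_axis)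
      have H: "H q = mscale (1 / \<alpha> q) (matrix_inv (\<gamma> q))"
        using nz by (intro mat_eqI) (simp add: H_def Se[OF Sq inv] \<beta>_def[symmetric] sq vec_mult_axis field_simps)
      have "H q ** G q = mscale (u q) (mat 1)"
        unfolding G H using nz by (simp add: mscale_mult_left mscale_mult_right mscale_mscale matrix_inv[OF inv])
      with nz G show "\<alpha> q \<noteq> 0 \<and> G q = mscale (u q * \<alpha> q) (\<gamma> q) \<and> H q ** G q = mscale (u q) (mat 1)" by blast
    qed
  qed
  have "eventually (\<lambda>q. H q ** G q = mscale (u q) (mat 1)) (near p)"
    by (rule regm_zero_off_finite[OF p finite_D])
      (use main in \<open>auto intro: regm_mult regH regG regm_mscale u regm_const elim: eventually_mono\<close>)
  moreover have "eventually (\<lambda>q. q \<notin> D \<longrightarrow> \<alpha> q \<noteq> 0 \<and> G q = mscale (u q * \<alpha> q) (\<gamma> q)) (near p)"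
    using main by eventually_elim blast
  ultimately show ?thesis using regG regH unfolding \<gamma>_def by blast
qed

text \<open>Off \<open>D\<close> the regular intertwiner with \<open>u = 1\<close> is invertible and
  is absorbed by the frame of \<open>Q\<close>. At a marked point \<open>u\<close> is a uniformizer;
  the normal form leaves a power of the shift and a unit \<open>k\<close>, which is absorbed by the
  frame of \<open>P\<close>.\<close>

lemma shifted_match:
  assumes p: "p \<in> X"
  shows "\<exists>m a b c t. aframe P p a \<and> aframe Q p b \<and> (p \<in> D \<longrightarrow> unif p t) \<and>
      eventually (\<lambda>q. q \<notin> D \<longrightarrow> c q \<noteq> 0 \<and>
        mscale (c q) (g q) ** (a q ** cycpow (t q) (if p \<in> D then m else 0)) = b q) (near p)"
proof -
  obtain a where a: "aframe P p a" using aframe_exists[OF P p] by blast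
  obtain b where b: "aframe Q p b" using aframe_exists[OF Q p] by blast
  have fa: "frame (sheaf_of P) p a" and fb: "frame (sheaf_of Q) p b" using a b by (auto simp: aframe_def)
  have ib: "eventually (\<lambda>q. invertible (b q)) (near p)" by (rule frame_invertible[OF fb])
  show ?thesis
  proof (cases "p \<in> D")
    case False
    obtain G H c where G: "regm p G" and HG: "eventually (\<lambda>q. H q ** G q = mscale 1 (mat 1)) (near p)"
      and Gc: "eventually (\<lambda>q. q \<notin> D \<longrightarrow> c q \<noteq> 0 \<and> G q = mscale (1 * c q) (matrix_inv (b q) ** g q ** a q)) (near p)"
      using regular_intertwiner[OF p a b reg_const[of p 1]] False by blast
    have "invertible (G p)"
      using near_self[OF p HG] invertible_left_inverse by auto
    from frame_change[OF p fb G this] have "frame (sheaf_of Q) p (\<lambda>q. b q ** G q)"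
      by simp
    then have "aframe Q p (\<lambda>q. b q ** G q)" using False by (simp add: aframe_def)
    moreover have "eventually (\<lambda>q. q \<notin> D \<longrightarrow> c q \<noteq> 0 \<and>
        mscale (c q) (g q) ** (a q ** cycpow (0 :: complex) 0) = b q ** G q) (near p)"
      using Gc ib
    proof eventually_elim
      case (elim q)
      have "b q ** mscale (c q) (matrix_inv (b q) ** g q ** a q) = mscale (c q) ((b q ** matrix_inv (b q)) ** g q ** a q)"
        by (simp add: mscale_mult_right matrix_mul_assoc)
      then show ?case using elim by (simp add: matrix_inv[OF elim(2)] mscale_mult_left)
    qed
    ultimately show ?thesis
      using a False by (intro exI[of _ 0] exI[of _ a] exI[of _ "\<lambda>q. b q ** G q"] exI[of _ c] exI[of _ "\<lambda>_. 0"]) simp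
  next
    case True
    obtain t where t: "unif p t" using uniformizer_exists[OF p] unfolding unif_def by blast
    have t': "reg p t" "t p = 0" "eventually (\<lambda>q. q \<noteq> p \<longrightarrow> t q \<noteq> 0) (near p)" using t by (auto simp: unif_def)
    obtain G H c where G: "regm p G" and H: "regm p H" and HG: "eventually (\<lambda>q. H q ** G q = mscale (t q) (mat 1)) (near p)"
      and Gc: "eventually (\<lambda>q. q \<notin> D \<longrightarrow> c q \<noteq> 0 \<and> G q = mscale (t q * c q) (matrix_inv (b q) ** g q ** a q)) (near p)"
      using regular_intertwiner[OF p a b t'(1)] t'(2) by blast
    have norm: "\<exists>B. gl_germ p B \<and> eventually (\<lambda>q. A q ** G q = G q ** B q) (near p)" if A: "gl_germ p A" for A
    proof -
      obtain B where B: "gl_germ p B" "eventually (\<lambda>q. q \<notin> D \<longrightarrow>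
          A q ** (matrix_inv (b q) ** g q ** a q) = (matrix_inv (b q) ** g q ** a q) ** B q) (near p)"
        using gl_germ_backward[OF p a b A] by blast
      have "eventually (\<lambda>q. q \<notin> D \<longrightarrow> A q ** G q = G q ** B q) (near p)"
        using B(2) Gc by eventually_elim (simp add: mscale_mult_left mscale_mult_right)
      then have "eventually (\<lambda>q. A q ** G q = G q ** B q) (near p)"
        using A B(1) G by (intro regm_zero_off_finite[OF p finite_D] regm_mult) (auto simp: gl_germ_def)
      then show ?thesis using B(1) by blast
    qed
    have "G p $ i $ j = 0" if "CARD('r) \<le> ix i" for i j using ix_less[of i] that by simp
    then obtain m k where k: "regm p k" "invertible (k p)"
      "\<forall>M\<le>CARD('r). (*v) (matrix_inv (k p)) ` stdV M = stdV M"
      "eventually (\<lambda>q. cycpow (t q) m ** G q = mscale (t q) (k q)) (near p)"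
      using lattice_normal_form[OF True t G H HG norm] by blast
    \<comment> \<open>Still adapted, since the inverse of \<open>k p\<close> preserves every
      standard subspace.\<close>
    let ?a = "\<lambda>q. a q ** matrix_inv (k q)"
    have ik: "eventually (\<lambda>q. invertible (k q)) (near p)" by (rule regm_inverse(1)[OF p k(1,2)])
    have "frame (sheaf_of P) p ?a"
      using frame_change[OF p fa regm_inverse(2)[OF p k(1,2)] invertible_matrix_inv[OF k(2)]] by simp
    moreover have "flag P p i = (*v) (?a p) ` stdV (CARD('r) + 1 - i)" if i: "i \<in> {1..CARD('r) + 1}" for i
    proof -
      have "CARD('r) + 1 - i \<le> CARD('r)"
        using i unfolding atLeastAtMost_iff by linarith
      then have kV: "stdV (CARD('r) + 1 - i) = (*v) (matrix_inv (k p)) ` stdV (CARD('r) + 1 - i)"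
        using k(3) by simp
      have "flag P p i = (*v) (a p) ` stdV (CARD('r) + 1 - i)"
        using a True i by (simp add: aframe_def)
      also note kV
      finally show ?thesis by (simp add: image_image matrix_vector_mul_assoc)
    qed
    ultimately have "aframe P p ?a" by (simp add: aframe_def)
    moreover have "eventually (\<lambda>q. q \<notin> D \<longrightarrow> c q \<noteq> 0 \<and> mscale (c q) (g q) ** (?a q ** cycpow (t q) m) = b q) (near p)"
      using k(4) Gc ik ib t'(3)
    proof eventually_elim
      case (elim q)
      show ?case
      proof
        assume q: "q \<notin> D"
        then have tq: "t q \<noteq> 0" using elim(5) True by blast
        have c: "c q \<noteq> 0" and G: "G q = mscale (t q * c q) (matrix_inv (b q) ** g q ** a q)" using elim(2) q by auto
        let ?\<gamma> = "mscale (c q) (matrix_inv (b q) ** g q ** a q)"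
        have "mscale (t q) (cycpow (t q) m ** ?\<gamma> - k q) = 0"
          using elim(1) unfolding G by (simp add: mscale_diff mscale_mult_right mscale_mscale)
        then have "cycpow (t q) m ** ?\<gamma> = k q" using tq by simp
        then have "cycpow (t q) m ** (?\<gamma> ** matrix_inv (k q)) = mat 1"
          by (simp add: matrix_mul_assoc matrix_inv[OF elim(3)])
        \<comment> \<open>A one-sided inverse of a square matrix is two-sided; this brings the
          shifts from the left of the intertwiner to its right, next to the frame of
          \<open>P\<close>.\<close>
        then have "?\<gamma> ** matrix_inv (k q) ** cycpow (t q) m = mat 1"
          by (simp only: matrix_left_right_inverse)
        then have "b q ** (?\<gamma> ** matrix_inv (k q) ** cycpow (t q) m) = b q" by simp
        moreover have "b q ** (?\<gamma> ** matrix_inv (k q) ** cycpow (t q) m) =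
            (b q ** matrix_inv (b q)) ** (mscale (c q) (g q) ** (?a q ** cycpow (t q) m))"
          by (simp only: mscale_mult_left mscale_mult_right matrix_mul_assoc)
        ultimately show "c q \<noteq> 0 \<and> mscale (c q) (g q) ** (?a q ** cycpow (t q) m) = b q"
          using c by (simp add: matrix_inv[OF elim(4)])
      qed
    qed
    ultimately show ?thesis
      using b t True by (intro exI[of _ m] exI[of _ ?a] exI[of _ b] exI[of _ c] exI[of _ t]) simp
  qed
qed

lemma obtainable_of_inner: "obtainable X D E P \<Longrightarrow> obtainable X D E Q"
proof -
  assume E: "obtainable X D E P"
  have "\<forall>p\<in>X. \<exists>m a b c t. aframe P p a \<and> aframe Q p b \<and> (p \<in> D \<longrightarrow> unif p t) \<and>
      eventually (\<lambda>q. q \<notin> D \<longrightarrow> c q \<noteq> 0 \<and>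
        mscale (c q) (g q) ** (a q ** cycpow (t q) (if p \<in> D then m else 0)) = b q) (near p)"
    using shifted_match by blast
  then obtain m where "\<forall>p\<in>X. \<exists>a b c t. aframe P p a \<and> aframe Q p b \<and> (p \<in> D \<longrightarrow> unif p t) \<and>
      eventually (\<lambda>q. q \<notin> D \<longrightarrow> c q \<noteq> 0 \<and>
        mscale (c q) (g q) ** (a q ** cycpow (t q) (if p \<in> D then m p else 0)) = b q) (near p)"
    by (rule bchoice[THEN exE])
  then show ?thesis
    by (intro obtainable_of_shifted_match[where g = g and m = m, OF Q E P]) blast
qed

end

end

section \<open>Constancy of the type of the fibre maps\<close>

context marked
begin

text \<open>With \<open>A0\<close> and \<open>B0\<close> extended as constant matrices in a frame, a
  failure is a nonzero entry of a regular matrix. The parameter \<open>f\<close> covers the product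
  and the negative of the reversed product together; \<open>f_conj\<close> lets the condition be
  read in the frame \<open>b\<close>.\<close>

lemma fibre_condition_open:
  fixes P Q :: "('n, 'r::finite) qpar" and f :: "complex ^ 'r ^ 'r \<Rightarrow> complex ^ 'r ^ 'r \<Rightarrow> complex ^ 'r ^ 'r"
  assumes P: "quasi_parabolic X D P" and Q: "quasi_parabolic X D Q" and iso: "lie_sheaf_iso X D P Q \<Phi>"
    and f_reg: "\<And>p A B. regm p A \<Longrightarrow> regm p B \<Longrightarrow> regm p (\<lambda>q. f (A q) (B q))"
    and f_conj: "\<And>b A B. invertible b \<Longrightarrow>
      f (b ** A ** matrix_inv b) (b ** B ** matrix_inv b) = b ** f A B ** matrix_inv b"
    and p: "p \<in> X" "p \<notin> D" and A0: "trace A0 = 0" and B0: "trace B0 = 0"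
    and fail: "fibre_map P \<Phi> p (traceless (A0 ** B0)) \<noteq> f (fibre_map P \<Phi> p A0) (fibre_map P \<Phi> p B0)"
  shows "eventually (\<lambda>q. \<exists>A B. trace A = 0 \<and> trace B = 0 \<and>
    fibre_map P \<Phi> q (traceless (A ** B)) \<noteq> f (fibre_map P \<Phi> q A) (fibre_map P \<Phi> q B)) (near p)"
proof -
  let ?T = "fibre_map P \<Phi>"
  obtain a where a: "aframe P p a" using aframe_exists[OF P p(1)] by blast
  obtain b where b: "aframe Q p b" using aframe_exists[OF Q p(1)] by blast
  have ia: "eventually (\<lambda>q. invertible (a q)) (near p)" and ib: "eventually (\<lambda>q. invertible (b q)) (near p)"
    using a b by (auto intro: frame_invertible simp: aframe_def)
  have iap: "invertible (a p)" by (rule near_self[OF p(1) ia])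
  let ?c = "\<lambda>C. matrix_inv (a p) ** C ** a p"
  define A where "A = ?c A0"
  define B where "B = ?c B0"
  have trA: "trace A = 0" and trB: "trace B = 0"
    using A0 B0 by (simp_all add: A_def B_def trace_conj'[OF iap])
  have sl: "sl_germ p (\<lambda>_. C)" if "trace C = 0" for C :: "complex ^ 'r ^ 'r"
    using that p by (simp add: sl_germ_def regm_const)
  obtain A' where A': "sl_germ p A'" "germ_related P \<Phi> p a b (\<lambda>_. A) A'"
    using germ_related_forward[OF P Q iso p(1) a b sl[OF trA]] by blast
  obtain B' where B': "sl_germ p B'" "germ_related P \<Phi> p a b (\<lambda>_. B) B'"
    using germ_related_forward[OF P Q iso p(1) a b sl[OF trB]] by blast
  obtain C' where C': "sl_germ p C'" "germ_related P \<Phi> p a b (\<lambda>_. traceless (A ** B)) C'"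
    using germ_related_forward[OF P Q iso p(1) a b sl] trace_traceless by blast
  have rel: "eventually (\<lambda>q. q \<notin> D \<longrightarrow> ?T q (a q ** A ** matrix_inv (a q)) = b q ** A' q ** matrix_inv (b q) \<and>
      ?T q (a q ** B ** matrix_inv (a q)) = b q ** B' q ** matrix_inv (b q) \<and>
      ?T q (a q ** traceless (A ** B) ** matrix_inv (a q)) = b q ** C' q ** matrix_inv (b q)) (near p)"
    using A'(2) B'(2) C'(2) unfolding germ_related_def[OF P Q iso] by eventually_elim blast
  have key: "?T q (traceless ((a q ** A ** matrix_inv (a q)) ** (a q ** B ** matrix_inv (a q)))) =
      f (?T q (a q ** A ** matrix_inv (a q))) (?T q (a q ** B ** matrix_inv (a q))) \<longleftrightarrow> C' q = f (A' q) (B' q)"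
    if q: "q \<notin> D" and ia: "invertible (a q)" and ib: "invertible (b q)"
      and rel: "q \<notin> D \<longrightarrow> ?T q (a q ** A ** matrix_inv (a q)) = b q ** A' q ** matrix_inv (b q) \<and>
      ?T q (a q ** B ** matrix_inv (a q)) = b q ** B' q ** matrix_inv (b q) \<and>
      ?T q (a q ** traceless (A ** B) ** matrix_inv (a q)) = b q ** C' q ** matrix_inv (b q)" for q
  proof -
    have "traceless ((a q ** A ** matrix_inv (a q)) ** (a q ** B ** matrix_inv (a q))) = a q ** traceless (A ** B) ** matrix_inv (a q)"
      by (simp only: conj_mult_conj[OF ia] traceless_conj[OF ia])
    then show ?thesis
      using rel q f_conj[OF ib] conj_inverse_conj(1)[OF ib] by metis
  qed
  have "C' p \<noteq> f (A' p) (B' p)"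
  proof
    assume "C' p = f (A' p) (B' p)"
    moreover have "a p ** A ** matrix_inv (a p) = A0" "a p ** B ** matrix_inv (a p) = B0"
      by (simp_all add: A_def B_def conj_inverse_conj[OF iap])
    ultimately show False
      using key[OF p(2) iap near_self[OF p(1) ib] near_self[OF p(1) rel]] fail by simp
  qed
  then obtain i j where ij: "C' p $ i $ j - f (A' p) (B' p) $ i $ j \<noteq> 0" by (auto simp: vec_eq_iff)
  have "regm p (\<lambda>q. f (A' q) (B' q))" using A'(1) B'(1) by (intro f_reg) (auto simp: sl_germ_def)
  then have "reg p (\<lambda>q. C' q $ i $ j - f (A' q) (B' q) $ i $ j)"
    using C'(1) by (intro reg_diff regm_entry) (auto simp: sl_germ_def)
  from reg_nonzero_inverse(1)[OF p(1) this ij] rel ia ib near_not_D[OF p(1)] show ?thesis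
  proof eventually_elim
    case (elim q)
    have q: "q \<notin> D" using elim(5) p by blast
    have "trace (a q ** A ** matrix_inv (a q)) = 0" "trace (a q ** B ** matrix_inv (a q)) = 0"
      using trA trB by (simp_all add: trace_conj[OF elim(3)])
    moreover have "C' q \<noteq> f (A' q) (B' q)" using elim(1) by auto
    ultimately show ?case using key[OF q elim(3,4,2)] by blast
  qed
qed

text \<open>Two nonempty open sets of failures would meet outside \<open>D\<close>, at a point
  contradicting \<open>sl_aut_cases\<close>.\<close>

lemma fibre_map_dichotomy:
  fixes P Q :: "('n, 'r::finite) qpar"
  assumes P: "quasi_parabolic X D P" and Q: "quasi_parabolic X D Q" and iso: "lie_sheaf_iso X D P Q \<Phi>"
    and card: "CARD('r) \<ge> 2"
  shows "(\<forall>q\<in>X - D. sl_mult (fibre_map P \<Phi> q)) \<or> (\<forall>q\<in>X - D. sl_antimult (fibre_map P \<Phi> q))"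
proof (rule ccontr)
  assume "\<not> ?thesis"
  then obtain p p' where p: "p \<in> X" "p \<notin> D" "\<not> sl_mult (fibre_map P \<Phi> p)"
    and p': "p' \<in> X" "p' \<notin> D" "\<not> sl_antimult (fibre_map P \<Phi> p')" by blast
  let ?T = "fibre_map P \<Phi>"
  have "eventually (\<lambda>q. \<not> sl_mult (?T q)) (near p)"
  proof -
    obtain A B where AB: "trace A = 0" "trace B = 0" "?T p (traceless (A ** B)) \<noteq> traceless (?T p A ** ?T p B)"
      using p(3) unfolding sl_mult_def by blast
    have "eventually (\<lambda>q. \<exists>A B. trace A = 0 \<and> trace B = 0 \<and>
        ?T q (traceless (A ** B)) \<noteq> traceless (?T q A ** ?T q B)) (near p)"
      by (rule fibre_condition_open[where f = "\<lambda>A B. traceless (A ** B)", OF P Q iso _ _ p(1,2) AB])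
        (simp_all add: regm_traceless regm_mult conj_mult_conj traceless_conj)
    then show ?thesis by eventually_elim (auto simp: sl_mult_def)
  qed
  then obtain V where V: "zopen X V" "p \<in> V" "\<forall>q\<in>V. \<not> sl_mult (?T q)"
    unfolding eventually_near[OF p(1)] by blast
  have "eventually (\<lambda>q. \<not> sl_antimult (?T q)) (near p')"
  proof -
    obtain A B where AB: "trace A = 0" "trace B = 0" "?T p' (traceless (A ** B)) \<noteq> - traceless (?T p' B ** ?T p' A)"
      using p'(3) unfolding sl_antimult_def by blast
    have "eventually (\<lambda>q. \<exists>A B. trace A = 0 \<and> trace B = 0 \<and>
        ?T q (traceless (A ** B)) \<noteq> - traceless (?T q B ** ?T q A)) (near p')"
    proof (rule fibre_condition_open[where f = "\<lambda>A B. - traceless (B ** A)", OF P Q iso _ _ p'(1,2) AB])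
      fix q and A B :: "'n point \<Rightarrow> complex ^ 'r ^ 'r"
      assume "regm q A" "regm q B"
      then have "regm q (\<lambda>q. mscale (- 1) (traceless (B q ** A q)))"
        by (intro regm_mscale reg_const regm_traceless regm_mult)
      then show "regm q (\<lambda>q. - traceless (B q ** A q))" by simp
    qed (simp_all add: conj_mult_conj traceless_conj mat_mult_minus_left mat_mult_minus_right)
    then show ?thesis by eventually_elim (auto simp: sl_antimult_def)
  qed
  then obtain V' where V': "zopen X V'" "p' \<in> V'" "\<forall>q\<in>V'. \<not> sl_antimult (?T q)"
    unfolding eventually_near[OF p'(1)] by blast
  have "V \<inter> (V' - D) \<noteq> {}"
    using V V' p' by (intro zopen_meet zopen_Diff_finite finite_D) auto
  then obtain q where q: "q \<in> V" "q \<in> V'" "q \<notin> D" by blast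
  then have "q \<in> X" using V zopen_subset by blast
  then show False
    using sl_aut_cases(1)[OF sl_aut_fibre_map[OF P Q iso _ q(3)] card] V(3) V'(3) q by blast
qed

section \<open>Dualization\<close>

definition dual_germ :: "('n, complex ^ 'r::finite) fsheaf \<Rightarrow> 'n point \<Rightarrow> ('n point \<Rightarrow> complex ^ 'r) \<Rightarrow> bool" where
  "dual_germ M p w \<longleftrightarrow> (\<forall>s. sect M p s \<longrightarrow> reg p (\<lambda>q. pairing (w q) (s q)))"

lemma dual_bundle_eq:
  assumes M: "is_sheaf X M" and U: "zopen X U"
  shows "dual_bundle X M U = {w. (\<forall>p. p \<notin> U \<longrightarrow> w p = 0) \<and> (\<forall>p\<in>U. dual_germ M p w)}"
proof -
  have "(\<forall>V s. zopen X V \<and> V \<subseteq> U \<and> s \<in> M V \<longrightarrow> res V (\<lambda>p. pairing (w p) (s p)) \<in> regular X V) \<longleftrightarrow>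
      (\<forall>p\<in>U. dual_germ M p w)" (is "?L \<longleftrightarrow> ?R") for w
  proof
    assume L: ?L
    show ?R
      unfolding dual_germ_def
    proof (intro ballI allI impI)
      fix p s assume p: "p \<in> U" and s: "sect M p s"
      then obtain V where V: "zopen X V" "p \<in> V" "res V s \<in> M V" unfolding sect_def by blast
      define W where "W = V \<inter> U"
      have W: "zopen X W" "p \<in> W" "W \<subseteq> U" "W \<subseteq> V" using V U p zopen_Int by (auto simp: W_def)
      have "res W (res V s) \<in> M W" by (rule is_sheaf_res[OF M V(1) W(1,4) V(3)])
      then have "res W (\<lambda>p. pairing (w p) (res W (res V s) p)) \<in> regular X W" using L W by blast
      then have 1: "reg p (res W (\<lambda>p. pairing (w p) (res W (res V s) p)))"
        using W(2) unfolding regular_iff[OF W(1)] by blast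
      show "reg p (\<lambda>q. pairing (w q) (s q))"
        by (rule reg_cong[OF eventually_mono[OF near_open[OF W(1,2)]] 1]) (use W in \<open>auto simp: res_def\<close>)
    qed
  next
    assume R: ?R
    show ?L
    proof (intro allI impI, elim conjE)
      fix V s assume V: "zopen X V" "V \<subseteq> U" "s \<in> M V"
      show "res V (\<lambda>p. pairing (w p) (s p)) \<in> regular X V"
        by (rule regular_res[OF V(1)]) (use R V sect_of_mem[OF M V(1,3)] in \<open>auto simp: dual_germ_def\<close>)
    qed
  qed
  then show ?thesis unfolding dual_bundle_def by simp
qed

lemma dual_germ_cong:
  assumes "p \<in> X" "eventually (\<lambda>q. w q = w' q) (near p)" "dual_germ M p w" shows "dual_germ M p w'"
  unfolding dual_germ_def
proof (intro allI impI)
  fix s assume "sect M p s"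
  then have 1: "reg p (\<lambda>q. pairing (w q) (s q))" using assms(3) by (simp add: dual_germ_def)
  show "reg p (\<lambda>q. pairing (w' q) (s q))"
    by (rule reg_cong[OF eventually_mono[OF assms(2)] 1]) simp
qed

lemma pairing_matrix: "pairing w (A *v v) = pairing (transpose A *v w) v" for A :: "complex ^ 'r ^ 'r"
proof -
  have "pairing w (A *v v) = (\<Sum>i\<in>UNIV. \<Sum>j\<in>UNIV. w $ i * A $ i $ j * v $ j)"
    by (simp add: pairing_def matrix_vector_mult_def sum_distrib_left mult.assoc)
  also have "\<dots> = (\<Sum>j\<in>UNIV. \<Sum>i\<in>UNIV. w $ i * A $ i $ j * v $ j)"
    by (rule sum.swap)
  also have "\<dots> = pairing (transpose A *v w) v"
    by (simp only: pairing_def) (simp add: matrix_vector_mult_def transpose_def sum_distrib_left sum_distrib_right mult_ac)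
  finally show ?thesis .
qed

declare transpose_matrix_vector [simp del]

text \<open>Pairing with the basis sections \<open>a q *v axis i 1\<close> reads off coordinates in
  the dual basis, so the dual frame is the inverse transpose of \<open>a\<close>.\<close>

lemma dual_germ_iff:
  assumes p: "p \<in> X" and a: "frame M p a"
  shows "dual_germ M p w \<longleftrightarrow> regv p (\<lambda>q. transpose (a q) *v w q)"
proof
  assume w: "dual_germ M p w"
  have "reg p (\<lambda>q. (transpose (a q) *v w q) $ i)" for i
  proof -
    have "sect M p (\<lambda>q. a q *v axis i 1)" by (rule frame_sectI[OF p a regv_const])
    then have "reg p (\<lambda>q. pairing (w q) (a q *v axis i 1))" using w by (simp add: dual_germ_def)
    then show ?thesis by (simp only: pairing_matrix pairing_axis)
  qed
  then show "regv p (\<lambda>q. transpose (a q) *v w q)" unfolding regv_def by blast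
next
  assume w: "regv p (\<lambda>q. transpose (a q) *v w q)"
  show "dual_germ M p w"
    unfolding dual_germ_def
  proof (intro allI impI)
    fix s assume "sect M p s"
    then have "regv p (\<lambda>q. matrix_inv (a q) *v s q)" by (rule iffD1[OF frame_sect[OF p a]])
    from reg_pairing[OF w this] have 1: "reg p (\<lambda>q. pairing (transpose (a q) *v w q) (matrix_inv (a q) *v s q))" .
    show "reg p (\<lambda>q. pairing (w q) (s q))"
      by (rule reg_cong[OF eventually_mono[OF frame_invertible[OF a]] 1])
        (simp only: pairing_matrix[symmetric] matrix_inv_mult_vec(2))
  qed
qed

lemma invertible_transpose_complex: "invertible A \<Longrightarrow> invertible (transpose A)" for A :: "complex ^ 'r ^ 'r"
  by (simp add: invertible_det_nz)

context
  fixes P :: "('n, 'r::finite) qpar"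
  assumes P: "quasi_parabolic X D P"
begin

lemma sheaf_P': "is_sheaf X (sheaf_of P)"
  using P by (rule quasi_parabolic_sheaf)

lemma frame_P: "p \<in> X \<Longrightarrow> \<exists>a. frame (sheaf_of P) p a"
  using aframe_exists[OF P] unfolding aframe_def by blast

lemma dual_germ_near:
  assumes p: "p \<in> X" and w: "dual_germ (sheaf_of P) p w"
  shows "eventually (\<lambda>q. dual_germ (sheaf_of P) q w) (near p)"
proof -
  obtain a where a: "frame (sheaf_of P) p a" using frame_P[OF p] by blast
  have "regv p (\<lambda>q. transpose (a q) *v w q)" using w by (rule iffD1[OF dual_germ_iff[OF p a]])
  from regv_near[OF p this] frame_near[OF p a] near_in_X[OF p] show ?thesis
  proof eventually_elim
    case (elim q)
    then show ?case by (intro iffD2[OF dual_germ_iff[of q "sheaf_of P" a]])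
  qed
qed

lemma sect_dual:
  assumes p: "p \<in> X" shows "sect (dual_bundle X (sheaf_of P)) p w \<longleftrightarrow> dual_germ (sheaf_of P) p w"
proof
  show "dual_germ (sheaf_of P) p w" if "sect (dual_bundle X (sheaf_of P)) p w"
    using dual_bundle_eq[OF sheaf_P'] dual_germ_cong p that by (rule is_sheaf_of_germs(3))
  show "sect (dual_bundle X (sheaf_of P)) p w" if "dual_germ (sheaf_of P) p w"
    using dual_bundle_eq[OF sheaf_P'] dual_germ_cong p dual_germ_near[OF p that] by (rule is_sheaf_of_germs(2))
qed

lemma is_sheaf_dual: "is_sheaf X (dual_bundle X (sheaf_of P))"
  using dual_bundle_eq[OF sheaf_P'] dual_germ_cong by (rule is_sheaf_of_germs(1))

lemma vector_bundle_dual: "vector_bundle X (dual_bundle X (sheaf_of P))"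
proof (rule vector_bundleI[OF is_sheaf_dual])
  fix p assume p: "p \<in> X"
  obtain a where a: "frame (sheaf_of P) p a" using frame_P[OF p] by blast
  have "frame (dual_bundle X (sheaf_of P)) p (\<lambda>q. matrix_inv (transpose (a q)))"
    unfolding frame_def
    using frame_near[OF p a] near_near[OF p frame_invertible[OF a]] frame_invertible[OF a] near_in_X[OF p]
  proof eventually_elim
    case (elim q)
    have inv_inv: "matrix_inv (matrix_inv (transpose (a q'))) = transpose (a q')" if "invertible (a q')" for q'
      using matrix_inv(1)[OF invertible_transpose_complex[OF that]] by (rule matrix_inv_eqI(2))
    have 1: "eventually (\<lambda>q'. transpose (a q') *v w q' = matrix_inv (matrix_inv (transpose (a q'))) *v w q') (near q)" for w
      using elim(2) by eventually_elim (simp add: inv_inv)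
    have 2: "eventually (\<lambda>q'. matrix_inv (matrix_inv (transpose (a q'))) *v w q' = transpose (a q') *v w q') (near q)" for w
      using elim(2) by eventually_elim (simp add: inv_inv)
    have "regv q (\<lambda>q'. transpose (a q') *v w q') \<longleftrightarrow> regv q (\<lambda>q'. matrix_inv (matrix_inv (transpose (a q'))) *v w q')" for w
      using regv_cong[OF 1[of w]] regv_cong[OF 2[of w]] by blast
    then show ?case
      using sect_dual[OF elim(4)] dual_germ_iff[OF elim(4,1)] elim(3)
      by (simp only: invertible_matrix_inv invertible_transpose_complex simp_thms)
  qed
  then show "\<exists>a. frame (dual_bundle X (sheaf_of P)) p a" by blast
qed

lemma flag_standard: "x \<in> D \<Longrightarrow> \<exists>c :: complex ^ 'r ^ 'r. invertible c \<and>
    (\<forall>i\<in>{1..CARD('r) + 1}. flag P x i = (*v) c ` stdV (CARD('r) + 1 - i))"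
  using P full_flag_standard unfolding quasi_parabolic_def by blast

lemma subspace_ann: "vec.subspace (ann S)"
  by (auto simp: vec.subspace_def ann_def pairing_sum_left pairing_scale pairing_def[of 0])

text \<open>Annihilators are described by coordinates in the dual basis and not by
  \<open>stdV\<close>: dualizing reverses the order of the basis, so the first coordinates vanish
  instead of the last.\<close>

lemma ann_standard:
  fixes c :: "complex ^ 'r ^ 'r"
  assumes "invertible c"
  shows "w \<in> ann ((*v) c ` stdV m) \<longleftrightarrow> (\<forall>k. ix k < m \<longrightarrow> (transpose c *v w) $ k = 0)"
proof
  assume w: "w \<in> ann ((*v) c ` stdV m)"
  have "(transpose c *v w) $ k = 0" if "ix k < m" for k
  proof -
    have "axis k 1 \<in> stdV m" using that by (auto simp: stdV_def axis_one_nth)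
    then have "pairing w (c *v axis k 1) = 0" using w by (simp add: ann_def)
    then show ?thesis by (simp only: pairing_matrix pairing_axis)
  qed
  then show "\<forall>k. ix k < m \<longrightarrow> (transpose c *v w) $ k = 0" by blast
next
  assume w: "\<forall>k. ix k < m \<longrightarrow> (transpose c *v w) $ k = 0"
  have "pairing w (c *v v) = 0" if "v \<in> stdV m" for v
    unfolding pairing_matrix unfolding pairing_def
  proof (rule sum.neutral, rule ballI)
    fix k show "(transpose c *v w) $ k * v $ k = 0"
      using w that by (cases "ix k < m") (auto simp: stdV_def)
  qed
  then show "w \<in> ann ((*v) c ` stdV m)" by (auto simp: ann_def)
qed

text \<open>Biduality, needed to return from stability of the dual flag to stability of the flag.
  The dual basis vectors beyond the flag step serve as test functionals.\<close>

lemma ann_ann_flag: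
  assumes x: "x \<in> D" and i: "i \<in> {1..CARD('r) + 1}" and v: "\<And>w. w \<in> ann (flag P x i) \<Longrightarrow> pairing w v = 0"
  shows "v \<in> flag P x i"
proof -
  obtain c :: "complex ^ 'r ^ 'r" where c: "invertible c" "flag P x i = (*v) c ` stdV (CARD('r) + 1 - i)"
    using flag_standard[OF x] i by blast
  have ct: "invertible (transpose c)" using c(1) by (rule invertible_transpose_complex)
  have "(matrix_inv c *v v) $ k = 0" if k: "CARD('r) + 1 - i \<le> ix k" for k
  proof -
    have "matrix_inv (transpose c) *v axis k 1 \<in> ann (flag P x i)"
      unfolding c(2) ann_standard[OF c(1)] matrix_inv_mult_vec(2)[OF ct] using k by (auto simp: axis_one_nth)
    from v[OF this] have "pairing (matrix_inv (transpose c) *v axis k 1) (c *v (matrix_inv c *v v)) = 0"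
      by (simp only: matrix_inv_mult_vec(2)[OF c(1)])
    then show ?thesis
      by (simp only: pairing_matrix[of _ c] matrix_inv_mult_vec(2)[OF ct] pairing_axis)
  qed
  then have "matrix_inv c *v v \<in> stdV (CARD('r) + 1 - i)" by (simp add: stdV_def)
  then show ?thesis unfolding c(2) mem_image_matrix[OF c(1)] .
qed

lemma quasi_parabolic_dual: "quasi_parabolic X D (dual_qpar X P)"
  unfolding quasi_parabolic_def
proof (intro conjI ballI)
  show "vector_bundle X (sheaf_of (dual_qpar X P))"
    using vector_bundle_dual by (simp add: dual_qpar_def)
  fix x assume x: "x \<in> D"
  obtain c :: "complex ^ 'r ^ 'r" where c: "invertible c"
    "\<And>i. i \<in> {1..CARD('r) + 1} \<Longrightarrow> flag P x i = (*v) c ` stdV (CARD('r) + 1 - i)"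
    using flag_standard[OF x] by blast
  have ct: "invertible (transpose c)" using c(1) by (rule invertible_transpose_complex)
  let ?F = "flag (dual_qpar X P) x"
  \<comment> \<open>Step \<open>CARD('r) + 2 - i\<close> of the flag has dimension
    \<open>i - 1\<close>, which is the number of coordinates required to vanish.\<close>
  have F: "w \<in> ?F i \<longleftrightarrow> (\<forall>k. ix k < i - 1 \<longrightarrow> (transpose c *v w) $ k = 0)" if i: "i \<in> {1..CARD('r) + 1}" for i w
  proof -
    have "CARD('r) + 2 - i \<in> {1..CARD('r) + 1}" and m: "CARD('r) + 1 - (CARD('r) + 2 - i) = i - 1"
      using i unfolding atLeastAtMost_iff by linarith+
    then have "?F i = ann ((*v) c ` stdV (i - 1))"
      using c(2) by (simp add: dual_qpar_def)
    then show ?thesis using ann_standard[OF c(1)] by simp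
  qed
  show "full_flag ?F"
    unfolding full_flag_def
  proof (intro conjI ballI)
    show "vec.subspace (?F i)" for i by (simp add: dual_qpar_def subspace_ann)
    show "?F 1 = UNIV" using F[of 1] by auto
    have "transpose c *v w = 0 \<Longrightarrow> w = 0" for w
      using matrix_inv_mult_vec(1)[OF ct, of w] by simp
    then show "?F (CARD('r) + 1) = {0}"
      using F[of "CARD('r) + 1"] ix_less[where 'r = 'r] by (auto simp: vec_eq_iff)
    fix i assume i: "i \<in> {1..CARD('r)}"
    have "i - 1 < CARD('r)" using i unfolding atLeastAtMost_iff by linarith
    then obtain k :: 'r where k: "ix k = i - 1" using ix_surj[where 'r = 'r] by blast
    have "matrix_inv (transpose c) *v axis k 1 \<in> ?F i" "matrix_inv (transpose c) *v axis k 1 \<notin> ?F (i + 1)"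
      using i k by (auto simp: F matrix_inv_mult_vec(2)[OF ct] axis_one_nth)
    moreover have "?F (i + 1) \<subseteq> ?F i" using i by (auto simp: F)
    ultimately show "?F (i + 1) \<subset> ?F i" by blast
  qed
qed

lemma PEnd0_sect:
  assumes U: "zopen X U" "p \<in> U" and S: "S \<in> PEnd0 X D R U" and R: "is_sheaf X (sheaf_of R)" and s: "sect (sheaf_of R) p s"
  shows "sect (sheaf_of R) p (\<lambda>q. S q *v s q)"
proof -
  obtain V where V: "zopen X V" "p \<in> V" "res V s \<in> sheaf_of R V" using s unfolding sect_def by blast
  define W where "W = V \<inter> U"
  have W: "zopen X W" "p \<in> W" "W \<subseteq> U" "W \<subseteq> V" using V U zopen_Int by (auto simp: W_def)
  have "res W (res V s) \<in> sheaf_of R W" by (rule is_sheaf_res[OF R V(1) W(1,4) V(3)])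
  then have "(\<lambda>q. S q *v res W (res V s) q) \<in> sheaf_of R W"
    using S W unfolding PEnd0_def by blast
  then have 1: "sect (sheaf_of R) p (\<lambda>q. S q *v res W (res V s) q)"
    using sect_of_mem[OF R W(1) _ W(2)] by blast
  have pX: "p \<in> X" using U zopen_subset by blast
  show ?thesis
    by (rule sect_cong[OF R pX eventually_mono[OF near_open[OF W(1,2)]] 1]) (use W in \<open>auto simp: res_def\<close>)
qed

lemma transpose_uminus_vec: "transpose (- A) *v w = - (transpose A *v w)" for A :: "complex ^ 'r ^ 'r"
  by (simp add: vec_eq_iff matrix_vector_mult_def transpose_def sum_negf)

lemma pairing_uminus: "pairing (- v) w = - pairing v w" "pairing v (- w) = - pairing v w"
  by (simp_all add: pairing_def sum_negf)

text \<open>The adjoint for \<open>pairing\<close> is the transpose, and a matrix preserves a flag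
  step exactly if its adjoint preserves the annihilator. The sign turns the reversal of products
  into compatibility with brackets.\<close>

lemma PEnd0_dual_iff:
  assumes U: "zopen X U"
  shows "A \<in> PEnd0 X D (dual_qpar X P) U \<longleftrightarrow> (\<lambda>p. - transpose (A p)) \<in> PEnd0 X D P U"
proof
  let ?B = "\<lambda>p. - transpose (A p)"
  assume A: "A \<in> PEnd0 X D (dual_qpar X P) U"
  have "(\<lambda>p. ?B p *v s p) \<in> sheaf_of P V" if V: "zopen X V" "V \<subseteq> U" and s: "s \<in> sheaf_of P V" for V s
    unfolding sheaf_iff[OF sheaf_P' V(1)]
  proof (intro conjI allI impI ballI)
    show "?B p *v s p = 0" if "p \<notin> V" for p using is_sheaf_supp[OF sheaf_P' V(1) s that] by simp
    fix p assume p: "p \<in> V"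
    have pX: "p \<in> X" using p V zopen_subset by blast
    obtain a where a: "frame (sheaf_of P) p a" using frame_P[OF pX] by blast
    have "reg p (\<lambda>q. (matrix_inv (a q) *v (?B q *v s q)) $ i)" for i
    proof -
      \<comment> \<open>The dual basis section number \<open>i\<close>: pairing with it extracts
        coordinate \<open>i\<close>, and \<open>A\<close> maps it to another section of the dual
        bundle.\<close>
      let ?w = "\<lambda>q. matrix_inv (transpose (a q)) *v axis i 1"
      have "eventually (\<lambda>q. axis i 1 = transpose (a q) *v ?w q) (near p)"
        using frame_invertible[OF a] by eventually_elim (simp add: matrix_inv_mult_vec(2) invertible_transpose_complex)
      then have "regv p (\<lambda>q. transpose (a q) *v ?w q)" by (rule regv_cong[OF _ regv_const])
      then have "dual_germ (sheaf_of P) p ?w" by (rule iffD2[OF dual_germ_iff[OF pX a]])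
      then have "sect (sheaf_of (dual_qpar X P)) p ?w" by (simp add: sect_dual[OF pX] dual_qpar_def)
      from PEnd0_sect[OF U _ A _ this] have "sect (sheaf_of (dual_qpar X P)) p (\<lambda>q. A q *v ?w q)"
        using p V(2) is_sheaf_dual by (auto simp: dual_qpar_def)
      then have "dual_germ (sheaf_of P) p (\<lambda>q. A q *v ?w q)" by (simp add: sect_dual[OF pX] dual_qpar_def)
      then have "reg p (\<lambda>q. pairing (A q *v ?w q) (s q))"
        using sect_of_mem[OF sheaf_P' V(1) s p] by (simp add: dual_germ_def)
      then have 1: "reg p (\<lambda>q. - pairing (A q *v ?w q) (s q))" by (rule reg_minus)
      show ?thesis
      proof (rule reg_cong[OF eventually_mono[OF frame_invertible[OF a]] 1])
        fix q assume ia: "invertible (a q)"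
        have "(matrix_inv (a q) *v (?B q *v s q)) $ i = pairing (transpose (a q) *v ?w q) (matrix_inv (a q) *v (?B q *v s q))"
          by (simp add: matrix_inv_mult_vec(2)[OF invertible_transpose_complex[OF ia]])
        also have "\<dots> = pairing (?w q) (?B q *v s q)"
          by (simp only: pairing_matrix[symmetric] matrix_inv_mult_vec(2)[OF ia])
        also have "\<dots> = - pairing (A q *v ?w q) (s q)"
          by (simp only: pairing_matrix transpose_uminus_vec transpose_transpose pairing_uminus)
        finally show "- pairing (A q *v ?w q) (s q) = (matrix_inv (a q) *v (?B q *v s q)) $ i" by simp
      qed
    qed
    then have "regv p (\<lambda>q. matrix_inv (a q) *v (?B q *v s q))" unfolding regv_def by blast
    then show "sect (sheaf_of P) p (\<lambda>q. ?B q *v s q)" by (rule iffD2[OF frame_sect[OF pX a]])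
  qed
  moreover have "(*v) (?B x) ` flag P x i \<subseteq> flag P x i" if x: "x \<in> D \<inter> U" and i: "i \<in> {1..CARD('r) + 1}" for x i
  proof safe
    fix v assume v: "v \<in> flag P x i"
    have j: "CARD('r) + 2 - i \<in> {1..CARD('r) + 1}" "CARD('r) + 2 - (CARD('r) + 2 - i) = i"
      using i unfolding atLeastAtMost_iff by linarith+
    then have "(*v) (A x) ` flag (dual_qpar X P) x (CARD('r) + 2 - i) \<subseteq> flag (dual_qpar X P) x (CARD('r) + 2 - i)"
      using A x unfolding PEnd0_def by blast
    then have "(*v) (A x) ` ann (flag P x i) \<subseteq> ann (flag P x i)"
      using j(2) by (simp add: dual_qpar_def)
    then have "pairing (A x *v w) v = 0" if "w \<in> ann (flag P x i)" for w
      using that v by (auto simp: ann_def image_subset_iff)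
    then have "pairing w (?B x *v v) = 0" if "w \<in> ann (flag P x i)" for w
      using that by (simp only: pairing_matrix transpose_uminus_vec transpose_transpose pairing_uminus neg_equal_0_iff_equal)
    then show "?B x *v v \<in> flag P x i" using x i by (intro ann_ann_flag) auto
  qed
  moreover have "trace (?B p) = 0" if "p \<in> U" for p
    using A that unfolding PEnd0_def by (simp add: trace_minus trace_transpose)
  moreover have "?B p = 0" if "p \<notin> U" for p
  proof -
    have "A p = 0" using A that unfolding PEnd0_def by blast
    then show ?thesis by (simp add: transpose_def vec_eq_iff)
  qed
  ultimately show "?B \<in> PEnd0 X D P U" unfolding PEnd0_def by blast
next
  let ?B = "\<lambda>p. - transpose (A p)"
  assume B: "?B \<in> PEnd0 X D P U"
  have AB: "pairing (A q *v w) v = - pairing w (?B q *v v)" for q w v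
    by (simp only: pairing_matrix transpose_uminus_vec transpose_transpose pairing_uminus minus_minus)
  have "A p = - transpose (?B p)" for p by (simp add: transpose_minus)
  moreover have "?B p = 0" if "p \<notin> U" for p using B that by (simp add: PEnd0_def)
  ultimately have supp: "A p = 0" if "p \<notin> U" for p
    using that by (metis add.inverse_neutral mscale_zero transpose_mscale)
  have sd: "is_sheaf X (sheaf_of (dual_qpar X P))" using is_sheaf_dual by (simp add: dual_qpar_def)
  have "(\<lambda>p. A p *v w p) \<in> sheaf_of (dual_qpar X P) V" if V: "zopen X V" "V \<subseteq> U" and w: "w \<in> sheaf_of (dual_qpar X P) V" for V w
    unfolding sheaf_iff[OF sd V(1)]
  proof (intro conjI allI impI ballI)
    show "A p *v w p = 0" if "p \<notin> V" for p using is_sheaf_supp[OF sd V(1) w that] by simp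
    fix p assume p: "p \<in> V"
    have pX: "p \<in> X" using p V zopen_subset by blast
    have wg: "dual_germ (sheaf_of P) p w"
      using sect_of_mem[OF sd V(1) w p] by (simp add: sect_dual[OF pX] dual_qpar_def)
    have "dual_germ (sheaf_of P) p (\<lambda>q. A q *v w q)"
      unfolding dual_germ_def AB
    proof (intro allI impI)
      fix s assume s: "sect (sheaf_of P) p s"
      have "sect (sheaf_of P) p (\<lambda>q. ?B q *v s q)"
        by (rule PEnd0_sect[OF U _ B sheaf_P' s]) (use p V in blast)
      then show "reg p (\<lambda>q. - pairing (w q) (?B q *v s q))"
        using wg unfolding dual_germ_def by (intro reg_minus) blast
    qed
    then show "sect (sheaf_of (dual_qpar X P)) p (\<lambda>q. A q *v w q)"
      by (simp add: sect_dual[OF pX] dual_qpar_def)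
  qed
  moreover have "(*v) (A x) ` flag (dual_qpar X P) x i \<subseteq> flag (dual_qpar X P) x i"
    if x: "x \<in> D \<inter> U" and i: "i \<in> {1..CARD('r) + 1}" for x i
  proof -
    have "CARD('r) + 2 - i \<in> {1..CARD('r) + 1}"
      using i unfolding atLeastAtMost_iff by linarith
    then have "(*v) (?B x) ` flag P x (CARD('r) + 2 - i) \<subseteq> flag P x (CARD('r) + 2 - i)"
      using B x unfolding PEnd0_def by blast
    then have "pairing (A x *v w) v = 0" if "w \<in> flag (dual_qpar X P) x i" "v \<in> flag P x (CARD('r) + 2 - i)" for w v
      unfolding AB[of x w v] using that by (auto simp: dual_qpar_def ann_def)
    then show ?thesis by (auto simp: dual_qpar_def ann_def)
  qed
  moreover have "trace (A p) = 0" if "p \<in> U" for p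
    using B that unfolding PEnd0_def by (simp add: trace_minus trace_transpose)
  ultimately show "A \<in> PEnd0 X D (dual_qpar X P) U"
    using supp unfolding PEnd0_def by blast
qed

text \<open>Precomposition with the negative transpose, which identifies the endomorphism sheaves of
  \<open>P\<close> and of its dual.\<close>

lemma lie_sheaf_iso_dual:
  assumes iso: "lie_sheaf_iso X D P Q \<Phi>"
  shows "lie_sheaf_iso X D (dual_qpar X P) Q (\<lambda>U A. \<Phi> U (\<lambda>p. - transpose (A p)))"
proof -
  let ?n = "\<lambda>(A :: 'n point \<Rightarrow> complex ^ 'r ^ 'r) p. - transpose (A p)"
  have nn: "?n (?n A) = A" for A by (simp add: transpose_minus)
  show ?thesis
    unfolding lie_sheaf_iso_def sheaf_iso_def
  proof (intro conjI allI impI ballI; (elim conjE)?)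
    fix U assume U: "zopen X U"
    note S = iso[unfolded lie_sheaf_iso_def sheaf_iso_def, THEN conjunct1, THEN spec[of _ U], THEN mp, OF U]
    note L = iso[unfolded lie_sheaf_iso_def, THEN conjunct2, THEN spec[of _ U], THEN mp, OF U]
    note dual = PEnd0_dual_iff[OF U]
    have "bij_betw ?n (PEnd0 X D (dual_qpar X P) U) (PEnd0 X D P U)"
      by (rule bij_betwI[where g = ?n]) (use dual nn in \<open>auto simp: transpose_minus\<close>)
    moreover have "bij_betw (\<Phi> U) (PEnd0 X D P U) (PEnd0 X D Q U)" using S by blast
    ultimately have "bij_betw (\<Phi> U \<circ> ?n) (PEnd0 X D (dual_qpar X P) U) (PEnd0 X D Q U)"
      by (rule bij_betw_trans)
    then show "bij_betw (\<lambda>A. \<Phi> U (?n A)) (PEnd0 X D (dual_qpar X P) U) (PEnd0 X D Q U)"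
      by (simp add: comp_def)
    fix A assume A: "A \<in> PEnd0 X D (dual_qpar X P) U"
    have nA: "?n A \<in> PEnd0 X D P U" using A dual by blast
    {
      fix B assume B: "B \<in> PEnd0 X D (dual_qpar X P) U"
      have nB: "?n B \<in> PEnd0 X D P U" using B dual by blast
      have eq: "?n (\<lambda>p. A p + B p) = (\<lambda>p. ?n A p + ?n B p)" by (simp add: transpose_add)
      show "\<Phi> U (?n (\<lambda>p. A p + B p)) = (\<lambda>p. \<Phi> U (?n A) p + \<Phi> U (?n B) p)"
        by (simp only: eq S[THEN conjunct2, THEN conjunct1, THEN bspec, OF nA, THEN bspec, OF nB])
      have eq': "?n (\<lambda>p. A p ** B p - B p ** A p) = (\<lambda>p. ?n A p ** ?n B p - ?n B p ** ?n A p)"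
        by (simp add: transpose_diff matrix_transpose_mul mat_mult_minus_left mat_mult_minus_right)
      show "\<Phi> U (?n (\<lambda>p. A p ** B p - B p ** A p)) =
          (\<lambda>p. \<Phi> U (?n A) p ** \<Phi> U (?n B) p - \<Phi> U (?n B) p ** \<Phi> U (?n A) p)"
        by (simp only: eq' L[THEN bspec, OF nA, THEN bspec, OF nB])
    }
    {
      fix f assume f: "f \<in> regular X U"
      have eq: "?n (\<lambda>p. mscale (f p) (A p)) = (\<lambda>p. mscale (f p) (?n A p))"
        by (simp add: transpose_mscale fun_eq_iff vec_eq_iff)
      show "\<Phi> U (?n (\<lambda>p. mscale (f p) (A p))) = (\<lambda>p. mscale (f p) (\<Phi> U (?n A) p))"
        by (simp only: eq S[THEN conjunct2, THEN conjunct2, THEN conjunct1, THEN bspec, OF f, THEN bspec, OF nA])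
    }
    fix V assume V: "zopen X V" "V \<subseteq> U"
    have eq: "?n (res V A) = res V (?n A)" by (auto simp: res_def fun_eq_iff transpose_def vec_eq_iff)
    show "\<Phi> V (?n (res V A)) = res V (\<Phi> U (?n A))"
      by (simp only: eq S[THEN conjunct2, THEN conjunct2, THEN conjunct2, THEN spec, THEN mp, OF conjI, OF V, THEN bspec, OF nA])
  qed
qed

end

end

section \<open>From multiplicative or antimultiplicative fibre maps to obtainability\<close>

context marked
begin

text \<open>The conjugating matrices are chosen point by point without regard to regularity, which
  \<open>obtainable_of_inner\<close> does not ask for.\<close>

lemma obtainable_of_mult:
  fixes P Q E :: "('n, 'r::finite) qpar"
  assumes P: "quasi_parabolic X D P" and Q: "quasi_parabolic X D Q" and iso: "lie_sheaf_iso X D P Q \<Phi>"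
    and card: "CARD('r) \<ge> 2" and mult: "\<And>q. q \<in> X \<Longrightarrow> q \<notin> D \<Longrightarrow> sl_mult (fibre_map P \<Phi> q)"
    and E: "obtainable X D E P"
  shows "obtainable X D E Q"
proof -
  have "\<forall>q\<in>X - D. \<exists>g. invertible g \<and> (\<forall>A. trace A = 0 \<longrightarrow> fibre_map P \<Phi> q A = g ** A ** matrix_inv g)"
    using skolem_noether[OF sl_aut_fibre_map[OF P Q iso] card mult] by blast
  from bchoice[OF this] obtain g
    where g: "\<forall>q\<in>X - D. invertible (g q) \<and> (\<forall>A. trace A = 0 \<longrightarrow> fibre_map P \<Phi> q A = g q ** A ** matrix_inv (g q))" ..
  show ?thesis
    by (rule obtainable_of_inner[OF P Q iso _ _ E, of g]) (use g in blast)+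
qed

lemma fibre_map_dual:
  fixes P Q :: "('n, 'r::finite) qpar"
  assumes P: "quasi_parabolic X D P" and Q: "quasi_parabolic X D Q" and iso: "lie_sheaf_iso X D P Q \<Phi>"
    and q: "q \<in> X" "q \<notin> D" and A: "trace A = 0"
  shows "fibre_map (dual_qpar X P) (\<lambda>U A. \<Phi> U (\<lambda>p. - transpose (A p))) q A = fibre_map P \<Phi> q (- transpose A)"
proof -
  note P' = quasi_parabolic_dual[OF P] and iso' = lie_sheaf_iso_dual[OF P iso]
  obtain V S where V: "zopen X V" "q \<in> V" and S: "S \<in> PEnd0 X D (dual_qpar X P) V" "S q = A"
    using PEnd0_extend[OF P' q] A by blast
  have "(\<lambda>p. - transpose (S p)) \<in> PEnd0 X D P V"
    using S(1) by (rule iffD1[OF PEnd0_dual_iff[OF P V(1)]])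
  from fibre_map_eq[OF P Q iso q V this] fibre_map_eq[OF P' Q iso' q V S(1)] S(2)
  show ?thesis by simp
qed

text \<open>Transposition reverses products and undoes the reversal in \<open>sl_antimult\<close>.
  The two signs inside the product cancel, and the outer one cancels the sign in that
  definition.\<close>

lemma sl_mult_fibre_map_dual:
  fixes P Q :: "('n, 'r::finite) qpar"
  assumes P: "quasi_parabolic X D P" and Q: "quasi_parabolic X D Q" and iso: "lie_sheaf_iso X D P Q \<Phi>"
    and q: "q \<in> X" "q \<notin> D" and anti: "sl_antimult (fibre_map P \<Phi> q)"
  shows "sl_mult (fibre_map (dual_qpar X P) (\<lambda>U A. \<Phi> U (\<lambda>p. - transpose (A p))) q)"
    (is "sl_mult ?f")
  unfolding sl_mult_def
proof (intro allI impI, elim conjE)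
  fix A B :: "complex ^ 'r ^ 'r" assume A: "trace A = 0" and B: "trace B = 0"
  note dual = fibre_map_dual[OF P Q iso q]
  have tr: "trace (- transpose A) = 0" "trace (- transpose B) = 0"
    using A B by (simp_all add: trace_minus trace_transpose)
  have "- transpose (traceless (A ** B)) = - traceless ((- transpose B) ** (- transpose A))"
    by (simp add: traceless_transpose matrix_transpose_mul mat_mult_minus_left mat_mult_minus_right)
  then have "?f (traceless (A ** B)) = fibre_map P \<Phi> q (- traceless ((- transpose B) ** (- transpose A)))"
    by (simp add: dual)
  also have "\<dots> = - fibre_map P \<Phi> q (traceless ((- transpose B) ** (- transpose A)))"
    by (rule sl_aut_minus[OF sl_aut_fibre_map[OF P Q iso q]]) simp
  also have "\<dots> = traceless (fibre_map P \<Phi> q (- transpose A) ** fibre_map P \<Phi> q (- transpose B))"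
    using anti tr unfolding sl_antimult_def by simp
  finally show "?f (traceless (A ** B)) = traceless (?f A ** ?f B)"
    by (simp only: dual[OF A] dual[OF B])
qed

end

theorem lemma6p14:
  fixes X D :: "'n::finite point set" and E E' :: "('n, 'r::finite) qpar"
  assumes "marked_curve X D"
    and "CARD('r) \<ge> 2"
    and "quasi_parabolic X D E"
    and "quasi_parabolic X D E'"
    and "lie_isomorphic_PEnd0 X D E E'"
  shows "obtainable X D E E'"
proof -
  interpret marked X D by unfold_locales (rule assms(1))
  note P = assms(3) and Q = assms(4)
  obtain \<Phi> where iso: "lie_sheaf_iso X D E E' \<Phi>"
    using assms(5) unfolding lie_isomorphic_PEnd0_def lie_sheaf_iso_def by blast
  consider "\<forall>q\<in>X - D. sl_mult (fibre_map E \<Phi> q)" | "\<forall>q\<in>X - D. sl_antimult (fibre_map E \<Phi> q)"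
    using fibre_map_dichotomy[OF P Q iso assms(2)] by blast
  then show ?thesis
  proof cases
    case 1
    show ?thesis
      by (rule obtainable_of_mult[OF P Q iso assms(2) _ obtainable.refl]) (use 1 in blast)
  next
    case 2
    \<comment> \<open>The isomorphism now starts from the dual of \<open>E\<close>, which is
      obtainable from \<open>E\<close> in one step.\<close>
    show ?thesis
      by (rule obtainable_of_mult[OF quasi_parabolic_dual[OF P] Q lie_sheaf_iso_dual[OF P iso] assms(2)
            sl_mult_fibre_map_dual[OF P Q iso] obtainable.dual[OF obtainable.refl]])
        (use 2 in blast)+
  qed
qed

end
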